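(* Let $z_0\in L^2(0,1)\setminus\{0\}$ and $M>0$. For every $\varepsilon\geqslant0$, the time-optimal problem $$\tau_\varepsilon^*(M)=\inf\left\{\tau>0:\ \text{there exists }u\in L^\infty((0,\tau)\times I),\ \|u\|_{L^\infty((0,\tau)\times I)}\leqslant M,\ z_\varepsilon(\tau;z_0,u)=0\right\}$$ admits a unique optimal control $u_\varepsilon^*(M)$ (that is, there is exactly one $u_\varepsilon^*(M)\in L^\infty((0,\tau_\varepsilon^*(M))\times I)$ of $L^\infty$-norm at most $M$ with $z_\varepsilon(\tau_\varepsilon^*(M);z_0,u_\varepsilon^*(M))=0$). It is bang-bang: $$|u_\varepsilon^*(M)(t,x)|=M\quad\text{for almost every }(t,x)\in(0,\tau_\varepsilon^*(M))\times I.$$ There exists $\widehat\tau>0$, depending only on $M$, $|I|$, $K$ and $\|z_0\|_{L^2(0,1)}$, such that $\tau_\varepsilon^*(M)\leqslant\widehat\tau$ for every $\varepsilon\geqslant0$. Furthermore, $\tau_\varepsilon^*(M)\to\tau_0^*(M)$ as $\varepsilon\to0$ (through positive values). After extending every $u_\varepsilon^*(M)$ by zero to $(0,\widehat\tau)\times I$, these extensions converge, as $\varepsilon\to0$, weakly-* in $L^\infty((0,\widehat\tau)\times I)$ and strongly in $L^p((0,\widehat\tau)\times I)$, for every $1\leqslant p<\infty$, to the corresponding extension of $u_0^*(M)$.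
   Context: Let $a\in L^\infty(\mathbb R)$ be a real-valued $1$-periodic function such that, for some constant $K>0$, $K^{-1}\leqslant a(x)\leqslant K$ for a.e. $x\in\mathbb R$. Let $I\subset(0,1)$ be a nonempty open interval with characteristic function $\chi_I$ and Lebesgue measure $|I|$. For $\varepsilon>0$ put $a_\varepsilon(x)=a(x/\varepsilon)$, and for $\varepsilon=0$ let $a_0$ be the constant $a_0=\left(\int_0^1\frac{1}{a(y)}\,dy\right)^{-1}$ (homogenized coefficient). Function spaces consist of complex-valued functions. For $\varepsilon\geqslant0$, $z_0\in L^2(0,1)$ and a control $u$, $z_\varepsilon(\cdot;z_0,u)$ denotes the (mild) solution of $$\partial_t z(t,x)-\partial_x\bigl(a_\varepsilon(x)\,\partial_x z(t,x)\bigr)=u(t,x)\chi_I(x)\quad (t\geqslant0,\ x\in(0,1)),$$ $$z(t,0)=z(t,1)=0\quad(t\geqslant0),\qquad z(0,x)=z_0(x)\quad(x\in(0,1)).$$ *)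

theory Defs
  imports "HOL-Analysis.Analysis"
begin

section \<open>The Hilbert space of complex-valued square-integrable functions on (0,1)\<close>

abbreviation leb01 :: "real measure" where
  "leb01 \<equiv> lebesgue_on {0<..<1}"

definition L2_fun :: "(real \<Rightarrow> complex) set" where
  "L2_fun = {f. f \<in> borel_measurable leb01 \<and> integrable leb01 (\<lambda>x. (norm (f x))\<^sup>2)}"

definition L2_eq :: "(real \<Rightarrow> complex) \<Rightarrow> (real \<Rightarrow> complex) \<Rightarrow> bool" where
  "L2_eq f g \<longleftrightarrow> f \<in> L2_fun \<and> g \<in> L2_fun \<and> (AE x in leb01. f x = g x)"

lemma finite_measure_leb01: "finite_measure leb01"
  by (rule finite_measureI) (simp add: space_restrict_space emeasure_restrict_space)

lemma emeasure_leb01_UNIV: "emeasure leb01 (space leb01) = 1"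
  by (simp add: space_restrict_space emeasure_restrict_space)

lemma L2_fun_zero: "(\<lambda>x. 0) \<in> L2_fun"
  by (simp add: L2_fun_def)

lemma L2_fun_add:
  assumes "f \<in> L2_fun" "g \<in> L2_fun"
  shows "(\<lambda>x. f x + g x) \<in> L2_fun"
proof -
  have m: "f \<in> borel_measurable leb01" "g \<in> borel_measurable leb01"
    and i: "integrable leb01 (\<lambda>x. (norm (f x))\<^sup>2)" "integrable leb01 (\<lambda>x. (norm (g x))\<^sup>2)"
    using assms by (auto simp: L2_fun_def)
  have b: "(norm (f x + g x))\<^sup>2 \<le> 2 * (norm (f x))\<^sup>2 + 2 * (norm (g x))\<^sup>2" for x
  proof -
    have "(norm (f x + g x))\<^sup>2 \<le> (norm (f x) + norm (g x))\<^sup>2"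
      by (intro power_mono norm_triangle_ineq) auto
    also have "\<dots> \<le> 2 * (norm (f x))\<^sup>2 + 2 * (norm (g x))\<^sup>2"
      using sum_squares_bound[of "norm (f x)" "norm (g x)"] by (simp add: power2_sum)
    finally show ?thesis .
  qed
  have "integrable leb01 (\<lambda>x. (norm (f x + g x))\<^sup>2)"
  proof (rule Bochner_Integration.integrable_bound)
    show "integrable leb01 (\<lambda>x. 2 * (norm (f x))\<^sup>2 + 2 * (norm (g x))\<^sup>2)"
      using i by simp
    show "(\<lambda>x. (norm (f x + g x))\<^sup>2) \<in> borel_measurable leb01"
      using m by measurable
  qed (use b in \<open>auto intro!: AE_I2\<close>)
  then show ?thesis
    using m by (auto simp: L2_fun_def)
qed

lemma L2_fun_cmult:
  assumes "f \<in> L2_fun"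
  shows "(\<lambda>x. c * f x) \<in> L2_fun"
  using assms by (auto simp: L2_fun_def norm_mult power_mult_distrib)

lemma L2_fun_scaleR:
  assumes "f \<in> L2_fun"
  shows "(\<lambda>x. r *\<^sub>R f x) \<in> L2_fun"
  using L2_fun_cmult[OF assms, of "of_real r"] by (simp add: scaleR_conv_of_real)

lemma L2_fun_uminus:
  assumes "f \<in> L2_fun"
  shows "(\<lambda>x. - f x) \<in> L2_fun"
  using L2_fun_cmult[OF assms, of "-1"] by simp

lemma L2_fun_diff:
  assumes "f \<in> L2_fun" "g \<in> L2_fun"
  shows "(\<lambda>x. f x - g x) \<in> L2_fun"
  using L2_fun_add[OF assms(1) L2_fun_uminus[OF assms(2)]] by simp

lemma L2_fun_inner:
  assumes "f \<in> L2_fun" "g \<in> L2_fun"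
  shows "integrable leb01 (\<lambda>x. f x \<bullet> g x)"
proof (rule Bochner_Integration.integrable_bound)
  have m: "f \<in> borel_measurable leb01" "g \<in> borel_measurable leb01"
    and i: "integrable leb01 (\<lambda>x. (norm (f x))\<^sup>2)" "integrable leb01 (\<lambda>x. (norm (g x))\<^sup>2)"
    using assms by (auto simp: L2_fun_def)
  show "integrable leb01 (\<lambda>x. (norm (f x))\<^sup>2 + (norm (g x))\<^sup>2)"
    using i by simp
  show "(\<lambda>x. f x \<bullet> g x) \<in> borel_measurable leb01"
    using m by measurable
  have "\<bar>f x \<bullet> g x\<bar> \<le> (norm (f x))\<^sup>2 + (norm (g x))\<^sup>2" for x
  proof -
    have "\<bar>f x \<bullet> g x\<bar> \<le> norm (f x) * norm (g x)" by (rule Cauchy_Schwarz_ineq2)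
    also have "\<dots> \<le> (norm (f x))\<^sup>2 + (norm (g x))\<^sup>2"
      using sum_squares_bound[of "norm (f x)" "norm (g x)"]
        mult_nonneg_nonneg[OF norm_ge_zero norm_ge_zero, of "f x" "g x"] by linarith
    finally show ?thesis .
  qed
  then show "AE x in leb01. norm (f x \<bullet> g x) \<le> norm ((norm (f x))\<^sup>2 + (norm (g x))\<^sup>2)"
    by (intro AE_I2) simp
qed

lemma L2_fun_AE_cong:
  assumes "f \<in> L2_fun" "g \<in> borel_measurable leb01" "AE x in leb01. f x = g x"
  shows "g \<in> L2_fun"
proof -
  have "integrable leb01 (\<lambda>x. (norm (g x))\<^sup>2)"
  proof (rule Bochner_Integration.integrable_cong_AE_imp)
    show "integrable leb01 (\<lambda>x. (norm (f x))\<^sup>2)"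
      using assms by (simp add: L2_fun_def)
    show "AE x in leb01. (norm (f x))\<^sup>2 = (norm (g x))\<^sup>2"
      using assms(3) by eventually_elim simp
  qed (use assms(2) in measurable)
  then show ?thesis using assms by (simp add: L2_fun_def)
qed

quotient_type L2 = "real \<Rightarrow> complex" / partial: L2_eq
  morphisms rep_L2 abs_L2
proof (rule part_equivpI)
  show "\<exists>f. L2_eq f f" by (rule exI[of _ "\<lambda>x. 0"]) (simp add: L2_eq_def L2_fun_zero)
  show "symp L2_eq" by (simp add: symp_def L2_eq_def eq_commute)
  show "transp L2_eq"
  proof (rule transpI)
    fix f g h assume "L2_eq f g" "L2_eq g h"
    then have "f \<in> L2_fun" "h \<in> L2_fun"
      and "AE x in leb01. f x = g x" "AE x in leb01. g x = h x"
      by (auto simp: L2_eq_def)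
    from this(3,4) have "AE x in leb01. f x = h x" by eventually_elim simp
    with \<open>f \<in> L2_fun\<close> \<open>h \<in> L2_fun\<close> show "L2_eq f h" by (simp add: L2_eq_def)
  qed
qed

instantiation L2 :: real_inner
begin

lift_definition zero_L2 :: L2 is "\<lambda>x. 0"
  by (simp add: L2_eq_def L2_fun_zero)

lift_definition plus_L2 :: "L2 \<Rightarrow> L2 \<Rightarrow> L2" is "\<lambda>f g x. f x + g x"
proof -
  fix f f' g g' assume *: "L2_eq f f'" "L2_eq g g'"
  then have "AE x in leb01. f x = f' x" "AE x in leb01. g x = g' x" by (auto simp: L2_eq_def)
  then have "AE x in leb01. f x + g x = f' x + g' x" by eventually_elim simp
  with * show "L2_eq (\<lambda>x. f x + g x) (\<lambda>x. f' x + g' x)"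
    by (simp add: L2_eq_def L2_fun_add)
qed

lift_definition minus_L2 :: "L2 \<Rightarrow> L2 \<Rightarrow> L2" is "\<lambda>f g x. f x - g x"
proof -
  fix f f' g g' assume *: "L2_eq f f'" "L2_eq g g'"
  then have "AE x in leb01. f x = f' x" "AE x in leb01. g x = g' x" by (auto simp: L2_eq_def)
  then have "AE x in leb01. f x - g x = f' x - g' x" by eventually_elim simp
  with * show "L2_eq (\<lambda>x. f x - g x) (\<lambda>x. f' x - g' x)"
    by (simp add: L2_eq_def L2_fun_diff)
qed

lift_definition uminus_L2 :: "L2 \<Rightarrow> L2" is "\<lambda>f x. - f x"
proof -
  fix f f' assume *: "L2_eq f f'"
  then have "AE x in leb01. f x = f' x" by (simp add: L2_eq_def)
  then have "AE x in leb01. - f x = - f' x" by eventually_elim simp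
  with * show "L2_eq (\<lambda>x. - f x) (\<lambda>x. - f' x)"
    by (simp add: L2_eq_def L2_fun_uminus)
qed

lift_definition scaleR_L2 :: "real \<Rightarrow> L2 \<Rightarrow> L2" is "\<lambda>r f x. r *\<^sub>R f x"
proof -
  fix r :: real and f f' assume *: "L2_eq f f'"
  then have "AE x in leb01. f x = f' x" by (simp add: L2_eq_def)
  then have "AE x in leb01. r *\<^sub>R f x = r *\<^sub>R f' x" by eventually_elim simp
  with * show "L2_eq (\<lambda>x. r *\<^sub>R f x) (\<lambda>x. r *\<^sub>R f' x)"
    by (simp add: L2_eq_def L2_fun_scaleR)
qed

text \<open>The real part of the usual sesquilinear product; it induces the usual norm.\<close>

lift_definition inner_L2 :: "L2 \<Rightarrow> L2 \<Rightarrow> real" is "\<lambda>f g. LINT x|leb01. f x \<bullet> g x"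
proof -
  fix f f' g g' assume *: "L2_eq f f'" "L2_eq g g'"
  then have "AE x in leb01. f x = f' x" "AE x in leb01. g x = g' x" by (auto simp: L2_eq_def)
  then have "AE x in leb01. f x \<bullet> g x = f' x \<bullet> g' x" by eventually_elim simp
  then show "(LINT x|leb01. f x \<bullet> g x) = (LINT x|leb01. f' x \<bullet> g' x)"
    using * by (intro integral_cong_AE borel_measurable_inner) (auto simp: L2_eq_def L2_fun_def)
qed

definition norm_L2 :: "L2 \<Rightarrow> real" where "norm_L2 F = sqrt (F \<bullet> F)"

definition sgn_L2 :: "L2 \<Rightarrow> L2" where "sgn_L2 F = scaleR (inverse (norm F)) F"

definition dist_L2 :: "L2 \<Rightarrow> L2 \<Rightarrow> real" where "dist_L2 F G = norm (F - G)"

definition uniformity_L2 :: "(L2 \<times> L2) filter" where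
  "uniformity_L2 = (INF e\<in>{0 <..}. principal {(F, G). dist F G < e})"

definition open_L2 :: "L2 set \<Rightarrow> bool" where
  "open_L2 U \<longleftrightarrow> (\<forall>F\<in>U. eventually (\<lambda>(F', G). F' = F \<longrightarrow> G \<in> U) uniformity)"

instance
proof
  fix F G H :: L2 and r s :: real
  show "F + G + H = F + (G + H)"
    by transfer (simp add: L2_eq_def add.assoc L2_fun_add)
  show "F + G = G + F"
    by transfer (simp add: L2_eq_def add.commute L2_fun_add)
  show "0 + F = F"
    by transfer (simp add: L2_eq_def)
  show "- F + F = 0"
    by transfer (simp add: L2_eq_def L2_fun_zero)
  show "F - G = F + - G"
    by transfer (simp add: L2_eq_def L2_fun_diff)
  show "r *\<^sub>R (F + G) = r *\<^sub>R F + r *\<^sub>R G"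
    by transfer (simp add: L2_eq_def scaleR_add_right L2_fun_add L2_fun_scaleR)
  show "(r + s) *\<^sub>R F = r *\<^sub>R F + s *\<^sub>R F"
    by transfer (simp add: L2_eq_def scaleR_add_left L2_fun_add L2_fun_scaleR)
  show "r *\<^sub>R s *\<^sub>R F = (r * s) *\<^sub>R F"
    by transfer (simp add: L2_eq_def L2_fun_scaleR)
  show "1 *\<^sub>R F = F"
    by transfer (simp add: L2_eq_def)
  show "F \<bullet> G = G \<bullet> F"
    by transfer (simp add: inner_commute)
  show "(F + G) \<bullet> H = F \<bullet> H + G \<bullet> H"
    by transfer (simp add: L2_eq_def inner_add_left L2_fun_inner)
  show "(r *\<^sub>R F) \<bullet> G = r * (F \<bullet> G)"
    by transfer simp
  show "0 \<le> F \<bullet> F"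
    by transfer simp
  show "F \<bullet> F = 0 \<longleftrightarrow> F = 0"
  proof transfer
    fix f assume "L2_eq f f"
    then have f: "f \<in> L2_fun" by (simp add: L2_eq_def)
    have "(LINT x|leb01. f x \<bullet> f x) = 0 \<longleftrightarrow> (AE x in leb01. f x \<bullet> f x = 0)"
      by (rule integral_nonneg_eq_0_iff_AE[OF L2_fun_inner[OF f f]]) simp
    then show "(LINT x|leb01. f x \<bullet> f x) = 0 \<longleftrightarrow> L2_eq f (\<lambda>x. 0)"
      using f by (simp add: L2_eq_def L2_fun_zero)
  qed
next
  fix F G :: L2
  show "norm F = sqrt (F \<bullet> F)" by (rule norm_L2_def)
  show "sgn F = scaleR (inverse (norm F)) F" by (rule sgn_L2_def)
  show "dist F G = norm (F - G)" by (rule dist_L2_def)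
  show "(uniformity :: (L2 \<times> L2) filter) = (INF e\<in>{0 <..}. principal {(F, G). dist F G < e})"
    by (rule uniformity_L2_def)
  show "open U \<longleftrightarrow> (\<forall>F\<in>U. eventually (\<lambda>(F', G). F' = F \<longrightarrow> G \<in> U) uniformity)" for U :: "L2 set"
    by (rule open_L2_def)
qed

end

text \<open>The class of \<open>f\<close>, with the value 0 for functions that are not square integrable.\<close>

definition L2_of :: "(real \<Rightarrow> complex) \<Rightarrow> L2" where
  "L2_of f = (if f \<in> L2_fun then abs_L2 f else 0)"

lemma L2_cases:
  obtains f where "f \<in> L2_fun" "F = L2_of f"
proof -
  have "rep_L2 F \<in> L2_fun"
    using Quotient3_rep_reflp[OF Quotient3_L2, of F] by (simp add: L2_eq_def)
  then show ?thesis
    using Quotient3_abs_rep[OF Quotient3_L2, of F] by (intro that[of "rep_L2 F"]) (simp_all add: L2_of_def)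
qed

lemma L2_of_eq_iff:
  assumes "f \<in> L2_fun" "g \<in> L2_fun"
  shows "L2_of f = L2_of g \<longleftrightarrow> (AE x in leb01. f x = g x)"
proof -
  have "abs_L2 f = abs_L2 g \<longleftrightarrow> L2_eq f g"
    using assms Quotient3_rel[OF Quotient3_L2, of f g] by (simp add: L2_eq_def)
  then show ?thesis using assms by (simp add: L2_of_def L2_eq_def)
qed

lemma L2_of_add:
  assumes "f \<in> L2_fun" "g \<in> L2_fun"
  shows "L2_of (\<lambda>x. f x + g x) = L2_of f + L2_of g"
  using assms plus_L2.abs_eq[of f g] by (simp add: L2_of_def L2_fun_add L2_eq_def)

lemma L2_of_diff:
  assumes "f \<in> L2_fun" "g \<in> L2_fun"
  shows "L2_of (\<lambda>x. f x - g x) = L2_of f - L2_of g"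
  using assms minus_L2.abs_eq[of f g] by (simp add: L2_of_def L2_fun_diff L2_eq_def)

lemma L2_of_scaleR:
  assumes "f \<in> L2_fun"
  shows "L2_of (\<lambda>x. r *\<^sub>R f x) = r *\<^sub>R L2_of f"
  using assms scaleR_L2.abs_eq[of f r] by (simp add: L2_of_def L2_fun_scaleR L2_eq_def)

lemma L2_of_zero: "L2_of (\<lambda>x. 0) = 0"
  by (simp add: L2_of_def zero_L2.abs_eq)

lemma norm_L2_of:
  assumes "f \<in> L2_fun"
  shows "norm (L2_of f) = sqrt (LINT x|leb01. (norm (f x))\<^sup>2)"
  using assms inner_L2.abs_eq[of f f]
  by (simp add: L2_of_def norm_L2_def L2_eq_def power2_norm_eq_inner)

lemma ennreal_norm_L2_of:
  assumes "f \<in> L2_fun"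
  shows "ennreal ((norm (L2_of f))\<^sup>2) = (\<integral>\<^sup>+x. ennreal ((norm (f x))\<^sup>2) \<partial>leb01)"
  using assms by (subst nn_integral_eq_integral) (auto simp: L2_fun_def norm_L2_of)

lemma L2_funI_nn:
  assumes "f \<in> borel_measurable leb01"
    and "(\<integral>\<^sup>+x. ennreal ((norm (f x))\<^sup>2) \<partial>leb01) < \<infinity>"
  shows "f \<in> L2_fun"
proof -
  have "integrable leb01 (\<lambda>x. (norm (f x))\<^sup>2)"
    by (rule integrableI_bounded) (use assms in \<open>simp_all add: power2_eq_square\<close>)
  then show ?thesis using assms by (simp add: L2_fun_def)
qed

lemma nn_integral_norm_le_L2:
  assumes f: "f \<in> L2_fun" and e: "0 < e" and n: "norm (L2_of f) \<le> e"
  shows "(\<integral>\<^sup>+x. ennreal (norm (f x)) \<partial>leb01) \<le> ennreal (2 * e)"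
proof -
  have [measurable]: "f \<in> borel_measurable leb01" using f by (simp add: L2_fun_def)
  have b: "norm (f x) \<le> e + (1 / e) * (norm (f x))\<^sup>2" for x
  proof -
    have "e * norm (f x) \<le> e * e + (norm (f x))\<^sup>2"
    proof -
      have "0 \<le> e * norm (f x)" using e by simp
      then show ?thesis
        using sum_squares_bound[of e "norm (f x)"] unfolding power2_eq_square by linarith
    qed
    then show ?thesis using e by (simp add: field_simps)
  qed
  have "(\<integral>\<^sup>+x. ennreal (norm (f x)) \<partial>leb01)
      \<le> (\<integral>\<^sup>+x. ennreal e + ennreal (1 / e) * ennreal ((norm (f x))\<^sup>2) \<partial>leb01)"
    using b e by (intro nn_integral_mono) (simp flip: ennreal_mult ennreal_plus)
  also have "\<dots> = ennreal e * emeasure leb01 (space leb01)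
      + ennreal (1 / e) * (\<integral>\<^sup>+x. ennreal ((norm (f x))\<^sup>2) \<partial>leb01)"
    by (subst nn_integral_add) (simp_all add: nn_integral_cmult)
  also have "\<dots> = ennreal e + ennreal (1 / e) * ennreal ((norm (L2_of f))\<^sup>2)"
    by (simp only: emeasure_leb01_UNIV ennreal_norm_L2_of[OF f] mult_1_right)
  also have "\<dots> = ennreal (e + (1 / e) * (norm (L2_of f))\<^sup>2)"
    using e by (simp flip: ennreal_mult ennreal_plus)
  also have "\<dots> \<le> ennreal (2 * e)"
  proof (rule ennreal_leI)
    have "(norm (L2_of f))\<^sup>2 \<le> e\<^sup>2" using n by (intro power_mono) auto
    then have "(1 / e) * (norm (L2_of f))\<^sup>2 \<le> (1 / e) * e\<^sup>2"
      using e by (intro mult_left_mono) auto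
    then show "e + (1 / e) * (norm (L2_of f))\<^sup>2 \<le> 2 * e" using e by (simp add: power2_eq_square)
  qed
  finally show ?thesis .
qed

instance L2 :: banach
proof
  fix X :: "nat \<Rightarrow> L2"
  assume C: "Cauchy X"
  have "\<exists>f. f \<in> L2_fun \<and> X n = L2_of f" for n using L2_cases by metis
  then obtain f where f: "\<And>n. f n \<in> L2_fun" and X: "\<And>n. X n = L2_of (f n)" by metis
  have [measurable]: "f n \<in> borel_measurable leb01" for n using f by (simp add: L2_fun_def)
  have "\<exists>N. \<forall>m\<ge>N. \<forall>k\<ge>N. norm (X m - X k) < (1/2)^n" for n :: nat
    using CauchyD[OF C, of "(1/2)^n"] by simp
  then obtain N where N: "\<And>n m k. N n \<le> m \<Longrightarrow> N n \<le> k \<Longrightarrow> norm (X m - X k) < (1/2)^n"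
    by metis
  define r where "r n = Max (N ` {..n})" for n
  have r: "N n \<le> r m" if "n \<le> m" for n m
    using that by (auto simp: r_def)
  define g where "g n = f (r n)" for n
  have [measurable]: "g n \<in> borel_measurable leb01" for n by (simp add: g_def)
  have "(\<integral>\<^sup>+x. (\<Sum>n. ennreal (norm (g (Suc n) x - g n x))) \<partial>leb01)
      = (\<Sum>n. \<integral>\<^sup>+x. ennreal (norm (g (Suc n) x - g n x)) \<partial>leb01)"
    by (rule nn_integral_suminf) measurable
  also have "\<dots> \<le> (\<Sum>n. ennreal (2 * (1/2)^n))"
  proof (rule suminf_le)
    fix n
    have "norm (L2_of (\<lambda>x. g (Suc n) x - g n x)) \<le> (1/2)^n"
      using N[of n "r (Suc n)" "r n"] r[of n "Suc n"] r[of n n]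
      by (simp add: g_def L2_of_diff f flip: X)
    then show "(\<integral>\<^sup>+x. ennreal (norm (g (Suc n) x - g n x)) \<partial>leb01) \<le> ennreal (2 * (1/2)^n)"
      by (intro nn_integral_norm_le_L2) (auto simp: g_def f L2_fun_diff)
  qed auto
  also have "\<dots> = ennreal (\<Sum>n. 2 * (1/2)^n)"
    by (rule suminf_ennreal2) (auto intro!: summable_mult summable_geometric)
  also have "\<dots> < \<infinity>" by simp
  finally have "AE x in leb01. (\<Sum>n. ennreal (norm (g (Suc n) x - g n x))) \<noteq> \<infinity>"
    by (intro nn_integral_noteq_infinite) auto
  then have conv: "AE x in leb01. convergent (\<lambda>n. g n x)"
  proof eventually_elim
    fix x assume "(\<Sum>n. ennreal (norm (g (Suc n) x - g n x))) \<noteq> \<infinity>"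
    then have "summable (\<lambda>n. norm (g (Suc n) x - g n x))"
      by (intro summable_suminf_not_top) auto
    then have "summable (\<lambda>n. g (Suc n) x - g n x)" by (rule summable_norm_cancel)
    then have "convergent (\<lambda>n. \<Sum>i<n. g (Suc i) x - g i x)" by (simp add: summable_iff_convergent)
    then have "convergent (\<lambda>n. g n x - g 0 x)" by (simp only: sum_lessThan_telescope[of "\<lambda>n. g n x"])
    then have "convergent (\<lambda>n. g n x - g 0 x + g 0 x)"
      by (rule convergent_add) (rule convergent_const)
    then show "convergent (\<lambda>n. g n x)" by simp
  qed
  define h where "h x = lim (\<lambda>n. g n x)" for x
  have [measurable]: "h \<in> borel_measurable leb01"
    unfolding h_def by (rule borel_measurable_lim_metric) measurable
  have lim: "AE x in leb01. (\<lambda>n. g n x) \<longlonglongrightarrow> h x"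
    using conv by eventually_elim (simp add: h_def convergent_LIMSEQ_iff)
  have bound: "(\<integral>\<^sup>+x. ennreal ((norm (f m x - h x))\<^sup>2) \<partial>leb01) \<le> ennreal (((1/2)^n)\<^sup>2)"
    if m: "N n \<le> m" for m n
  proof -
    have "(\<integral>\<^sup>+x. ennreal ((norm (f m x - h x))\<^sup>2) \<partial>leb01)
        = (\<integral>\<^sup>+x. liminf (\<lambda>k. ennreal ((norm (f m x - g k x))\<^sup>2)) \<partial>leb01)"
    proof (rule nn_integral_cong_AE)
      show "AE x in leb01. ennreal ((norm (f m x - h x))\<^sup>2)
          = liminf (\<lambda>k. ennreal ((norm (f m x - g k x))\<^sup>2))"
        using lim
      proof eventually_elim
        fix x assume "(\<lambda>n. g n x) \<longlonglongrightarrow> h x"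
        then have "(\<lambda>k. ennreal ((norm (f m x - g k x))\<^sup>2)) \<longlonglongrightarrow> ennreal ((norm (f m x - h x))\<^sup>2)"
          by (intro tendsto_intros)
        then show "ennreal ((norm (f m x - h x))\<^sup>2)
            = liminf (\<lambda>k. ennreal ((norm (f m x - g k x))\<^sup>2))"
          by (rule lim_imp_Liminf[OF sequentially_bot, symmetric])
      qed
    qed
    also have "\<dots> \<le> liminf (\<lambda>k. \<integral>\<^sup>+x. ennreal ((norm (f m x - g k x))\<^sup>2) \<partial>leb01)"
      by (rule nn_integral_liminf) measurable
    also have "\<dots> \<le> limsup (\<lambda>k. \<integral>\<^sup>+x. ennreal ((norm (f m x - g k x))\<^sup>2) \<partial>leb01)"
      by (rule Liminf_le_Limsup) simp
    also have "\<dots> \<le> ennreal (((1/2)^n)\<^sup>2)"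
    proof (rule Limsup_bounded)
      show "\<forall>\<^sub>F k in sequentially.
          (\<integral>\<^sup>+x. ennreal ((norm (f m x - g k x))\<^sup>2) \<partial>leb01) \<le> ennreal (((1/2)^n)\<^sup>2)"
        using eventually_ge_at_top[of n]
      proof eventually_elim
        fix k assume k: "n \<le> k"
        have "(\<integral>\<^sup>+x. ennreal ((norm (f m x - g k x))\<^sup>2) \<partial>leb01)
            = ennreal ((norm (X m - X (r k)))\<^sup>2)"
          using ennreal_norm_L2_of[of "\<lambda>x. f m x - g k x"]
          by (simp add: g_def L2_fun_diff L2_of_diff f X)
        also have "\<dots> \<le> ennreal (((1/2)^n)\<^sup>2)"
          using N[OF m r[OF k]] by (intro ennreal_leI power_mono) auto
        finally show "(\<integral>\<^sup>+x. ennreal ((norm (f m x - g k x))\<^sup>2) \<partial>leb01) \<le> ennreal (((1/2)^n)\<^sup>2)" .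
      qed
    qed
    finally show ?thesis .
  qed
  have diff: "(\<lambda>x. f m x - h x) \<in> L2_fun" if "N n \<le> m" for m n
  proof (rule L2_funI_nn)
    show "(\<integral>\<^sup>+x. ennreal ((norm (f m x - h x))\<^sup>2) \<partial>leb01) < \<infinity>"
      using bound[OF that] by (rule order_le_less_trans) simp
  qed measurable
  have h: "h \<in> L2_fun"
    using L2_fun_diff[OF f[of "N 0"] diff[of 0 "N 0"]] by simp
  have le: "norm (X m - L2_of h) \<le> (1/2)^n" if m: "N n \<le> m" for m n
  proof -
    have "ennreal ((norm (X m - L2_of h))\<^sup>2) \<le> ennreal (((1/2)^n)\<^sup>2)"
      using bound[OF m] ennreal_norm_L2_of[OF diff[OF m]] by (simp add: L2_of_diff f h X)
    then have "(norm (X m - L2_of h))\<^sup>2 \<le> ((1/2)^n)\<^sup>2"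
      by (subst (asm) ennreal_le_iff) auto
    then show ?thesis by (rule power2_le_imp_le) simp
  qed
  have "X \<longlonglongrightarrow> L2_of h"
  proof (rule LIMSEQ_I)
    fix e :: real assume "0 < e"
    then obtain n where "(1/2)^n < e" using real_arch_pow_inv[of e "1/2"] by auto
    then show "\<exists>no. \<forall>m\<ge>no. norm (X m - L2_of h) < e"
      using le[of n] by (intro exI[of _ "N n"]) (meson order_le_less_trans)
  qed
  then show "convergent X" by (rule convergentI)
qed

lemma L2_fun_bounded:
  assumes "f \<in> borel_measurable leb01" and "\<And>x. norm (f x) \<le> B"
  shows "f \<in> L2_fun"
proof -
  interpret finite_measure leb01 by (rule finite_measure_leb01)
  have "(norm (f x))\<^sup>2 \<le> B\<^sup>2" for x using assms(2) by (intro power_mono) auto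
  then have "integrable leb01 (\<lambda>x. (norm (f x))\<^sup>2)"
    by (intro integrable_const_bound[where B="B\<^sup>2"] AE_I2) (use assms(1) in \<open>simp_all\<close>)
  then show ?thesis using assms by (simp add: L2_fun_def)
qed

lemma L2_of_tendsto:
  fixes f :: "nat \<Rightarrow> real \<Rightarrow> complex"
  assumes m: "\<And>n. f n \<in> borel_measurable leb01" "g \<in> borel_measurable leb01"
    and lim: "\<And>x. (\<lambda>n. f n x) \<longlonglongrightarrow> g x"
    and bd: "\<And>n x. norm (f n x) \<le> norm (w x)" and w: "w \<in> L2_fun"
  shows "(\<lambda>n. L2_of (f n)) \<longlonglongrightarrow> L2_of g"
proof -
  note [measurable] = m
  have wi: "integrable leb01 (\<lambda>x. (norm (w x))\<^sup>2)" using w by (simp add: L2_fun_def)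
  have gb: "norm (g x) \<le> norm (w x)" for x
    using LIMSEQ_le_const2[OF tendsto_norm[OF lim[of x]]] bd by blast
  have dom: "u \<in> L2_fun" if [measurable]: "u \<in> borel_measurable leb01"
    and b: "\<And>x. norm (u x) \<le> norm (w x)" for u :: "real \<Rightarrow> complex"
  proof -
    have "(norm (u x))\<^sup>2 \<le> (norm (w x))\<^sup>2" for x using b by (intro power_mono) auto
    then have "integrable leb01 (\<lambda>x. (norm (u x))\<^sup>2)"
      by (intro Bochner_Integration.integrable_bound[OF wi]) auto
    then show ?thesis by (simp add: L2_fun_def)
  qed
  have fL: "f n \<in> L2_fun" for n using bd by (intro dom) auto
  have gL: "g \<in> L2_fun" using gb by (intro dom) auto
  have "(\<lambda>n. LINT x|leb01. (norm (f n x - g x))\<^sup>2) \<longlonglongrightarrow> (LINT x|leb01. 0)"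
  proof (rule integral_dominated_convergence[where w="\<lambda>x. 4 * (norm (w x))\<^sup>2"])
    show "integrable leb01 (\<lambda>x. 4 * (norm (w x))\<^sup>2)" using wi by simp
    show "AE x in leb01. (\<lambda>n. (norm (f n x - g x))\<^sup>2) \<longlonglongrightarrow> 0"
    proof (rule AE_I2)
      fix x
      have "(\<lambda>n. (norm (f n x - g x))\<^sup>2) \<longlonglongrightarrow> (norm (g x - g x))\<^sup>2"
        using lim[of x] by (intro tendsto_intros)
      then show "(\<lambda>n. (norm (f n x - g x))\<^sup>2) \<longlonglongrightarrow> 0" by simp
    qed
    fix n
    show "AE x in leb01. norm ((norm (f n x - g x))\<^sup>2) \<le> 4 * (norm (w x))\<^sup>2"
    proof (rule AE_I2)
      fix x
      have "norm (f n x - g x) \<le> norm (f n x) + norm (g x)" by (rule norm_triangle_ineq4)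
      also have "\<dots> \<le> 2 * norm (w x)" using bd[of n x] gb[of x] by simp
      finally have "(norm (f n x - g x))\<^sup>2 \<le> (2 * norm (w x))\<^sup>2" by (intro power_mono) auto
      then show "norm ((norm (f n x - g x))\<^sup>2) \<le> 4 * (norm (w x))\<^sup>2" by (simp add: power_mult_distrib)
    qed
  qed measurable
  then have "(\<lambda>n. sqrt (LINT x|leb01. (norm (f n x - g x))\<^sup>2)) \<longlonglongrightarrow> sqrt 0"
    by (intro tendsto_real_sqrt) simp
  moreover have "sqrt (LINT x|leb01. (norm (f n x - g x))\<^sup>2) = norm (L2_of (f n) - L2_of g)" for n
    using norm_L2_of[OF L2_fun_diff[OF fL[of n] gL]] L2_of_diff[OF fL[of n] gL] by simp
  ultimately have "(\<lambda>n. norm (L2_of (f n) - L2_of g)) \<longlonglongrightarrow> 0" by simp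
  then show ?thesis by (simp add: tendsto_norm_zero_iff LIM_zero_iff)
qed

lemma borel_imp_leb01: "f \<in> borel_measurable borel \<Longrightarrow> f \<in> borel_measurable leb01"
  by (intro measurable_restrict_space1 measurable_completion) (simp add: measurable_lborel1)

lemma L2_borel_cases:
  obtains f where "f \<in> borel_measurable borel" "f \<in> L2_fun" "F = L2_of f"
proof -
  obtain f where f: "f \<in> L2_fun" "F = L2_of f" by (rule L2_cases)
  define g where "g x = indicator {0<..<1} x *\<^sub>R f x" for x
  have "f \<in> borel_measurable leb01" using f by (simp add: L2_fun_def)
  then have g: "g \<in> borel_measurable lebesgue"
    unfolding g_def by (subst (asm) borel_measurable_restrict_space_iff) auto
  have "(\<lambda>x. Re (g x)) \<in> borel_measurable (completion lborel)"
    "(\<lambda>x. Im (g x)) \<in> borel_measurable (completion lborel)"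
    using g by measurable
  then obtain p q where pq: "p \<in> borel_measurable lborel" "AE x in lborel. Re (g x) = p x"
      "q \<in> borel_measurable lborel" "AE x in lborel. Im (g x) = q x"
    using completion_ex_borel_measurable_real[of _ lborel] by metis
  define h where "h x = Complex (p x) (q x)" for x
  have h: "h \<in> borel_measurable borel"
    unfolding h_def using pq by (simp add: Complex_eq)
  have "AE x in lborel. g x = h x"
    using pq(2,4) by eventually_elim (simp add: h_def complex_eq_iff)
  then have "AE x in lebesgue. g x = h x" by (rule AE_completion)
  then have "AE x in leb01. f x = h x"
    by (subst AE_restrict_space_iff) (auto simp: g_def elim: eventually_mono)
  moreover from this have hL: "h \<in> L2_fun"
    by (intro L2_fun_AE_cong[OF f(1) borel_imp_leb01[OF h]])
  ultimately have "F = L2_of h" using f L2_of_eq_iff by simp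
  then show ?thesis by (rule that[OF h hL])
qed

lemma L2_separable: "\<exists>D :: L2 set. countable D \<and> closure D = UNIV"
proof -
  obtain R :: "real set" where R: "countable R" "\<And>X. open X \<Longrightarrow> X \<noteq> {} \<Longrightarrow> \<exists>d\<in>R. d \<in> X"
    using countable_dense_exists by metis
  obtain E :: "complex set" where E: "countable E" "\<And>X. open X \<Longrightarrow> X \<noteq> {} \<Longrightarrow> \<exists>d\<in>E. d \<in> X"
    using countable_dense_exists by metis
  define b :: "complex \<times> real \<Rightarrow> L2" where "b = (\<lambda>(c, q). L2_of (\<lambda>x. c * indicator {..<q} x))"
  define D where "D = (\<lambda>l. sum_list (map b l)) ` lists (E \<times> R)"
  have D_countable: "countable D" using R E by (auto simp: D_def)
  have D_add: "F + G \<in> D" if "F \<in> D" "G \<in> D" for F G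
  proof -
    obtain l k where "l \<in> lists (E \<times> R)" "F = sum_list (map b l)"
      "k \<in> lists (E \<times> R)" "G = sum_list (map b k)"
      using \<open>F \<in> D\<close> \<open>G \<in> D\<close> by (auto simp: D_def)
    then show ?thesis unfolding D_def by (intro image_eqI[of _ _ "l @ k"]) auto
  qed
  define C where "C = closure D"
  have C_add: "F + G \<in> C" if "F \<in> C" "G \<in> C" for F G
  proof -
    obtain s t where "\<And>n. s n \<in> D" "s \<longlonglongrightarrow> F" "\<And>n. t n \<in> D" "t \<longlonglongrightarrow> G"
      using \<open>F \<in> C\<close> \<open>G \<in> C\<close> unfolding C_def closure_sequential by metis
    then have "\<And>n. s n + t n \<in> D" "(\<lambda>n. s n + t n) \<longlonglongrightarrow> F + G"
      by (auto intro: D_add tendsto_add)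
    then show ?thesis unfolding C_def closure_sequential by metis
  qed
  have C_lim: "F \<in> C" if "\<And>n. s n \<in> C" "s \<longlonglongrightarrow> F" for s :: "nat \<Rightarrow> L2" and F
    using that closed_sequentially[of C] by (auto simp: C_def)
  have "0 \<in> D" unfolding D_def by (intro image_eqI[of _ _ "[]"]) auto
  then have C0: "0 \<in> C" using closure_subset by (auto simp: C_def)
  have ind_L2: "(\<lambda>x. c * indicator A x) \<in> L2_fun" if "A \<in> sets borel" for c :: complex and A
  proof (rule L2_fun_bounded)
    show "(\<lambda>x. c * indicator A x) \<in> borel_measurable leb01"
      using that by (intro borel_imp_leb01 borel_measurable_times borel_measurable_const
          borel_measurable_indicator)
    show "norm (c * indicator A x) \<le> norm c" for x by (auto simp: indicator_def)
  qed
  have ind_lim: "L2_of (\<lambda>x. c * indicator A x) \<in> C"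
    if B: "\<And>n. B n \<in> sets borel" and A: "A \<in> sets borel" and mem: "\<And>n. L2_of (\<lambda>x. d n * indicator (B n) x) \<in> C"
      and lim: "d \<longlonglongrightarrow> c" "\<And>x. (\<lambda>n. indicator (B n) x :: complex) \<longlonglongrightarrow> indicator A x"
    for B :: "nat \<Rightarrow> real set" and A and d :: "nat \<Rightarrow> complex" and c
  proof (rule C_lim[OF mem])
    obtain K where K: "\<And>n. norm (d n) \<le> K"
      using convergent_imp_Bseq[OF convergentI[OF lim(1)]] unfolding Bseq_def by blast
    have "0 \<le> K" using K[of 0] norm_ge_zero order_trans by blast
    show "(\<lambda>n. L2_of (\<lambda>x. d n * indicator (B n) x)) \<longlonglongrightarrow> L2_of (\<lambda>x. c * indicator A x)"
    proof (rule L2_of_tendsto[where w="\<lambda>x. of_real K"])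
      show "(\<lambda>x. d n * indicator (B n) x) \<in> borel_measurable leb01" for n
        using ind_L2[OF B] by (simp add: L2_fun_def)
      show "(\<lambda>x. c * indicator A x) \<in> borel_measurable leb01"
        using ind_L2[OF A] by (simp add: L2_fun_def)
      show "(\<lambda>n. d n * indicator (B n) x) \<longlonglongrightarrow> c * indicator A x" for x
        using lim by (intro tendsto_mult)
      show "norm (d n * indicator (B n) x) \<le> norm (of_real K :: complex)" for n x
        using K[of n] \<open>0 \<le> K\<close> by (auto simp: indicator_def)
      show "(\<lambda>x. of_real K) \<in> L2_fun" by (rule L2_fun_bounded[where B="\<bar>K\<bar>"]) auto
    qed
  qed
  have halfline: "L2_of (\<lambda>x. c * indicator {..<a} x) \<in> C" for c a
  proof -
    have "\<exists>d\<in>E. d \<in> ball c (1 / Suc n)" for n by (rule E) auto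
    then obtain d where d: "\<And>n. d n \<in> E" "\<And>n. d n \<in> ball c (1 / Suc n)" by metis
    have "\<exists>q\<in>R. q \<in> {a - 1 / Suc n <..< a}" for n by (rule R) auto
    then obtain q where q: "\<And>n. q n \<in> R" "\<And>n. q n \<in> {a - 1 / Suc n <..< a}" by metis
    have z: "(\<lambda>n. 1 / real (Suc n)) \<longlonglongrightarrow> 0" using LIMSEQ_inverse_real_of_nat by (simp add: inverse_eq_divide)
    have "(\<lambda>n. norm (d n - c)) \<longlonglongrightarrow> 0"
      by (rule tendsto_sandwich[OF _ _ tendsto_const z])
         (use d(2) in \<open>auto simp: dist_norm norm_minus_commute intro!: always_eventually less_imp_le\<close>)
    then have dl: "d \<longlonglongrightarrow> c" by (simp add: tendsto_norm_zero_iff LIM_zero_iff)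
    have ql: "q \<longlonglongrightarrow> a"
    proof (rule tendsto_sandwich)
      show "(\<lambda>n. a - 1 / real (Suc n)) \<longlonglongrightarrow> a" using tendsto_diff[OF tendsto_const z, of a] by simp
    qed (use q(2) in \<open>auto intro!: always_eventually less_imp_le\<close>)
    show ?thesis
    proof (rule ind_lim[of "\<lambda>n. {..<q n}"])
      show "L2_of (\<lambda>x. d n * indicator {..<q n} x) \<in> C" for n
      proof -
        have "L2_of (\<lambda>x. d n * indicator {..<q n} x) \<in> D"
          unfolding D_def using d(1)[of n] q(1)[of n]
          by (intro image_eqI[of _ _ "[(d n, q n)]"]) (auto simp: b_def)
        then show ?thesis using closure_subset by (auto simp: C_def)
      qed
      show "(\<lambda>n. indicator {..<q n} x :: complex) \<longlonglongrightarrow> indicator {..<a} x" for x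
      proof (rule tendsto_eventually)
        show "\<forall>\<^sub>F n in sequentially. indicator {..<q n} x = (indicator {..<a} x :: complex)"
        proof (cases "x < a")
          case True
          from order_tendstoD(1)[OF ql True] show ?thesis
            by eventually_elim (use True in simp)
        next
          case False
          have "indicator {..<q n} x = (indicator {..<a} x :: complex)" for n
            using False q(2)[of n] by (auto simp: indicator_def)
          then show ?thesis by simp
        qed
      qed
    qed (use dl in auto)
  qed
  have ind: "\<forall>c. L2_of (\<lambda>x. c * indicator A x) \<in> C" if "A \<in> sets borel" for A :: "real set"
  proof -
    have gen: "sets borel = sigma_sets UNIV (range lessThan :: real set set)"
      by (simp add: borel_Iio)
    have "Int_stable (range lessThan :: real set set)"
    proof (rule Int_stableI)
      fix U V :: "real set" assume "U \<in> range lessThan" "V \<in> range lessThan"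
      then obtain p q where "U = {..<p}" "V = {..<q}" by auto
      then have "U \<inter> V = {..<min p q}" by auto
      then show "U \<inter> V \<in> range lessThan" by simp
    qed
    moreover have "range lessThan \<subseteq> Pow (UNIV :: real set)" by simp
    moreover have "A \<in> sigma_sets UNIV (range lessThan)" using that gen by simp
    ultimately show ?thesis
    proof (induction rule: sigma_sets_induct_disjoint)
      case (basic A)
      then show ?case using halfline by auto
    next
      case empty
      then show ?case using C0 by (simp add: L2_of_zero)
    next
      case (compl A)
      have A: "A \<in> sets borel" using compl gen by simp
      show ?case
      proof
        fix c
        have 1: "(\<lambda>x. c * indicator {..<1} x) \<in> L2_fun" by (rule ind_L2) simp
        have 2: "(\<lambda>x. (- c) * indicator A x) \<in> L2_fun" by (rule ind_L2) (rule A)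
        have 3: "(\<lambda>x. c * indicator (UNIV - A) x) \<in> L2_fun" by (rule ind_L2) (use A in auto)
        have "L2_of (\<lambda>x. c * indicator (UNIV - A) x)
            = L2_of (\<lambda>x. c * indicator {..<1} x + (- c) * indicator A x)"
          by (subst L2_of_eq_iff[OF 3 L2_fun_add[OF 1 2]])
             (auto intro!: AE_I2 simp: space_restrict_space indicator_def)
        also have "\<dots> = L2_of (\<lambda>x. c * indicator {..<1} x) + L2_of (\<lambda>x. (- c) * indicator A x)"
          by (rule L2_of_add[OF 1 2])
        also have "\<dots> \<in> C" using compl.IH by (intro C_add halfline) blast
        finally show "L2_of (\<lambda>x. c * indicator (UNIV - A) x) \<in> C" .
      qed
    next
      case (union A)
      have A: "A n \<in> sets borel" for n using union gen by auto
      have U: "(\<Union>i<n. A i) \<in> sets borel" for n using A by auto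
      have fin: "L2_of (\<lambda>x. c * indicator (\<Union>i<n. A i) x) \<in> C" for c and n :: nat
      proof (induction n)
        case 0
        show ?case using C0 by (simp add: L2_of_zero)
      next
        case (Suc n)
        have "indicator (\<Union>i<Suc n. A i) x = indicator (\<Union>i<n. A i) x + (indicator (A n) x :: complex)" for x
        proof -
          have "x \<notin> A i" if "x \<in> A n" "i < n" for i
            using disjoint_family_onD[OF \<open>disjoint_family A\<close>, of n i] that by auto
          then show ?thesis by (auto simp: indicator_def less_Suc_eq)
        qed
        then have "L2_of (\<lambda>x. c * indicator (\<Union>i<Suc n. A i) x)
            = L2_of (\<lambda>x. c * indicator (\<Union>i<n. A i) x + c * indicator (A n) x)"
          by (simp add: distrib_left)
        also have "\<dots> = L2_of (\<lambda>x. c * indicator (\<Union>i<n. A i) x) + L2_of (\<lambda>x. c * indicator (A n) x)"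
          by (rule L2_of_add[OF ind_L2[OF U] ind_L2[OF A]])
        also have "\<dots> \<in> C" using Suc.IH union.IH by (intro C_add) blast+
        finally show ?case .
      qed
      show ?case
      proof
        fix c
        show "L2_of (\<lambda>x. c * indicator (\<Union> (range A)) x) \<in> C"
        proof (rule ind_lim[of "\<lambda>n. \<Union>i<n. A i" _ "\<lambda>n. c"])
          show "(\<lambda>n. indicator (\<Union>i<n. A i) x :: complex) \<longlonglongrightarrow> indicator (\<Union> (range A)) x" for x
            using LIMSEQ_indicator_UN[of A x] by simp
        qed (use U fin A in auto)
      qed
    qed
  qed
  have "F \<in> C" for F
  proof -
    obtain f where f: "f \<in> borel_measurable borel" "f \<in> L2_fun" "F = L2_of f"
      by (rule L2_borel_cases)
    obtain s where s: "\<And>i. simple_function borel (s i)" "\<And>x. (\<lambda>i. s i x) \<longlonglongrightarrow> f x"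
        "\<And>i x. norm (s i x) \<le> 2 * norm (f x)"
      using borel_measurable_implies_sequence_metric[OF f(1), of 0] by (auto simp: dist_norm)
    have simple: "L2_of u \<in> C" if u: "simple_function borel u" for u :: "real \<Rightarrow> complex"
    proof -
      have fin: "finite (range u)" using simple_functionD(1)[OF u] by simp
      have meas: "u -` {y} \<in> sets borel" for y using simple_functionD(2)[OF u, of "{y}"] by simp
      have part: "L2_of (\<lambda>x. \<Sum>y\<in>Y. y * indicator (u -` {y}) x) \<in> C
          \<and> (\<lambda>x. \<Sum>y\<in>Y. y * indicator (u -` {y}) x) \<in> L2_fun" if "finite Y" for Y
        using that
      proof induction
        case empty
        show ?case using C0 by (simp add: L2_of_zero L2_fun_zero)
      next
        case (insert y Y)
        let ?S = "\<lambda>x. \<Sum>y\<in>Y. y * indicator (u -` {y}) x"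
        have "(\<lambda>x. \<Sum>y\<in>insert y Y. y * indicator (u -` {y}) x) = (\<lambda>x. y * indicator (u -` {y}) x + ?S x)"
          using insert.hyps by (simp only: sum.insert not_False_eq_True)
        moreover have "?S \<in> L2_fun" "L2_of ?S \<in> C" using insert.IH by blast+
        moreover have "L2_of (\<lambda>x. y * indicator (u -` {y}) x) \<in> C" using ind[OF meas[of y]] by blast
        ultimately show ?case
          by (simp only: L2_of_add[OF ind_L2[OF meas]] L2_fun_add[OF ind_L2[OF meas]] C_add simp_thms)
      qed
      have "(\<Sum>y\<in>range u. y * indicator (u -` {y}) x) = u x" for x
      proof -
        have "(\<Sum>y\<in>range u. y * indicator (u -` {y}) x) = (\<Sum>y\<in>range u. if u x = y then y else 0)"
          by (intro sum.cong) (auto simp: indicator_def)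
        then show ?thesis using fin by simp
      qed
      then show ?thesis using part[OF fin] by simp
    qed
    have "(\<lambda>i. L2_of (s i)) \<longlonglongrightarrow> L2_of f"
    proof (rule L2_of_tendsto[where w="\<lambda>x. 2 * f x"])
      show "s i \<in> borel_measurable leb01" for i
        using borel_measurable_simple_function[OF s(1)] by (rule borel_imp_leb01)
      show "f \<in> borel_measurable leb01" using f(1) by (rule borel_imp_leb01)
      show "(\<lambda>x. 2 * f x) \<in> L2_fun" by (rule L2_fun_cmult[OF f(2)])
    qed (use s in \<open>auto simp: norm_mult\<close>)
    then show ?thesis using C_lim[of "\<lambda>i. L2_of (s i)"] simple s(1) f(3) by blast
  qed
  then show ?thesis using D_countable by (auto simp: C_def)
qed

instance L2 :: second_countable_topology
proof
  obtain D :: "L2 set" where D: "countable D" "closure D = UNIV" using L2_separable by blast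
  define B where "B = (\<lambda>(F, n). ball F (1 / real (Suc n))) ` (D \<times> (UNIV :: nat set))"
  have "countable B" using D by (auto simp: B_def)
  moreover have "topological_basis B"
  proof (rule topological_basisI)
    show "open U" if "U \<in> B" for U using that by (auto simp: B_def)
    fix U and F :: L2 assume "open U" "F \<in> U"
    then obtain e where e: "0 < e" "ball F e \<subseteq> U" by (meson open_contains_ball)
    obtain n where n: "1 / real (Suc n) < e / 2"
      using nat_approx_posE[of "e / 2"] e by auto
    have "F \<in> closure D" using D by simp
    then obtain G where G: "G \<in> D" "dist G F < 1 / real (Suc n)"
      unfolding closure_approachable by (meson divide_pos_pos of_nat_0_less_iff zero_less_Suc zero_less_one)
    have "ball G (1 / real (Suc n)) \<subseteq> ball F e"
    proof
      fix H assume "H \<in> ball G (1 / real (Suc n))"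
      then show "H \<in> ball F e" using dist_triangle[of F H G] G n by (simp add: dist_commute)
    qed
    moreover have "ball G (1 / real (Suc n)) \<in> B" using G by (auto simp: B_def)
    ultimately show "\<exists>V\<in>B. F \<in> V \<and> V \<subseteq> U" using G e by (intro bexI) auto
  qed
  ultimately show "\<exists>B :: L2 set set. countable B \<and> open = generate_topology B"
    using topological_basis_imp_subbasis by blast
qed


section \<open>Sturm--Liouville operators on (0,1) with Dirichlet boundary conditions\<close>

text \<open>\<open>f\<close> is the absolutely continuous representative, on \<open>[0,1]\<close>, of an element of \<open>H\<^sup>1(0,1)\<close>,
  and \<open>f'\<close> is its derivative.\<close>

definition H1_deriv :: "(real \<Rightarrow> complex) \<Rightarrow> (real \<Rightarrow> complex) \<Rightarrow> bool" where
  "H1_deriv f f' \<longleftrightarrow>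
     f' \<in> L2_fun \<and> (\<forall>x\<in>{0..1}. f x = f 0 + (LINT y|lebesgue_on {0<..<x}. f' y))"

text \<open>The graph of \<open>A z = (\<alpha> z')'\<close> with domain \<open>{z \<in> H\<^sup>1\<^sub>0(0,1). \<alpha> z' \<in> H\<^sup>1(0,1)}\<close>; the function \<open>v\<close> is
  the continuous representative of the flux \<open>\<alpha> z'\<close>.\<close>

definition dirichlet_op :: "(real \<Rightarrow> real) \<Rightarrow> L2 \<Rightarrow> L2 \<Rightarrow> bool" where
  "dirichlet_op \<alpha> Z W \<longleftrightarrow>
     (\<exists>z z' v v'. H1_deriv z z' \<and> z 0 = 0 \<and> z 1 = 0 \<and>
        H1_deriv v v' \<and> (AE x in leb01. v x = of_real (\<alpha> x) * z' x) \<and>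
        Z = L2_of z \<and> W = L2_of v')"

section \<open>Mild solutions\<close>

definition C0_semigroup :: "(real \<Rightarrow> 'a \<Rightarrow> 'a::banach) \<Rightarrow> bool" where
  "C0_semigroup T \<longleftrightarrow>
     (\<forall>t\<ge>0. bounded_linear (T t)) \<and> (\<forall>x. T 0 x = x) \<and>
     (\<forall>s\<ge>0. \<forall>t\<ge>0. \<forall>x. T (s + t) x = T s (T t x)) \<and>
     (\<forall>x. ((\<lambda>t. T t x) \<longlongrightarrow> x) (at_right 0))"

definition generator :: "(real \<Rightarrow> 'a \<Rightarrow> 'a::banach) \<Rightarrow> 'a \<Rightarrow> 'a \<Rightarrow> bool" where
  "generator T x y \<longleftrightarrow> ((\<lambda>h. (T h x - x) /\<^sub>R h) \<longlongrightarrow> y) (at_right 0)"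

text \<open>The mild solution on \<open>[0,\<tau>]\<close> of \<open>z' = A z + f\<close>, \<open>z 0 = z\<^sub>0\<close>, i.e. Duhamel's formula for the
  semigroup generated by \<open>A\<close>. Real linearity of the semigroup loses nothing: a semigroup is
  determined by its generator, and \<open>A\<close> commutes with multiplication by the imaginary unit.\<close>

definition mild_solution ::
  "(real \<Rightarrow> real) \<Rightarrow> (real \<Rightarrow> L2) \<Rightarrow> L2 \<Rightarrow> real \<Rightarrow> (real \<Rightarrow> L2) \<Rightarrow> bool" where
  "mild_solution \<alpha> f z\<^sub>0 \<tau> z \<longleftrightarrow>
     (\<exists>T. C0_semigroup T \<and> (\<forall>F G. generator T F G \<longleftrightarrow> dirichlet_op \<alpha> F G) \<and>
        (\<forall>t\<in>{0..\<tau>}. has_bochner_integral (lebesgue_on {0..t}) (\<lambda>s. T (t - s) (f s)) (z t - T t z\<^sub>0)))"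

section \<open>Time-optimal control\<close>

text \<open>Controls are functions of \<open>(t,x)\<close>, considered up to equality almost everywhere on
  \<open>(0,\<tau>) \<times> J\<close>; their values elsewhere are irrelevant.\<close>

definition control_ball :: "real \<Rightarrow> real set \<Rightarrow> real \<Rightarrow> (real \<times> real \<Rightarrow> complex) set" where
  "control_ball \<tau> J M =
     {u. u \<in> borel_measurable (lebesgue_on ({0<..<\<tau>} \<times> J)) \<and>
         (AE q in lebesgue_on ({0<..<\<tau>} \<times> J). norm (u q) \<le> M)}"

definition control_input :: "real set \<Rightarrow> (real \<times> real \<Rightarrow> complex) \<Rightarrow> real \<Rightarrow> L2" where
  "control_input J u t = L2_of (\<lambda>x. indicator J x * u (t, x))"

definition steers_to_zero ::
  "(real \<Rightarrow> real) \<Rightarrow> real set \<Rightarrow> real \<Rightarrow> L2 \<Rightarrow> real \<Rightarrow> (real \<times> real \<Rightarrow> complex) \<Rightarrow> bool" where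
  "steers_to_zero \<alpha> J M z\<^sub>0 \<tau> u \<longleftrightarrow>
     0 < \<tau> \<and> u \<in> control_ball \<tau> J M \<and>
     (\<exists>z. mild_solution \<alpha> (control_input J u) z\<^sub>0 \<tau> z \<and> z \<tau> = 0)"

definition optimal_time :: "(real \<Rightarrow> real) \<Rightarrow> real set \<Rightarrow> real \<Rightarrow> L2 \<Rightarrow> real" where
  "optimal_time \<alpha> J M z\<^sub>0 = Inf {\<tau>. \<exists>u. steers_to_zero \<alpha> J M z\<^sub>0 \<tau> u}"

text \<open>Existence of an optimal control entails that the infimum in \<^const>\<open>optimal_time\<close> is taken
  over a nonempty set and is attained at a positive time.\<close>

definition optimal_control ::
  "(real \<Rightarrow> real) \<Rightarrow> real set \<Rightarrow> real \<Rightarrow> L2 \<Rightarrow> (real \<times> real \<Rightarrow> complex) \<Rightarrow> bool" where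
  "optimal_control \<alpha> J M z\<^sub>0 u \<longleftrightarrow> steers_to_zero \<alpha> J M z\<^sub>0 (optimal_time \<alpha> J M z\<^sub>0) u"

definition extend_by_zero ::
  "(real \<times> real) set \<Rightarrow> (real \<times> real \<Rightarrow> complex) \<Rightarrow> real \<times> real \<Rightarrow> complex" where
  "extend_by_zero \<Omega> u q = (if q \<in> \<Omega> then u q else 0)"

section \<open>Periodic coefficients and modes of convergence\<close>

definition periodic_coeff :: "(real \<Rightarrow> real) \<Rightarrow> real \<Rightarrow> bool" where
  "periodic_coeff a K \<longleftrightarrow>
     0 < K \<and> a \<in> borel_measurable lebesgue \<and>
     (AE x in lebesgue. a (x + 1) = a x) \<and>
     (AE x in lebesgue. inverse K \<le> a x \<and> a x \<le> K)"

definition scaled_coeff :: "(real \<Rightarrow> real) \<Rightarrow> real \<Rightarrow> real \<Rightarrow> real" where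
  "scaled_coeff a \<epsilon> x =
     (if \<epsilon> = 0 then inverse (LINT y|lebesgue_on {0..1}. 1 / a y) else a (x / \<epsilon>))"

definition weak_star_tendsto ::
  "'b::euclidean_space set \<Rightarrow> ('c \<Rightarrow> 'b \<Rightarrow> complex) \<Rightarrow> ('b \<Rightarrow> complex) \<Rightarrow> 'c filter \<Rightarrow> bool" where
  "weak_star_tendsto \<Omega> v w F \<longleftrightarrow>
     (\<forall>\<phi>. integrable (lebesgue_on \<Omega>) \<phi> \<longrightarrow>
        ((\<lambda>i. LINT q|lebesgue_on \<Omega>. \<phi> q * v i q) \<longlongrightarrow> (LINT q|lebesgue_on \<Omega>. \<phi> q * w q)) F)"

definition Lp_norm :: "'b::euclidean_space set \<Rightarrow> real \<Rightarrow> ('b \<Rightarrow> complex) \<Rightarrow> real" where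
  "Lp_norm \<Omega> p v = (LINT q|lebesgue_on \<Omega>. norm (v q) powr p) powr (1 / p)"

definition Lp_tendsto ::
  "'b::euclidean_space set \<Rightarrow> real \<Rightarrow> ('c \<Rightarrow> 'b \<Rightarrow> complex) \<Rightarrow> ('b \<Rightarrow> complex) \<Rightarrow> 'c filter \<Rightarrow> bool" where
  "Lp_tendsto \<Omega> p v w F \<longleftrightarrow> ((\<lambda>i. Lp_norm \<Omega> p (\<lambda>q. v i q - w q)) \<longlongrightarrow> 0) F"

end

theory Submission
  imports Defs "HOL-Complex_Analysis.Complex_Analysis" "HOL-Real_Asymp.Real_Asymp"
begin

text \<open>The Dirichlet problem is solved by the Green operator, a positive injective operator on \<open>L\<^sup>2\<close>. A continuous
 functional calculus for it yields the heat semigroup, its analyticity in time and its continuous dependence on the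
 coefficient, which enters the Green operator only through the primitive of \<open>1/a\<close>. For the oscillating coefficients
 these primitives converge uniformly.

 Null controllability, with a cost depending only on \<open>K\<close>, \<open>|I|\<close> and the time, is proved by flatness: near an end
 point the solution is a series in iterated integrals whose coefficients are time derivatives of the boundary flux;
 cutting these off with a Gevrey function and gluing the two ends inside \<open>I\<close> steers to zero. The same series shows
 that a free solution vanishing on a set of positive measure is zero, hence approximate controllability from such a set.

 If an optimal control were smaller than \<open>M\<close> on a set of positive measure, combining both kinds of control would give a
 control of norm less than \<open>M\<close>, and the slack buys a shorter time. Bang-bang controls are unique by strict convexity.
 Limits of controls exist by minimising the norm over convex sets of almost-controls. An extra linear constraint in
 that argument shows that the inner product with the limit control converges, and since all norms are known, so do
 the controls.\<close>

text \<open>The coefficient is only bounded and measurable, so nothing may differentiate it. Two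
  facts stand in for regularity. First, \<open>\<rho> = 1 / a\<close> occurs only under integrals:
  solving \<open>(z' / \<rho>)' = f\<close> means integrating twice, and an oscillating
  \<open>\<rho>\<close> is close to its mean once integrated, with an error of order
  \<open>\<epsilon>\<close>. Second, the free solution is real analytic in positive time whatever
  the coefficient is: its \<open>j\<close>-th time derivative grows like \<open>j!\<close>, while
  \<open>2 i\<close> integrations in space gain \<open>1 / (2 i)!\<close>. A cutoff in time whose
  derivatives grow like \<open>(i!)^(3/2)\<close> therefore still yields convergent series; the gap
  between the orders 3/2 and 2 is what makes flatness work. Every constant met on the way depends on
  \<open>K\<close>, times and lengths only, so the same bounds hold for all
  \<open>\<epsilon>\<close>, and this keeps optimal times from jumping up in the limit. Apart from
  its identification with \<open>dirichlet_op\<close>, the generator is handled through its bounded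
  inverse, so that no domain questions arise.\<close>

lemmas integral_eqI = Bochner_Integration.integral_cong[OF refl]

section \<open>Functional calculus for bounded nonnegative self-adjoint operators\<close>

definition pev :: "('a => 'a) => real poly => 'a => 'a::real_vector" where
 "pev S p x = (\<Sum>i\<le>degree p. coeff p i *\<^sub>R (S ^^ i) x)"

lemma pev_0 [simp]: "pev S 0 x = 0"
 by (simp add: pev_def)

lemma pev_alt:
 assumes "degree p <= n"
 shows "pev S p x = (\<Sum>i\<le>n. coeff p i *\<^sub>R (S ^^ i) x)"
 unfolding pev_def
 by (rule sum.mono_neutral_left) (use assms in \<open>auto simp: coeff_eq_0\<close>)

lemma pev_1 [simp]: "pev S 1 x = x"
 by (simp add: pev_def)

lemma pev_add: "pev S (p + q) x = pev S p x + pev S q x"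
proof -
 let ?n = "max (degree p) (degree q)"
 have "degree (p + q) <= ?n" by (rule degree_add_le_max)
 then show ?thesis
  by (simp add: pev_alt[of "p + q" ?n] pev_alt[of p ?n] pev_alt[of q ?n] scaleR_add_left sum.distrib)
qed

lemma pev_smult: "pev S (smult c p) x = c *\<^sub>R pev S p x"
 by (simp add: pev_alt[of "smult c p" "degree p"] pev_def scaleR_sum_right degree_smult_le)

lemma pev_minus: "pev S (- p) x = - pev S p x"
 using pev_smult[of S "-1" p x] by simp

lemma pev_diff: "pev S (p - q) x = pev S p x - pev S q x"
 using pev_add[of S p "- q" x] by (simp add: pev_minus)

lemma pev_sum: "pev S (\<Sum>k\<in>A. p k) x = (\<Sum>k\<in>A. pev S (p k) x)"
 by (induction A rule: infinite_finite_induct) (auto simp: pev_add)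

lemma smult_sum_right: "smult c (\<Sum>k\<in>A. p k) = (\<Sum>k\<in>A. smult c (p k))"
 by (induction A rule: infinite_finite_induct) (auto simp: smult_add_right)

text \<open>One bound \<open>C\<close> is carried along instead of the norm of \<open>S\<close>, so
  that all operators of a family live over the same spectral interval \<open>{0..C}\<close> and one
  function on it can be applied to each of them.\<close>

locale pos_op =
 fixes S :: "'a => 'a :: {real_inner, banach}" and C :: real
 assumes C_pos: "0 < C"
  and lin: "linear S"
  and sym: "S x \<bullet> y = x \<bullet> S y"
  and nonneg: "0 <= S x \<bullet> x"
  and norm_bd: "norm (S x) <= C * norm x"
begin

lemma S_simps: "S (x + y) = S x + S y" "S (x - y) = S x - S y" "S (- x) = - S x" "S 0 = 0"
  "S (r *\<^sub>R x) = r *\<^sub>R S x"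
 using lin by (simp_all add: linear_add linear_diff linear_neg linear_0 linear_scale)

lemma S_sum: "S (sum f A) = (\<Sum>k\<in>A. S (f k))"
 using linear_sum[OF lin] .

lemma bounded_linear_S: "bounded_linear S"
 by (rule bounded_linear_intro[of S C]) (use lin norm_bd in \<open>auto simp: linear_add linear_scale mult.commute\<close>)

lemma S_le: "S x \<bullet> x <= C * (x \<bullet> x)"
proof -
 have "S x \<bullet> x <= norm (S x) * norm x" by (rule norm_cauchy_schwarz)
 also have "... <= C * norm x * norm x" by (intro mult_right_mono norm_bd) simp
 finally show ?thesis by (simp add: dot_square_norm power2_eq_square)
qed

lemma pev_pCons: "pev S (pCons a p) x = a *\<^sub>R x + S (pev S p x)"
proof -
 have "degree (pCons a p) <= Suc (degree p)" by (rule degree_pCons_le)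
 then have "pev S (pCons a p) x = (\<Sum>i\<le>Suc (degree p). coeff (pCons a p) i *\<^sub>R (S ^^ i) x)"
  by (rule pev_alt)
 also have "... = a *\<^sub>R x + (\<Sum>i\<le>degree p. coeff p i *\<^sub>R (S ^^ Suc i) x)"
  by (simp only: sum.atMost_Suc_shift coeff_pCons_0 coeff_pCons_Suc funpow_0)
 also have "(\<Sum>i\<le>degree p. coeff p i *\<^sub>R (S ^^ Suc i) x) = S (pev S p x)"
  by (simp add: pev_def S_sum S_simps)
 finally show ?thesis .
qed

lemma pev_lin: "pev S p (x + y) = pev S p x + pev S p y" "pev S p (r *\<^sub>R x) = r *\<^sub>R pev S p x"
 by (induction p) (auto simp: pev_pCons S_simps algebra_simps)

lemma pev_lin_diff: "pev S p (x - y) = pev S p x - pev S p y"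
 using pev_lin(1)[of p "x - y" y] by simp

lemma pev_mult: "pev S (p * q) x = pev S p (pev S q x)"
 by (induction p) (auto simp: pev_pCons S_simps mult_pCons_left pev_add pev_smult)

lemma pev_S: "S (pev S p x) = pev S p (S x)"
 by (induction p) (auto simp: pev_pCons S_simps)

lemma pev_sym: "pev S p x \<bullet> y = x \<bullet> pev S p y"
proof (induction p arbitrary: x y)
 case (pCons a p)
 then show ?case
  by (simp add: pev_pCons inner_add_left inner_add_right pev_S) (metis pev_S sym)
qed simp

text \<open>The Bernstein polynomials of \<open>{0..C}\<close> without their binomial factors. They
  carry nonnegativity of a polynomial on the interval over to the operator and so take the place of
  the spectral theorem.\<close>

definition bern :: "nat => nat => real poly" where
 "bern n k = [:0, 1 / C:] ^ k * [:1, - (1 / C):] ^ (n - k)"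

text \<open>\<open>p(S)\<close> is self-adjoint and commutes with \<open>q(S)\<close>, so one factor
  of the square moves to the other side of the inner product.\<close>

lemma pev_square_nonneg:
 assumes "!!y. 0 <= pev S q y \<bullet> y"
 shows "0 <= pev S (p ^ 2 * q) x \<bullet> x"
proof -
 have "pev S (p ^ 2 * q) x = pev S p (pev S q (pev S p x))"
  by (metis mult.commute mult.left_commute pev_mult power2_eq_square)
 then show ?thesis using assms[of "pev S p x"] by (simp add: pev_sym)
qed

lemma pev_bern_nonneg: "0 <= pev S (bern n k) x \<bullet> x"
proof -
 let ?P = "[:0, 1 / C:]" and ?Q = "[:1, - (1 / C):]"
 have P: "0 <= pev S ?P y \<bullet> y" for y
  using nonneg[of y] C_pos by (simp add: pev_pCons S_simps)
 have Q: "0 <= pev S ?Q y \<bullet> y" for y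
  using S_le[of y] C_pos by (simp add: pev_pCons S_simps inner_diff_left field_simps)
 \<comment> \<open>The two factors add up to 1, so their product equals
   \<open>?P ^ 2 * ?Q + ?Q ^ 2 * ?P\<close>. This settles the product of two commuting nonnegative
   operators without operator square roots.\<close>
 have PQ: "0 <= pev S (?P * ?Q) y \<bullet> y" for y
 proof -
  have "?P * ?Q = ?P ^ 2 * ?Q + ?Q ^ 2 * ?P"
   by (simp add: power2_eq_square algebra_simps)
  then show ?thesis
   using pev_square_nonneg[of ?Q ?P y, OF Q] pev_square_nonneg[of ?P ?Q y, OF P]
   by (simp add: pev_add inner_add_left del: mult_pCons_left mult_pCons_right)
 qed
 \<comment> \<open>Even powers are squares, so only the parities of \<open>k\<close> and
   \<open>n - k\<close> matter.\<close>
 have par: "\<exists>p. q ^ m = p ^ 2 * (if odd m then q else 1)" for q :: "real poly" and m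
 proof (intro exI)
  have "q ^ m = q ^ (m div 2 * 2 + m mod 2)" by simp
  also have "... = (q ^ (m div 2)) ^ 2 * q ^ (m mod 2)" by (simp only: power_add power_mult)
  also have "q ^ (m mod 2) = (if odd m then q else 1)" by (simp add: odd_iff_mod_2_eq_one even_iff_mod_2_eq_zero)
  finally show "q ^ m = (q ^ (m div 2)) ^ 2 * (if odd m then q else 1)" .
 qed
 obtain p q where p: "?P ^ k = p ^ 2 * (if odd k then ?P else 1)"
  and q: "?Q ^ (n - k) = q ^ 2 * (if odd (n - k) then ?Q else 1)"
  using par by meson
 have "bern n k = (p * q) ^ 2 * ((if odd k then ?P else 1) * (if odd (n - k) then ?Q else 1))"
  unfolding bern_def p q by (simp only: power_mult_distrib mult_ac)
 moreover have "0 <= pev S ((if odd k then ?P else 1) * (if odd (n - k) then ?Q else 1)) y \<bullet> y" for y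
  using P Q PQ by (auto simp del: mult_pCons_left mult_pCons_right)
 ultimately show ?thesis by (simp only: pev_square_nonneg)
qed

text \<open>After cancelling binomials this is the binomial theorem for
  \<open>?x + (1 - ?x) = 1\<close> to the power \<open>n - j\<close>, shifted by \<open>j\<close>.
  The coefficients are close to the values of the monomial at the nodes \<open>C * k / n\<close>,
  which \<open>choose_ratio\<close> makes quantitative.\<close>

lemma monom_bern:
 assumes "j <= n"
 shows "monom 1 j = (\<Sum>k\<le>n. smult (C ^ j * (of_nat (k choose j) / of_nat (n choose j)) * of_nat (n choose k)) (bern n k))"
proof (rule poly_eq_poly_eq_iff[THEN iffD1], rule ext)
 fix s :: real
 let ?x = "s / C"
 have nz: "real (n choose j) ~= 0" using assms by simp
 have "(\<Sum>k\<le>n. real (k choose j) * real (n choose k) * (?x ^ k * (1 - ?x) ^ (n - k)))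
   = (\<Sum>k=j..n. real (k choose j) * real (n choose k) * (?x ^ k * (1 - ?x) ^ (n - k)))"
  by (rule sum.mono_neutral_right) (auto simp: not_le binomial_eq_0)
 also have "... = (\<Sum>k=j..n. real (n choose j) * ?x ^ j * (real ((n - j) choose (k - j)) * ?x ^ (k - j) * (1 - ?x) ^ (n - j - (k - j))))"
 proof (rule sum.cong[OF refl])
  fix k assume k: "k \<in> {j..n}"
  have "real (n choose k) * real (k choose j) = real (n choose j) * real ((n - j) choose (k - j))"
   using choose_mult[of j k n] k by (simp flip: of_nat_mult)
  moreover have "?x ^ k = ?x ^ j * ?x ^ (k - j)" using k by (simp flip: power_add)
  moreover have "n - k = n - j - (k - j)" using k by auto
  moreover have "real (k choose j) * real (n choose k) * (?x ^ k * (1 - ?x) ^ (n - k))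
    = (real (n choose k) * real (k choose j)) * (?x ^ k * (1 - ?x) ^ (n - k))" by (simp only: mult.commute)
  ultimately show "real (k choose j) * real (n choose k) * (?x ^ k * (1 - ?x) ^ (n - k))
   = real (n choose j) * ?x ^ j * (real ((n - j) choose (k - j)) * ?x ^ (k - j) * (1 - ?x) ^ (n - j - (k - j)))"
   by (simp only: mult_ac)
 qed
 also have "... = real (n choose j) * ?x ^ j * (\<Sum>i\<le>n - j. real ((n - j) choose i) * ?x ^ i * (1 - ?x) ^ (n - j - i))"
  unfolding sum_distrib_left
  by (rule sum.reindex_bij_witness[of _ "%i. i + j" "%k. k - j"]) (use assms in auto)
 also have "(\<Sum>i\<le>n - j. real ((n - j) choose i) * ?x ^ i * (1 - ?x) ^ (n - j - i)) = 1"
  using binomial_ring[of ?x "1 - ?x" "n - j"] by simp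
 finally have *: "(\<Sum>k\<le>n. real (k choose j) * real (n choose k) * (?x ^ k * (1 - ?x) ^ (n - k)))
  = real (n choose j) * ?x ^ j" by simp
 have "poly (\<Sum>k\<le>n. smult (C ^ j * (of_nat (k choose j) / of_nat (n choose j)) * of_nat (n choose k)) (bern n k)) s
  = C ^ j / real (n choose j) * (\<Sum>k\<le>n. real (k choose j) * real (n choose k) * (?x ^ k * (1 - ?x) ^ (n - k)))"
  unfolding poly_sum sum_distrib_left
  by (rule sum.cong[OF refl]) (simp add: bern_def poly_power divide_inverse mult_ac)
 also have "... = s ^ j"
  unfolding * using nz C_pos by (simp add: power_divide)
 finally show "poly (monom 1 j) s = poly (\<Sum>k\<le>n. smult (C ^ j * (of_nat (k choose j) / of_nat (n choose j)) * of_nat (n choose k)) (bern n k)) s"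
  by (simp add: poly_monom)
qed

end

text \<open>Raising \<open>j\<close> by one multiplies the ratio by
  \<open>(k - j) / (n - j)\<close>, which differs from \<open>k / n\<close> by at most
  \<open>j / (n - j)\<close>. All factors lie between 0 and 1, so the errors merely add up.\<close>

lemma choose_ratio:
 assumes "j < n" "k <= n"
 shows "\<bar>real (k choose j) / real (n choose j) - (real k / real n) ^ j\<bar> <= real (j * j) / (real n - real j)"
 using assms(1)
proof (induction j)
 case (Suc j)
 let ?r = "%j. real (k choose j) / real (n choose j)"
 define q where "q = real k / real n"
 \<comment> \<open>For \<open>k < j\<close> the ratio is already zero, and 0 is still within the
   allowed distance of \<open>k / n\<close>.\<close>
 define e where "e = (if k < j then 0 else (real k - real j) / (real n - real j))"
 have jn: "j < n" using Suc by simp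
 have rec: "real (m choose Suc j) * real (Suc j) = real (m choose j) * (real m - real j)" for m
 proof (cases "j <= m")
  case True
  have "Suc j * (m choose Suc j) = (m - j) * (m choose j)"
   by (metis binomial_absorb_comp binomial_absorption Suc_times_binomial_eq binomial_absorb_comp mult.commute)
  then have "real (Suc j * (m choose Suc j)) = real ((m - j) * (m choose j))" by simp
  then show ?thesis using True by (simp add: algebra_simps)
 qed (simp add: binomial_eq_0)
 have r0: "0 <= ?r j" "?r j <= 1"
  using binomial_right_mono[OF assms(2), of j] jn by (simp_all add: divide_le_eq_1)
 have q: "0 <= q" "q <= 1" using assms by (auto simp: q_def divide_le_eq_1)
 have nz: "real (n choose j) ~= 0" "real (n choose Suc j) ~= 0" using Suc.prems by auto
 have step: "?r (Suc j) = ?r j * e"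
 proof (cases "k < j")
  case True then show ?thesis by (simp add: binomial_eq_0 e_def)
 next
  case False
  have "?r (Suc j) = (real (k choose Suc j) * real (Suc j)) / (real (n choose Suc j) * real (Suc j))"
   by simp
  also have "... = ?r j * ((real k - real j) / (real n - real j))" unfolding rec by simp
  finally show ?thesis using False by (simp add: e_def)
 qed
 have eq: "\<bar>e - q\<bar> <= real j / (real n - real j)"
 proof (cases "k < j")
  case True
  have "q <= real j / real n" using True by (auto simp: q_def intro!: divide_right_mono)
  also have "... <= real j / (real n - real j)" using jn by (intro divide_left_mono) auto
  finally show ?thesis using True q by (simp add: e_def)
 next
  case False
  have "q - e = real j * (real n - real k) / (real n * (real n - real j))"
   using False jn by (simp add: q_def e_def field_simps)
  moreover have "real j * (real n - real k) / (real n * (real n - real j)) <= real j * real n / (real n * (real n - real j))"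
   using jn assms by (intro divide_right_mono mult_left_mono mult_nonneg_nonneg) auto
  moreover have "0 <= real j * (real n - real k) / (real n * (real n - real j))"
   using jn assms by (intro divide_nonneg_nonneg mult_nonneg_nonneg) auto
  moreover have "real j * real n / (real n * (real n - real j)) = real j / (real n - real j)" using jn by simp
  ultimately show ?thesis by linarith
 qed
 have "!!r. r * e - q ^ Suc j = r * (e - q) + (r - q ^ j) * q" by (simp add: algebra_simps)
 then have "?r (Suc j) - q ^ Suc j = ?r j * (e - q) + (?r j - q ^ j) * q"
  unfolding step .
 then have "\<bar>?r (Suc j) - q ^ Suc j\<bar> <= ?r j * \<bar>e - q\<bar> + \<bar>?r j - q ^ j\<bar> * q"
  using abs_triangle_ineq[of "?r j * (e - q)" "(?r j - q ^ j) * q"] r0 q by (simp add: abs_mult)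
 also have "... <= 1 * (real j / (real n - real j)) + real (j * j) / (real n - real j) * 1"
  using Suc.IH[OF jn] eq r0 q jn unfolding q_def[symmetric] by (intro add_mono mult_mono) auto
 also have "... = real (j + j * j) / (real n - real j)" by (simp add: add_divide_distrib)
 also have "... <= real (Suc j * Suc j) / (real n - real (Suc j))"
  using Suc.prems by (intro frac_le) auto
 finally show ?case by (simp add: q_def)
qed simp

context pos_op begin

text \<open>In degree \<open>n\<close> the Bernstein coefficients of \<open>p\<close> exceed its
  values at the nodes by an error of order \<open>1 / n\<close>. The Bernstein operators are
  nonnegative and, with binomial weights, sum to the identity; then \<open>n\<close> tends to
  infinity.\<close>

lemma pev_inner_le:
 assumes B: "!!s. 0 <= s ==> s <= C ==> poly p s <= B"
 shows "pev S p x \<bullet> x <= B * (x \<bullet> x)"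
proof -
 define d where "d = degree p"
 define A where "A = (\<Sum>j\<le>d. \<bar>coeff p j\<bar> * C ^ j)"
 have A0: "0 <= A" unfolding A_def using C_pos by (intro sum_nonneg) auto
 have step: "pev S p x \<bullet> x <= (B + A * (real (d * d) / (real n - real d))) * (x \<bullet> x)" if n: "d < n" for n
 proof -
  define c where "c k = (\<Sum>j\<le>d. coeff p j * (C ^ j * (real (k choose j) / real (n choose j))))" for k
  have p: "p = (\<Sum>k\<le>n. smult (c k * real (n choose k)) (bern n k))"
  proof -
   have "p = (\<Sum>j\<le>d. monom (coeff p j) j)" unfolding d_def by (simp add: poly_as_sum_of_monoms)
   also have "... = (\<Sum>j\<le>d. smult (coeff p j) (monom 1 j))" by (simp add: smult_monom)
   also have "... = (\<Sum>j\<le>d. \<Sum>k\<le>n. smult (coeff p j * (C ^ j * (of_nat (k choose j) / of_nat (n choose j)) * of_nat (n choose k))) (bern n k))"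
    using n by (intro sum.cong refl) (simp add: monom_bern[of _ n] smult_sum_right)
   also have "... = (\<Sum>k\<le>n. \<Sum>j\<le>d. smult (coeff p j * (C ^ j * (of_nat (k choose j) / of_nat (n choose j)) * of_nat (n choose k))) (bern n k))"
    by (rule sum.swap)
   also have "... = (\<Sum>k\<le>n. smult (c k * real (n choose k)) (bern n k))"
    unfolding c_def by (simp only: smult_sum[symmetric] sum_distrib_right mult.assoc)
   finally show ?thesis .
  qed
  have c: "c k <= B + A * (real (d * d) / (real n - real d))" if k: "k <= n" for k
  proof -
   have "c k - poly p (C * (real k / real n))
     = (\<Sum>j\<le>d. coeff p j * C ^ j * (real (k choose j) / real (n choose j) - (real k / real n) ^ j))"
    unfolding c_def poly_altdef d_def[symmetric] sum_subtractf[symmetric]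
    by (rule sum.cong[OF refl]) (simp only: power_mult_distrib power_divide right_diff_distrib mult.assoc)
   also have "... <= (\<Sum>j\<le>d. \<bar>coeff p j\<bar> * C ^ j * (real (d * d) / (real n - real d)))"
   proof (rule sum_mono)
    fix j assume j: "j \<in> {..d}"
    let ?t = "real (k choose j) / real (n choose j) - (real k / real n) ^ j"
    have "\<bar>?t\<bar> <= real (j * j) / (real n - real j)" using j n k by (intro choose_ratio) auto
    also have "... <= real (d * d) / (real n - real d)"
     using j n by (intro frac_le) (auto intro!: mult_mono simp del: of_nat_mult simp: of_nat_mono)
    finally have t: "\<bar>?t\<bar> <= real (d * d) / (real n - real d)" .
    have "coeff p j * C ^ j * ?t <= \<bar>coeff p j * C ^ j * ?t\<bar>" by simp
    also have "... = \<bar>coeff p j\<bar> * C ^ j * \<bar>?t\<bar>" using C_pos by (simp add: abs_mult)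
    also have "... <= \<bar>coeff p j\<bar> * C ^ j * (real (d * d) / (real n - real d))"
     using t C_pos by (intro mult_left_mono) auto
    finally show "coeff p j * C ^ j * ?t <= \<bar>coeff p j\<bar> * C ^ j * (real (d * d) / (real n - real d))" .
   qed
   also have "... = A * (real (d * d) / (real n - real d))"
    unfolding A_def by (rule sum_distrib_right[symmetric])
   finally have "c k <= poly p (C * (real k / real n)) + A * (real (d * d) / (real n - real d))" by simp
   moreover have "poly p (C * (real k / real n)) <= B"
   proof (rule B)
    have "real k / real n <= 1" using k n by (auto simp: divide_le_eq_1)
    then show "C * (real k / real n) <= C" using C_pos mult_left_mono[of "real k / real n" 1 C] by simp
   qed (use C_pos in auto)
   ultimately show ?thesis by linarith
  qed
  have "pev S p x \<bullet> x = (\<Sum>k\<le>n. c k * (real (n choose k) * (pev S (bern n k) x \<bullet> x)))"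
   by (subst p) (simp add: pev_sum pev_smult inner_sum_left mult.assoc)
  also have "... <= (\<Sum>k\<le>n. (B + A * (real (d * d) / (real n - real d))) * (real (n choose k) * (pev S (bern n k) x \<bullet> x)))"
   using c pev_bern_nonneg by (intro sum_mono mult_right_mono) auto
  also have "... = (B + A * (real (d * d) / (real n - real d))) * (pev S (\<Sum>k\<le>n. smult (real (n choose k)) (bern n k)) x \<bullet> x)"
   by (simp add: sum_distrib_left pev_sum pev_smult inner_sum_left)
  also have "(\<Sum>k\<le>n. smult (real (n choose k)) (bern n k)) = 1"
   using monom_bern[of 0 n] by simp
  finally show ?thesis by simp
 qed
 have "(%n. real (d * d) / (real n - real d)) \<longlonglongrightarrow> 0"
  by real_asymp
 then have "(%n. (B + A * (real (d * d) / (real n - real d))) * (x \<bullet> x)) \<longlonglongrightarrow> (B + A * 0) * (x \<bullet> x)"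
  by (intro tendsto_intros)
 then have "(%n. (B + A * (real (d * d) / (real n - real d))) * (x \<bullet> x)) \<longlonglongrightarrow> B * (x \<bullet> x)" by simp
 moreover have "\<exists>N. \<forall>n\<ge>N. pev S p x \<bullet> x <= (B + A * (real (d * d) / (real n - real d))) * (x \<bullet> x)"
  using step by (intro exI[of _ "Suc d"]) auto
 ultimately show ?thesis by (rule LIMSEQ_le_const)
qed

lemma pev_norm_le:
 assumes B: "!!s. 0 <= s ==> s <= C ==> \<bar>poly p s\<bar> <= B"
 shows "norm (pev S p x) <= B * norm x"
proof -
 have B0: "0 <= B" using B[of 0] C_pos by auto
 have "pev S (p * p) x \<bullet> x <= B\<^sup>2 * (x \<bullet> x)"
 proof (rule pev_inner_le)
  fix s assume "0 <= s" "s <= C"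
  then have "\<bar>poly p s\<bar>\<^sup>2 <= B\<^sup>2" using B by (intro power_mono) auto
  then show "poly (p * p) s <= B\<^sup>2" by (simp add: power2_eq_square)
 qed
 moreover have "pev S (p * p) x \<bullet> x = (norm (pev S p x))\<^sup>2"
  by (simp add: pev_mult pev_sym dot_square_norm)
 ultimately have "(norm (pev S p x))\<^sup>2 <= (B * norm x)\<^sup>2"
  by (simp add: dot_square_norm power_mult_distrib)
 then show ?thesis by (rule power2_le_imp_le) (use B0 in simp)
qed

end

section \<open>Extension of the calculus from polynomials to continuous functions\<close>

context pos_op begin

lemma poly_approx:
 assumes "continuous_on {0..C} f" "0 < e"
 shows "\<exists>p. \<forall>s\<in>{0..C}. \<bar>f s - poly p s\<bar> < e"
proof -
 obtain g where "real_polynomial_function g" and g: "!!s. s \<in> {0..C} ==> \<bar>f s - g s\<bar> < e"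
  using Stone_Weierstrass_real_polynomial_function[OF _ assms] by (metis compact_Icc)
 then obtain a n where "g = (%x. \<Sum>i\<le>n::nat. a i * x^i)"
  by (auto simp: real_polynomial_function_iff_sum)
 then have "poly (\<Sum>i\<le>n. monom (a i) i) = g" by (auto simp: poly_sum poly_monom)
 then show ?thesis using g by metis
qed

text \<open>A limit along arbitrarily chosen uniform approximations. By \<open>fc_tendsto\<close>
  every other sequence of uniformly approximating polynomials gives the same limit.\<close>

definition fc :: "(real => real) => 'a => 'a" where
 "fc f x = lim (%n. pev S (SOME p. \<forall>s\<in>{0..C}. \<bar>f s - poly p s\<bar> < 1 / real (Suc n)) x)"

lemma pev_diff_le:
 assumes "!!s. s \<in> {0..C} ==> \<bar>f s - poly p s\<bar> <= d" "!!s. s \<in> {0..C} ==> \<bar>f s - poly q s\<bar> <= e"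
 shows "norm (pev S p x - pev S q x) <= (d + e) * norm x"
proof -
 have "norm (pev S (p - q) x) <= (d + e) * norm x"
 proof (rule pev_norm_le)
  fix s assume "0 <= s" "s <= C"
  then show "\<bar>poly (p - q) s\<bar> <= d + e" using assms(1)[of s] assms(2)[of s] by auto
 qed
 then show ?thesis by (simp add: pev_diff)
qed

lemma fc_tendsto:
 assumes c: "continuous_on {0..C} f"
  and q: "!!n s. s \<in> {0..C} ==> \<bar>f s - poly (q n) s\<bar> <= e n" and e: "e \<longlonglongrightarrow> 0"
 shows "(%n. pev S (q n) x) \<longlonglongrightarrow> fc f x"
proof -
 define p where "p n = (SOME p. \<forall>s\<in>{0..C}. \<bar>f s - poly p s\<bar> < 1 / real (Suc n))" for n
 have p: "\<forall>s\<in>{0..C}. \<bar>f s - poly (p n) s\<bar> < 1 / real (Suc n)" for n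
  unfolding p_def by (rule someI_ex) (rule poly_approx[OF c], simp)
 have p': "s \<in> {0..C} ==> \<bar>f s - poly (p n) s\<bar> <= 1 / real (Suc n)" for n s
  using p[of n] by force
 have l: "(%n. 1 / real (Suc n)) \<longlonglongrightarrow> 0" by real_asymp
 have "Cauchy (%n. pev S (p n) x)"
 proof (rule metric_CauchyI)
  fix d :: real assume d: "0 < d"
  have "(%n. 1 / real (Suc n) * norm x) \<longlonglongrightarrow> 0 * norm x" by (intro tendsto_intros l)
  then have "\<forall>\<^sub>F n in sequentially. 1 / real (Suc n) * norm x < d / 2"
   by (rule order_tendstoD(2)) (use d in simp)
  then obtain N where N: "!!n. N <= n ==> 1 / real (Suc n) * norm x < d / 2"
   by (auto simp: eventually_sequentially)
  have "dist (pev S (p m) x) (pev S (p n) x) < d" if "N <= m" "N <= n" for m n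
  proof -
   have "dist (pev S (p m) x) (pev S (p n) x) <= (1 / real (Suc m) + 1 / real (Suc n)) * norm x"
    unfolding dist_norm by (rule pev_diff_le[OF p' p'])
   then show ?thesis using N[OF that(1)] N[OF that(2)] unfolding distrib_right by linarith
  qed
  then show "\<exists>N. \<forall>m\<ge>N. \<forall>n\<ge>N. dist (pev S (p m) x) (pev S (p n) x) < d" by blast
 qed
 then have lim: "(%n. pev S (p n) x) \<longlonglongrightarrow> fc f x"
  unfolding fc_def p_def[symmetric] using Cauchy_convergent_iff convergent_LIMSEQ_iff by blast
 have "(%n. pev S (q n) x - pev S (p n) x) \<longlonglongrightarrow> 0"
 proof (rule Lim_null_comparison)
  show "\<forall>\<^sub>F n in sequentially. norm (pev S (q n) x - pev S (p n) x) <= (e n + 1 / real (Suc n)) * norm x"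
   by (intro always_eventually allI pev_diff_le[OF q p'])
  have "(%n. (e n + 1 / real (Suc n)) * norm x) \<longlonglongrightarrow> (0 + 0) * norm x" by (intro tendsto_intros e l)
  then show "(%n. (e n + 1 / real (Suc n)) * norm x) \<longlonglongrightarrow> 0" by simp
 qed
 from tendsto_add[OF this lim] show ?thesis by simp
qed

lemma fc_obtain:
 assumes "continuous_on {0..C} f"
 obtains q where "!!n s. s \<in> {0..C} ==> \<bar>f s - poly (q n) s\<bar> <= 1 / real (Suc n)"
  "!!x. (%n. pev S (q n) x) \<longlonglongrightarrow> fc f x"
proof -
 have "\<forall>n. \<exists>p. \<forall>s\<in>{0..C}. \<bar>f s - poly p s\<bar> < 1 / real (Suc n)"
  using poly_approx[OF assms] by simp
 then obtain q where "!!n. \<forall>s\<in>{0..C}. \<bar>f s - poly (q n) s\<bar> < 1 / real (Suc n)" by metis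
 then have q: "s \<in> {0..C} ==> \<bar>f s - poly (q n) s\<bar> <= 1 / real (Suc n)" for n s by (metis less_imp_le)
 have "(%n. 1 / real (Suc n)) \<longlonglongrightarrow> 0" by real_asymp
 then have "(%n. pev S (q n) x) \<longlonglongrightarrow> fc f x" for x
  by (intro fc_tendsto[OF assms q])
 then show ?thesis using that q by blast
qed

lemma fc_poly: "fc (poly p) x = pev S p x"
proof -
 have "(%n. pev S p x) \<longlonglongrightarrow> fc (poly p) x"
  by (rule fc_tendsto[where e="%_. 0"]) (auto intro: continuous_intros)
 then show ?thesis by (simp add: LIMSEQ_const_iff)
qed

lemma fc_cong:
 assumes "!!s. 0 <= s ==> s <= C ==> f s = g s"
 shows "fc f x = fc g x"
proof -
 have "(\<forall>s\<in>{0..C}. \<bar>f s - poly p s\<bar> < e) = (\<forall>s\<in>{0..C}. \<bar>g s - poly p s\<bar> < e)" for p e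
  using assms by auto
 then show ?thesis by (simp add: fc_def)
qed

lemma fc_norm_le:
 assumes c: "continuous_on {0..C} f" and B: "!!s. 0 <= s ==> s <= C ==> \<bar>f s\<bar> <= B"
 shows "norm (fc f x) <= B * norm x"
proof -
 obtain q where q: "!!n s. s \<in> {0..C} ==> \<bar>f s - poly (q n) s\<bar> <= 1 / real (Suc n)"
  "!!x. (%n. pev S (q n) x) \<longlonglongrightarrow> fc f x" by (rule fc_obtain[OF c]) blast
 have "norm (pev S (q n) x) <= (B + 1 / real (Suc n)) * norm x" for n
 proof (rule pev_norm_le)
  fix s assume "0 <= s" "s <= C"
  then show "\<bar>poly (q n) s\<bar> <= B + 1 / real (Suc n)" using q(1)[of s n] B[of s] by auto
 qed
 moreover have "(%n. (B + 1 / real (Suc n)) * norm x) \<longlonglongrightarrow> B * norm x" by real_asymp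
 ultimately show ?thesis using LIMSEQ_le[OF tendsto_norm[OF q(2)[of x]]] by blast
qed

lemma fc_inner_nonneg:
 assumes c: "continuous_on {0..C} f" and B: "!!s. 0 <= s ==> s <= C ==> 0 <= f s"
 shows "0 <= fc f x \<bullet> x"
proof -
 obtain q where q: "!!n s. s \<in> {0..C} ==> \<bar>f s - poly (q n) s\<bar> <= 1 / real (Suc n)"
  "!!x. (%n. pev S (q n) x) \<longlonglongrightarrow> fc f x" by (rule fc_obtain[OF c]) blast
 have "pev S (- q n) x \<bullet> x <= (1 / real (Suc n)) * (x \<bullet> x)" for n
 proof (rule pev_inner_le)
  fix s assume "0 <= s" "s <= C"
  then show "poly (- q n) s <= 1 / real (Suc n)" using q(1)[of s n] B[of s] by auto
 qed
 then have "- (1 / real (Suc n)) * (x \<bullet> x) <= pev S (q n) x \<bullet> x" for n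
  by (simp add: pev_minus) (smt (verit, best))
 moreover have "(%n. - (1 / real (Suc n)) * (x \<bullet> x)) \<longlonglongrightarrow> 0" by real_asymp
 moreover have "(%n. pev S (q n) x \<bullet> x) \<longlonglongrightarrow> fc f x \<bullet> x" by (intro tendsto_intros q)
 ultimately show ?thesis using LIMSEQ_le by blast
qed

lemma fc_lin: "continuous_on {0..C} f ==> fc f (x + y) = fc f x + fc f y"
 "continuous_on {0..C} f ==> fc f (r *\<^sub>R x) = r *\<^sub>R fc f x"
proof -
 assume "continuous_on {0..C} f"
 then obtain q where q: "!!x. (%n. pev S (q n) x) \<longlonglongrightarrow> fc f x" by (rule fc_obtain) blast
 show "fc f (x + y) = fc f x + fc f y"
  using q[of "x + y"] tendsto_add[OF q[of x] q[of y]] by (auto simp: pev_lin intro: LIMSEQ_unique)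
 show "fc f (r *\<^sub>R x) = r *\<^sub>R fc f x"
  using q[of "r *\<^sub>R x"] tendsto_scaleR[OF tendsto_const[of r] q[of x]] by (auto simp: pev_lin intro: LIMSEQ_unique)
qed

lemma fc_sym:
 assumes "continuous_on {0..C} f"
 shows "fc f x \<bullet> y = x \<bullet> fc f y"
proof -
 obtain q where q: "!!x. (%n. pev S (q n) x) \<longlonglongrightarrow> fc f x" using assms by (rule fc_obtain) blast
 show ?thesis
  using tendsto_inner[OF q[of x] tendsto_const[of y]] tendsto_inner[OF tendsto_const[of x] q[of y]]
  by (auto simp: pev_sym intro: LIMSEQ_unique)
qed

lemma fc_add:
 assumes "continuous_on {0..C} f" "continuous_on {0..C} g"
 shows "fc (%s. f s + g s) x = fc f x + fc g x"
proof -
 obtain q where q: "!!n s. s \<in> {0..C} ==> \<bar>f s - poly (q n) s\<bar> <= 1 / real (Suc n)"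
  "!!x. (%n. pev S (q n) x) \<longlonglongrightarrow> fc f x" by (rule fc_obtain[OF assms(1)]) blast
 obtain r where r: "!!n s. s \<in> {0..C} ==> \<bar>g s - poly (r n) s\<bar> <= 1 / real (Suc n)"
  "!!x. (%n. pev S (r n) x) \<longlonglongrightarrow> fc g x" by (rule fc_obtain[OF assms(2)]) blast
 have "(%n. pev S (q n + r n) x) \<longlonglongrightarrow> fc (%s. f s + g s) x"
 proof (rule fc_tendsto)
  show "\<bar>f s + g s - poly (q n + r n) s\<bar> <= 1 / real (Suc n) + 1 / real (Suc n)" if "s \<in> {0..C}" for n s
   using q(1)[OF that, of n] r(1)[OF that, of n] unfolding poly_add by linarith
  show "(%n. 1 / real (Suc n) + 1 / real (Suc n)) \<longlonglongrightarrow> 0" by real_asymp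
 qed (intro continuous_intros assms)
 moreover have "(%n. pev S (q n + r n) x) \<longlonglongrightarrow> fc f x + fc g x"
  unfolding pev_add by (intro tendsto_intros q r)
 ultimately show ?thesis by (rule LIMSEQ_unique)
qed

lemma fc_mult:
 assumes "continuous_on {0..C} f" "continuous_on {0..C} g"
 shows "fc (%s. f s * g s) x = fc f (fc g x)"
proof -
 obtain q where q: "!!n s. s \<in> {0..C} ==> \<bar>f s - poly (q n) s\<bar> <= 1 / real (Suc n)"
  "!!x. (%n. pev S (q n) x) \<longlonglongrightarrow> fc f x" by (rule fc_obtain[OF assms(1)]) blast
 obtain r where r: "!!n s. s \<in> {0..C} ==> \<bar>g s - poly (r n) s\<bar> <= 1 / real (Suc n)"
  "!!x. (%n. pev S (r n) x) \<longlonglongrightarrow> fc g x" by (rule fc_obtain[OF assms(2)]) blast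
 have bd: "\<exists>B\<ge>0. \<forall>s\<in>{0..C}. \<bar>h s\<bar> <= B" if "continuous_on {0..C} h" for h :: "real => real"
 proof -
  have "bounded (h ` {0..C})" using that compact_continuous_image compact_imp_bounded by blast
  then show ?thesis unfolding bounded_pos by (metis image_eqI less_imp_le real_norm_def)
 qed
 obtain A where A: "0 <= A" "!!s. s \<in> {0..C} ==> \<bar>f s\<bar> <= A" using bd[OF assms(1)] by blast
 obtain B where B: "0 <= B" "!!s. s \<in> {0..C} ==> \<bar>g s\<bar> <= B" using bd[OF assms(2)] by blast
 have "(%n. pev S (q n * r n) x) \<longlonglongrightarrow> fc (%s. f s * g s) x"
 proof (rule fc_tendsto)
  fix n s assume s: "s \<in> {0..C}"
  have "f s * g s - poly (q n * r n) s = (f s - poly (q n) s) * g s + poly (q n) s * (g s - poly (r n) s)"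
   by (simp add: algebra_simps)
  moreover have "\<bar>(f s - poly (q n) s) * g s\<bar> <= 1 / real (Suc n) * B"
   unfolding abs_mult using q(1)[OF s, of n] B(2)[OF s] by (intro mult_mono) auto
  moreover have "\<bar>poly (q n) s\<bar> <= A + 1 / real (Suc n)"
   using q(1)[OF s, of n] A(2)[OF s] by linarith
  then have "\<bar>poly (q n) s * (g s - poly (r n) s)\<bar> <= (A + 1 / real (Suc n)) * (1 / real (Suc n))"
   unfolding abs_mult using r(1)[OF s, of n] A by (intro mult_mono) auto
  ultimately show "\<bar>f s * g s - poly (q n * r n) s\<bar> <= 1 / real (Suc n) * B + (A + 1 / real (Suc n)) * (1 / real (Suc n))"
   by linarith
 next
  show "(%n. 1 / real (Suc n) * B + (A + 1 / real (Suc n)) * (1 / real (Suc n))) \<longlonglongrightarrow> 0" by real_asymp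
 qed (intro continuous_intros assms)
 moreover have "(%n. pev S (q n * r n) x) \<longlonglongrightarrow> fc f (fc g x)"
 proof -
  have "(%n. pev S (q n) (pev S (r n) x - fc g x)) \<longlonglongrightarrow> 0"
  proof (rule Lim_null_comparison)
   show "\<forall>\<^sub>F n in sequentially. norm (pev S (q n) (pev S (r n) x - fc g x)) <= (A + 1) * norm (pev S (r n) x - fc g x)"
   proof (intro always_eventually allI pev_norm_le)
    fix n s assume "0 <= s" "s <= C"
    then have "\<bar>poly (q n) s\<bar> <= A + 1 / real (Suc n)" using q(1)[of s n] A(2)[of s] by auto
    also have "... <= A + 1" by simp
    finally show "\<bar>poly (q n) s\<bar> <= A + 1" .
   qed
   have "(%n. (A + 1) * norm (pev S (r n) x - fc g x)) \<longlonglongrightarrow> (A + 1) * norm (fc g x - fc g x)"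
    by (intro tendsto_intros r)
   then show "(%n. (A + 1) * norm (pev S (r n) x - fc g x)) \<longlonglongrightarrow> 0" by simp
  qed
  from tendsto_add[OF this q(2)[of "fc g x"]] show ?thesis by (simp add: pev_mult pev_lin_diff)
 qed
 ultimately show ?thesis by (rule LIMSEQ_unique)
qed

lemma fc_cmult: "continuous_on {0..C} f ==> fc (%s. c * f s) x = c *\<^sub>R fc f x"
 using fc_mult[of "%s. c" f x] fc_poly[of "[:c:]" "fc f x"]
  fc_cong[of "%s. c" "poly [:c:]"] by (simp add: pev_pCons S_simps continuous_on_const)

lemma fc_diff:
 assumes "continuous_on {0..C} f" "continuous_on {0..C} g"
 shows "fc (%s. f s - g s) x = fc f x - fc g x"
 using fc_add[OF assms(1), of "%s. (-1) * g s" x] fc_cmult[OF assms(2), of "-1" x] assms(2)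
 by (simp add: continuous_on_minus)

lemma fc_sum:
 assumes "!!k. k \<in> A ==> continuous_on {0..C} (f k)"
 shows "fc (%s. \<Sum>k\<in>A. f k s) x = (\<Sum>k\<in>A. fc (f k) x)"
 using assms
proof (induction A rule: infinite_finite_induct)
 case (insert k A)
 then show ?case by (simp add: fc_add continuous_on_sum)
qed (use fc_poly[of 0 x] in \<open>auto simp: poly_0[abs_def]\<close>)

lemma fc_id: "fc (%s. s) x = S x"
 using fc_poly[of "[:0, 1:]" x] fc_cong[of "%s. s" "poly [:0, 1:]" x] by (simp add: pev_pCons S_simps)

lemma fc_S: "continuous_on {0..C} f ==> fc (%s. s * f s) x = S (fc f x)"
 using fc_mult[of "%s. s" f x] by (simp add: fc_id)

lemma fc_S_commute: "continuous_on {0..C} f ==> fc f (S x) = S (fc f x)"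
 using fc_mult[of "%s. s" f x] fc_mult[of f "%s. s" x] by (simp add: fc_id mult.commute)

lemma fc_diff_norm_le:
 assumes "continuous_on {0..C} f" "continuous_on {0..C} g"
  "!!s. 0 <= s ==> s <= C ==> \<bar>f s - g s\<bar> <= B"
 shows "norm (fc f x - fc g x) <= B * norm x"
 using fc_norm_le[of "%s. f s - g s" B x] assms by (simp add: fc_diff continuous_on_diff)

end

section \<open>Continuity of the calculus in the operator\<close>

lemma pev_perturb:
 assumes "pos_op S C"
 shows "\<exists>L\<ge>0. \<forall>S' d x. pos_op S' C --> (\<forall>x. norm (S' x - S x) <= d * norm x) -->
  norm (pev S' p x - pev S p x) <= L * d * norm x"
proof (induction p)
 case 0
 then show ?case by (intro exI[of _ 0]) auto
next
 case (pCons a p)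
 interpret S: pos_op S C by fact
 from pCons.IH obtain L where L: "0 <= L" "!!S' d x. pos_op S' C ==> (\<forall>x. norm (S' x - S x) <= d * norm x) ==>
  norm (pev S' p x - pev S p x) <= L * d * norm x" by blast
 have "bounded (poly p ` {0..C})"
  by (intro compact_imp_bounded compact_continuous_image continuous_intros) auto
 then obtain B where B: "0 <= B" "!!s. s \<in> {0..C} ==> \<bar>poly p s\<bar> <= B"
  unfolding bounded_pos by (metis image_eqI less_imp_le real_norm_def)
 show ?case
 proof (intro exI[of _ "C * L + B"] conjI allI impI)
  show "0 <= C * L + B" using L B S.C_pos by simp
  fix S' d x assume *: "pos_op S' C" "\<forall>x. norm (S' x - S x) <= d * norm x"
  interpret S': pos_op S' C by fact
  have "pev S' (pCons a p) x - pev S (pCons a p) x = S' (pev S' p x - pev S p x) + (S' (pev S p x) - S (pev S p x))"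
   by (simp add: S.pev_pCons S'.pev_pCons S'.S_simps)
  also have "norm ... <= C * norm (pev S' p x - pev S p x) + d * norm (pev S p x)"
   by (intro norm_triangle_le add_mono S'.norm_bd) (use * in blast)
  also have "... <= C * (L * d * norm x) + d * (B * norm x)"
  \<comment> \<open>The assumption on \<open>d\<close> forces \<open>0 <= d\<close> as soon as a
    nonzero vector is at hand.\<close>
  proof (cases "x = 0")
   case True
   then show ?thesis using S.pev_lin(2)[of p 0] S'.pev_lin(2)[of p 0] by simp
  next
   case False
   have "0 <= d * norm x" using *(2) norm_ge_zero order_trans by blast
   then have "0 <= d" using False by (simp add: zero_le_mult_iff)
   then show ?thesis using S.C_pos B
    by (intro add_mono mult_left_mono L(2) * S.pev_norm_le) auto
  qed
  finally show "norm (pev S' (pCons a p) x - pev S (pCons a p) x) <= (C * L + B) * d * norm x"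
   by (simp add: algebra_simps)
 qed
qed

text \<open>One polynomial approximates \<open>f\<close> for all operators with bound
  \<open>C\<close> simultaneously; for a fixed polynomial the dependence on the operator is
  Lipschitz.\<close>

lemma fc_perturb:
 assumes S: "pos_op S C" and f: "continuous_on {0..C} f" and e: "0 < e"
 shows "\<exists>d>0. \<forall>S'. pos_op S' C --> (\<forall>x. norm (S' x - S x) <= d * norm x) -->
  (\<forall>x. norm (pos_op.fc S' C f x - pos_op.fc S C f x) <= e * norm x)"
proof -
 interpret S: pos_op S C by fact
 obtain p where p: "!!s. s \<in> {0..C} ==> \<bar>f s - poly p s\<bar> < e / 3"
  using S.poly_approx[OF f, of "e / 3"] e by (metis divide_pos_pos zero_less_numeral)
 obtain L where L: "0 <= L" "!!S' d x. pos_op S' C ==> (\<forall>x. norm (S' x - S x) <= d * norm x) ==>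
  norm (pev S' p x - pev S p x) <= L * d * norm x" using pev_perturb[OF S, of p] by blast
 define d where "d = e / (3 * (L + 1))"
 have d: "0 < d" "L * d <= e / 3" using e L(1) by (auto simp: d_def field_simps)
 show ?thesis
 proof (intro exI[of _ d] conjI d allI impI)
  fix S' x assume *: "pos_op S' C" "\<forall>x. norm (S' x - S x) <= d * norm x"
  interpret S': pos_op S' C by fact
  have cp: "continuous_on {0..C} (poly p)" by (intro continuous_intros)
  have 1: "norm (S'.fc f x - pev S' p x) <= e / 3 * norm x"
   unfolding S'.fc_poly[symmetric] by (rule S'.fc_diff_norm_le[OF f cp]) (use p in force)
  have 2: "norm (S.fc f x - pev S p x) <= e / 3 * norm x"
   unfolding S.fc_poly[symmetric] by (rule S.fc_diff_norm_le[OF f cp]) (use p in force)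
  have 3: "norm (pev S' p x - pev S p x) <= e / 3 * norm x"
   using L(2)[OF *, of x] mult_right_mono[OF d(2) norm_ge_zero[of x]] by linarith
  have "norm (S'.fc f x - S.fc f x) <= norm (S'.fc f x - pev S' p x) + norm (pev S' p x - pev S p x) + norm (pev S p x - S.fc f x)"
   using norm_triangle_ineq[of "S'.fc f x - pev S' p x" "pev S' p x - pev S p x"]
    norm_triangle_ineq[of "S'.fc f x - pev S p x" "pev S p x - S.fc f x"] by simp
  also have "... <= e / 3 * norm x + e / 3 * norm x + e / 3 * norm x"
   using 1 2 3 by (intro add_mono) (simp_all add: norm_minus_commute)
  finally show "norm (S'.fc f x - S.fc f x) <= e * norm x" by simp
 qed
qed

section \<open>The semigroup generated by the negative inverse\<close>

text \<open>In the spectral variable \<open>s\<close> of \<open>S\<close> the semigroup with generator \<open>- S\<inverse>\<close> is \<open>exp (- t / s)\<close>.\<close>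

definition expi :: "nat => real => real => real" where
 "expi j t s = (if s <= 0 then 0 else exp (- t / s) / s ^ j)"

lemma power_le_fact_exp:
 fixes y :: real
 assumes "0 <= y"
 shows "y ^ j <= fact j * exp y"
proof -
 have "(\<Sum>n\<in>{j}. y ^ n /\<^sub>R fact n) <= (\<Sum>n. y ^ n /\<^sub>R fact n)"
  using assms by (intro sum_le_suminf summable_exp_generic) auto
 then have "y ^ j / fact j <= exp y" by (simp add: exp_def divide_inverse mult.commute)
 then show ?thesis by (simp add: field_simps)
qed

lemma expi_nonneg: "0 <= expi j t s"
 by (auto simp: expi_def)

text \<open>With \<open>y = t / s\<close> the claim is \<open>y ^ j * exp (- y) <= fact j\<close>.
  The factorial growth in \<open>j\<close>, uniform in \<open>s\<close>, is the source of
  analyticity in time.\<close>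

lemma expi_le:
 assumes "0 < t"
 shows "expi j t s <= fact j / t ^ j"
proof (cases "s <= 0")
 case False
 then have "(t / s) ^ j <= fact j * exp (t / s)" using assms by (intro power_le_fact_exp) auto
 then show ?thesis using False assms
  by (simp add: expi_def exp_minus field_simps)
qed (use assms in \<open>simp add: expi_def\<close>)

lemma expi_abs_le: "0 < t ==> \<bar>expi j t s\<bar> <= fact j / t ^ j"
 using expi_le[of t j s] expi_nonneg[of j t s] by simp

lemma expi_Suc: "s * expi (Suc j) t s = expi j t s"
 by (auto simp: expi_def)

lemma expi_mult: "expi j t s * expi k u s = expi (j + k) (t + u) s"
 by (auto simp: expi_def power_add exp_add[symmetric] add_divide_distrib diff_divide_distrib)

lemma expi_continuous:
 assumes "0 < t"
 shows "continuous_on {0..C} (expi j t)"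
proof (rule continuous_on_eq_continuous_within[THEN iffD2, rule_format])
 fix s assume s: "s \<in> {0..C}"
 show "continuous (at s within {0..C}) (expi j t)"
 proof (cases "s = 0")
  case True
  \<comment> \<open>Near zero \<open>expi j t s\<close> is \<open>s\<close> times
    \<open>expi (Suc j) t s\<close>, and the second factor is bounded.\<close>
  have "(expi j t \<longlongrightarrow> 0) (at 0 within {0..C})"
  proof (rule Lim_null_comparison)
   show "\<forall>\<^sub>F s in at 0 within {0..C}. norm (expi j t s) <= s * (fact (Suc j) / t ^ Suc j)"
    unfolding eventually_at_filter
   proof (intro always_eventually allI impI)
    fix s assume "s \<in> {0..C}"
    then have "s * expi (Suc j) t s <= s * (fact (Suc j) / t ^ Suc j)"
     using assms by (intro mult_left_mono expi_le) auto
    then show "norm (expi j t s) <= s * (fact (Suc j) / t ^ Suc j)"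
     unfolding expi_Suc using expi_nonneg[of j t s] by simp
   qed
   have "((%s. s * (fact (Suc j) / t ^ Suc j)) \<longlongrightarrow> 0 * (fact (Suc j) / t ^ Suc j)) (at 0 within {0..C})"
    by (intro tendsto_intros)
   then show "((%s. s * (fact (Suc j) / t ^ Suc j)) \<longlongrightarrow> 0) (at 0 within {0..C})" by simp
  qed
  then show ?thesis using True by (simp add: continuous_within expi_def)
 next
  case False
  then have "0 < s" using s by simp
  then have ev: "\<forall>\<^sub>F u in at s within {0..C}. exp (- t / u) / u ^ j = expi j t u"
   using order_tendstoD(1)[OF tendsto_ident_at[of s "{0..C}"] \<open>0 < s\<close>] by (auto simp: expi_def elim: eventually_mono)
  have "((%u. exp (- t / u) / u ^ j) \<longlongrightarrow> exp (- t / s) / s ^ j) (at s within {0..C})"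
   using \<open>0 < s\<close> by (intro tendsto_intros) auto
  then have "(expi j t \<longlongrightarrow> exp (- t / s) / s ^ j) (at s within {0..C})"
   using tendsto_cong[OF ev] by simp
  then show ?thesis using \<open>0 < s\<close> by (simp add: continuous_within expi_def)
 qed
qed

lemma expi_has_derivative: "((%t. expi j t s) has_real_derivative - expi (Suc j) t s) (at t)"
proof (cases "s <= 0")
 case False
 then show ?thesis
  unfolding expi_def by (auto intro!: derivative_eq_intros simp: field_simps)
qed (simp add: expi_def)

text \<open>The remainder sits at an intermediate time not below \<open>t - \<bar>h\<bar>\<close>,
  so its bound is uniform in the spectral variable and passes to operators.\<close>

lemma expi_taylor:
 assumes "\<bar>h\<bar> < t"
 shows "\<bar>expi k (t + h) s - (\<Sum>m<n. (- h) ^ m / fact m * expi (k + m) t s)\<bar>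
  <= fact (k + n) / fact n * \<bar>h\<bar> ^ n / (t - \<bar>h\<bar>) ^ (k + n)"
proof -
 define D where "D m u = (-1) ^ m * expi (k + m) (t + u) s" for m u
 have "DERIV (D m) u :> D (Suc m) u" for m u
 proof -
  have "((%u. expi (k + m) (t + u) s) has_real_derivative (- expi (Suc (k + m)) (t + u) s) * 1) (at u)"
   by (rule DERIV_chain2[OF expi_has_derivative]) (auto intro!: derivative_eq_intros)
  from DERIV_cmult[OF this, of "(-1)^m"] show ?thesis by (simp add: D_def[abs_def])
 qed
 then obtain u where u: "\<bar>u\<bar> <= \<bar>h\<bar>"
  and eq: "D 0 h = (\<Sum>m<n. D m 0 / fact m * h ^ m) + D n u / fact n * h ^ n"
  using Maclaurin_bi_le[of D "D 0" n h] by blast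
 have "expi k (t + h) s - (\<Sum>m<n. (- h) ^ m / fact m * expi (k + m) t s) = D n u / fact n * h ^ n"
 proof -
  have "(\<Sum>m<n. D m 0 / fact m * h ^ m) = (\<Sum>m<n. (- h) ^ m / fact m * expi (k + m) t s)"
  proof (rule sum.cong[OF refl])
   fix m
   have "(- h) ^ m = (-1) ^ m * h ^ m" using power_mult_distrib[of "-1" h m] by simp
   then show "D m 0 / fact m * h ^ m = (- h) ^ m / fact m * expi (k + m) t s" by (simp add: D_def)
  qed
  then show ?thesis using eq by (simp add: D_def)
 qed
 also have "\<bar>...\<bar> = expi (k + n) (t + u) s / fact n * \<bar>h\<bar> ^ n"
  by (simp add: D_def abs_mult power_abs expi_nonneg)
 also have "... <= (fact (k + n) / (t - \<bar>h\<bar>) ^ (k + n)) / fact n * \<bar>h\<bar> ^ n"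
 proof (intro mult_right_mono divide_right_mono)
  have "expi (k + n) (t + u) s <= fact (k + n) / (t + u) ^ (k + n)"
   using u assms by (intro expi_le) auto
  also have "... <= fact (k + n) / (t - \<bar>h\<bar>) ^ (k + n)"
   using u assms by (intro divide_left_mono power_mono mult_pos_pos zero_less_power) auto
  finally show "expi (k + n) (t + u) s <= fact (k + n) / (t - \<bar>h\<bar>) ^ (k + n)" .
 qed auto
 finally show ?thesis by (simp add: field_simps)
qed

lemma expi_0_decay:
 assumes "0 <= s" "s <= C" "0 < t"
 shows "expi 0 t s <= exp (- t / C)"
proof (cases "s = 0")
 case False
 then have "t / C <= t / s" using assms by (intro divide_left_mono) auto
 then show ?thesis using False assms by (simp add: expi_def)
qed (simp add: expi_def)

lemma expi_0_mono:
 assumes "t <= u"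
 shows "expi 0 u s <= expi 0 t s"
 using assms by (auto simp: expi_def divide_right_mono)

lemma expi_0_le_1: "0 <= t ==> expi 0 t s <= 1"
 by (auto simp: expi_def)

section \<open>The semigroup and its time derivatives as operators\<close>

context pos_op begin

text \<open>Up to the sign \<open>(-1) ^ j\<close> this is the \<open>j\<close>-th time derivative
  of the semigroup, that is, the semigroup followed by the \<open>j\<close>-th power of the
  unbounded inverse of \<open>S\<close>.\<close>

definition sgd :: "nat => real => 'a => 'a" where
 "sgd j t x = fc (expi j t) x"

text \<open>The identity at nonpositive times: this makes \<open>sg\<close> continuous on the whole
  line, and integrands with \<open>sg (t - s)\<close> need no restriction to
  \<open>s <= t\<close>.\<close>

definition sg :: "real => 'a => 'a" where
 "sg t x = (if t <= 0 then x else sgd 0 t x)"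

lemma sgd_0: "0 < t ==> sgd 0 t x = sg t x"
 by (simp add: sg_def)

lemma sgd_norm: "0 < t ==> norm (sgd j t x) <= fact j / t ^ j * norm x"
 unfolding sgd_def by (rule fc_norm_le[OF expi_continuous]) (auto intro: expi_abs_le)

lemma sgd_lin: "0 < t ==> linear (sgd j t)"
 unfolding sgd_def by (intro linearI fc_lin expi_continuous)

lemma sgd_bounded_linear: "0 < t ==> bounded_linear (sgd j t)"
 by (rule bounded_linear_intro[of _ "fact j / t ^ j"])
   (use sgd_lin[of t j] sgd_norm[of t j] in \<open>auto simp: linear_add linear_scale mult.commute\<close>)

lemma S_sgd: "0 < t ==> S (sgd (Suc j) t x) = sgd j t x"
 unfolding sgd_def by (subst fc_S[symmetric, OF expi_continuous]) (simp_all add: expi_Suc)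

lemma sgd_S_commute: "0 < t ==> sgd j t (S x) = S (sgd j t x)"
 unfolding sgd_def by (intro fc_S_commute expi_continuous)

lemma sgd_sgd: "0 < t ==> 0 < u ==> sgd j t (sgd k u x) = sgd (j + k) (t + u) x"
 unfolding sgd_def by (subst fc_mult[symmetric, OF expi_continuous expi_continuous]) (simp_all add: expi_mult)

lemma sgd_sym: "0 < t ==> sgd j t x \<bullet> y = x \<bullet> sgd j t y"
 unfolding sgd_def by (intro fc_sym expi_continuous)

lemma sgd_taylor:
 assumes h: "\<bar>h\<bar> < t"
 shows "norm (sgd k (t + h) x - (\<Sum>m<n. ((- h) ^ m / fact m) *\<^sub>R sgd (k + m) t x))
  <= fact (k + n) / fact n * \<bar>h\<bar> ^ n / (t - \<bar>h\<bar>) ^ (k + n) * norm x"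
proof -
 have t: "0 < t" "0 < t + h" using h by auto
 have "(\<Sum>m<n. ((- h) ^ m / fact m) *\<^sub>R sgd (k + m) t x)
   = fc (%s. \<Sum>m<n. (- h) ^ m / fact m * expi (k + m) t s) x"
  by (subst fc_sum) (auto simp: sgd_def fc_cmult[OF expi_continuous[OF t(1)]] simp del: times_divide_eq_left intro!: continuous_intros expi_continuous t)
 then show ?thesis
  unfolding sgd_def
  by (simp only:) (intro fc_diff_norm_le expi_continuous t continuous_intros expi_taylor h)
qed

lemma sgd_has_vector_derivative:
 assumes t: "0 < t"
 shows "((%t. sgd k t x) has_vector_derivative - sgd (Suc k) t x) (at t)"
proof -
 define B where "B = fact (k + 2) / fact 2 / (t / 2) ^ (k + 2) * norm x"
 have bd: "norm (sgd k (t + h) x - sgd k t x - h *\<^sub>R (- sgd (Suc k) t x)) <= B * \<bar>h\<bar> ^ 2" if h: "\<bar>h\<bar> < t / 2" for h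
 proof -
  have "(\<Sum>m<2. ((- h) ^ m / fact m) *\<^sub>R sgd (k + m) t x) = sgd k t x + h *\<^sub>R (- sgd (Suc k) t x)"
   by (simp add: numeral_2_eq_2)
  then have "norm (sgd k (t + h) x - sgd k t x - h *\<^sub>R (- sgd (Suc k) t x))
   <= fact (k + 2) / fact 2 * \<bar>h\<bar> ^ 2 / (t - \<bar>h\<bar>) ^ (k + 2) * norm x"
   using sgd_taylor[of h t k x 2] h t by (simp only: diff_diff_eq)
  also have "... <= fact (k + 2) / fact 2 * \<bar>h\<bar> ^ 2 / (t / 2) ^ (k + 2) * norm x"
   using h t by (intro mult_right_mono divide_left_mono power_mono mult_pos_pos zero_less_power mult_nonneg_nonneg) auto
  finally show ?thesis unfolding B_def by (simp only: divide_inverse mult_ac)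
 qed
 show ?thesis
  unfolding has_vector_derivative_def has_derivative_at
 proof (intro conjI bounded_linear_scaleR_left)
  show "(%h. norm (sgd k (t + h) x - sgd k t x - h *\<^sub>R - sgd (Suc k) t x) / norm h) \<midarrow>0\<rightarrow> 0"
  proof (rule Lim_null_comparison)
   have "\<forall>\<^sub>F h in at 0. \<bar>h\<bar> < t / 2"
    using t by (auto simp: eventually_at intro!: exI[of _ "t / 2"])
   then show "\<forall>\<^sub>F h in at 0. norm (norm (sgd k (t + h) x - sgd k t x - h *\<^sub>R - sgd (Suc k) t x) / norm h) <= B * \<bar>h\<bar>"
   proof (eventually_elim)
    case (elim h)
    show ?case using bd[OF elim]
     by (cases "h = 0") (simp_all add: divide_le_eq power2_eq_square mult.assoc)
   qed
   have "((%h. B * \<bar>h\<bar>) \<longlongrightarrow> B * \<bar>0\<bar>) (at 0)" by (intro tendsto_intros)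
   then show "((%h. B * \<bar>h\<bar>) \<longlongrightarrow> 0) (at 0)" by simp
  qed
 qed
qed

lemma sg_nonpos [simp]: "t <= 0 ==> sg t x = x"
 by (simp add: sg_def)

lemma sg_decay: "0 <= t ==> norm (sg t x) <= exp (- t / C) * norm x"
 using fc_norm_le[OF expi_continuous, of t 0 "exp (- t / C)" x] expi_0_decay[of _ C t]
 by (auto simp: sg_def sgd_def expi_nonneg)

lemma sg_contraction: "norm (sg t x) <= norm x"
 unfolding sg_def sgd_def
 using fc_norm_le[OF expi_continuous, of t 0 1 x] by (auto simp: expi_nonneg expi_0_le_1)

lemma sg_bounded_linear: "bounded_linear (sg t)"
 by (cases "t <= 0") (simp_all add: sg_def[abs_def] bounded_linear_ident sgd_bounded_linear)

lemma sg_add: "0 <= t ==> 0 <= u ==> sg (t + u) x = sg t (sg u x)"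
 using sgd_sgd[of t u 0 0 x] by (auto simp: sg_def)

lemma sg_sym: "sg t x \<bullet> y = x \<bullet> sg t y"
 by (simp add: sg_def sgd_sym)

lemma sg_S_commute: "sg t (S x) = S (sg t x)"
 by (simp add: sg_def sgd_S_commute)

text \<open>In the spectral variable this is \<open>0 <= s - s * exp (- t / s) <= t\<close>, from
  \<open>1 - y <= exp (- y)\<close>. On the range of \<open>S\<close> it upgrades strong continuity
  to a rate.\<close>

lemma sg_S_diff: "0 <= t ==> norm (sg t (S x) - S x) <= t * norm x"
proof (cases "t = 0")
 case False
 assume "0 <= t" then have t: "0 < t" using False by simp
 have "sg t (S x) - S x = fc (%s. expi 0 t s * s) x - fc (%s. s) x"
  using t by (simp add: sg_def sgd_def fc_mult[OF expi_continuous[OF t]] fc_id)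
 also have "norm ... <= t * norm x"
 proof (intro fc_diff_norm_le continuous_intros expi_continuous t)
  fix s assume s: "0 <= s" "s <= C"
  show "\<bar>expi 0 t s * s - s\<bar> <= t"
  proof (cases "s = 0")
   case False
   then have "1 - t / s <= expi 0 t s"
    using s exp_ge_add_one_self[of "- t / s"] by (simp add: expi_def)
   then have "s * (1 - t / s) <= s * expi 0 t s" using s by (intro mult_left_mono) auto
   moreover have "s * (1 - t / s) = s - t" using False by (simp add: field_simps)
   moreover have "s * expi 0 t s <= s * 1" using s t by (intro mult_left_mono expi_0_le_1) auto
   ultimately show ?thesis by (simp add: mult.commute)
  qed (use t in simp)
 qed
 finally show ?thesis .
qed simp

text \<open>On the range of \<open>S\<close> applied twice the difference quotient converges with a
  rate. With \<open>y = t / s\<close> it comes down to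
  \<open>0 <= exp (- y) - 1 + y <= y * y\<close>.\<close>

lemma sg_SS_diff:
 assumes "0 < t"
 shows "norm ((sg t (S (S x)) - S (S x)) /\<^sub>R t + S x) <= t * norm x"
proof -
 have "(sg t (S (S x)) - S (S x)) /\<^sub>R t + S x
   = fc (%s. inverse t * (expi 0 t s * (s * s) - s * s) + s) x"
  using assms by (simp add: sg_def sgd_def fc_add fc_cmult fc_diff fc_mult expi_continuous fc_id continuous_intros)
 also have "norm ... <= t * norm x"
 proof (intro fc_norm_le continuous_intros expi_continuous assms)
  fix s assume s: "0 <= s" "s <= C"
  show "\<bar>inverse t * (expi 0 t s * (s * s) - s * s) + s\<bar> <= t"
  proof (cases "s = 0")
   case False
   then have s0: "0 < s" using s by simp
   let ?y = "t / s"
   have y: "0 < ?y" using assms s0 by simp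
   have l: "1 - ?y <= exp (- ?y)" using exp_ge_add_one_self[of "- ?y"] by simp
   have "exp (- ?y) <= 1 / (1 + ?y)"
    using exp_ge_add_one_self[of ?y] y by (simp add: exp_minus inverse_eq_divide frac_le)
   also have "... <= 1 - ?y + ?y * ?y"
   proof -
    have "1 <= (1 - ?y + ?y * ?y) * (1 + ?y)" using y mult_nonneg_nonneg[of "?y * ?y" ?y] by (simp only: algebra_simps) simp
    then show ?thesis using y by (simp add: divide_le_eq)
   qed
   finally have u: "exp (- ?y) - 1 + ?y <= ?y * ?y" by simp
   have "inverse t * (expi 0 t s * (s * s) - s * s) + s = (s * s / t) * (exp (- ?y) - 1 + ?y)"
    using s0 assms by (simp add: expi_def field_simps)
   moreover have "0 <= (s * s / t) * (exp (- ?y) - 1 + ?y)" using l s0 assms by (intro mult_nonneg_nonneg) auto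
   moreover have "(s * s / t) * (exp (- ?y) - 1 + ?y) <= (s * s / t) * (?y * ?y)"
    using u s0 assms by (intro mult_left_mono) auto
   moreover have "(s * s / t) * (?y * ?y) = t" using s0 assms by simp
   ultimately show ?thesis by linarith
  qed (use assms in simp)
 qed
 finally show ?thesis .
qed

end

locale pos_inj = pos_op +
 assumes inj: "S x = 0 ==> x = 0"
begin

text \<open>\<open>sg\<close> increases to a bounded operator as \<open>t\<close> decreases to 0; the limit fixes the range of \<open>S\<close>
 and commutes with \<open>S\<close>, so injectivity makes it the identity. In particular \<open>S\<close> has dense range.\<close>

lemma sg_seq_tendsto: "(%n. sg (1 / real (Suc n)) x) \<longlonglongrightarrow> x"
proof -
 define t where "t n = 1 / real (Suc n)" for n
 have t: "0 < t n" "m <= n ==> t n <= t m" for n m by (auto simp: t_def frac_le)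
 define p where "p n = sg (t n) x \<bullet> x" for n
 \<comment> \<open>The difference of the two spectral functions takes values in
   \<open>[0,1]\<close>, so its square is below it. This bounds squared distances by increments of
   the monotone sequence \<open>p\<close>.\<close>
 have d: "(norm (sg (t n) x - sg (t m) x))\<^sup>2 <= p n - p m" if "m <= n" for m n
 proof -
  let ?f = "%s. expi 0 (t n) s - expi 0 (t m) s"
  have c: "continuous_on {0..C} ?f" by (intro continuous_intros expi_continuous t)
  have f: "0 <= ?f s" "?f s <= 1" for s
   using expi_0_mono[OF t(2)[OF that], of s] expi_nonneg[of 0 "t m" s] expi_0_le_1[of "t n" s] less_imp_le[OF t(1)[of n]]
   by linarith+
  have e: "sg (t n) y - sg (t m) y = fc ?f y" for y
   unfolding sgd_0[OF t(1), symmetric] sgd_def by (rule fc_diff[symmetric]) (intro expi_continuous t)+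
  have "0 <= fc (%s. ?f s - ?f s * ?f s) x \<bullet> x"
  proof (rule fc_inner_nonneg)
   fix s show "0 <= ?f s - ?f s * ?f s"
    using mult_left_mono[OF f(2) f(1), of s s] by simp
  qed (intro continuous_intros expi_continuous t)
  moreover have "fc (%s. ?f s - ?f s * ?f s) x = fc ?f x - fc ?f (fc ?f x)"
   by (subst fc_diff[OF c continuous_on_mult[OF c c]]) (simp add: fc_mult[OF c c])
  moreover have "fc ?f (fc ?f x) \<bullet> x = (norm (fc ?f x))\<^sup>2"
   by (simp add: fc_sym[OF c] dot_square_norm)
  ultimately have "(norm (fc ?f x))\<^sup>2 <= fc ?f x \<bullet> x" by (simp only: inner_diff_left)
  then show ?thesis unfolding p_def e[symmetric] by (simp only: inner_diff_left)
 qed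
 have inc: "incseq p"
 proof (rule incseq_SucI)
  show "p n <= p (Suc n)" for n
   using d[of n "Suc n"] zero_le_power2[of "norm (sg (t (Suc n)) x - sg (t n) x)"] by linarith
 qed
 have bd: "p n <= norm x * norm x" for n
  unfolding p_def using norm_cauchy_schwarz mult_right_mono[OF sg_contraction norm_ge_zero] by (rule order_trans)
 obtain L where "p \<longlonglongrightarrow> L" by (rule incseq_convergent[OF inc, of "norm x * norm x"]) (use bd in auto)
 then have "convergent p" by (rule convergentI)
 then have Cp: "Cauchy p" by (rule convergent_Cauchy)
 have "Cauchy (%n. sg (t n) x)"
 proof (rule metric_CauchyI)
  fix e :: real assume e: "0 < e"
  then have "0 < e\<^sup>2" by simp
  from metric_CauchyD[OF Cp this]
  obtain N where N: "!!m n. N <= m ==> N <= n ==> dist (p m) (p n) < e\<^sup>2" by blast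
  have *: "dist (sg (t n) x) (sg (t m) x) < e" if "N <= m" "m <= n" for m n
  proof -
   have "(norm (sg (t n) x - sg (t m) x))\<^sup>2 < e\<^sup>2"
    using d[OF that(2)] N[of n m] that unfolding dist_real_def by linarith
   then show ?thesis unfolding dist_norm using e by (auto dest: power2_less_imp_less)
  qed
  have "dist (sg (t m) x) (sg (t n) x) < e" if "N <= m" "N <= n" for m n
   using *[of m n] *[of n m] that by (cases "m <= n") (auto simp: dist_commute)
  then show "\<exists>N. \<forall>m\<ge>N. \<forall>n\<ge>N. dist (sg (t m) x) (sg (t n) x) < e" by blast
 qed
 then obtain y where y: "(%n. sg (t n) x) \<longlonglongrightarrow> y" using Cauchy_convergent convergentD by blast
 have "(%n. S (sg (t n) x)) \<longlonglongrightarrow> S y" by (rule bounded_linear.tendsto[OF bounded_linear_S y])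
 moreover have "(%n. S (sg (t n) x)) \<longlonglongrightarrow> S x"
 proof -
  have "(%n. sg (t n) (S x) - S x) \<longlonglongrightarrow> 0"
  proof (rule Lim_null_comparison)
   show "\<forall>\<^sub>F n in sequentially. norm (sg (t n) (S x) - S x) <= t n * norm x"
    by (intro always_eventually allI sg_S_diff less_imp_le t)
   show "(%n. t n * norm x) \<longlonglongrightarrow> 0" unfolding t_def by real_asymp
  qed
  from LIM_zero_cancel[OF this] show ?thesis by (simp only: sg_S_commute)
 qed
 ultimately have "S y = S x" by (rule LIMSEQ_unique)
 then have "S (y - x) = 0" by (simp add: S_simps)
 then have "y = x" using inj[of "y - x"] by simp
 then show ?thesis using y by (simp add: t_def)
qed

lemma S_dense:
 assumes "0 < e"
 shows "\<exists>y. norm (x - S y) < e"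
proof -
 obtain n where n: "norm (sg (1 / real (Suc n)) x - x) < e"
  using LIMSEQ_D[OF sg_seq_tendsto assms] by blast
 then show ?thesis
  by (intro exI[of _ "sgd 1 (1 / real (Suc n)) x"])
    (metis One_nat_def S_sgd norm_minus_commute sgd_0 zero_less_divide_1_iff of_nat_0_less_iff zero_less_Suc)
qed

lemma sg_tendsto_0: "((%t. sg t x) \<longlongrightarrow> x) (at 0)"
proof (rule tendstoI)
 fix e :: real assume e: "0 < e"
 obtain y where y: "norm (x - S y) < e / 3" using S_dense[of "e / 3" x] e by auto
 have "\<forall>\<^sub>F t in at 0. \<bar>t\<bar> < e / (3 * (norm y + 1))"
  using e by (auto simp: eventually_at intro!: exI[of _ "e / (3 * (norm y + 1))"] divide_pos_pos add_nonneg_pos)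
 then show "\<forall>\<^sub>F t in at 0. dist (sg t x) x < e"
 proof eventually_elim
  case (elim t)
  show ?case
  proof (cases "t <= 0")
   case False
   interpret sg: bounded_linear "sg t" by (rule sg_bounded_linear)
   have "t * norm y <= t * (norm y + 1)" using False by simp
   also have "... < e / (3 * (norm y + 1)) * (norm y + 1)"
    using elim False by (intro mult_strict_right_mono) (auto simp: add_nonneg_pos)
   also have "... = e / 3" using norm_ge_zero[of y] by (simp add: field_simps add_nonneg_eq_0_iff del: norm_ge_zero)
   finally have 1: "t * norm y < e / 3" .
   have "sg t x - x = sg t (x - S y) + (sg t (S y) - S y) + (S y - x)" by (simp add: sg.diff)
   also have "norm ... <= norm (sg t (x - S y)) + norm (sg t (S y) - S y) + norm (S y - x)"
    by (intro norm_triangle_le add_right_mono norm_triangle_ineq) auto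
   also have "... <= norm (x - S y) + t * norm y + norm (x - S y)"
    using False by (intro add_mono sg_contraction sg_S_diff) (auto simp: norm_minus_commute)
   also have "... < e" using y 1 by linarith
   finally show ?thesis by (simp add: dist_norm)
  qed (use e in simp)
 qed
qed

lemma sg_continuous: "continuous_on UNIV (%t. sg t x)"
proof -
 have "isCont (%t. sg t x) t" for t
 proof -
  consider "t < 0" | "t = 0" | "0 < t" by linarith
  then show ?thesis
  proof cases
   case 1
   have "\<forall>\<^sub>F u in nhds t. u < 0" using 1 by (rule order_tendstoD(2)[OF filterlim_ident])
   then have "\<forall>\<^sub>F u in nhds t. sg u x = x" by eventually_elim simp
   then show ?thesis by (subst isCont_cong) auto
  next
   case 2
   then show ?thesis using sg_tendsto_0[of x] by (simp add: isCont_def)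
  next
   case 3
   have "\<forall>\<^sub>F u in nhds t. 0 < u" using 3 by (rule order_tendstoD(1)[OF filterlim_ident])
   then have "\<forall>\<^sub>F u in nhds t. sg u x = sgd 0 u x" by eventually_elim (simp add: sg_def)
   moreover have "isCont (%u. sgd 0 u x) t"
    using sgd_has_vector_derivative[OF 3] by (rule has_vector_derivative_continuous)
   ultimately show ?thesis by (subst isCont_cong) auto
  qed
 qed
 then show ?thesis by (simp add: continuous_at_imp_continuous_on)
qed

lemma sg_jointly_continuous: "continuous_on UNIV (%p. sg (fst p) (snd p))"
proof -
 have "isCont (%p. sg (fst p) (snd p)) (t, x)" for t x
  unfolding isCont_def
 proof (rule LIM_zero_cancel, rule Lim_null_comparison)
  show "\<forall>\<^sub>F p in at (t, x). norm (sg (fst p) (snd p) - sg (fst (t, x)) (snd (t, x)))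
    <= norm (snd p - x) + norm (sg (fst p) x - sg t x)"
  proof (intro always_eventually allI)
   fix p :: "real \<times> 'a"
   interpret sg: bounded_linear "sg (fst p)" by (rule sg_bounded_linear)
   have "sg (fst p) (snd p) - sg t x = sg (fst p) (snd p - x) + (sg (fst p) x - sg t x)" by (simp add: sg.diff)
   also have "norm ... <= norm (snd p - x) + norm (sg (fst p) x - sg t x)"
    by (intro norm_triangle_le add_mono sg_contraction) auto
   finally show "norm (sg (fst p) (snd p) - sg (fst (t, x)) (snd (t, x))) <= norm (snd p - x) + norm (sg (fst p) x - sg t x)"
    by simp
  qed
  have "isCont (%t. sg t x) t" using sg_continuous by (simp add: continuous_on_eq_continuous_at)
  then have "((%p. sg (fst p) x) \<longlongrightarrow> sg t x) (at (t, x))"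
   by (rule isCont_tendsto_compose) (intro tendsto_eq_intros, auto)
  then have "((%p. norm (snd p - x) + norm (sg (fst p) x - sg t x)) \<longlongrightarrow> norm (snd (t, x) - x) + norm (sg t x - sg t x)) (at (t, x))"
   by (intro tendsto_intros)
  then show "((%p. norm (snd p - x) + norm (sg (fst p) x - sg t x)) \<longlongrightarrow> 0) (at (t, x))" by simp
 qed
 then show ?thesis by (simp add: continuous_at_imp_continuous_on)
qed

lemma C0_semigroup_sg: "C0_semigroup sg"
 unfolding C0_semigroup_def
 using sg_bounded_linear sg_add sg_tendsto_0
 by (auto intro: tendsto_within_subset[OF sg_tendsto_0])

text \<open>Difference quotients have a rate only on the range of \<open>S\<close> taken twice. In
  one direction \<open>S\<close> is applied twice to the quotient and cancelled by injectivity. In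
  the other \<open>y\<close> is approximated by some \<open>S u\<close>, the quotients at
  \<open>S v\<close> being bounded by \<open>norm v\<close>.\<close>

lemma generator_sg: "generator sg x y \<longleftrightarrow> x = - S y"
proof
 assume "generator sg x y"
 then have lim: "((%h. (sg h x - x) /\<^sub>R h) \<longlongrightarrow> y) (at_right 0)" by (simp add: generator_def)
 have "((%h. S ((sg h x - x) /\<^sub>R h)) \<longlongrightarrow> S y) (at_right 0)"
  by (rule bounded_linear.tendsto[OF bounded_linear_S lim])
 then have 1: "((%h. S (S ((sg h x - x) /\<^sub>R h))) \<longlongrightarrow> S (S y)) (at_right 0)"
  by (rule bounded_linear.tendsto[OF bounded_linear_S])
 have 2: "((%h. S (S ((sg h x - x) /\<^sub>R h))) \<longlongrightarrow> - S x) (at_right 0)"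
 proof (rule LIM_zero_cancel, rule Lim_null_comparison)
  show "\<forall>\<^sub>F h in at_right 0. norm (S (S ((sg h x - x) /\<^sub>R h)) - - S x) <= h * norm x"
   using eventually_at_right_less[of 0]
  proof eventually_elim
   case (elim h)
   then show ?case using sg_SS_diff[OF elim, of x] by (simp add: S_simps sg_S_commute)
  qed
  have "((%h. h * norm x) \<longlongrightarrow> 0 * norm x) (at_right 0)" by (intro tendsto_intros)
  then show "((%h. h * norm x) \<longlongrightarrow> 0) (at_right 0)" by simp
 qed
 have "S (S y) = - S x" by (rule tendsto_unique[OF _ 1 2]) simp
 then have "S (S y + x) = 0" by (simp add: S_simps)
 then show "x = - S y" using inj by (metis add.commute add_eq_0_iff)
next
 assume x: "x = - S y"
 show "generator sg x y"
  unfolding generator_def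
 proof (rule tendstoI)
  fix e :: real assume e: "0 < e"
  obtain u where u: "norm (y - S u) < e / 3" using S_dense[of "e / 3" y] e by auto
  have "\<forall>\<^sub>F h in at_right 0. h < e / (3 * (norm u + 1))"
   using e by (intro order_tendstoD(2)[OF tendsto_ident_at] divide_pos_pos mult_pos_pos add_nonneg_pos) auto
  then show "\<forall>\<^sub>F h in at_right 0. dist ((sg h x - x) /\<^sub>R h) y < e"
   using eventually_at_right_less[of 0]
  proof eventually_elim
   case (elim h)
   interpret sg: bounded_linear "sg h" by (rule sg_bounded_linear)
   have "h * norm u <= h * (norm u + 1)" using elim by simp
   also have "... < e / (3 * (norm u + 1)) * (norm u + 1)"
    using elim by (intro mult_strict_right_mono) (auto simp: add_nonneg_pos)
   also have "... = e / 3" using norm_ge_zero[of u] by (simp add: field_simps add_nonneg_eq_0_iff del: norm_ge_zero)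
   finally have 1: "h * norm u < e / 3" .
   let ?D = "%v. (sg h (S v) - S v) /\<^sub>R h"
   have D: "norm (?D v) <= norm v" for v
   proof -
    have "norm (?D v) = norm (sg h (S v) - S v) / h" using elim by (simp add: divide_inverse mult.commute)
    then show ?thesis using sg_S_diff[of h v] elim by (simp add: divide_le_eq mult.commute)
   qed
   have "(sg h x - x) /\<^sub>R h - y = - (?D (y - S u) + (?D (S u) + S u) + (y - S u))"
    by (simp add: x sg.diff sg.neg S_simps scaleR_diff_right)
   also have "norm ... <= norm (?D (y - S u)) + norm (?D (S u) + S u) + norm (y - S u)"
    unfolding norm_minus_cancel by (intro norm_triangle_le add_right_mono norm_triangle_ineq) auto
   also have "... <= norm (y - S u) + h * norm u + norm (y - S u)"
    using elim by (intro add_mono D sg_SS_diff) auto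
   also have "... < e" using u 1 by linarith
   finally show ?case by (simp add: dist_norm)
  qed
 qed
qed

end

section \<open>Uniqueness of the semigroup with a given generator\<close>

lemma has_vector_derivative_quotient:
 assumes "(f has_vector_derivative y) (at s)"
 shows "((%h. (f (s + h) - f s) /\<^sub>R h) \<longlongrightarrow> y) (at 0)"
proof (rule LIM_zero_cancel, rule tendsto_norm_zero_cancel)
 have lim: "((%h. norm (f (s + h) - f s - h *\<^sub>R y) / norm h) \<longlongrightarrow> 0) (at 0)"
  using assms by (simp add: has_vector_derivative_def has_derivative_at)
 have "\<forall>\<^sub>F h in at 0. norm (f (s + h) - f s - h *\<^sub>R y) / norm h = norm ((f (s + h) - f s) /\<^sub>R h - y)"
  unfolding eventually_at_filter
 proof (intro always_eventually allI impI)
  fix h :: real assume h: "h ~= 0"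
  have "(f (s + h) - f s) /\<^sub>R h - y = (f (s + h) - f s - h *\<^sub>R y) /\<^sub>R h"
   using h by (simp add: scaleR_diff_right)
  then show "norm (f (s + h) - f s - h *\<^sub>R y) / norm h = norm ((f (s + h) - f s) /\<^sub>R h - y)"
   by (simp add: divide_inverse mult.commute)
 qed
 from tendsto_cong[OF this] lim show "((%h. norm ((f (s + h) - f s) /\<^sub>R h - y)) \<longlongrightarrow> 0) (at 0)" by simp
qed

text \<open>A quantitative uniform boundedness principle without Baire category. Vectors of norm
  \<open>(1 / 3) ^ n\<close> are added one after another, the \<open>n\<close>-th nearly norming for
  \<open>A n\<close>; as the operator norm exceeds \<open>4 ^ n\<close>, the images grow at least
  like \<open>(4 / 3) ^ n\<close>.\<close>

lemma gliding_hump: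
 fixes A :: "nat => 'a::banach => 'b::real_normed_vector"
 assumes lin: "!!n. bounded_linear (A n)" and big: "!!n. \<exists>v. norm (A n v) > 4 ^ n * norm v"
 shows "\<exists>x. \<forall>n. (4 / 3) ^ n / 6 <= norm (A n x)"
proof -
 have on: "4 ^ n < onorm (A n)" for n
 proof -
  obtain v where v: "norm (A n v) > 4 ^ n * norm v" using big by blast
  then have "4 ^ n * norm v < onorm (A n) * norm v" using onorm[OF lin, of n v] by linarith
  then show ?thesis by (simp add: mult_less_cancel_right)
 qed
 have step: "\<exists>y. norm (y - x) <= (1 / 3) ^ n \<and> 2 / 3 * onorm (A n) * (1 / 3) ^ n <= norm (A n y)" for n x
 proof -
  interpret A: bounded_linear "A n" by (rule lin)
  have pos: "0 < onorm (A n)" by (rule less_trans[OF _ on]) simp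
  have "\<exists>v. 2 / 3 * onorm (A n) * norm v < norm (A n v)"
  proof (rule ccontr)
   assume "\<not> ?thesis"
   then have "onorm (A n) <= 2 / 3 * onorm (A n)" using pos by (intro onorm_bound) (auto simp: not_less)
   then show False using pos by simp
  qed
  then obtain v where v: "2 / 3 * onorm (A n) * norm v < norm (A n v)" by blast
  then have v0: "norm v ~= 0" by auto
  define u where "u = ((1 / 3) ^ n / norm v) *\<^sub>R v"
  have nu: "norm u = (1 / 3) ^ n" using v0 by (simp add: u_def)
  have "norm (A n u) = (1 / 3) ^ n / norm v * norm (A n v)" by (simp add: u_def A.scaleR)
  also have "... \<ge> (1 / 3) ^ n / norm v * (2 / 3 * onorm (A n) * norm v)"
   using v by (intro mult_left_mono) auto
  finally have Au: "2 / 3 * onorm (A n) * (1 / 3) ^ n <= norm (A n u)" using v0 by (simp add: mult.commute)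
  \<comment> \<open>The images of \<open>x + u\<close> and \<open>x - u\<close> differ by twice the
    image of \<open>u\<close>, so one of the two signs gives an image at least as large as that of
    \<open>u\<close>.\<close>
  have "2 * norm (A n u) = norm (A n (x + u) - A n (x - u))"
   by (simp add: A.add A.diff flip: scaleR_2)
  also have "... <= norm (A n (x + u)) + norm (A n (x - u))" by (rule norm_triangle_ineq4)
  finally have "norm (A n u) <= norm (A n (x + u)) \<or> norm (A n u) <= norm (A n (x - u))" by linarith
  then show ?thesis
  proof
   assume "norm (A n u) <= norm (A n (x + u))"
   then show ?thesis using Au nu by (intro exI[of _ "x + u"]) auto
  next
   assume "norm (A n u) <= norm (A n (x - u))"
   then show ?thesis using Au nu by (intro exI[of _ "x - u"]) auto
  qed
 qed
 define g where "g n x = (SOME y. norm (y - x) <= (1 / 3) ^ n \<and> 2 / 3 * onorm (A n) * (1 / 3) ^ n <= norm (A n y))" for n x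
 have g: "norm (g n x - x) <= (1 / 3) ^ n" "2 / 3 * onorm (A n) * (1 / 3) ^ n <= norm (A n (g n x))" for n x
  using someI_ex[OF step[of x n]] by (simp_all add: g_def)
 define f where "f = rec_nat 0 g"
 have f: "f (Suc n) = g n (f n)" for n by (simp add: f_def)
 define a where "a n = f (Suc n) - f n" for n
 have a: "norm (a n) <= (1 / 3) ^ n" for n using g(1)[of n "f n"] by (simp add: a_def f)
 have sa: "summable a" by (rule summable_comparison_test'[OF summable_geometric[of "1 / 3 :: real"] a]) simp
 define x where "x = suminf a"
 have xf: "x - f m = (\<Sum>k. a (k + m))" for m
  using suminf_split_initial_segment[OF sa, of m] sum_lessThan_telescope[of f m] by (simp add: x_def a_def f_def)
 have tail: "norm (x - f m) <= (3 / 2) * (1 / 3) ^ m" for m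
 proof -
  have "norm (x - f m) <= (\<Sum>k. (1 / 3) ^ m * (1 / 3 :: real) ^ k)"
   unfolding xf
  proof (rule norm_suminf_le)
   show "norm (a (k + m)) <= (1 / 3) ^ m * (1 / 3) ^ k" for k using a[of "k + m"] by (simp add: power_add mult.commute)
  qed (intro summable_mult summable_geometric, simp)
  also have "... = (1 / 3) ^ m * (\<Sum>k. (1 / 3 :: real) ^ k)" by (rule suminf_mult[OF summable_geometric]) simp
  finally show ?thesis by (simp add: suminf_geometric)
 qed
 have "(4 / 3) ^ n / 6 <= norm (A n x)" for n
 proof -
  interpret A: bounded_linear "A n" by (rule lin)
  \<comment> \<open>All later steps together move the point by at most
    \<open>(1 / 3) ^ n / 2\<close>. Of the fraction 2/3 gained at step \<open>n\<close> there
    remains 2/3 - 1/2 = 1/6.\<close>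
  have "norm (x - f (Suc n)) <= (3 / 2) * (1 / 3) ^ Suc n" by (rule tail)
  then have "onorm (A n) * norm (x - f (Suc n)) <= onorm (A n) * ((3 / 2) * (1 / 3) ^ Suc n)"
   by (intro mult_left_mono onorm_pos_le lin)
  then have "norm (A n (x - f (Suc n))) <= onorm (A n) * ((1 / 3) ^ n / 2)"
   using onorm[OF lin, of n "x - f (Suc n)"] by simp
  moreover have "2 / 3 * onorm (A n) * (1 / 3) ^ n <= norm (A n (f (Suc n)))" unfolding f by (rule g)
  moreover have "norm (A n (f (Suc n))) <= norm (A n x) + norm (A n (x - f (Suc n)))"
   using norm_triangle_ineq4[of "A n x" "A n (x - f (Suc n))"] by (simp add: A.diff)
  ultimately have "onorm (A n) * (1 / 3) ^ n / 6 <= norm (A n x)" by (simp add: algebra_simps)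
  moreover have "4 ^ n * (1 / 3) ^ n <= onorm (A n) * (1 / 3) ^ n" using on[of n] by (intro mult_right_mono) auto
  ultimately show ?thesis by (simp flip: power_mult_distrib)
 qed
 then show ?thesis by blast
qed

text \<open>Otherwise there are times at most \<open>1 / (n + 1)\<close> with norms above
  \<open>4 ^ n\<close>, and the vector from \<open>gliding_hump\<close> contradicts strong
  continuity at 0. The semigroup law then extends the bound to longer intervals.\<close>

lemma C0_semigroup_locally_bounded:
 fixes T :: "real => 'a => 'a::banach"
 assumes T: "C0_semigroup T"
 shows "\<exists>B\<ge>0. \<forall>r\<in>{0..t}. \<forall>x. norm (T r x) <= B * norm x"
proof -
 have "\<exists>\<delta>>0. \<exists>B\<ge>0. \<forall>r\<in>{0..\<delta>}. \<forall>x. norm (T r x) <= B * norm x"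
 proof (rule ccontr)
  assume "\<not> ?thesis"
  then have neg: "\<not> (\<forall>r\<in>{0..\<delta>}. \<forall>x. norm (T r x) <= B * norm x)" if "0 < \<delta>" "0 <= B" for \<delta> B
   using that by blast
  have "\<exists>r. r \<in> {0..1 / real (Suc n)} \<and> (\<exists>v. norm (T r v) > 4 ^ n * norm v)" for n
   using neg[of "1 / real (Suc n)" "4 ^ n"] by (force simp: not_le)
  then obtain r where r: "!!n. r n \<in> {0..1 / real (Suc n)}" and v: "!!n. \<exists>v. norm (T (r n) v) > 4 ^ n * norm v"
   by metis
  have r0: "0 < r n" for n
  proof (rule ccontr)
   assume "\<not> 0 < r n"
   then have "r n = 0" using r[of n] by simp
   then have "\<exists>v::'a. norm v > 4 ^ n * norm v" using v[of n] T by (simp add: C0_semigroup_def)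
   then obtain v :: 'a where "norm v > 4 ^ n * norm v" by blast
   moreover have "1 * norm v <= 4 ^ n * norm v" by (intro mult_right_mono) auto
   ultimately show False by simp
  qed
  obtain x where x: "!!n. (4 / 3) ^ n / 6 <= norm (T (r n) x)"
   using gliding_hump[of "%n. T (r n)"] v T r0 by (auto simp: C0_semigroup_def less_imp_le)
  have "r \<longlonglongrightarrow> 0"
   by (rule tendsto_sandwich[of "%_. 0" _ _ "%n. 1 / real (Suc n)"]) (use r in \<open>auto\<close>, real_asymp)
  then have "filterlim r (at_right 0) sequentially"
   using r0 by (auto simp: filterlim_at less_le intro!: always_eventually)
  moreover have "((%t. T t x) \<longlongrightarrow> x) (at_right 0)" using T by (simp add: C0_semigroup_def)
  ultimately have "(%n. T (r n) x) \<longlonglongrightarrow> x" by (rule filterlim_compose[rotated])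
  then have "Bseq (%n. T (r n) x)" by (intro convergent_imp_Bseq convergentI)
  then obtain K where K: "!!n. norm (T (r n) x) <= K" unfolding Bseq_def by blast
  have "filterlim (%n. (4 / 3 :: real) ^ n / 6) at_top sequentially" by real_asymp
  then obtain n where "K < (4 / 3 :: real) ^ n / 6"
   by (auto simp: filterlim_at_top_dense eventually_sequentially)
  then show False using x[of n] K[of n] by linarith
 qed
 then obtain \<delta> B where \<delta>: "0 < \<delta>" "0 <= B" and B: "!!r x. 0 <= r ==> r <= \<delta> ==> norm (T r x) <= B * norm x"
  by auto
 have ind: "\<exists>B\<ge>0. \<forall>r\<in>{0..real n * \<delta>}. \<forall>x. norm (T r x) <= B * norm x" for n
 proof (induction n)
  case 0
  have "norm (T 0 x) <= B * norm x" for x using B[of 0 x] \<delta> by simp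
  then show ?case using \<delta> by (intro exI[of _ B]) auto
 next
  case (Suc n)
  then obtain B' where B': "0 <= B'" "!!r x. 0 <= r ==> r <= real n * \<delta> ==> norm (T r x) <= B' * norm x" by auto
  show ?case
  proof (intro exI[of _ "max B (B * B')"] conjI ballI allI)
   fix r x assume r: "r \<in> {0..real (Suc n) * \<delta>}"
   show "norm (T r x) <= max B (B * B') * norm x"
   proof (cases "r <= \<delta>")
    case True
    then have "norm (T r x) <= B * norm x" using r by (intro B) auto
    also have "... <= max B (B * B') * norm x" by (intro mult_right_mono) auto
    finally show ?thesis .
   next
    case False
    then have "T r x = T \<delta> (T (r - \<delta>) x)"
     using T \<delta> by (simp add: C0_semigroup_def) (metis add.commute diff_add_cancel diff_ge_0_iff_ge less_imp_le not_le)
    also have "norm ... <= B * norm (T (r - \<delta>) x)" using \<delta> by (intro B) auto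
    also have "... <= B * (B' * norm x)"
     using False r \<delta> by (intro mult_left_mono B') (auto simp: algebra_simps)
    also have "... <= max B (B * B') * norm x"
     using mult_right_mono[OF max.cobounded2[of "B * B'" B] norm_ge_zero[of x]] by (simp add: mult.assoc)
    finally show ?thesis .
   qed
  qed (use \<delta> in auto)
 qed
 obtain n where "t / \<delta> <= real n" using real_arch_simple by blast
 then have "t <= real n * \<delta>" using \<delta> by (simp add: divide_le_eq)
 then show ?thesis using ind[of n] by force
qed

context pos_inj begin

text \<open>The curve \<open>T (t - s) (sg s x)\<close> runs from \<open>T t x\<close> to
  \<open>sg t x\<close> with zero derivative. Of \<open>T\<close> only the right derivative at 0 and
  local boundedness are available, so the two one-sided derivatives of the curve need separate
  estimates.\<close>

lemma C0_semigroup_unique: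
 assumes T: "C0_semigroup T" and gen: "!!x y. generator T x y \<longleftrightarrow> x = - S y" and t: "0 <= t"
 shows "T t x = sg t x"
proof (cases "t = 0")
 case True
 then show ?thesis using T by (simp add: C0_semigroup_def)
next
 case False
 then have t: "0 < t" using t by simp
 obtain B where B: "0 <= B" "!!r x. 0 <= r ==> r <= t ==> norm (T r x) <= B * norm x"
  using C0_semigroup_locally_bounded[OF T, of t] by auto
 have bl: "bounded_linear (T r)" if "0 <= r" for r using T that by (simp add: C0_semigroup_def)
 have T0: "T 0 y = y" for y using T by (simp add: C0_semigroup_def)
 have Tadd: "T (r + u) y = T r (T u y)" if "0 <= r" "0 <= u" for r u y using T that by (simp add: C0_semigroup_def)
 have cont0: "((%t. T t y) \<longlongrightarrow> y) (at_right 0)" for y using T by (simp add: C0_semigroup_def)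
 define F where "F s = T (t - s) (sg s x)" for s
 have der: "(F has_vector_derivative 0) (at s)" if s: "0 < s" "s < t" for s
 proof -
  define y where "y = sg s x"
  define y' where "y' = - sgd 1 s x"
  have yS: "y = - S y'" using s S_sgd[of s 0 x] by (simp add: y_def y'_def S_simps sg_def)
  have sgder: "((%h. (sg (s + h) x - y) /\<^sub>R h) \<longlongrightarrow> y') (at 0)"
  proof -
   have "((%h. (sgd 0 (s + h) x - sgd 0 s x) /\<^sub>R h) \<longlongrightarrow> y') (at 0)"
    using has_vector_derivative_quotient[OF sgd_has_vector_derivative[OF s(1), of 0 x]] by (simp add: y'_def)
   moreover have "\<forall>\<^sub>F h in at 0. (sgd 0 (s + h) x - sgd 0 s x) /\<^sub>R h = (sg (s + h) x - y) /\<^sub>R h"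
    using s by (auto simp: eventually_at y_def sg_def dist_real_def intro!: exI[of _ s])
   ultimately show ?thesis by (rule Lim_transform_eventually)
  qed
  have Tder: "((%h. (T h y - y) /\<^sub>R h) \<longlongrightarrow> y') (at_right 0)"
   using gen[of y y'] yS by (simp add: generator_def)
  have right: "((%h. norm (F (s + h) - F s) / norm h) \<longlongrightarrow> 0) (at_right 0)"
  proof (rule Lim_null_comparison)
   have "\<forall>\<^sub>F h in at_right 0. h < t - s" using s by (intro order_tendstoD(2)[OF tendsto_ident_at]) auto
   then show "\<forall>\<^sub>F h in at_right 0. norm (norm (F (s + h) - F s) / norm h)
     <= B * norm ((sg (s + h) x - y) /\<^sub>R h - (T h y - y) /\<^sub>R h)"
    using eventually_at_right_less[of 0]
   proof eventually_elim
    case (elim h)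
    interpret bounded_linear "T (t - (s + h))" using elim by (intro bl) auto
    have "F s = T (t - (s + h)) (T h y)"
     using elim Tadd[of "t - (s + h)" h y] by (simp add: F_def y_def)
    then have "F (s + h) - F s = T (t - (s + h)) (h *\<^sub>R ((sg (s + h) x - y) /\<^sub>R h - (T h y - y) /\<^sub>R h))"
     using elim by (simp add: F_def diff scaleR_diff_right flip: scaleR_diff_right)
    also have "norm ... <= B * norm (h *\<^sub>R ((sg (s + h) x - y) /\<^sub>R h - (T h y - y) /\<^sub>R h))"
     using elim s by (intro B) auto
    finally show ?case using elim by (simp add: divide_le_eq mult_ac)
   qed
   have "((%h. B * norm ((sg (s + h) x - y) /\<^sub>R h - (T h y - y) /\<^sub>R h)) \<longlongrightarrow> B * norm (y' - y')) (at_right 0)"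
    by (intro tendsto_intros Tder tendsto_within_subset[OF sgder]) auto
   then show "((%h. B * norm ((sg (s + h) x - y) /\<^sub>R h - (T h y - y) /\<^sub>R h)) \<longlongrightarrow> 0) (at_right 0)" by simp
  qed
  have sgder_left: "((%k. (y - sg (s - k) x) /\<^sub>R k) \<longlongrightarrow> y') (at_right 0)"
  proof -
   have "((%h. (sg (s + h) x - y) /\<^sub>R h) \<longlongrightarrow> y') (at_left 0)"
    by (rule tendsto_within_subset[OF sgder]) auto
   then have "((%k. (sg (s + - k) x - y) /\<^sub>R (- k)) \<longlongrightarrow> y') (at_right 0)"
    by (simp add: filterlim_at_left_to_right)
   then show ?thesis by (simp add: scaleR_diff_right)
  qed
  have left: "((%k. norm (F (s - k) - F s) / norm k) \<longlongrightarrow> 0) (at_right 0)"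
  proof (rule Lim_null_comparison)
   let ?v = "%k. (y - sg (s - k) x) /\<^sub>R k"
   have "\<forall>\<^sub>F k in at_right 0. k < min s (t - s)" using s by (intro order_tendstoD(2)[OF tendsto_ident_at]) auto
   then show "\<forall>\<^sub>F k in at_right 0. norm (norm (F (s - k) - F s) / norm k)
     <= B * (norm (T k y' - y') + B * norm (?v k - y') + norm ((T k y - y) /\<^sub>R k - y'))"
    using eventually_at_right_less[of 0]
   proof eventually_elim
    case (elim k)
    interpret l: bounded_linear "T (t - s)" using s by (intro bl) auto
    interpret k: bounded_linear "T k" using elim by (intro bl) auto
    have "t - (s - k) = (t - s) + k" by simp
    then have "F (s - k) = T (t - s) (T k (sg (s - k) x))"
     using elim s by (simp only: F_def) (rule Tadd, auto)
    then have "F (s - k) - F s = T (t - s) (T k (sg (s - k) x) - y)"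
     by (simp add: F_def y_def l.diff)
    \<comment> \<open>Three errors: that of the quotient of \<open>T\<close>, that of the continuity
      of \<open>T\<close> at \<open>y'\<close>, and that of the backward quotient of
      \<open>sg\<close>, to which \<open>T k\<close> is applied.\<close>
    also have "T k (sg (s - k) x) - y = k *\<^sub>R (((T k y - y) /\<^sub>R k - y') - (T k y' - y') - T k (?v k - y'))"
    proof -
     have "((T k y - y) /\<^sub>R k - y') - (T k y' - y') - T k (?v k - y') = (T k (sg (s - k) x) - y) /\<^sub>R k"
      by (simp add: k.diff k.scaleR scaleR_diff_right)
     then show ?thesis using elim by simp
    qed
    also have "norm (T (t - s) ...) <= B * norm (k *\<^sub>R (((T k y - y) /\<^sub>R k - y') - (T k y' - y') - T k (?v k - y')))"
     using s by (intro B) auto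
    also have "... = k * (B * norm (((T k y - y) /\<^sub>R k - y') - (T k y' - y') - T k (?v k - y')))"
     using elim by simp
    also have "... <= k * (B * (norm (T k y' - y') + B * norm (?v k - y') + norm ((T k y - y) /\<^sub>R k - y')))"
    proof (intro mult_left_mono B)
     have "norm (T k (?v k - y')) <= B * norm (?v k - y')" using elim s by (intro B) auto
     then show "norm (((T k y - y) /\<^sub>R k - y') - (T k y' - y') - T k (?v k - y'))
       <= norm (T k y' - y') + B * norm (?v k - y') + norm ((T k y - y) /\<^sub>R k - y')"
      using norm_triangle_ineq4[of "((T k y - y) /\<^sub>R k - y') - (T k y' - y')" "T k (?v k - y')"]
       norm_triangle_ineq4[of "(T k y - y) /\<^sub>R k - y'" "T k y' - y'"] by linarith
    qed (use elim in auto)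
    finally show ?case using elim by (simp add: divide_le_eq mult.commute)
   qed
   have "((%k. B * (norm (T k y' - y') + B * norm (?v k - y') + norm ((T k y - y) /\<^sub>R k - y')))
     \<longlongrightarrow> B * (norm (y' - y') + B * norm (y' - y') + norm (y' - y'))) (at_right 0)"
    by (intro tendsto_intros cont0 sgder_left Tder)
   then show "((%k. B * (norm (T k y' - y') + B * norm (?v k - y') + norm ((T k y - y) /\<^sub>R k - y'))) \<longlongrightarrow> 0) (at_right 0)"
    by simp
  qed
  then have left': "((%h. norm (F (s + h) - F s) / norm h) \<longlongrightarrow> 0) (at_left 0)"
   by (simp add: filterlim_at_left_to_right)
  have "((%h. norm (F (s + h) - F s) / norm h) \<longlongrightarrow> 0) (at 0)"
   by (rule filterlim_split_at[OF left' right])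
  then show ?thesis
   by (simp add: has_vector_derivative_def has_derivative_at bounded_linear_zero)
 qed
 have cont: "continuous_on {0..t} F"
 proof (rule continuous_on_eq_continuous_within[THEN iffD2, rule_format])
  fix s assume s: "s \<in> {0..t}"
  consider "s = 0" | "0 < s" "s < t" | "s = t" using s by fastforce
  then show "continuous (at s within {0..t}) F"
  proof cases
   case 1
   have "((%u. F u) \<longlongrightarrow> F 0) (at_right 0)"
   proof (rule LIM_zero_cancel, rule Lim_null_comparison)
    have "\<forall>\<^sub>F u in at_right 0. u < t" using t by (intro order_tendstoD(2)[OF tendsto_ident_at]) auto
    then show "\<forall>\<^sub>F u in at_right 0. norm (F u - F 0) <= B * norm (sg u x - T u x)"
     using eventually_at_right_less[of 0]
    proof eventually_elim
     case (elim u)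
     interpret bounded_linear "T (t - u)" using elim by (intro bl) auto
     have "F u - F 0 = T (t - u) (sg u x - T u x)"
      using elim Tadd[of "t - u" u x] by (simp add: F_def diff)
     then show ?case using elim by (auto intro!: B)
    qed
    have "((%u. B * norm (sg u x - T u x)) \<longlongrightarrow> B * norm (x - x)) (at_right 0)"
     by (intro tendsto_intros cont0 tendsto_within_subset[OF sg_tendsto_0]) auto
    then show "((%u. B * norm (sg u x - T u x)) \<longlongrightarrow> 0) (at_right 0)" by simp
   qed
   then show ?thesis using 1 t by (simp add: continuous_within at_within_Icc_at_right)
  next
   case 2
   then show ?thesis using der has_vector_derivative_continuous continuous_at_imp_continuous_at_within by blast
  next
   case 3
   let ?y = "sg t x"
   have "((%k. F (t - k)) \<longlongrightarrow> F t) (at_right 0)"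
   proof (rule LIM_zero_cancel, rule Lim_null_comparison)
    have "\<forall>\<^sub>F u in at_right 0. u < t" using t by (intro order_tendstoD(2)[OF tendsto_ident_at]) auto
    then show "\<forall>\<^sub>F k in at_right 0. norm (F (t - k) - F t) <= B * norm (sg (t - k) x - ?y) + norm (T k ?y - ?y)"
     using eventually_at_right_less[of 0]
    proof eventually_elim
     case (elim k)
     interpret bounded_linear "T k" using elim by (intro bl) auto
     have "F (t - k) - F t = T k (sg (t - k) x - ?y) + (T k ?y - ?y)"
      using elim by (simp add: F_def diff T0)
     also have "norm ... <= B * norm (sg (t - k) x - ?y) + norm (T k ?y - ?y)"
      using elim by (intro norm_triangle_le add_right_mono B) auto
     finally show ?case .
    qed
    have "isCont (%t. sg t x) t" using sg_continuous by (simp add: continuous_on_eq_continuous_at)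
    then have "((%k. sg (t - k) x) \<longlongrightarrow> sg t x) (at_right 0)"
     by (rule isCont_tendsto_compose) (intro tendsto_eq_intros, auto)
    then have "((%k. B * norm (sg (t - k) x - ?y) + norm (T k ?y - ?y)) \<longlongrightarrow> B * norm (?y - ?y) + norm (?y - ?y)) (at_right 0)"
     by (intro tendsto_intros cont0)
    then show "((%k. B * norm (sg (t - k) x - ?y) + norm (T k ?y - ?y)) \<longlongrightarrow> 0) (at_right 0)" by simp
   qed
   then have "(F \<longlongrightarrow> F t) (at_left t)"
    unfolding filterlim_at_left_to_right[of F _ t] filterlim_at_right_to_0[of _ _ "- t"] by simp
   then show ?thesis using 3 t by (simp add: continuous_within at_within_Icc_at_left)
  qed
 qed
 have "F t = F 0"
 proof (rule has_derivative_zero_unique_strong_interval[of "{0, t}" 0 t F "F 0" t])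
  fix s assume "s \<in> {0..t} - {0, t}"
  then have "(F has_derivative (%h. h *\<^sub>R 0)) (at s)"
   using der[of s] unfolding has_vector_derivative_def by auto
  then show "(F has_derivative (%h. 0)) (at s within {0..t})"
   by (simp add: has_derivative_at_withinI)
 qed (use t cont in auto)
 then show ?thesis by (simp add: F_def T0)
qed

end

section \<open>Joint continuity of the semigroup in operator and time\<close>

lemma sg_perturb:
 assumes S: "pos_op S C" and t: "0 < t" and e: "0 < e"
 shows "\<exists>d>0. \<forall>S' u. pos_op S' C --> (\<forall>x. norm (S' x - S x) <= d * norm x) --> \<bar>u - t\<bar> < d -->
  (\<forall>x. norm (pos_op.sg S' C u x - pos_op.sg S C t x) <= e * norm x)"
proof -
 interpret S: pos_op S C by fact
 obtain d where d: "0 < d" "!!S' x. pos_op S' C ==> (\<forall>x. norm (S' x - S x) <= d * norm x) ==>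
  norm (pos_op.fc S' C (expi 0 t) x - pos_op.fc S C (expi 0 t) x) <= e / 2 * norm x"
  using fc_perturb[OF S expi_continuous[OF t, of C 0], of "e / 2"] e by auto
 \<comment> \<open>The bound \<open>t / 2\<close> keeps \<open>u\<close> away from 0; with
   \<open>e * t / 4\<close> the change of time, whose derivative is of order \<open>1 / t\<close>,
   costs at most \<open>e / 2\<close>.\<close>
 define d' where "d' = min d (min (t / 2) (e * t / 4))"
 have d': "0 < d'" "d' <= d" "d' <= t / 2" "d' <= e * t / 4" using d e t by (auto simp: d'_def)
 show ?thesis
 proof (intro exI[of _ d'] conjI allI impI d')
  fix S' u x assume *: "pos_op S' C" "\<forall>x. norm (S' x - S x) <= d' * norm x" "\<bar>u - t\<bar> < d'"
  interpret S': pos_op S' C by fact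
  have u: "0 < u" using * d' by linarith
  have 1: "norm (S'.fc (expi 0 u) x - S'.fc (expi 0 t) x) <= e / 2 * norm x"
  proof (intro S'.fc_diff_norm_le expi_continuous u t)
   fix s
   have "\<bar>expi 0 u s - expi 0 t s\<bar> <= \<bar>u - t\<bar> / (t - \<bar>u - t\<bar>)"
    using expi_taylor[of "u - t" t 0 s 1] * d' by simp
   also have "... <= (e * t / 4) / (t / 2)" using * d' e t by (intro frac_le) auto
   also have "... = e / 2" using t by simp
   finally show "\<bar>expi 0 u s - expi 0 t s\<bar> <= e / 2" .
  qed
  have "\<forall>x. norm (S' x - S x) <= d * norm x"
   using *(2) d'(2) by (meson mult_right_mono norm_ge_zero order_trans)
  then have 2: "norm (S'.fc (expi 0 t) x - S.fc (expi 0 t) x) <= e / 2 * norm x" by (rule d(2)[OF *(1)])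
  have "norm (S'.sg u x - S.sg t x) <= e / 2 * norm x + e / 2 * norm x"
   using norm_triangle_ineq[of "S'.fc (expi 0 u) x - S'.fc (expi 0 t) x" "S'.fc (expi 0 t) x - S.fc (expi 0 t) x"] 1 2 u t
   by (simp add: S'.sg_def S.sg_def S'.sgd_def S.sgd_def)
  then show "norm (S'.sg u x - S.sg t x) <= e * norm x" by simp
 qed
qed

text \<open>At time 0 only strong convergence can be expected, hence a fixed vector
  \<open>z\<close>. It is close to some \<open>S y\<close>, thus also to \<open>S' y\<close>, which
  the perturbed semigroup moves by at most \<open>u * norm y\<close>.\<close>

lemma sg_perturb_0:
 assumes S: "pos_inj S C" and e: "0 < e"
 shows "\<exists>d>0. \<forall>S' u. pos_op S' C --> (\<forall>x. norm (S' x - S x) <= d * norm x) --> u < d -->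
  norm (pos_op.sg S' C u z - z) <= e"
proof -
 interpret S: pos_inj S C by fact
 obtain y where y: "norm (z - S y) < e / 6" using S.S_dense[of "e / 6" z] e by auto
 define d where "d = e / (6 * (norm y + 1))"
 have d0: "0 < d" using e by (simp add: d_def add_nonneg_pos)
 have dy: "d * norm y <= e / 6"
 proof -
  have "d * norm y <= d * (norm y + 1)" using d0 by simp
  also have "... = e / 6" using norm_ge_zero[of y] by (simp add: d_def field_simps add_nonneg_eq_0_iff del: norm_ge_zero)
  finally show ?thesis .
 qed
 show ?thesis
 proof (intro exI[of _ d] conjI allI impI d0)
  fix S' u assume *: "pos_op S' C" "\<forall>x. norm (S' x - S x) <= d * norm x" "u < d"
  interpret S': pos_op S' C by fact
  show "norm (S'.sg u z - z) <= e"
  proof (cases "u <= 0")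
   case False
   interpret sg: bounded_linear "S'.sg u" by (rule S'.sg_bounded_linear)
   have a: "norm (z - S' y) <= e / 3"
    using norm_triangle_ineq4[of "z - S y" "S' y - S y"] y *(2)[rule_format, of y] dy by simp
   have "norm (S'.sg u (S' y) - S' y) <= u * norm y" using False by (intro S'.sg_S_diff) auto
   also have "... <= d * norm y" using *(3) by (intro mult_right_mono) auto
   finally have b: "norm (S'.sg u (S' y) - S' y) <= e / 6" using dy by simp
   have c: "norm (S'.sg u (z - S' y)) <= e / 3" using S'.sg_contraction[of u "z - S' y"] a by linarith
   have "S'.sg u z - z = S'.sg u (z - S' y) + (S'.sg u (S' y) - S' y) - (z - S' y)" by (simp add: sg.diff)
   also have "norm ... <= norm (S'.sg u (z - S' y)) + norm (S'.sg u (S' y) - S' y) + norm (z - S' y)"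
    by (intro order_trans[OF norm_triangle_ineq4] add_right_mono norm_triangle_ineq)
   finally show ?thesis using a b c e by linarith
  qed (use e in simp)
 qed
qed

section \<open>Integrals over the unit interval\<close>

lemma integral_lebesgue_on_borel:
 fixes g :: "'b::euclidean_space => 'a::{banach, second_countable_topology}"
 assumes "g \<in> borel_measurable borel" "A \<in> sets borel"
 shows "(LINT y|lebesgue_on A. g y) = (LINT y|lborel. indicator A y *\<^sub>R g y)"
 using assms by (simp add: integral_restrict_space integral_completion)

lemma integrable_lebesgue_on_borel:
 fixes g :: "'b::euclidean_space => 'a::{banach, second_countable_topology}"
 assumes "g \<in> borel_measurable borel" "A \<in> sets borel"
 shows "integrable (lebesgue_on A) g \<longleftrightarrow> integrable lborel (%y. indicator A y *\<^sub>R g y)"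
 using assms by (simp add: integrable_restrict_space integrable_completion)

lemma AE_lebesgue_on_iff:
 assumes "A \<in> sets lebesgue"
 shows "(AE x in lebesgue_on A. P x) \<longleftrightarrow> (AE x in lborel. x \<in> A --> P x)"
 using assms by (simp add: AE_restrict_space_iff AE_completion_iff)

text \<open>Borel representatives that vanish off the open interval. Integrals over
  \<open>leb01\<close> then become integrals over the line with respect to \<open>lborel\<close>,
  where Fubini applies.\<close>

definition unit_rep :: "(real => complex) => bool" where
 "unit_rep f \<longleftrightarrow> f \<in> borel_measurable borel \<and> f \<in> L2_fun \<and> integrable lborel f \<and> (\<forall>x. x \<notin> {0<..<1} --> f x = 0)"

lemma L2_rep_cases:
 obtains f where "unit_rep f" "F = L2_of f"
proof -
 obtain g where g: "g \<in> borel_measurable borel" "g \<in> L2_fun" "F = L2_of g" by (rule L2_borel_cases)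
 define f where "f x = indicator {0<..<1} x *\<^sub>R g x" for x
 have [measurable]: "f \<in> borel_measurable borel" using g(1) unfolding f_def by measurable
 have ae: "AE x in leb01. g x = f x" by (rule AE_I2) (auto simp: space_restrict_space f_def)
 have f: "f \<in> L2_fun" by (rule L2_fun_AE_cong[OF g(2) borel_imp_leb01 ae]) simp
 have "integrable leb01 f"
 proof (rule Bochner_Integration.integrable_bound)
  interpret finite_measure leb01 by (rule finite_measure_leb01)
  show "integrable leb01 (%x. 1 + (norm (f x))\<^sup>2)" using f by (simp add: L2_fun_def)
  show "f \<in> borel_measurable leb01" using f by (simp add: L2_fun_def)
  have "norm (f x) <= 1 + (norm (f x))\<^sup>2" for x
   using sum_squares_bound[of 1 "norm (f x)"] norm_ge_zero[of "f x"] unfolding power_one by linarith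
  then show "AE x in leb01. norm (f x) <= norm (1 + (norm (f x))\<^sup>2)" by (auto intro!: AE_I2)
 qed
 then have "integrable lborel (%y. indicator {0<..<1} y *\<^sub>R f y)"
  by (subst (asm) integrable_lebesgue_on_borel) auto
 moreover have "(%y. indicator {0<..<1} y *\<^sub>R f y) = f" by (auto simp: f_def indicator_def)
 ultimately have "unit_rep f" using f by (auto simp: unit_rep_def f_def)
 moreover have "F = L2_of f" using g f ae by (simp add: L2_of_eq_iff)
 ultimately show ?thesis by (rule that)
qed

lemma unit_rep_integral:
 fixes h :: "real => 'a::{banach, second_countable_topology}"
 assumes "h \<in> borel_measurable borel" "!!y. y \<notin> {0<..<1} ==> h y = 0"
 shows "(LINT y|leb01. h y) = (LINT y|lborel. h y)"
proof -
 have "indicator {0<..<1} y *\<^sub>R h y = h y" for y using assms(2) by (auto simp: indicator_def)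
 then show ?thesis using assms by (subst integral_lebesgue_on_borel) auto
qed

lemma rep_L2_fun: "rep_L2 F \<in> L2_fun"
 using Quotient3_rep_reflp[OF Quotient3_L2, of F] by (simp add: L2_eq_def)

lemma L2_of_rep: "L2_of (rep_L2 F) = F"
 using Quotient3_abs_rep[OF Quotient3_L2, of F] rep_L2_fun by (simp add: L2_of_def)

lemma rep_L2_of: "f \<in> L2_fun ==> AE x in leb01. rep_L2 (L2_of f) x = f x"
 using L2_of_eq_iff[OF rep_L2_fun] by (metis L2_of_rep)

lemma norm_L2_of_le:
 assumes f: "f \<in> borel_measurable leb01" and B: "0 <= B" "!!x. x \<in> {0<..<1} ==> norm (f x) <= B"
 shows "f \<in> L2_fun" "norm (L2_of f) <= B"
proof -
 interpret finite_measure leb01 by (rule finite_measure_leb01)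
 have b: "AE x in leb01. (norm (f x))\<^sup>2 <= B\<^sup>2"
  using B by (intro AE_I2) (auto simp: space_restrict_space power_mono)
 have "integrable leb01 (%x. (norm (f x))\<^sup>2)"
  by (rule integrable_const_bound[where B="B\<^sup>2"]) (use b f in auto)
 then show L: "f \<in> L2_fun" using f by (simp add: L2_fun_def)
 have "(LINT x|leb01. (norm (f x))\<^sup>2) <= (LINT x|leb01. B\<^sup>2)"
  using L b by (intro integral_mono_AE) (auto simp: L2_fun_def)
 also have "... = B\<^sup>2" using emeasure_leb01_UNIV by (simp add: measure_def)
 finally have "sqrt (LINT x|leb01. (norm (f x))\<^sup>2) <= sqrt (B\<^sup>2)" by (rule real_sqrt_le_mono)
 then show "norm (L2_of f) <= B" using B by (simp add: norm_L2_of[OF L])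
qed

lemma inner_L2_of: "f \<in> L2_fun ==> g \<in> L2_fun ==> L2_of f \<bullet> L2_of g = (LINT x|leb01. f x \<bullet> g x)"
 using inner_L2.abs_eq[of f g] by (simp add: L2_of_def L2_eq_def)

subsection \<open>Pairing with bounded real kernels\<close>

definition pair :: "L2 => (real => real) => complex" where
 "pair F k = (LINT y|leb01. k y *\<^sub>R rep_L2 F y)"

lemma pair_L2_of:
 assumes [measurable]: "f \<in> L2_fun" "k \<in> borel_measurable borel"
 shows "pair (L2_of f) k = (LINT y|leb01. k y *\<^sub>R f y)"
 unfolding pair_def
proof (rule integral_cong_AE)
 have [measurable]: "k \<in> borel_measurable leb01"
  using assms(2) by (intro measurable_restrict_space1 measurable_completion) (simp add: measurable_lborel1)
 have [measurable]: "rep_L2 (L2_of f) \<in> borel_measurable leb01" "f \<in> borel_measurable leb01"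
  using rep_L2_fun[of "L2_of f"] assms(1) by (simp_all add: L2_fun_def)
 show "(%y. k y *\<^sub>R rep_L2 (L2_of f) y) \<in> borel_measurable leb01" "(%y. k y *\<^sub>R f y) \<in> borel_measurable leb01"
  by measurable
 show "AE y in leb01. k y *\<^sub>R rep_L2 (L2_of f) y = k y *\<^sub>R f y"
  using rep_L2_of[OF assms(1)] by eventually_elim simp
qed

lemma pair_unit_rep:
 assumes f: "unit_rep f" and k: "k \<in> borel_measurable borel"
 shows "pair (L2_of f) k = (LINT y|lborel. k y *\<^sub>R f y)"
proof -
 have [measurable]: "f \<in> borel_measurable borel" "k \<in> borel_measurable borel" using f k by (auto simp: unit_rep_def)
 have m: "(%y. k y *\<^sub>R f y) \<in> borel_measurable borel" by measurable
 have "pair (L2_of f) k = (LINT y|leb01. k y *\<^sub>R f y)"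
  using f k by (intro pair_L2_of) (auto simp: unit_rep_def)
 then show ?thesis using f unit_rep_integral[OF m] by (simp add: unit_rep_def)
qed

lemma pair_integrable:
 assumes f: "unit_rep f" and k: "k \<in> borel_measurable borel" "!!y. 0 < y ==> y < 1 ==> \<bar>k y\<bar> <= B"
 shows "integrable lborel (%y. k y *\<^sub>R f y)"
proof (rule Bochner_Integration.integrable_bound)
 show "integrable lborel (%y. B *\<^sub>R f y)" using f by (simp add: unit_rep_def)
 show "(%y. k y *\<^sub>R f y) \<in> borel_measurable lborel"
  using f k(1) by (intro borel_measurable_scaleR) (auto simp: unit_rep_def)
 have "\<bar>k y\<bar> * norm (f y) <= \<bar>B\<bar> * norm (f y)" for y
  using f k(2)[of y] by (cases "y \<in> {0<..<1}") (auto simp: unit_rep_def intro!: mult_right_mono)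
 then show "AE y in lborel. norm (k y *\<^sub>R f y) <= norm (B *\<^sub>R f y)" by simp
qed

lemma unit_rep_add: "unit_rep f ==> unit_rep g ==> unit_rep (%x. f x + g x)"
 by (auto simp: unit_rep_def L2_fun_add)

lemma unit_rep_scaleR: "unit_rep f ==> unit_rep (%x. r *\<^sub>R f x)"
 by (auto simp: unit_rep_def L2_fun_scaleR)

lemma pair_add:
 assumes k: "k \<in> borel_measurable borel" "!!y. 0 < y ==> y < 1 ==> \<bar>k y\<bar> <= B"
 shows "pair (F + G) k = pair F k + pair G k"
proof -
 obtain f where f: "unit_rep f" "F = L2_of f" by (rule L2_rep_cases)
 obtain g where g: "unit_rep g" "G = L2_of g" by (rule L2_rep_cases)
 have "F + G = L2_of (%x. f x + g x)" using f g by (simp add: L2_of_add unit_rep_def)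
 then show ?thesis
  using f(1) g(1) pair_integrable[OF f(1) k] pair_integrable[OF g(1) k]
  by (simp add: f(2) g(2) pair_unit_rep[OF _ k(1)] unit_rep_add scaleR_add_right)
qed

lemma pair_scaleR:
 assumes k: "k \<in> borel_measurable borel"
 shows "pair (r *\<^sub>R F) k = r *\<^sub>R pair F k"
proof -
 obtain f where f: "unit_rep f" "F = L2_of f" by (rule L2_rep_cases)
 have "r *\<^sub>R F = L2_of (%x. r *\<^sub>R f x)" using f by (simp add: L2_of_scaleR unit_rep_def)
 then show ?thesis using f(1)
  by (simp add: f(2) pair_unit_rep[OF _ k(1)] unit_rep_scaleR scaleR_left_commute flip: integral_scaleR_right)
    (simp add: mult.commute)
qed

lemma pair_kernel_diff:
 assumes k: "k \<in> borel_measurable borel" "!!y. 0 < y ==> y < 1 ==> \<bar>k y\<bar> <= B"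
  and l: "l \<in> borel_measurable borel" "!!y. 0 < y ==> y < 1 ==> \<bar>l y\<bar> <= B'"
 shows "pair F k - pair F l = pair F (%y. k y - l y)"
proof -
 obtain f where f: "unit_rep f" "F = L2_of f" by (rule L2_rep_cases)
 show ?thesis
  using pair_integrable[OF f(1) k] pair_integrable[OF f(1) l] k l
  by (simp add: f(2) pair_unit_rep[OF f(1)] scaleR_diff_left)
qed

text \<open>The factor 2, which returns in the bounds for \<open>zf\<close> and \<open>flux\<close>,
  comes from \<open>nn_integral_norm_le_L2\<close>; that lemma asks for a positive bound, whence the
  slack \<open>e\<close> when the norm may vanish.\<close>

lemma unit_rep_L1_le:
 assumes f: "unit_rep f"
 shows "(LINT y|lborel. norm (f y)) <= 2 * norm (L2_of f)"
proof (rule field_le_epsilon)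
 fix e :: real assume "0 < e"
 have L: "f \<in> L2_fun" "integrable lborel f" "f \<in> borel_measurable borel" using f by (auto simp: unit_rep_def)
 have "norm (L2_of f) <= norm (L2_of f) + e / 2" using \<open>0 < e\<close> by simp
 then have "(\<integral>\<^sup>+x. ennreal (norm (f x)) \<partial>leb01) <= ennreal (2 * (norm (L2_of f) + e / 2))"
  using \<open>0 < e\<close> by (intro nn_integral_norm_le_L2 L) (auto simp: add_nonneg_pos)
 moreover have i: "integrable leb01 (%x. norm (f x))"
  using f by (subst integrable_lebesgue_on_borel) (auto simp: unit_rep_def intro!: integrable_mult_indicator[of _ _ "%x. norm (f x)", simplified])
 ultimately have "ennreal (LINT x|leb01. norm (f x)) <= ennreal (2 * (norm (L2_of f) + e / 2))"
  by (simp add: nn_integral_eq_integral)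
 then have "(LINT x|leb01. norm (f x)) <= 2 * (norm (L2_of f) + e / 2)"
  using \<open>0 < e\<close> by (subst (asm) ennreal_le_iff) (auto simp: add_nonneg_nonneg)
 also have "(LINT x|leb01. norm (f x)) = (LINT y|lborel. norm (f y))"
  using f by (intro unit_rep_integral) (auto simp: unit_rep_def)
 finally show "(LINT y|lborel. norm (f y)) <= 2 * norm (L2_of f) + e" by simp
qed

lemma pair_norm_le:
 assumes k: "k \<in> borel_measurable borel" "!!y. 0 < y ==> y < 1 ==> \<bar>k y\<bar> <= B" and B: "0 <= B"
 shows "norm (pair F k) <= 2 * B * norm F"
proof -
 obtain f where f: "unit_rep f" "F = L2_of f" by (rule L2_rep_cases)
 have "norm (pair F k) <= (LINT y|lborel. norm (k y *\<^sub>R f y))"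
  unfolding f(2) pair_unit_rep[OF f(1) k(1)] by (rule integral_norm_bound)
 also have "... <= (LINT y|lborel. B * norm (f y))"
 proof (rule integral_mono)
  show "integrable lborel (%y. norm (k y *\<^sub>R f y))" using pair_integrable[OF f(1) k] by (rule integrable_norm)
  show "integrable lborel (%y. B * norm (f y))" using f by (simp add: unit_rep_def)
  show "norm (k y *\<^sub>R f y) <= B * norm (f y)" for y
   using f k(2)[of y] by (cases "y \<in> {0<..<1}") (auto simp: unit_rep_def intro!: mult_right_mono)
 qed
 also have "... <= B * (2 * norm F)" unfolding f(2) using unit_rep_L1_le[OF f(1)] B by (simp add: mult_left_mono)
 finally show ?thesis by simp
qed

lemma borel_measurable_cnj [measurable (raw)]:
 "f \<in> borel_measurable M ==> (%x. cnj (f x)) \<in> borel_measurable M"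
 by (rule measurable_compose[OF _ borel_measurable_continuous_onI[OF continuous_on_cnj]]) (auto intro: continuous_on_id)

lemma integral_cnj_zero: "(LINT x|M. cnj (f x)) = cnj (LINT x|M. f x)"
proof (cases "integrable M f")
 case True
 then show ?thesis by (rule integral_bounded_linear[OF bounded_linear_cnj])
next
 case False
 then have "\<not> integrable M (%x. cnj (f x))"
  using integrable_cnj[of M "%x. cnj (f x)"] by auto
 then show ?thesis using False by (simp add: not_integrable_integral_eq)
qed

subsection \<open>Primitives\<close>

definition prim :: "(real => 'a::{banach, second_countable_topology}) => real => 'a" where
 "prim f x = (LINT y|lborel. indicator {0<..<x} y *\<^sub>R f y)"

lemma prim_cong: "(!!y. 0 < y ==> y < x ==> f y = g y) ==> prim f x = prim g x"
 unfolding prim_def by (intro integral_eqI) (auto simp: indicator_def)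

lemma prim_nonpos [simp]: "x <= 0 ==> prim f x = 0"
 by (simp add: prim_def)

lemma prim_eq_lebesgue_on:
 "g \<in> borel_measurable borel ==> (LINT y|lebesgue_on {0<..<x}. g y) = prim g x"
 by (simp add: integral_lebesgue_on_borel prim_def)

lemma indicator_integrable_bounded:
 fixes f :: "real => 'a::{banach, second_countable_topology}"
 assumes [measurable]: "f \<in> borel_measurable borel" and B: "!!y. a < y ==> y < b ==> norm (f y) <= B"
 shows "integrable lborel (%y. indicator {a<..<b} y *\<^sub>R f y)"
proof (cases "a < b")
 case True
 show ?thesis
 proof (rule Bochner_Integration.integrable_bound)
  show "integrable lborel (%y. B * indicator {a<..<b} y)"
   using True by (intro integrable_mult_right integrable_real_indicator) auto
  show "AE y in lborel. norm (indicator {a<..<b} y *\<^sub>R f y) <= norm (B * indicator {a<..<b} y :: real)"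
   using B by (intro always_eventually allI) (auto simp: indicator_def intro: order_trans[OF _ abs_ge_self])
 qed measurable
qed simp

lemma prim_diff:
 fixes f :: "real => 'a::{banach, second_countable_topology}"
 assumes i: "integrable lborel (%y. indicator {0<..<b} y *\<^sub>R f y)" and xy: "0 <= x" "x <= y" "y <= b"
 shows "prim f y - prim f x = (LINT u|lborel. indicator {x<..<y} u *\<^sub>R f u)"
proof (cases "x < y")
 case True
 have int: "integrable lborel (%u. indicator {p<..<q} u *\<^sub>R f u)" if "0 <= p" "q <= b" for p q
 proof -
  have "integrable lborel (%u. indicator {p<..<q} u *\<^sub>R (indicator {0<..<b} u *\<^sub>R f u))"
   by (rule integrable_mult_indicator[OF _ i]) simp
  moreover have "(%u. indicator {p<..<q} u *\<^sub>R (indicator {0<..<b} u *\<^sub>R f u)) = (%u. indicator {p<..<q} u *\<^sub>R f u)"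
   using that by (auto simp: indicator_def)
  ultimately show ?thesis by (simp only:)
 qed
 have "prim f y - prim f x = (LINT u|lborel. indicator {0<..<y} u *\<^sub>R f u - indicator {0<..<x} u *\<^sub>R f u)"
  unfolding prim_def using xy by (intro Bochner_Integration.integral_diff[symmetric] int) auto
 also have "... = (LINT u|lborel. indicator {x<..<y} u *\<^sub>R f u)"
 proof (rule integral_cong_AE)
  have [measurable]: "(%u. indicator {0<..<y} u *\<^sub>R f u) \<in> borel_measurable lborel"
   "(%u. indicator {0<..<x} u *\<^sub>R f u) \<in> borel_measurable lborel"
   "(%u. indicator {x<..<y} u *\<^sub>R f u) \<in> borel_measurable lborel"
   using int[of 0 y] int[of 0 x] int[of x y] xy by auto
  show "(%u. indicator {0<..<y} u *\<^sub>R f u - indicator {0<..<x} u *\<^sub>R f u) \<in> borel_measurable lborel"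
   "(%u. indicator {x<..<y} u *\<^sub>R f u) \<in> borel_measurable lborel" by measurable
  have "AE u in lborel. u ~= x" by (rule AE_lborel_singleton)
  then show "AE u in lborel. indicator {0<..<y} u *\<^sub>R f u - indicator {0<..<x} u *\<^sub>R f u = indicator {x<..<y} u *\<^sub>R f u"
   by eventually_elim (use xy in \<open>auto simp: indicator_def\<close>)
 qed
 finally show ?thesis .
qed (use xy in simp)

lemma prim_lipschitz:
 fixes f :: "real => 'a::{banach, second_countable_topology}"
 assumes f: "f \<in> borel_measurable borel" and B: "!!y. 0 < y ==> y < b ==> norm (f y) <= B"
  and xy: "0 <= x" "x <= y" "y <= b"
 shows "norm (prim f y - prim f x) <= B * (y - x)"
proof -
 have "prim f y - prim f x = (LINT u|lborel. indicator {x<..<y} u *\<^sub>R f u)"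
  by (rule prim_diff[OF indicator_integrable_bounded[OF f B] xy])
 also have "norm ... <= (LINT u|lborel. norm (indicator {x<..<y} u *\<^sub>R f u))" by (rule integral_norm_bound)
 also have "... <= (LINT u|lborel. B * indicator {x<..<y} u)"
 proof (rule integral_mono)
  show "integrable lborel (%u. norm (indicator {x<..<y} u *\<^sub>R f u))"
   using xy by (intro integrable_norm indicator_integrable_bounded[OF f]) (auto intro!: B)
  show "integrable lborel (%u. B * indicator {x<..<y} u)"
   using xy by (intro integrable_mult_right integrable_real_indicator) auto
 qed (use xy B in \<open>auto simp: indicator_def\<close>)
 also have "... = B * (y - x)" using xy by simp
 finally show ?thesis .
qed

lemma fubini_triangle:
 fixes f h :: "real => complex"
 assumes f: "integrable lborel f" and h: "integrable lborel h"
 shows "(LINT s|lborel. h s * (LINT y|lborel. indicator {s<..} y *\<^sub>R f y))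
  = (LINT y|lborel. f y * (LINT s|lborel. indicator {..<y} s *\<^sub>R h s))"
proof -
 have [measurable]: "f \<in> borel_measurable borel" "h \<in> borel_measurable borel" using f h by auto
 define k where "k p = h (fst p) * f (snd p) * (if fst p < snd p then 1 else 0)" for p
 have [measurable]: "k \<in> borel_measurable (lborel \<Otimes>\<^sub>M lborel)" unfolding k_def by measurable
 have int: "integrable (lborel \<Otimes>\<^sub>M lborel) k"
 proof (rule lborel_pair.Fubini_integrable)
  have 1: "integrable lborel (%y. k (s, y))" for s
   by (rule Bochner_Integration.integrable_bound[of _ "%y. h s * f y"]) (use f in \<open>auto simp: k_def norm_mult\<close>)
  then show "AE s in lborel. integrable lborel (%y. k (s, y))" by simp
  show "integrable lborel (%s. LINT y|lborel. norm (k (s, y)))"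
  proof (rule Bochner_Integration.integrable_bound)
   show "integrable lborel (%s. norm (h s) * (LINT y|lborel. norm (f y)))" using h by simp
   show "AE s in lborel. norm (LINT y|lborel. norm (k (s, y))) <= norm (norm (h s) * (LINT y|lborel. norm (f y)))"
   proof (intro always_eventually allI)
    fix s
    have "(LINT y|lborel. norm (k (s, y))) <= (LINT y|lborel. norm (h s) * norm (f y))"
     using 1 f by (intro integral_mono integrable_norm) (auto simp: k_def norm_mult)
    then show "norm (LINT y|lborel. norm (k (s, y))) <= norm (norm (h s) * (LINT y|lborel. norm (f y)))"
     by simp
   qed
  qed measurable
 qed measurable
 have "(LINT s|lborel. h s * (LINT y|lborel. indicator {s<..} y *\<^sub>R f y)) = (LINT s|lborel. LINT y|lborel. k (s, y))"
  by (intro integral_eqI, subst integral_mult_right_zero[symmetric])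
    (auto simp: k_def indicator_def intro!: Bochner_Integration.integral_cong)
 also have "... = (LINT y|lborel. LINT s|lborel. k (s, y))"
  using lborel_pair.Fubini_integral[of "%s y. k (s, y)"] int by simp
 also have "... = (LINT y|lborel. f y * (LINT s|lborel. indicator {..<y} s *\<^sub>R h s))"
  by (intro integral_eqI, subst integral_mult_right_zero[symmetric])
    (auto simp: k_def indicator_def intro!: Bochner_Integration.integral_cong)
 finally show ?thesis .
qed

text \<open>The sets over which \<open>g\<close> integrates to zero form a Dynkin system, closed
  under complements because the total integral vanishes; it contains the half lines, which are
  stable under intersection.\<close>

lemma AE_zero_if_half_line_integrals_zero:
 fixes g :: "real => complex"
 assumes g: "integrable lborel g" and z: "!!a. (LINT y|lborel. indicator {..<a} y *\<^sub>R g y) = 0"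
  and z': "(LINT y|lborel. g y) = 0"
 shows "AE y in lborel. g y = 0"
proof -
 have gi: "integrable lborel (%y. indicator A y *\<^sub>R g y)" if "A \<in> sets borel" for A
  by (rule integrable_mult_indicator[OF _ g]) (use that in simp)
 have ind: "(LINT y|lborel. indicator A y *\<^sub>R g y) = 0" if "A \<in> sets borel" for A :: "real set"
 proof -
  have gen: "sets borel = sigma_sets UNIV (range lessThan :: real set set)"
   by (simp add: borel_Iio)
  have "Int_stable (range lessThan :: real set set)"
  proof (rule Int_stableI)
   fix U V :: "real set" assume "U \<in> range lessThan" "V \<in> range lessThan"
   then obtain p q where "U = {..<p}" "V = {..<q}" by auto
   then have "U \<inter> V = {..<min p q}" by auto
   then show "U \<inter> V \<in> range lessThan" by simp
  qed
  moreover have "range lessThan \<subseteq> Pow (UNIV :: real set)" by simp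
  moreover have "A \<in> sigma_sets UNIV (range lessThan)" using that gen by simp
  ultimately show ?thesis
  proof (induction rule: sigma_sets_induct_disjoint)
   case (compl A)
   then have A: "A \<in> sets borel" using gen by simp
   have "(LINT y|lborel. indicator (UNIV - A) y *\<^sub>R g y) = (LINT y|lborel. g y - indicator A y *\<^sub>R g y)"
    by (intro Bochner_Integration.integral_cong) (auto simp: indicator_def)
   also have "... = 0" using g gi[OF A] z' compl.IH by simp
   finally show ?case .
  next
   case (union A)
   have A: "A n \<in> sets borel" for n using union gen by auto
   have "set_lebesgue_integral lborel (\<Union> (range A)) g = (\<Sum>i. set_lebesgue_integral lborel (A i) g)"
    using union A gi[of "\<Union> (range A)"]
    by (intro lebesgue_integral_countable_add) (auto simp: set_integrable_def disjoint_family_on_def)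
   then show ?case using union.IH by (simp add: set_lebesgue_integral_def)
  qed (use z in auto)
 qed
 show ?thesis
  by (rule sigma_finite_measure.density_zero[OF sigma_finite_lborel g]) (use ind in \<open>simp add: set_lebesgue_integral_def\<close>)
qed

section \<open>The Green operator\<close>

text \<open>\<open>\<rho>\<close> is the reciprocal of the diffusion coefficient, in a Borel version
  bounded everywhere. The Green function depends on it through its primitive, and this reciprocal is
  what homogenization averages.\<close>

locale coef =
 fixes K :: real and \<rho> :: "real => real"
 assumes K1: "1 <= K" and rho_meas [measurable]: "\<rho> \<in> borel_measurable borel"
  and rho_ge: "1 / K <= \<rho> x" and rho_le: "\<rho> x <= K"
begin

lemma rho_pos: "0 < \<rho> x"
 by (rule less_le_trans[OF _ rho_ge]) (use K1 in simp)

lemma rho_nonneg: "0 <= \<rho> x" and rho_nz: "\<rho> x ~= 0"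
 using rho_pos[of x] by auto

text \<open>The harmonic coordinate: together with the constants it spans the solutions of the
  homogeneous equation \<open>(z' / \<rho>)' = 0\<close>.\<close>

definition R :: "real => real" where "R = prim \<rho>"

lemma R_0 [simp]: "x <= 0 ==> R x = 0"
 by (simp add: R_def)

lemma R_diff:
 assumes "x <= y"
 shows "0 <= R y - R x" "R y - R x <= K * (y - x)"
  and "0 <= x ==> (y - x) / K <= R y - R x"
proof -
 have main: "(y - x) / K <= R y - R x" "R y - R x <= K * (y - x)" if xy: "0 <= x" "x <= y" for x y
 proof -
  have int: "integrable lborel (%u. indicator {p<..<q} u *\<^sub>R \<rho> u)" for p q
   by (rule indicator_integrable_bounded[where B=K]) (use rho_pos rho_le in \<open>auto simp: abs_of_pos\<close>)
  have eq: "R y - R x = (LINT u|lborel. indicator {x<..<y} u *\<^sub>R \<rho> u)"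
   unfolding R_def using xy by (intro prim_diff[OF int]) auto
  have "(LINT u|lborel. indicator {x<..<y} u *\<^sub>R (1 / K)) <= R y - R x"
   unfolding eq using xy rho_ge by (intro integral_mono int indicator_integrable_bounded[where B="\<bar>1 / K\<bar>"]) (auto simp: indicator_def)
  then show "(y - x) / K <= R y - R x" using xy by simp
  have "R y - R x <= (LINT u|lborel. indicator {x<..<y} u *\<^sub>R K)"
   unfolding eq using xy rho_le by (intro integral_mono int indicator_integrable_bounded[where B="\<bar>K\<bar>"]) (auto simp: indicator_def)
  then show "R y - R x <= K * (y - x)" using xy by (simp add: mult.commute)
 qed
 show "0 <= x ==> (y - x) / K <= R y - R x" using main assms by simp
 have K0: "0 < K" using K1 by simp
 have nn: "0 <= (y - x) / K" if "x <= y" for x y using that K0 by simp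
 consider "0 <= x" | "x < 0" "0 <= y" | "y < 0" by linarith
 then have "0 <= R y - R x \<and> R y - R x <= K * (y - x)"
 proof cases
  case 1
  then show ?thesis using main[of x y] nn[of x y] assms by linarith
 next
  case 2
  then have "0 <= R y - R 0" "R y - R 0 <= K * (y - 0)" using main[of 0 y] nn[of 0 y] by linarith+
  moreover have "K * (y - 0) <= K * (y - x)" using 2 K0 by (intro mult_left_mono) auto
  ultimately show ?thesis using 2 by simp
 next
  case 3
  then show ?thesis using assms K0 by simp
 qed
 then show "0 <= R y - R x" "R y - R x <= K * (y - x)" by auto
qed

lemma R_mono: "x <= y ==> R x <= R y"
 using R_diff(1)[of x y] by simp

lemma R_nonneg: "0 <= R x"
 using R_mono[of 0 x] R_0[of x] R_0[of 0] by (cases "0 <= x") auto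

lemma R_lipschitz: "\<bar>R x - R y\<bar> <= K * \<bar>x - y\<bar>"
 using R_diff(1,2)[of x y] R_diff(1,2)[of y x] by (cases "x <= y") (auto simp: abs_if)

lemma R_1: "1 / K <= R 1" "0 < R 1" "R 1 <= K"
proof -
 have "0 < 1 / K" using K1 by simp
 then show "1 / K <= R 1" "R 1 <= K" using R_diff(2,3)[of 0 1] R_0[of 0] by simp_all
 then show "0 < R 1" using \<open>0 < 1 / K\<close> by linarith
qed

lemma R_continuous: "continuous_on UNIV R"
proof (rule continuous_onI)
 fix x e :: real assume "0 < e"
 then show "\<exists>d>0. \<forall>y\<in>UNIV. dist y x < d --> dist (R y) (R x) <= e"
  using K1 order_trans[OF R_lipschitz] by (intro exI[of _ "e / K"]) (auto simp: dist_real_def field_simps)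
qed

lemma R_measurable [measurable]: "R \<in> borel_measurable borel"
 using R_continuous by (rule borel_measurable_continuous_onI)

lemma ratio: "y <= 1 ==> 0 <= R y / R 1" "y <= 1 ==> R y / R 1 <= 1"
 using R_nonneg[of y] R_mono[of y 1] R_1 by (auto simp: divide_le_eq_1)

text \<open>The Green function of \<open>- (z' / \<rho>)'\<close> with Dirichlet conditions, which
  is that of minus the second derivative in the coordinate \<open>R\<close>. The kernel
  \<open>phi\<close> is its derivative in the first variable with respect to
  \<open>R\<close>.\<close>

definition kern :: "real => real => real" where
 "kern x y = min (R x) (R y) - R x * (R y / R 1)"

definition phi :: "real => real => real" where
 "phi s y = (if s < y then 1 else 0) - R y / R 1"

lemma abs_ratio: "0 < y ==> y < 1 ==> \<bar>R y / R 1\<bar> <= 1"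
 using ratio[of y] by linarith

lemma kern_measurable [measurable]: "kern x \<in> borel_measurable borel"
 unfolding kern_def by measurable

lemma phi_measurable [measurable]: "phi s \<in> borel_measurable borel"
 unfolding phi_def by measurable

lemma kern_bound:
 assumes "x <= 1" "0 < y" "y < 1"
 shows "\<bar>kern x y\<bar> <= K"
proof -
 have a: "0 <= min (R x) (R y)" "min (R x) (R y) <= K"
  using R_nonneg[of x] R_nonneg[of y] R_mono[OF assms(1)] R_1 by linarith+
 have b: "0 <= R x * (R y / R 1)" using ratio assms R_nonneg by (intro mult_nonneg_nonneg) auto
 have "R x * (R y / R 1) <= K * 1"
  using ratio[of y] assms R_nonneg R_mono[OF assms(1)] R_1 by (intro mult_mono) auto
 then show ?thesis using a b unfolding kern_def abs_le_iff by linarith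
qed

lemma phi_bound: "0 < y ==> y < 1 ==> \<bar>phi s y\<bar> <= 1"
 using ratio[of y] by (auto simp: phi_def)

lemma kern_lipschitz:
 assumes "0 < y" "y < 1"
 shows "\<bar>kern x y - kern x' y\<bar> <= 2 * K * \<bar>x - x'\<bar>"
proof -
 have "kern x y - kern x' y = (min (R x) (R y) - min (R x') (R y)) - (R x - R x') * (R y / R 1)"
  unfolding kern_def left_diff_distrib by simp
 moreover have "\<bar>min (R x) (R y) - min (R x') (R y)\<bar> <= \<bar>R x - R x'\<bar>" by (auto simp: min_def)
 moreover have "\<bar>(R x - R x') * (R y / R 1)\<bar> <= \<bar>R x - R x'\<bar> * 1"
  unfolding abs_mult using ratio[of y] assms by (intro mult_left_mono) auto
 ultimately have "\<bar>kern x y - kern x' y\<bar> <= 2 * \<bar>R x - R x'\<bar>"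
  using abs_triangle_ineq4[of "min (R x) (R y) - min (R x') (R y)" "(R x - R x') * (R y / R 1)"] by simp
 also have "... <= 2 * (K * \<bar>x - x'\<bar>)" using R_lipschitz[of x x'] by simp
 finally show ?thesis by (simp add: mult.assoc)
qed

text \<open>\<open>zf F\<close> is the continuous representative of the solution with right-hand
  side \<open>F\<close>, and \<open>flux F\<close> that of its derivative divided by
  \<open>\<rho>\<close>. Working with these functions gives meaning to point values in
  space.\<close>

definition zf :: "L2 => real => complex" where "zf F x = pair F (kern x)"
definition flux :: "L2 => real => complex" where "flux F s = pair F (phi s)"
definition green :: "L2 => L2" where "green F = L2_of (zf F)"

lemma kern_1: "x <= 1 ==> kern 1 x = 0" "kern 0 x = 0"
 using R_mono[of x 1] R_1 R_nonneg[of x] by (auto simp: kern_def)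

lemma zf_lipschitz: "norm (zf F x - zf F x') <= 4 * K * norm F * \<bar>x - x'\<bar>"
proof -
 have b: "\<exists>B. \<forall>y. 0 < y --> y < 1 --> \<bar>kern x y\<bar> <= B" for x
 proof (intro exI allI impI)
  fix y :: real assume "0 < y" "y < 1"
  then show "\<bar>kern x y\<bar> <= 2 * K * \<bar>x\<bar>" using kern_lipschitz[of y x 0] kern_1(2)[of y] by simp
 qed
 obtain B B' where "!!y. 0 < y ==> y < 1 ==> \<bar>kern x y\<bar> <= B" "!!y. 0 < y ==> y < 1 ==> \<bar>kern x' y\<bar> <= B'"
  using b by meson
 then have "zf F x - zf F x' = pair F (%y. kern x y - kern x' y)"
  unfolding zf_def by (intro pair_kernel_diff) auto
 also have "norm ... <= 2 * (2 * K * \<bar>x - x'\<bar>) * norm F"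
  using K1 by (intro pair_norm_le kern_lipschitz) auto
 finally show ?thesis by (simp add: mult_ac)
qed

lemma zf_continuous: "continuous_on UNIV (zf F)"
proof (rule continuous_onI)
 fix x e :: real assume e: "0 < e"
 define L where "L = 4 * K * norm F + 1"
 have L: "0 < L" using K1 by (simp add: L_def add_nonneg_pos)
 have "dist (zf F y) (zf F x) <= e" if "dist y x < e / L" for y
 proof -
  have "dist (zf F y) (zf F x) <= 4 * K * norm F * \<bar>y - x\<bar>" unfolding dist_norm by (rule zf_lipschitz)
  also have "... <= L * \<bar>y - x\<bar>" by (intro mult_right_mono) (auto simp: L_def)
  also have "... <= e" using that L by (simp add: dist_real_def field_simps)
  finally show ?thesis .
 qed
 then show "\<exists>d>0. \<forall>y\<in>UNIV. dist y x < d --> dist (zf F y) (zf F x) <= e"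
  using e L by (intro exI[of _ "e / L"]) auto
qed

lemma zf_measurable [measurable]: "zf F \<in> borel_measurable borel"
 using zf_continuous by (rule borel_measurable_continuous_onI)

lemma zf_bound: "x <= 1 ==> norm (zf F x) <= 2 * K * norm F"
 unfolding zf_def using K1 by (intro pair_norm_le kern_bound) auto

lemma flux_bound: "norm (flux F x) <= 2 * norm F"
 unfolding flux_def using pair_norm_le[of "phi x" 1 F] phi_bound by simp

lemma zf_L2: "zf F \<in> L2_fun"
 using K1 zf_bound[of _ F] by (intro norm_L2_of_le(1)[where B="2 * K * norm F"] borel_imp_leb01) auto

lemma green_norm: "norm (green F) <= 2 * K * norm F"
 unfolding green_def using K1 zf_bound[of _ F] by (intro norm_L2_of_le borel_imp_leb01) auto

lemma zf_add: "x <= 1 ==> zf (F + G) x = zf F x + zf G x"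
 unfolding zf_def using kern_bound[of x] by (intro pair_add) auto

lemma zf_scaleR: "zf (r *\<^sub>R F) x = r *\<^sub>R zf F x"
 unfolding zf_def by (intro pair_scaleR) auto

lemma flux_add: "flux (F + G) x = flux F x + flux G x"
 unfolding flux_def using phi_bound by (intro pair_add) auto

lemma flux_scaleR: "flux (r *\<^sub>R F) x = r *\<^sub>R flux F x"
 unfolding flux_def by (intro pair_scaleR) auto

lemma green_linear: "linear green"
proof (rule linearI)
 fix F G :: L2 and r :: real
 have "green (F + G) = L2_of (%x. zf F x + zf G x)"
  unfolding green_def
  by (subst L2_of_eq_iff) (auto intro!: AE_I2 zf_L2 L2_fun_add simp: zf_add space_restrict_space)
 then show "green (F + G) = green F + green G" by (simp add: green_def L2_of_add zf_L2)
 have "green (r *\<^sub>R F) = L2_of (%x. r *\<^sub>R zf F x)" unfolding green_def by (simp add: zf_scaleR[abs_def])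
 then show "green (r *\<^sub>R F) = r *\<^sub>R green F" by (simp add: green_def L2_of_scaleR zf_L2)
qed

lemma flux_unit_rep:
 assumes f: "unit_rep f"
 shows "flux (L2_of f) s = (LINT y|lborel. indicator {s<..} y *\<^sub>R f y) - (LINT y|lborel. (R y / R 1) *\<^sub>R f y)"
proof -
 have i1: "integrable lborel (%y. indicator {s<..} y *\<^sub>R f y)"
  using f by (intro integrable_mult_indicator) (auto simp: unit_rep_def)
 have i2: "integrable lborel (%y. (R y / R 1) *\<^sub>R f y)"
  by (rule pair_integrable[OF f, where B=1]) (use abs_ratio in \<open>simp_all del: abs_divide\<close>)
 have "flux (L2_of f) s = (LINT y|lborel. phi s y *\<^sub>R f y)"
  unfolding flux_def by (rule pair_unit_rep[OF f]) simp
 also have "... = (LINT y|lborel. indicator {s<..} y *\<^sub>R f y - (R y / R 1) *\<^sub>R f y)"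
  by (intro Bochner_Integration.integral_cong) (auto simp: phi_def indicator_def scaleR_diff_left)
 also have "... = (LINT y|lborel. indicator {s<..} y *\<^sub>R f y) - (LINT y|lborel. (R y / R 1) *\<^sub>R f y)"
  by (rule Bochner_Integration.integral_diff[OF i1 i2])
 finally show ?thesis .
qed

lemma flux_measurable [measurable]: "flux F \<in> borel_measurable borel"
proof -
 obtain f where f: "unit_rep f" "F = L2_of f" by (rule L2_rep_cases)
 have [measurable]: "f \<in> borel_measurable borel" using f by (simp add: unit_rep_def)
 have "(%s. LINT y|lborel. (if s < y then 1 else 0) *\<^sub>R f y) \<in> borel_measurable borel"
  using lborel.borel_measurable_lebesgue_integral[of "%s y. (if s < y then 1 else 0) *\<^sub>R f y" borel] by simp
 moreover have "(%s. LINT y|lborel. (if s < y then 1 else 0) *\<^sub>R f y) = (%s. LINT y|lborel. indicator {s<..} y *\<^sub>R f y)"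
  by (intro ext Bochner_Integration.integral_cong) (auto simp: indicator_def)
 ultimately have "(%s. LINT y|lborel. indicator {s<..} y *\<^sub>R f y) \<in> borel_measurable borel" by simp
 then have "(%s. (LINT y|lborel. indicator {s<..} y *\<^sub>R f y) - (LINT y|lborel. (R y / R 1) *\<^sub>R f y)) \<in> borel_measurable borel"
  by measurable
 then show ?thesis unfolding f(2) flux_unit_rep[OF f(1), abs_def] .
qed

text \<open>Fubini for the kernel \<open>phi\<close>, with a free test function. Taking
  \<open>h\<close> to be \<open>\<rho>\<close> on an initial interval shows that \<open>zf\<close>
  is a primitive of \<open>\<rho>\<close> times the flux; taking \<open>\<rho>\<close> times a
  conjugate flux gives the energy identity \<open>green_inner\<close>.\<close>

lemma flux_duality:
 assumes f: "unit_rep f" and h: "h \<in> borel_measurable borel" "!!y. 0 < y ==> y < 1 ==> norm (h y) <= B"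
 shows "(LINT s|lborel. indicator {0<..<1} s *\<^sub>R (h s * flux (L2_of f) s))
  = (LINT y|lborel. f y * (prim h y - of_real (R y / R 1) * prim h 1))"
proof -
 define H where "H s = indicator {0<..<1} s *\<^sub>R h s" for s
 define c where "c = (LINT y|lborel. (R y / R 1) *\<^sub>R f y)"
 have Hi: "integrable lborel H" unfolding H_def by (rule indicator_integrable_bounded[OF h])
 have fi: "integrable lborel f" and [measurable]: "f \<in> borel_measurable borel" "h \<in> borel_measurable borel"
  using f h by (auto simp: unit_rep_def)
 have [measurable]: "H \<in> borel_measurable borel" unfolding H_def by measurable
 have pH: "(LINT s|lborel. indicator {..<y} s *\<^sub>R H s) = prim h y" if "y <= 1" for y
  unfolding prim_def H_def using that by (intro Bochner_Integration.integral_cong) (auto simp: indicator_def)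
 have fpH: "f y * (LINT s|lborel. indicator {..<y} s *\<^sub>R H s) = f y * prim h y" for y
  using f pH[of y] by (cases "y \<in> {0<..<1}") (auto simp: unit_rep_def)
 have bdH: "norm (LINT s|lborel. indicator A s *\<^sub>R H s) <= (LINT s|lborel. norm (H s))" if "A \<in> sets borel" for A
 proof -
  have "norm (LINT s|lborel. indicator A s *\<^sub>R H s) <= (LINT s|lborel. norm (indicator A s *\<^sub>R H s))"
   by (rule integral_norm_bound)
  also have "... <= (LINT s|lborel. norm (H s))"
   using Hi that by (intro integral_mono integrable_norm integrable_mult_indicator) (auto simp: indicator_def)
  finally show ?thesis .
 qed
 have "(LINT s|lborel. indicator {0<..<1} s *\<^sub>R (h s * flux (L2_of f) s))
   = (LINT s|lborel. H s * (LINT y|lborel. indicator {s<..} y *\<^sub>R f y) - H s * c)"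
  by (intro integral_eqI)
    (simp add: H_def flux_unit_rep[OF f] c_def algebra_simps scaleR_conv_of_real)
 also have "... = (LINT s|lborel. H s * (LINT y|lborel. indicator {s<..} y *\<^sub>R f y)) - (LINT s|lborel. H s * c)"
 proof (rule Bochner_Integration.integral_diff)
  have m: "(%s. LINT y|lborel. indicator {s<..} y *\<^sub>R f y) \<in> borel_measurable borel"
  proof -
   have "(%s. flux (L2_of f) s + c) \<in> borel_measurable borel" by measurable
   then show ?thesis by (simp add: flux_unit_rep[OF f] c_def)
  qed
  show "integrable lborel (%s. H s * (LINT y|lborel. indicator {s<..} y *\<^sub>R f y))"
  proof (rule Bochner_Integration.integrable_bound)
   show "integrable lborel (%s. norm (H s) * (LINT y|lborel. norm (f y)))" using Hi by simp
   show "(%s. H s * (LINT y|lborel. indicator {s<..} y *\<^sub>R f y)) \<in> borel_measurable lborel" using m by measurable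
   show "AE s in lborel. norm (H s * (LINT y|lborel. indicator {s<..} y *\<^sub>R f y)) <= norm (norm (H s) * (LINT y|lborel. norm (f y)))"
   proof (intro always_eventually allI)
    fix s
    have "norm (LINT y|lborel. indicator {s<..} y *\<^sub>R f y) <= (LINT y|lborel. norm (indicator {s<..} y *\<^sub>R f y))"
     by (rule integral_norm_bound)
    also have "... <= (LINT y|lborel. norm (f y))"
     using fi by (intro integral_mono integrable_norm integrable_mult_indicator) (auto simp: indicator_def)
    finally show "norm (H s * (LINT y|lborel. indicator {s<..} y *\<^sub>R f y)) <= norm (norm (H s) * (LINT y|lborel. norm (f y)))"
     by (simp add: norm_mult mult_left_mono)
   qed
  qed
 qed (use Hi in simp)
 also have "(LINT s|lborel. H s * (LINT y|lborel. indicator {s<..} y *\<^sub>R f y))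
   = (LINT y|lborel. f y * (LINT s|lborel. indicator {..<y} s *\<^sub>R H s))"
  by (rule fubini_triangle[OF fi Hi])
 also have "... = (LINT y|lborel. f y * prim h y)"
  by (intro integral_eqI fpH)
 also have "(LINT s|lborel. H s * c) = c * prim h 1"
  using Hi by (simp add: prim_def H_def[symmetric] mult.commute)
 also have "c * prim h 1 = (LINT y|lborel. f y * (of_real (R y / R 1) * prim h 1))"
  unfolding c_def by (subst integral_mult_left_zero[symmetric]) (simp add: scaleR_conv_of_real mult_ac)
 also have "(LINT y|lborel. f y * prim h y) - (LINT y|lborel. f y * (of_real (R y / R 1) * prim h 1))
   = (LINT y|lborel. f y * (prim h y - of_real (R y / R 1) * prim h 1))"
 proof (subst Bochner_Integration.integral_diff[symmetric])
  have pm: "(%y. LINT s|lborel. indicator {..<y} s *\<^sub>R H s) \<in> borel_measurable borel"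
  proof -
   have "(%y. LINT s|lborel. (if s < y then 1 else 0) *\<^sub>R H s) \<in> borel_measurable borel"
    using lborel.borel_measurable_lebesgue_integral[of "%y s. (if s < y then 1 else 0) *\<^sub>R H s" borel] by simp
   moreover have "(%y. LINT s|lborel. (if s < y then 1 else 0) *\<^sub>R H s) = (%y. LINT s|lborel. indicator {..<y} s *\<^sub>R H s)"
    by (intro ext Bochner_Integration.integral_cong) (auto simp: indicator_def)
   ultimately show ?thesis by simp
  qed
  have "integrable lborel (%y. f y * (LINT s|lborel. indicator {..<y} s *\<^sub>R H s))"
  proof (rule Bochner_Integration.integrable_bound)
   show "integrable lborel (%y. norm (f y) * (LINT s|lborel. norm (H s)))" using fi by simp
   show "AE y in lborel. norm (f y * (LINT s|lborel. indicator {..<y} s *\<^sub>R H s)) <= norm (norm (f y) * (LINT s|lborel. norm (H s)))"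
    using bdH by (intro always_eventually allI) (auto simp: norm_mult intro!: mult_left_mono)
  qed (use pm in measurable)
  moreover have "(%y. f y * (LINT s|lborel. indicator {..<y} s *\<^sub>R H s)) = (%y. f y * prim h y)"
   using fpH by (simp only:)
  ultimately show "integrable lborel (%y. f y * prim h y)" by simp
  have "integrable lborel (%y. ((R y / R 1) *\<^sub>R f y) * prim h 1)"
   by (intro integrable_mult_left pair_integrable[OF f, where B=1]) (use abs_ratio in \<open>simp_all del: abs_divide\<close>)
  then show "integrable lborel (%y. f y * (of_real (R y / R 1) * prim h 1))"
   by (simp add: scaleR_conv_of_real mult_ac)
 qed (simp add: right_diff_distrib)
 finally show ?thesis .
qed

lemma zf_eq_prim:
 assumes x: "x <= 1"
 shows "zf F x = prim (%s. of_real (\<rho> s) * flux F s) x"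
proof (cases "0 < x")
 case True
 obtain f where f: "unit_rep f" "F = L2_of f" by (rule L2_rep_cases)
 define h :: "real => complex" where "h s = indicator {0<..<x} s *\<^sub>R of_real (\<rho> s)" for s
 have h: "h \<in> borel_measurable borel" unfolding h_def by measurable
 have hb: "norm (h s) <= K" for s using rho_pos[of s] rho_le[of s] K1 by (auto simp: h_def indicator_def)
 have ph: "prim h y = of_real (min (R x) (R y))" for y
 proof -
  have "prim h y = (LINT u|lborel. of_real (indicator {0<..<min x y} u *\<^sub>R \<rho> u))"
   unfolding prim_def h_def by (intro integral_eqI) (auto simp: indicator_def)
  also have "... = of_real (R (min x y))" unfolding R_def prim_def by (rule integral_complex_of_real)
  also have "R (min x y) = min (R x) (R y)" using R_mono[of x y] R_mono[of y x] by (auto simp: min_def)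
  finally show ?thesis .
 qed
 have "prim (%s. of_real (\<rho> s) * flux F s) x = (LINT s|lborel. indicator {0<..<1} s *\<^sub>R (h s * flux (L2_of f) s))"
  unfolding prim_def h_def f(2) using x
  by (intro integral_eqI) (auto simp: indicator_def scaleR_conv_of_real)
 also have "... = (LINT y|lborel. f y * (prim h y - of_real (R y / R 1) * prim h 1))"
  by (rule flux_duality[OF f(1) h]) (rule hb)
 also have "... = (LINT y|lborel. kern x y *\<^sub>R f y)"
  using R_mono[OF x]
  by (intro integral_eqI) (simp add: ph kern_def scaleR_conv_of_real mult.commute min_absorb1)
 also have "... = zf F x" unfolding zf_def f(2) by (subst pair_unit_rep[OF f(1)]) auto
 finally show ?thesis by simp
next
 case False
 then have "x <= 0" by simp
 obtain f where f: "unit_rep f" "F = L2_of f" by (rule L2_rep_cases)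
 have "zf F x = (LINT y|lborel. kern x y *\<^sub>R f y)" unfolding zf_def f(2) by (subst pair_unit_rep[OF f(1)]) auto
 also have "... = 0" using \<open>x <= 0\<close> R_nonneg by (simp add: kern_def)
 finally show ?thesis using \<open>x <= 0\<close> by simp
qed

lemma zf_1: "zf F 1 = 0"
proof -
 obtain f where f: "unit_rep f" "F = L2_of f" by (rule L2_rep_cases)
 have "pair F (kern 1) = (LINT y|lborel. kern 1 y *\<^sub>R f y)" unfolding f(2) by (subst pair_unit_rep[OF f(1)]) auto
 also have "(%y. kern 1 y *\<^sub>R f y) = (%y. 0)"
 proof
  show "kern 1 y *\<^sub>R f y = 0" for y
   using f kern_1(1)[of y] by (cases "y <= 1") (auto simp: unit_rep_def)
 qed
 finally show ?thesis by (simp add: zf_def)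
qed

text \<open>The energy form: symmetry and nonnegativity of \<open>green\<close> can be read off the
  right-hand side.\<close>

lemma green_inner:
 "green F \<bullet> G = (LINT s|lborel. indicator {0<..<1} s * (\<rho> s * (flux F s \<bullet> flux G s)))"
proof -
 obtain g where g: "unit_rep g" "G = L2_of g" by (rule L2_rep_cases)
 have [measurable]: "g \<in> borel_measurable borel" using g by (simp add: unit_rep_def)
 define h where "h s = of_real (\<rho> s) * cnj (flux F s)" for s
 have h [measurable]: "h \<in> borel_measurable borel" unfolding h_def by measurable
 have hb: "norm (h s) <= K * (2 * norm F)" for s
  unfolding h_def norm_mult using flux_bound[of F s] rho_pos[of s] rho_le[of s] K1
  by (intro mult_mono) auto
 have ph: "prim h y = cnj (zf F y)" if "y <= 1" for y
 proof -
  have "prim h y = (LINT u|lborel. cnj (indicator {0<..<y} u *\<^sub>R (of_real (\<rho> u) * flux F u)))"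
   unfolding prim_def h_def by simp
  also have "... = cnj (zf F y)" unfolding zf_eq_prim[OF that] prim_def by (rule integral_cnj_zero)
  finally show ?thesis .
 qed
 have "green F \<bullet> G = (LINT x|leb01. zf F x \<bullet> g x)"
  using g by (simp add: green_def inner_L2_of zf_L2 unit_rep_def)
 also have "... = (LINT x|lborel. zf F x \<bullet> g x)"
  using g by (intro unit_rep_integral) (auto simp: unit_rep_def)
 also have "... = (LINT x|lborel. Re (g x * cnj (zf F x)))"
  by (simp add: inner_complex_def mult.commute)
 also have "... = Re (LINT x|lborel. g x * cnj (zf F x))"
 proof (rule integral_Re)
  show "integrable lborel (%x. g x * cnj (zf F x))"
  proof (rule Bochner_Integration.integrable_bound)
   show "integrable lborel (%x. (2 * K * norm F) *\<^sub>R g x)" using g by (simp add: unit_rep_def)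
   show "AE x in lborel. norm (g x * cnj (zf F x)) <= norm ((2 * K * norm F) *\<^sub>R g x)"
   proof (intro always_eventually allI)
    fix x
    have "norm (g x) * norm (zf F x) <= norm (g x) * (2 * K * norm F)"
     using g zf_bound[of x F] by (cases "x \<in> {0<..<1}") (auto simp: unit_rep_def intro!: mult_left_mono)
    then show "norm (g x * cnj (zf F x)) <= norm ((2 * K * norm F) *\<^sub>R g x)"
     using K1 by (simp add: norm_mult mult_ac)
   qed
  qed measurable
 qed
 also have "(LINT x|lborel. g x * cnj (zf F x)) = (LINT y|lborel. g y * (prim h y - of_real (R y / R 1) * prim h 1))"
 proof (rule Bochner_Integration.integral_cong[OF refl])
  fix y
  show "g y * cnj (zf F y) = g y * (prim h y - of_real (R y / R 1) * prim h 1)"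
   using g zf_1[of F] by (cases "y \<in> {0<..<1}") (auto simp: unit_rep_def ph)
 qed
 also have "... = (LINT s|lborel. indicator {0<..<1} s *\<^sub>R (h s * flux G s))"
  unfolding g(2) by (rule flux_duality[OF g(1) h, symmetric]) (rule hb)
 also have "Re ... = (LINT s|lborel. Re (indicator {0<..<1} s *\<^sub>R (h s * flux G s)))"
 proof (rule integral_Re[symmetric], rule indicator_integrable_bounded)
  show "norm (h y * flux G y) <= K * (2 * norm F) * (2 * norm G)" for y
   unfolding norm_mult using hb flux_bound K1 by (intro mult_mono) auto
 qed measurable
 also have "... = (LINT s|lborel. indicator {0<..<1} s * (\<rho> s * (flux F s \<bullet> flux G s)))"
  by (intro integral_eqI) (simp add: h_def inner_complex_def algebra_simps)
 finally show ?thesis .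
qed

lemma flux_diff:
 assumes f: "unit_rep f" and x: "0 <= x" "x <= 1"
 shows "flux (L2_of f) x = flux (L2_of f) 0 - prim f x"
proof -
 have i: "integrable lborel (%y. indicator A y *\<^sub>R f y)" if "A \<in> sets borel" for A
  using f that by (intro integrable_mult_indicator) (auto simp: unit_rep_def)
 have "(LINT y|lborel. indicator {0<..} y *\<^sub>R f y) - (LINT y|lborel. indicator {x<..} y *\<^sub>R f y)
   = (LINT y|lborel. indicator {0<..} y *\<^sub>R f y - indicator {x<..} y *\<^sub>R f y)"
  by (rule Bochner_Integration.integral_diff[symmetric]) (auto intro!: i)
 also have "... = prim f x"
  unfolding prim_def
 proof (rule integral_cong_AE)
  have "AE u in lborel. u ~= x" by (rule AE_lborel_singleton)
  then show "AE u in lborel. indicator {0<..} u *\<^sub>R f u - indicator {x<..} u *\<^sub>R f u = indicator {0<..<x} u *\<^sub>R f u"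
   by eventually_elim (use x in \<open>auto simp: indicator_def\<close>)
 qed (use i[of "{0<..}"] i[of "{x<..}"] i[of "{0<..<x}"] in auto)
 finally show ?thesis by (simp add: flux_unit_rep[OF f] algebra_simps)
qed

text \<open>By the energy form the flux vanishes almost everywhere. The primitive of a
  representative is then constant on a dense set, by continuity everywhere, and so the
  representative is zero.\<close>

lemma green_inj:
 assumes "green F = 0"
 shows "F = 0"
proof -
 obtain f where f: "unit_rep f" "F = L2_of f" by (rule L2_rep_cases)
 have "0 = green F \<bullet> F" using assms by simp
 then have "(LINT s|lborel. indicator {0<..<1} s * (\<rho> s * (flux F s \<bullet> flux F s))) = 0"
  by (simp add: green_inner)
 moreover have "integrable lborel (%s. indicator {0<..<1} s *\<^sub>R (\<rho> s * (flux F s \<bullet> flux F s)))"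
 proof (rule indicator_integrable_bounded)
  fix s
  have "\<rho> s * (norm (flux F s))\<^sup>2 <= K * (2 * norm F)\<^sup>2"
   using rho_pos[of s] rho_le[of s] flux_bound[of F s] by (intro mult_mono power_mono) auto
  then show "norm (\<rho> s * (flux F s \<bullet> flux F s)) <= K * (2 * norm F)\<^sup>2"
   using rho_pos[of s] by (simp add: dot_square_norm abs_mult)
 qed measurable
 ultimately have "AE s in lborel. indicator {0<..<1} s * (\<rho> s * (flux F s \<bullet> flux F s)) = 0"
  using rho_nonneg by (subst integral_nonneg_eq_0_iff_AE[symmetric]) auto
 then have ae: "AE s in lborel. s \<in> {0<..<1} --> flux F s = 0"
 proof eventually_elim
  case (elim s)
  then show ?case using rho_pos[of s] by (auto simp: indicator_def)
 qed
 have dense: "\<exists>u. a < u \<and> u < b \<and> prim f u = flux F 0" if "0 <= a" "a < b" "b <= 1" for a b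
 proof (rule ccontr)
  assume n: "\<not> ?thesis"
  from ae have "AE u in lborel. u \<notin> {a<..<b}"
  proof eventually_elim
   case (elim u)
   show ?case
   proof
    assume u: "u \<in> {a<..<b}"
    then have "flux F u = 0" "0 <= u" "u <= 1" using elim that by auto
    then have "prim f u = flux F 0" using flux_diff[OF f(1), of u] by (simp add: f(2))
    then show False using n u by auto
   qed
  qed
  then have "emeasure lborel {a<..<b} = 0"
   by (subst (asm) AE_iff_measurable[of "{a<..<b}"]) auto
  then show False using that by simp
 qed
 have tend: "(%n. prim f (u n)) \<longlonglongrightarrow> prim f x" if u: "u \<longlonglongrightarrow> x" for u x
  unfolding prim_def
 proof (rule integral_dominated_convergence[where w="%y. norm (f y)"])
  have [measurable]: "f \<in> borel_measurable borel" using f by (simp add: unit_rep_def)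
  show "(%y. indicator {0<..<x} y *\<^sub>R f y) \<in> borel_measurable lborel"
   "(%y. indicator {0<..<u n} y *\<^sub>R f y) \<in> borel_measurable lborel" for n by measurable
  have "AE y in lborel. y ~= x" by (rule AE_lborel_singleton)
  then show "AE y in lborel. (%n. indicator {0<..<u n} y *\<^sub>R f y) \<longlonglongrightarrow> indicator {0<..<x} y *\<^sub>R f y"
  proof eventually_elim
   case (elim y)
   have "\<forall>\<^sub>F n in sequentially. (y < u n) = (y < x)"
    using order_tendstoD(1)[OF u, of y] order_tendstoD(2)[OF u, of y] elim
    by (cases "y < x") (auto elim!: eventually_mono)
   then have "\<forall>\<^sub>F n in sequentially. indicator {0<..<u n} y *\<^sub>R f y = indicator {0<..<x} y *\<^sub>R f y"
    by eventually_elim (auto simp: indicator_def)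
   then show ?case by (rule tendsto_eventually)
  qed
  show "AE y in lborel. norm (indicator {0<..<u n} y *\<^sub>R f y) <= norm (f y)" for n
   by (intro always_eventually allI) (auto simp: indicator_def)
 qed (use f in \<open>simp add: unit_rep_def\<close>)
 have const: "prim f x = flux F 0" if x: "0 <= x" "x < 1" for x
 proof -
  have "\<exists>u. x < u \<and> u < min 1 (x + 1 / real (Suc n)) \<and> prim f u = flux F 0" for n
   using x by (intro dense) auto
  then obtain u where u: "!!n. x < u n" "!!n. u n < min 1 (x + 1 / real (Suc n))" "!!n. prim f (u n) = flux F 0"
   by metis
  have "u \<longlonglongrightarrow> x"
  proof (rule tendsto_sandwich[of "%_. x" _ _ "%n. x + 1 / real (Suc n)"])
   show "(%n. x + 1 / real (Suc n)) \<longlonglongrightarrow> x" by real_asymp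
  qed (use u in \<open>auto intro!: always_eventually simp: less_eq_real_def\<close>)
  from tend[OF this] show ?thesis unfolding u(3) by (simp add: LIMSEQ_const_iff)
 qed
 then have c0: "flux F 0 = 0" using const[of 0] by simp
 have p0: "prim f x = 0" if "x <= 1" for x
 proof (cases "x = 1")
  case True
  have "(%n. 1 - 1 / real (Suc n)) \<longlonglongrightarrow> x" unfolding True by real_asymp
  from tend[OF this] have "(%n. prim f (1 - 1 / real (Suc n))) \<longlonglongrightarrow> prim f x" .
  moreover have "prim f (1 - 1 / real (Suc n)) = 0" for n using const[of "1 - 1 / real (Suc n)"] c0 by simp
  ultimately show ?thesis by (simp add: LIMSEQ_const_iff)
 next
  case False
  then show ?thesis using const[of x] c0 that by (cases "0 <= x") auto
 qed
 have "AE y in lborel. f y = 0"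
 proof (rule AE_zero_if_half_line_integrals_zero)
  show fi: "integrable lborel f" using f by (simp add: unit_rep_def)
  have e: "(LINT y|lborel. indicator {..<a} y *\<^sub>R f y) = prim f (min a 1)" for a
   unfolding prim_def using f
   by (intro integral_eqI) (auto simp: indicator_def unit_rep_def)
  then show "(LINT y|lborel. indicator {..<a} y *\<^sub>R f y) = 0" for a by (simp add: p0)
  have "(LINT y|lborel. f y) = prim f 1"
   unfolding prim_def using f
   by (intro integral_eqI) (auto simp: indicator_def unit_rep_def)
  then show "(LINT y|lborel. f y) = 0" by (simp add: p0)
 qed
 then have "AE y in leb01. f y = 0" by (subst AE_lebesgue_on_iff) auto
 then show ?thesis using f L2_of_eq_iff[of f "%x. 0"] by (simp add: unit_rep_def L2_fun_zero L2_of_zero)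
qed

end

text \<open>The bound \<open>2 * K\<close> serves all coefficients with the same \<open>K\<close>,
  so their calculi share one spectral interval and \<open>fc_perturb\<close> can compare
  them.\<close>

sublocale coef \<subseteq> pos_inj green "2 * K"
proof (intro pos_inj.intro pos_op.intro pos_inj_axioms.intro)
 show "0 < 2 * K" using K1 by simp
 show "linear green" by (rule green_linear)
 show "green F \<bullet> G = F \<bullet> green G" for F G
  using green_inner[of F G] green_inner[of G F] by (simp add: inner_commute)
 show "0 <= green F \<bullet> F" for F
  unfolding green_inner using rho_nonneg by (intro integral_nonneg_AE always_eventually allI) simp
 show "norm (green F) <= 2 * K * norm F" for F by (rule green_norm)
qed (rule green_inj)

context coef begin

text \<open>The equation determines the flux up to a constant \<open>c\<close>. Integrating once
  more adds \<open>R x * c\<close> to the solution, and the boundary condition at 1 forces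
  \<open>c = 0\<close>. The minus signs arise because \<open>green\<close> inverts the negative
  operator.\<close>

lemma primitive_solution:
 assumes f: "unit_rep f"
  and v: "!!x. 0 <= x ==> x <= 1 ==> v x = v0 + prim f x"
  and z: "!!x. 0 <= x ==> x <= 1 ==> z x = prim (%s. of_real (\<rho> s) * v s) x" and z1: "z 1 = 0"
  and x: "0 <= x" "x <= 1"
 shows "v x = - flux (L2_of f) x" "z x = - zf (L2_of f) x"
proof -
 define c where "c = v0 + flux (L2_of f) 0"
 have v': "v x = c - flux (L2_of f) x" if "0 <= x" "x <= 1" for x
  using v[OF that] flux_diff[OF f that] by (simp add: c_def)
 have z': "z x = of_real (R x) * c - zf (L2_of f) x" if x: "0 <= x" "x <= 1" for x
 proof -
  have i1: "integrable lborel (%s. indicator {0<..<x} s *\<^sub>R (of_real (\<rho> s) * c))"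
   using rho_le rho_pos
   by (intro indicator_integrable_bounded[where B="K * norm c"]) (auto simp: norm_mult abs_of_pos intro!: mult_right_mono)
  have i2: "integrable lborel (%s. indicator {0<..<x} s *\<^sub>R (of_real (\<rho> s) * flux (L2_of f) s))"
  proof (intro indicator_integrable_bounded[where B="K * (2 * norm (L2_of f))"])
   fix s show "norm (of_real (\<rho> s) * flux (L2_of f) s) <= K * (2 * norm (L2_of f))"
    unfolding norm_mult using rho_pos[of s] rho_le[of s] flux_bound K1 by (intro mult_mono) auto
  qed measurable
  have "z x = prim (%s. of_real (\<rho> s) * c - of_real (\<rho> s) * flux (L2_of f) s) x"
   unfolding z[OF x] using x by (intro prim_cong) (simp add: v' right_diff_distrib)
  also have "... = prim (%s. of_real (\<rho> s) * c) x - prim (%s. of_real (\<rho> s) * flux (L2_of f) s) x"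
   unfolding prim_def scaleR_diff_right by (rule Bochner_Integration.integral_diff[OF i1 i2])
  also have "prim (%s. of_real (\<rho> s) * c) x = (LINT s|lborel. of_real (indicator {0<..<x} s *\<^sub>R \<rho> s) * c)"
   unfolding prim_def by (intro integral_eqI) (simp add: scaleR_conv_of_real)
  also have "... = (LINT s|lborel. of_real (indicator {0<..<x} s *\<^sub>R \<rho> s)) * c"
   by (rule integral_mult_left_zero)
  also have "... = of_real (R x) * c" unfolding R_def prim_def by (simp only: integral_complex_of_real)
  also have "prim (%s. of_real (\<rho> s) * flux (L2_of f) s) x = zf (L2_of f) x" by (rule zf_eq_prim[OF x(2), symmetric])
  finally show ?thesis .
 qed
 have "c = 0" using z'[of 1] z1 zf_1 R_1 by simp
 then show "v x = - flux (L2_of f) x" "z x = - zf (L2_of f) x" using v' z' x by auto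
qed

text \<open>Together with \<open>generator_sg\<close> this identifies \<open>sg\<close> as the
  semigroup whose generator is the operator of the statement.\<close>

lemma dirichlet_op_iff:
 assumes \<alpha>: "AE x in leb01. \<alpha> x = 1 / \<rho> x"
 shows "dirichlet_op \<alpha> Z W \<longleftrightarrow> Z = - green W"
proof
 assume "dirichlet_op \<alpha> Z W"
 then obtain z z' v v' where H: "H1_deriv z z'" "z 0 = 0" "z 1 = 0" "H1_deriv v v'"
   "AE x in leb01. v x = of_real (\<alpha> x) * z' x" "Z = L2_of z" "W = L2_of v'"
  unfolding dirichlet_op_def by blast
 obtain f where f: "unit_rep f" "W = L2_of f" by (rule L2_rep_cases)
 have fm [measurable]: "f \<in> borel_measurable borel" using f by (simp add: unit_rep_def)
 have aef: "AE x in leb01. v' x = f x"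
  using f H(4,7) L2_of_eq_iff[of v' f] by (simp add: unit_rep_def H1_deriv_def)
 have sub: "(LINT y|lebesgue_on {0<..<x}. p y) = (LINT y|lebesgue_on {0<..<x}. q y)"
  if ae: "AE x in leb01. p x = q x" and x: "x <= 1" and m: "p \<in> borel_measurable leb01" "q \<in> borel_measurable leb01"
  for p q :: "real => complex" and x
 proof -
  have le: "lebesgue_on {0<..<x} = restrict_space leb01 {0<..<x}"
   using x by (subst restrict_restrict_space) (auto intro!: arg_cong2[where f=restrict_space])
  show ?thesis
  proof (rule integral_cong_AE)
   show "p \<in> borel_measurable (lebesgue_on {0<..<x})" "q \<in> borel_measurable (lebesgue_on {0<..<x})"
    unfolding le using m by (auto intro: measurable_restrict_space1)
   show "AE x in lebesgue_on {0<..<x}. p x = q x"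
    using ae x by (simp add: AE_lebesgue_on_iff) (auto elim: eventually_mono)
  qed
 qed
 have v: "v x = v 0 + prim f x" if "0 <= x" "x <= 1" for x
 proof -
  have "v x = v 0 + (LINT y|lebesgue_on {0<..<x}. v' y)" using H(4) that unfolding H1_deriv_def by (meson atLeastAtMost_iff)
  also have "(LINT y|lebesgue_on {0<..<x}. v' y) = (LINT y|lebesgue_on {0<..<x}. f y)"
   using that aef H(4) f by (intro sub) (auto simp: H1_deriv_def L2_fun_def unit_rep_def)
  finally show ?thesis by (simp add: prim_eq_lebesgue_on)
 qed
 \<comment> \<open>\<open>v\<close> is arbitrary outside the unit interval; \<open>V\<close> agrees
   with it inside and is Borel on the line.\<close>
 define V where "V x = v 0 + (flux W 0 - flux W x)" for x
 have vV: "v x = V x" if "0 <= x" "x <= 1" for x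
  using v[OF that] flux_diff[OF f(1) that] by (simp add: V_def f(2))
 have Vm [measurable]: "V \<in> borel_measurable borel" unfolding V_def by measurable
 have aez: "AE x in leb01. z' x = of_real (\<rho> x) * V x"
  using \<alpha> H(5) AE_space
 proof eventually_elim
  case (elim x)
  then have "0 < x" "x < 1" by (auto simp: space_restrict_space)
  then show ?case using elim vV[of x] rho_pos[of x] by simp
 qed
 have z: "z x = prim (%s. of_real (\<rho> s) * V s) x" if "0 <= x" "x <= 1" for x
 proof -
  have "z x = z 0 + (LINT y|lebesgue_on {0<..<x}. z' y)" using H(1) that unfolding H1_deriv_def by (meson atLeastAtMost_iff)
  also have "(LINT y|lebesgue_on {0<..<x}. z' y) = (LINT y|lebesgue_on {0<..<x}. of_real (\<rho> y) * V y)"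
  proof (rule sub[OF aez that(2)])
   show "z' \<in> borel_measurable leb01" using H(1) by (simp add: H1_deriv_def L2_fun_def)
   show "(%y. of_real (\<rho> y) * V y) \<in> borel_measurable leb01" by (intro borel_imp_leb01) measurable
  qed
  finally show ?thesis using H(2) by (simp add: prim_eq_lebesgue_on)
 qed
 have zz: "z x = - zf W x" if "0 <= x" "x <= 1" for x
  unfolding f(2)
 proof (rule primitive_solution(2)[OF f(1) _ z H(3) that])
  show "V x = v 0 + prim f x" if "0 <= x" "x <= 1" for x
   using v[OF that] vV[OF that] by simp
 qed
 have m: "(%x. - zf W x) \<in> L2_fun" by (intro L2_fun_uminus zf_L2)
 have "z \<in> borel_measurable leb01 \<longleftrightarrow> (%x. - zf W x) \<in> borel_measurable leb01"
  by (rule measurable_cong) (auto simp: space_restrict_space zz)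
 then have zL: "z \<in> L2_fun"
  using m by (intro L2_fun_AE_cong[OF m]) (auto simp: L2_fun_def zz space_restrict_space intro!: AE_I2)
 have "Z = L2_of (%x. - zf W x)"
  unfolding H(6) using zL m by (subst L2_of_eq_iff) (auto simp: zz space_restrict_space intro!: AE_I2)
 also have "... = - green W"
  using L2_of_scaleR[OF zf_L2[of W], of "-1"] by (simp add: green_def)
 finally show "Z = - green W" .
next
 assume Z: "Z = - green W"
 obtain f where f: "unit_rep f" "W = L2_of f" by (rule L2_rep_cases)
 let ?z = "%x. - zf W x" and ?z' = "%x. - (of_real (\<rho> x) * flux W x)" and ?v = "%x. - flux W x"
 have z'b: "norm (of_real (\<rho> x) * flux W x) <= K * (2 * norm W)" for x
  unfolding norm_mult using rho_pos[of x] rho_le[of x] flux_bound K1 by (intro mult_mono) auto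
 have L: "?z' \<in> L2_fun"
  using z'b by (intro norm_L2_of_le(1)[where B="K * (2 * norm W)"] borel_imp_leb01) (use K1 in auto)
 have "H1_deriv ?z ?z'"
  unfolding H1_deriv_def
 proof (intro conjI ballI L)
  fix x :: real assume x: "x \<in> {0..1}"
  have "(LINT y|lebesgue_on {0<..<x}. ?z' y) = prim ?z' x" by (rule prim_eq_lebesgue_on) measurable
  also have "... = - prim (%x. of_real (\<rho> x) * flux W x) x" by (simp add: prim_def)
  also have "... = - zf W x" using x by (simp add: zf_eq_prim)
  finally show "- zf W x = - zf W 0 + (LINT y|lebesgue_on {0<..<x}. - (of_real (\<rho> y) * flux W y))"
   by (simp add: zf_eq_prim)
 qed
 moreover have "H1_deriv ?v f"
  unfolding H1_deriv_def
 proof (intro conjI ballI)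
  show "f \<in> L2_fun" using f by (simp add: unit_rep_def)
  fix x :: real assume x: "x \<in> {0..1}"
  have "(LINT y|lebesgue_on {0<..<x}. f y) = prim f x" using f by (intro prim_eq_lebesgue_on) (simp add: unit_rep_def)
  then show "- flux W x = - flux W 0 + (LINT y|lebesgue_on {0<..<x}. f y)"
   using flux_diff[OF f(1), of x] x by (simp add: f(2))
 qed
 moreover have "AE x in leb01. ?v x = of_real (\<alpha> x) * ?z' x"
  using \<alpha>
 proof eventually_elim
  case (elim x)
  then show ?case using rho_nz[of x] by simp
 qed
 moreover have "Z = L2_of ?z"
  unfolding Z using L2_of_scaleR[OF zf_L2[of W], of "-1"] by (simp add: green_def)
 moreover have "?z 0 = 0" "?z 1 = 0" by (simp_all add: zf_eq_prim zf_1)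
 ultimately show "dirichlet_op \<alpha> Z W"
  unfolding dirichlet_op_def using f(2) by blast
qed

end

text \<open>The Green operator depends on the coefficient only through its primitive.\<close>

lemma green_perturb:
 assumes "coef K \<rho>" "coef K \<rho>'" and d: "!!x. 0 <= x ==> x <= 1 ==> \<bar>coef.R \<rho>' x - coef.R \<rho> x\<bar> <= \<delta>"
 shows "norm (coef.green \<rho>' F - coef.green \<rho> F) <= 4 * (1 + K * K) * \<delta> * norm F"
proof -
 interpret a: coef K \<rho> by fact
 interpret b: coef K \<rho>' by fact
 have K: "0 < K" "1 <= K" using a.K1 by auto
 have d0: "0 <= \<delta>" using d[of 0] by simp
 have kd: "\<bar>b.kern x y - a.kern x y\<bar> <= (2 + 2 * (K * K)) * \<delta>" if x: "0 < x" "x < 1" and y: "0 < y" "y < 1" for x y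
 proof -
  define q where "q = a.R y / a.R 1"
  define q' where "q' = b.R y / b.R 1"
  have q: "0 <= q" "q <= 1" using a.ratio[of y] y by (auto simp: q_def)
  have q': "0 <= q'" "q' <= 1" using b.ratio[of y] y by (auto simp: q'_def)
  have dx: "\<bar>b.R x - a.R x\<bar> <= \<delta>" and dy: "\<bar>b.R y - a.R y\<bar> <= \<delta>" and d1: "\<bar>b.R 1 - a.R 1\<bar> <= \<delta>"
   using d x y by auto
  have inv: "1 / b.R 1 <= K" using b.R_1 K by (simp add: field_simps)
  \<comment> \<open>Both quotients lie in \<open>[0,1]\<close>, so the changes of numerator and
    denominator each cost \<open>\<delta>\<close>, multiplied by
    \<open>1 / R 1 <= K\<close>.\<close>
  have "q' - q = ((b.R y - a.R y) - q * (b.R 1 - a.R 1)) * (1 / b.R 1)"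
   using a.R_1 b.R_1 by (simp add: q_def q'_def field_simps)
  also have "\<bar>...\<bar> <= (\<delta> + 1 * \<delta>) * K"
   unfolding abs_mult
  proof (intro mult_mono)
   have "\<bar>q * (b.R 1 - a.R 1)\<bar> <= 1 * \<delta>" unfolding abs_mult using q d1 by (intro mult_mono) auto
   then show "\<bar>b.R y - a.R y - q * (b.R 1 - a.R 1)\<bar> <= \<delta> + 1 * \<delta>"
    using dy abs_triangle_ineq4[of "b.R y - a.R y" "q * (b.R 1 - a.R 1)"] by linarith
  qed (use inv b.R_1 d0 K in auto)
  finally have qq: "\<bar>q' - q\<bar> <= 2 * K * \<delta>" by (simp add: mult_ac)
  have "b.kern x y - a.kern x y = (min (b.R x) (b.R y) - min (a.R x) (a.R y)) - ((b.R x - a.R x) * q' + a.R x * (q' - q))"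
   by (simp add: a.kern_def b.kern_def q_def[symmetric] q'_def[symmetric] algebra_simps)
  moreover have "\<bar>min (b.R x) (b.R y) - min (a.R x) (a.R y)\<bar> <= \<delta>" using dx dy by linarith
  moreover have "\<bar>(b.R x - a.R x) * q'\<bar> <= \<delta> * 1" unfolding abs_mult using dx q' by (intro mult_mono) auto
  moreover have "\<bar>a.R x * (q' - q)\<bar> <= K * (2 * K * \<delta>)"
   unfolding abs_mult using qq a.R_nonneg[of x] a.R_mono[of x 1] a.R_1 x K by (intro mult_mono) auto
  moreover have "\<bar>m - (p + r)\<bar> <= \<delta> + (\<delta> * 1 + E)" if "\<bar>m\<bar> <= \<delta>" "\<bar>p\<bar> <= \<delta> * 1" "\<bar>r\<bar> <= E" for m p r E :: real
   using that by linarith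
  ultimately have "\<bar>b.kern x y - a.kern x y\<bar> <= \<delta> + (\<delta> * 1 + K * (2 * K * \<delta>))" by (simp only:)
  then show ?thesis by (simp add: algebra_simps)
 qed
 have "b.green F - a.green F = L2_of (%x. b.zf F x - a.zf F x)"
  by (simp add: a.green_def b.green_def L2_of_diff a.zf_L2 b.zf_L2)
 also have "norm ... <= 2 * ((2 + 2 * (K * K)) * \<delta>) * norm F"
 proof (rule norm_L2_of_le)
  show "(%x. b.zf F x - a.zf F x) \<in> borel_measurable leb01" by (intro borel_imp_leb01) measurable
  show "0 <= 2 * ((2 + 2 * (K * K)) * \<delta>) * norm F" using d0 K by simp
  fix x :: real assume x: "x \<in> {0<..<1}"
  have "b.zf F x - a.zf F x = pair F (%y. b.kern x y - a.kern x y)"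
   unfolding a.zf_def b.zf_def using a.kern_bound[of x] b.kern_bound[of x] x by (intro pair_kernel_diff) auto
  also have "norm ... <= 2 * ((2 + 2 * (K * K)) * \<delta>) * norm F"
   using kd x d0 K by (intro pair_norm_le) auto
  finally show "norm (b.zf F x - a.zf F x) <= 2 * ((2 + 2 * (K * K)) * \<delta>) * norm F" .
 qed
 finally show ?thesis by (simp add: algebra_simps)
qed

section \<open>Duhamel's formula and the input map\<close>

text \<open>By separability every open set is a countable union of balls, so measurability of all
  distances is enough.\<close>

lemma L2_borel_measurableI:
 fixes X :: "'b => L2"
 assumes m: "!!G. (%s. norm (X s - G)) \<in> borel_measurable M"
 shows "X \<in> borel_measurable M"
proof (rule borel_measurableI)
 fix U :: "L2 set" assume U: "open U"
 obtain D :: "L2 set" where D: "countable D" "closure D = UNIV" using L2_separable by blast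
 define I where "I = {p \<in> D \<times> (UNIV :: nat set). ball (fst p) (1 / real (Suc (snd p))) \<subseteq> U}"
 have "countable (D \<times> (UNIV :: nat set))" using D by simp
 then have cI: "countable I" by (rule countable_subset[rotated]) (auto simp: I_def)
 have eq: "U = (\<Union>p\<in>I. ball (fst p) (1 / real (Suc (snd p))))"
 proof
  show "U \<subseteq> (\<Union>p\<in>I. ball (fst p) (1 / real (Suc (snd p))))"
  proof
   fix F assume "F \<in> U"
   then obtain e where e: "0 < e" "ball F e \<subseteq> U" using U by (meson open_contains_ball)
   obtain n where n: "1 / real (Suc n) < e / 2" using nat_approx_posE[of "e / 2"] e by auto
   have "F \<in> closure D" using D by simp
   then obtain G where G: "G \<in> D" "dist G F < 1 / real (Suc n)"
    unfolding closure_approachable by (meson divide_pos_pos of_nat_0_less_iff zero_less_Suc zero_less_one)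
   have "ball G (1 / real (Suc n)) \<subseteq> U"
   proof (rule order_trans[OF _ e(2)], rule subsetI)
    fix H assume "H \<in> ball G (1 / real (Suc n))"
    then show "H \<in> ball F e" using dist_triangle[of F H G] G n by (simp add: dist_commute)
   qed
   then have "(G, n) \<in> I" using G by (simp add: I_def)
   then show "F \<in> (\<Union>p\<in>I. ball (fst p) (1 / real (Suc (snd p))))" using G by force
  qed
 qed (auto simp: I_def)
 have "X -` ball G r \<inter> space M \<in> sets M" for G r
 proof -
  have [measurable]: "(%s. norm (X s - G)) \<in> borel_measurable M" by (rule m)
  have "{s \<in> space M. norm (X s - G) < r} \<in> sets M" by measurable
  moreover have "{s \<in> space M. norm (X s - G) < r} = X -` ball G r \<inter> space M"
   by (auto simp: dist_norm norm_minus_commute)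
  ultimately show ?thesis by simp
 qed
 then have "(\<Union>p\<in>I. X -` ball (fst p) (1 / real (Suc (snd p))) \<inter> space M) \<in> sets M"
  by (intro sets.countable_UN'[OF cI]) (simp add: image_subset_iff)
 moreover have "(\<Union>p\<in>I. X -` ball (fst p) (1 / real (Suc (snd p))) \<inter> space M) = X -` U \<inter> space M"
  by (subst eq) auto
 ultimately show "X -` U \<inter> space M \<in> sets M" by simp
qed

text \<open>Controls that are Borel on the whole plane and bounded everywhere. All constructions use
  such representatives, and \<open>nice_version\<close> supplies one for every member of
  \<open>control_ball\<close>.\<close>

definition nice :: "(real \<times> real => complex) => real => bool" where
 "nice u M \<longleftrightarrow> u \<in> borel_measurable borel \<and> (\<forall>q. norm (u q) <= M)"

lemma nice_nonneg: "nice u M ==> 0 <= M"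
 using order_trans[OF norm_ge_zero, of "u (0, 0)" M] by (simp add: nice_def)

lemma nice_meas [measurable (raw)]:
 assumes "nice u M" "f \<in> borel_measurable N" "g \<in> borel_measurable N"
 shows "(%x. u (f x, g x)) \<in> borel_measurable N"
 using assms unfolding nice_def borel_prod[symmetric] by (intro measurable_compose[of _ N _ u]) auto

lemma control_slice:
 assumes u: "nice u M" and J: "J \<in> sets borel"
 shows "(%x. indicator J x * u (s, x)) \<in> borel_measurable borel" "(%x. indicator J x * u (s, x)) \<in> L2_fun"
  "norm (control_input J u s) <= M"
proof -
 show m: "(%x. indicator J x * u (s, x)) \<in> borel_measurable borel"
  using J nice_meas[OF u, of "%x. s" borel "%x. x"] by measurable
 have b: "norm (indicator J x * u (s, x)) <= M" for x
  using u nice_nonneg[OF u] by (auto simp: nice_def indicator_def)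
 show "(%x. indicator J x * u (s, x)) \<in> L2_fun" "norm (control_input J u s) <= M"
  unfolding control_input_def using b nice_nonneg[OF u] by (auto intro!: norm_L2_of_le borel_imp_leb01 m)
qed

text \<open>The distance to a fixed vector is an integral depending on the parameter
  \<open>s\<close>, measurable by Fubini's theorem.\<close>

lemma control_input_measurable:
 assumes u: "nice u M" and J: "J \<in> sets borel"
 shows "control_input J u \<in> borel_measurable borel"
proof (rule L2_borel_measurableI)
 fix G :: L2
 obtain g where g: "unit_rep g" "G = L2_of g" by (rule L2_rep_cases)
 have [measurable]: "g \<in> borel_measurable borel" using g by (simp add: unit_rep_def)
 have [measurable]: "u \<in> borel_measurable (borel \<Otimes>\<^sub>M lborel)"
  using nice_meas[OF u, of fst "borel \<Otimes>\<^sub>M lborel" snd] by simp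
 have [measurable]: "(%p. g (snd p)) \<in> borel_measurable (borel \<Otimes>\<^sub>M lborel)"
  by (rule measurable_compose[OF measurable_snd]) simp
 have [measurable]: "J \<in> sets borel" by (rule J)
 have eq: "norm (control_input J u s - G) = sqrt (LINT x|lborel. indicator {0<..<1} x *\<^sub>R (norm (indicator J x * u (s, x) - g x))\<^sup>2)" for s
 proof -
  have d: "(%x. indicator J x * u (s, x) - g x) \<in> L2_fun"
   using g control_slice[OF u J] by (intro L2_fun_diff) (auto simp: unit_rep_def)
  have m: "(%x. (norm (indicator J x * u (s, x) - g x))\<^sup>2) \<in> borel_measurable borel"
   using control_slice(1)[OF u J, of s] by measurable
  have "control_input J u s - G = L2_of (%x. indicator J x * u (s, x) - g x)"
   using g control_slice[OF u J] by (simp add: control_input_def L2_of_diff unit_rep_def)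
  then show ?thesis using integral_lebesgue_on_borel[OF m, of "{0<..<1}"] by (simp add: norm_L2_of[OF d])
 qed
 have "(%s. LINT x|lborel. indicator {0<..<1} x *\<^sub>R (norm (indicator J x * u (s, x) - g x))\<^sup>2) \<in> borel_measurable borel"
  by (rule lborel.borel_measurable_lebesgue_integral) (simp add: split_beta', measurable)
 then show "(%s. norm (control_input J u s - G)) \<in> borel_measurable borel" unfolding eq by measurable
qed

lemma borel_measurable_lebesgue_on_AE:
 fixes f g :: "'a::euclidean_space => 'b::topological_space"
 assumes f: "f \<in> borel_measurable borel" and A: "A \<in> sets lebesgue" and ae: "AE x in lebesgue_on A. g x = f x"
 shows "g \<in> borel_measurable (lebesgue_on A)"
proof (rule borel_measurableI)
 fix U :: "'b set" assume U: "open U"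
 have "AE x in lebesgue. x \<in> A --> g x = f x" using ae A by (simp add: AE_restrict_space_iff)
 then obtain N where N: "N \<in> null_sets lebesgue" "!!x. x \<in> space lebesgue - N ==> x \<in> A --> g x = f x"
  by (rule AE_E3) blast
 have fU: "f -` U \<in> sets lebesgue" using measurable_sets[OF f borel_open[OF U]] by simp
 have sub: "A \<inter> N \<inter> g -` U \<in> sets lebesgue"
  using N(1) null_sets_completion_subset[of "A \<inter> N \<inter> g -` U" N lborel] by (auto simp: null_sets_def)
 have "g -` U \<inter> A = (f -` U \<inter> A - N) \<union> (A \<inter> N \<inter> g -` U)" using N(2) by auto
 also have "... \<in> sets lebesgue" using fU A N(1) sub by auto
 finally show "g -` U \<inter> space (lebesgue_on A) \<in> sets (lebesgue_on A)"
  using A by (auto simp: space_restrict_space sets_restrict_space_iff)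
qed

context coef begin

text \<open>The contribution of the source to the mild solution at time \<open>t\<close>. A control
  \<open>u\<close> steers \<open>z0\<close> to zero at time \<open>t\<close> exactly when
  \<open>duh (control_input J u) t = - sg t z0\<close>.\<close>

definition duh :: "(real => L2) => real => L2" where
 "duh f t = (LINT s|lborel. indicator {0..t} s *\<^sub>R sg (t - s) (f s))"

lemma sg_measurable:
 assumes "f \<in> borel_measurable N" "g \<in> borel_measurable N"
 shows "(%s. sg (f s) (g s)) \<in> borel_measurable N"
 using assms sg_jointly_continuous by (rule borel_measurable_continuous_Pair)

lemma duh_integrable:
 assumes f: "f \<in> borel_measurable borel" and b: "!!s. 0 <= s ==> s <= t ==> norm (f s) <= M"
 shows "integrable lborel (%s. indicator {0..t} s *\<^sub>R sg (t - s) (f s))"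
proof (cases "0 <= t")
 case True
 show ?thesis
 proof (rule Bochner_Integration.integrable_bound)
  show "integrable lborel (%s. M * indicator {0..t} s)" using True by (intro integrable_mult_right integrable_real_indicator) auto
  have [measurable]: "(%s. sg (t - s) (f s)) \<in> borel_measurable borel" by (rule sg_measurable[OF _ f]) measurable
  show "(%s. indicator {0..t} s *\<^sub>R sg (t - s) (f s)) \<in> borel_measurable lborel" by measurable
  show "AE s in lborel. norm (indicator {0..t} s *\<^sub>R sg (t - s) (f s)) <= norm (M * indicator {0..t} s :: real)"
  proof (intro always_eventually allI)
   fix s
   show "norm (indicator {0..t} s *\<^sub>R sg (t - s) (f s)) <= norm (M * indicator {0..t} s :: real)"
    using sg_contraction[of "t - s" "f s"] b[of s] by (auto simp: indicator_def)
  qed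
 qed
qed simp

lemma duh_norm:
 assumes f: "f \<in> borel_measurable borel" and b: "!!s. 0 <= s ==> s <= t ==> norm (f s) <= M" and t: "0 <= t"
 shows "norm (duh f t) <= M * t"
proof -
 have "norm (duh f t) <= (LINT s|lborel. norm (indicator {0..t} s *\<^sub>R sg (t - s) (f s)))"
  unfolding duh_def by (rule integral_norm_bound)
 also have "... <= (LINT s|lborel. M * indicator {0..t} s)"
 proof (rule integral_mono)
  show "integrable lborel (%s. norm (indicator {0..t} s *\<^sub>R sg (t - s) (f s)))"
   by (intro integrable_norm duh_integrable[OF f b])
  show "integrable lborel (%s. M * indicator {0..t} s)" using t by (intro integrable_mult_right integrable_real_indicator) auto
  fix s show "norm (indicator {0..t} s *\<^sub>R sg (t - s) (f s)) <= M * indicator {0..t} s"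
   using sg_contraction[of "t - s" "f s"] b[of s] by (auto simp: indicator_def)
 qed
 also have "... = M * t" using t by simp
 finally show ?thesis .
qed

lemma duh_add:
 assumes "f \<in> borel_measurable borel" "!!s. norm (f s) <= M" "g \<in> borel_measurable borel" "!!s. norm (g s) <= M'"
 shows "duh (%s. f s + g s) t = duh f t + duh g t"
proof -
 have "sg r (x + y) = sg r x + sg r y" for r x y
  using sg_bounded_linear[of r] by (simp add: bounded_linear.linear linear_add)
 then show ?thesis unfolding duh_def using duh_integrable[OF assms(1), of t M] duh_integrable[OF assms(3), of t M'] assms(2,4)
  by (simp add: scaleR_add_right)
qed

lemma duh_scaleR: "duh (%s. r *\<^sub>R f s) t = r *\<^sub>R duh f t"
proof -
 have "sg q (r *\<^sub>R x) = r *\<^sub>R sg q x" for q x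
  using sg_bounded_linear[of q] by (simp add: bounded_linear.linear linear_scale)
 then show ?thesis unfolding duh_def by (simp add: scaleR_left_commute mult.commute flip: integral_scaleR_right)
qed

lemma duh_cong_AE:
 assumes f: "f \<in> borel_measurable borel" and g: "g \<in> borel_measurable borel"
  and ae: "AE s in lborel. 0 < s --> s < t --> f s = g s"
 shows "duh f t = duh g t"
 unfolding duh_def
proof (rule integral_cong_AE)
 have [measurable]: "(%s. sg (t - s) (f s)) \<in> borel_measurable borel" by (rule sg_measurable[OF _ f]) measurable
 have [measurable]: "(%s. sg (t - s) (g s)) \<in> borel_measurable borel" by (rule sg_measurable[OF _ g]) measurable
 show "(%s. indicator {0..t} s *\<^sub>R sg (t - s) (f s)) \<in> borel_measurable lborel"
  "(%s. indicator {0..t} s *\<^sub>R sg (t - s) (g s)) \<in> borel_measurable lborel" by measurable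
 have "AE s in lborel. s ~= 0" "AE s in lborel. s ~= t" by (rule AE_lborel_singleton)+
 with ae show "AE s in lborel. indicator {0..t} s *\<^sub>R sg (t - s) (f s) = indicator {0..t} s *\<^sub>R sg (t - s) (g s)"
  by eventually_elim (auto simp: indicator_def)
qed

lemma duh_concat:
 assumes f: "f \<in> borel_measurable borel" "!!s. norm (f s) <= M" and t: "0 <= t" "0 <= r"
 shows "duh f (t + r) = sg r (duh f t) + duh (%s. f (t + s)) r"
proof -
 have fm: "(%s. f (t + s)) \<in> borel_measurable borel" using f(1) by measurable
 note i = duh_integrable[OF f(1), of "t + r" M, OF f(2)]
 have "duh f (t + r) = (LINT s|lborel. indicator {0..t} s *\<^sub>R sg (t + r - s) (f s) + indicator {t..t + r} s *\<^sub>R sg (t + r - s) (f s))"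
  unfolding duh_def
 proof (rule integral_cong_AE)
  have [measurable]: "(%s. sg (t + r - s) (f s)) \<in> borel_measurable borel" by (rule sg_measurable[OF _ f(1)]) measurable
  show "(%s. indicator {0..t + r} s *\<^sub>R sg (t + r - s) (f s)) \<in> borel_measurable lborel"
   "(%s. indicator {0..t} s *\<^sub>R sg (t + r - s) (f s) + indicator {t..t + r} s *\<^sub>R sg (t + r - s) (f s)) \<in> borel_measurable lborel"
   by measurable
  have "AE s in lborel. s ~= t" by (rule AE_lborel_singleton)
  then show "AE s in lborel. indicator {0..t + r} s *\<^sub>R sg (t + r - s) (f s)
    = indicator {0..t} s *\<^sub>R sg (t + r - s) (f s) + indicator {t..t + r} s *\<^sub>R sg (t + r - s) (f s)"
   by eventually_elim (use t in \<open>auto simp: indicator_def\<close>)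
 qed
 also have "... = (LINT s|lborel. indicator {0..t} s *\<^sub>R sg (t + r - s) (f s)) + (LINT s|lborel. indicator {t..t + r} s *\<^sub>R sg (t + r - s) (f s))"
 proof (rule Bochner_Integration.integral_add)
  have "integrable lborel (%s. indicator {0..t} s *\<^sub>R (indicator {0..t + r} s *\<^sub>R sg (t + r - s) (f s)))"
   by (rule integrable_mult_indicator[OF _ i]) auto
  moreover have "(%s. indicator {0..t} s *\<^sub>R (indicator {0..t + r} s *\<^sub>R sg (t + r - s) (f s))) = (%s. indicator {0..t} s *\<^sub>R sg (t + r - s) (f s))"
   using t by (auto simp: indicator_def)
  ultimately show "integrable lborel (%s. indicator {0..t} s *\<^sub>R sg (t + r - s) (f s))" by (simp only:)
  have "integrable lborel (%s. indicator {t..t + r} s *\<^sub>R (indicator {0..t + r} s *\<^sub>R sg (t + r - s) (f s)))"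
   by (rule integrable_mult_indicator[OF _ i]) auto
  moreover have "(%s. indicator {t..t + r} s *\<^sub>R (indicator {0..t + r} s *\<^sub>R sg (t + r - s) (f s))) = (%s. indicator {t..t + r} s *\<^sub>R sg (t + r - s) (f s))"
   using t by (auto simp: indicator_def)
  ultimately show "integrable lborel (%s. indicator {t..t + r} s *\<^sub>R sg (t + r - s) (f s))" by (simp only:)
 qed
 also have "(LINT s|lborel. indicator {0..t} s *\<^sub>R sg (t + r - s) (f s)) = (LINT s|lborel. sg r (indicator {0..t} s *\<^sub>R sg (t - s) (f s)))"
 proof (rule Bochner_Integration.integral_cong[OF refl])
  fix s
  have l: "sg r (c *\<^sub>R x) = c *\<^sub>R sg r x" for c x
   using sg_bounded_linear[of r] by (simp add: bounded_linear.linear linear_scale)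
  have "s <= t ==> sg (t + r - s) (f s) = sg r (sg (t - s) (f s))"
   using sg_add[of r "t - s" "f s"] t by (simp add: algebra_simps)
  then show "indicator {0..t} s *\<^sub>R sg (t + r - s) (f s) = sg r (indicator {0..t} s *\<^sub>R sg (t - s) (f s))"
   unfolding l by (auto simp: indicator_def)
 qed
 also have "... = sg r (duh f t)"
  unfolding duh_def by (rule integral_bounded_linear[OF sg_bounded_linear duh_integrable[OF f(1), of t M, OF f(2)]])
 also have "(LINT s|lborel. indicator {t..t + r} s *\<^sub>R sg (t + r - s) (f s)) = (LINT s|lborel. indicator {0..r} s *\<^sub>R sg (r - s) (f (t + s)))"
  using lborel_integral_real_affine[of 1 "%s. indicator {t..t + r} s *\<^sub>R sg (t + r - s) (f s)" t]
  by (simp add: indicator_def)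
 finally show ?thesis unfolding duh_def .
qed

lemma duh_tendsto:
 assumes f: "!!n. f n \<in> borel_measurable borel" "!!n s. norm (f n s) <= M" "g \<in> borel_measurable borel" and t: "0 <= t"
  and lim: "AE s in lborel. 0 < s --> s < t --> (%n. f n s) \<longlonglongrightarrow> g s"
 shows "(%n. duh (f n) t) \<longlonglongrightarrow> duh g t"
 unfolding duh_def
proof (rule integral_dominated_convergence[where w="%s. M * indicator {0..t} s"])
 have "(%s. sg (t - s) (g s)) \<in> borel_measurable borel" by (rule sg_measurable[OF _ f(3)]) measurable
 then show "(%s. indicator {0..t} s *\<^sub>R sg (t - s) (g s)) \<in> borel_measurable lborel" by measurable
 have "(%s. sg (t - s) (f n s)) \<in> borel_measurable borel" for n by (rule sg_measurable[OF _ f(1)]) measurable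
 then show "(%s. indicator {0..t} s *\<^sub>R sg (t - s) (f n s)) \<in> borel_measurable lborel" for n by measurable
 show "integrable lborel (%s. M * indicator {0..t} s)" using t by (intro integrable_mult_right integrable_real_indicator) auto
 have "AE s in lborel. s ~= 0" "AE s in lborel. s ~= t" by (rule AE_lborel_singleton)+
 with lim show "AE s in lborel. (%n. indicator {0..t} s *\<^sub>R sg (t - s) (f n s)) \<longlonglongrightarrow> indicator {0..t} s *\<^sub>R sg (t - s) (g s)"
  by eventually_elim
   (auto simp: indicator_def intro!: bounded_linear.tendsto[OF sg_bounded_linear])
 show "AE s in lborel. norm (indicator {0..t} s *\<^sub>R sg (t - s) (f n s)) <= M * indicator {0..t} s" for n
 proof (intro always_eventually allI)
  fix s show "norm (indicator {0..t} s *\<^sub>R sg (t - s) (f n s)) <= M * indicator {0..t} s"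
   using sg_contraction[of "t - s" "f n s"] f(2)[of n s] by (auto simp: indicator_def)
 qed
qed

lemma duh_inner:
 assumes f: "f \<in> borel_measurable borel" "!!s. norm (f s) <= M"
 shows "duh f t \<bullet> y = (LINT s|lborel. indicator {0..t} s * (f s \<bullet> sg (t - s) y))"
proof -
 have "duh f t \<bullet> y = (LINT s|lborel. (indicator {0..t} s *\<^sub>R sg (t - s) (f s)) \<bullet> y)"
  unfolding duh_def by (rule integral_inner_left[symmetric]) (rule duh_integrable[OF f(1), of t M, OF f(2)])
 also have "... = (LINT s|lborel. indicator {0..t} s * (f s \<bullet> sg (t - s) y))"
  by (simp add: sg_sym)
 finally show ?thesis .
qed

text \<open>The equation \<open>z' = - green\<inverse> z + f\<close> is written
 without the unbounded inverse.\<close>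

lemma duhamel:
 assumes t: "0 < t" and f: "f \<in> borel_measurable borel" "!!s. norm (f s) <= M"
  and z: "continuous_on {0..t} z" "!!s. 0 < s ==> s < t ==> (z has_vector_derivative z' s) (at s)"
  and eq: "!!s. 0 < s ==> s < t ==> z s = - green (z' s - f s)"
 shows "z t = sg t (z 0) + duh f t"
proof -
 have "z t \<bullet> y = (sg t (z 0) + duh f t) \<bullet> y" for y
 proof -
  \<comment> \<open>Pairing with a fixed \<open>y\<close> moves the semigroup to the other side,
    where it is differentiable in time; the claim becomes the fundamental theorem of calculus for a
    scalar function.\<close>
  define G where "G s = z s \<bullet> sg (t - s) y" for s
  define g where "g s = f s \<bullet> sg (t - s) y" for s
  have [measurable]: "(%s. sg (t - s) y) \<in> borel_measurable borel" by (rule sg_measurable) measurable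
  have gm [measurable]: "g \<in> borel_measurable borel" unfolding g_def using f(1) by measurable
  have gb: "norm (g s) <= M * norm y" for s
  proof -
   have "norm (g s) <= norm (f s) * norm (sg (t - s) y)" unfolding g_def by (simp add: Cauchy_Schwarz_ineq2)
   also have "... <= M * norm y" using f(2) sg_contraction order_trans[OF norm_ge_zero f(2)] by (intro mult_mono) auto
   finally show ?thesis .
  qed
  have "(g has_integral (G t - G 0)) {0..t}"
  proof (rule fundamental_theorem_of_calculus_interior)
   show "continuous_on {0..t} G" unfolding G_def
    by (intro continuous_intros z continuous_on_compose2[OF sg_continuous]) auto
   fix s assume s: "s \<in> {0<..<t}"
   have ts: "0 < t - s" using s by simp
   have "((%s. sgd 0 (t - s) y) has_vector_derivative (-1) *\<^sub>R (- sgd (Suc 0) (t - s) y)) (at s)"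
   proof -
    have "((%s. t - s) has_vector_derivative -1) (at s)" by (auto intro!: derivative_eq_intros)
    from vector_diff_chain_at[OF this sgd_has_vector_derivative[OF ts]] show ?thesis by (simp add: o_def)
   qed
   then have d0: "((%s. sgd 0 (t - s) y) has_vector_derivative sgd 1 (t - s) y) (at s)" by simp
   have d: "((%s. sg (t - s) y) has_vector_derivative sgd 1 (t - s) y) (at s)"
    by (rule has_vector_derivative_transform_within_open[OF d0, of "{..<t}"]) (use s in \<open>auto simp: sg_def\<close>)
   have "(G has_vector_derivative (z s \<bullet> sgd 1 (t - s) y + z' s \<bullet> sg (t - s) y)) (at s)"
    unfolding G_def using bounded_bilinear.has_vector_derivative[OF bounded_bilinear_inner z(2) d] s by simp
   \<comment> \<open>Inserting the equation for \<open>z s\<close> moves \<open>green\<close> onto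
     \<open>sgd 1\<close>, which turns into \<open>sg\<close>; the terms with \<open>z' s\<close>
     then cancel.\<close>
   moreover have "z s \<bullet> sgd 1 (t - s) y + z' s \<bullet> sg (t - s) y = g s"
    using eq[of s] s ts S_sgd[OF ts, of 0 y]
    by (simp add: sym inner_minus_left g_def inner_diff_left sgd_0)
   ultimately show "(G has_vector_derivative g s) (at s)" by simp
  qed (use t in simp)
  moreover have "integrable lborel (%s. indicator {0..t} s *\<^sub>R g s)"
  proof (rule Bochner_Integration.integrable_bound)
   show "integrable lborel (%s. (M * norm y) * indicator {0..t} s)"
    using t by (intro integrable_mult_right integrable_real_indicator) auto
   show "AE s in lborel. norm (indicator {0..t} s *\<^sub>R g s) <= norm ((M * norm y) * indicator {0..t} s :: real)"
    using gb order_trans[OF gb abs_ge_self] by (intro always_eventually allI) (auto simp: indicator_def)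
  qed measurable
  then have "(g has_integral (LINT s|lborel. indicator {0..t} s *\<^sub>R g s)) {0..t}"
   using set_borel_integral_eq_integral[of "{0..t}" g]
   by (simp add: set_integrable_def set_lebesgue_integral_def has_integral_integral)
  ultimately have "G t - G 0 = (LINT s|lborel. indicator {0..t} s *\<^sub>R g s)" by (rule has_integral_unique)
  then show ?thesis
   by (simp add: G_def g_def inner_add_left duh_inner[OF f] sg_sym)
 qed
 then show ?thesis using vector_eq_rdot by blast
qed

end

section \<open>Sequences of coefficients whose Green operators converge in norm\<close>

abbreviation sgc :: "real => (real => real) => real => L2 => L2" where
 "sgc K \<rho> \<equiv> pos_op.sg (coef.green \<rho>) (2 * K)"

locale coef_seq = coef +
 fixes \<rho>' :: "nat => real => real" and \<delta> :: "nat => real"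
 assumes coefs: "coef K (\<rho>' n)"
  and green_close: "norm (coef.green (\<rho>' n) F - green F) <= \<delta> n * norm F"
  and delta: "\<delta> \<longlonglongrightarrow> 0"
begin

lemma green_close_eventually:
 assumes "0 < d"
 shows "\<forall>\<^sub>F n in sequentially. \<forall>F. norm (coef.green (\<rho>' n) F - green F) <= d * norm F"
 using order_tendstoD(2)[OF delta assms]
proof eventually_elim
 case (elim n)
 show ?case
 proof
  fix F :: L2
  have "\<delta> n * norm F <= d * norm F" using elim by (intro mult_right_mono) auto
  then show "norm (coef.green (\<rho>' n) F - green F) <= d * norm F" using green_close[of n F] by linarith
 qed
qed

lemma pos_ops: "pos_op (coef.green (\<rho>' n)) (2 * K)" "pos_inj (coef.green (\<rho>' n)) (2 * K)"
proof -
 interpret b: coef K "\<rho>' n" by (rule coefs)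
 show "pos_op (coef.green (\<rho>' n)) (2 * K)" "pos_inj (coef.green (\<rho>' n)) (2 * K)" by unfold_locales
qed

lemma sgc_close_eventually:
 assumes t: "0 < t" and u: "u \<longlonglongrightarrow> t" and e: "0 < e"
 shows "\<forall>\<^sub>F n in sequentially. \<forall>x. norm (sgc K (\<rho>' n) (u n) x - sg t x) <= e * norm x"
proof -
 obtain d where d: "0 < d" "!!S' u. pos_op S' (2 * K) ==> (\<forall>x. norm (S' x - green x) <= d * norm x) ==> \<bar>u - t\<bar> < d ==>
  (\<forall>x. norm (pos_op.sg S' (2 * K) u x - sg t x) <= e * norm x)"
  using sg_perturb[OF pos_op_axioms t e] by blast
 have "\<forall>\<^sub>F n in sequentially. \<bar>u n - t\<bar> < d"
  using tendstoD[OF u d(1)] by (simp add: dist_real_def)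
 with green_close_eventually[OF d(1)] show ?thesis
  by eventually_elim (rule d(2)[OF pos_ops(1)], auto)
qed

text \<open>For positive \<open>t\<close> the semigroups are close uniformly over vectors. At time 0
  the convergence is only strong, and \<open>sg_perturb_0\<close> takes over.\<close>

lemma sgc_tendsto:
 assumes u: "u \<longlonglongrightarrow> t"
 shows "(%n. sgc K (\<rho>' n) (u n) z) \<longlonglongrightarrow> sg t z"
proof (rule tendstoI)
 fix e :: real assume e: "0 < e"
 show "\<forall>\<^sub>F n in sequentially. dist (sgc K (\<rho>' n) (u n) z) (sg t z) < e"
 proof (cases "0 < t")
  case True
  define e' where "e' = e / (2 * (norm z + 1))"
  have e': "0 < e'" using e by (simp add: e'_def add_nonneg_pos)
  have "e' * norm z <= e' * (norm z + 1)" using e' by simp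
  also have "... = e / 2" using norm_ge_zero[of z] by (simp add: e'_def field_simps add_nonneg_eq_0_iff del: norm_ge_zero)
  finally have le: "e' * norm z <= e / 2" .
  from sgc_close_eventually[OF True u e'] show ?thesis
  proof eventually_elim
   case (elim n)
   then have "norm (sgc K (\<rho>' n) (u n) z - sg t z) <= e' * norm z" by blast
   then show ?case using le e by (simp add: dist_norm)
  qed
 next
  case False
  obtain d where d: "0 < d" "!!S' u. pos_op S' (2 * K) ==> (\<forall>x. norm (S' x - green x) <= d * norm x) ==> u < d ==>
   norm (pos_op.sg S' (2 * K) u z - z) <= e / 2"
   using sg_perturb_0[OF pos_inj_axioms half_gt_zero[OF e], of z] by blast
  have "\<forall>\<^sub>F n in sequentially. u n < d" using False d(1) by (intro order_tendstoD(2)[OF u]) auto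
  with green_close_eventually[OF d(1)] show ?thesis
  proof eventually_elim
   case (elim n)
   have "norm (sgc K (\<rho>' n) (u n) z - z) <= e / 2" by (rule d(2)[OF pos_ops(1)]) (use elim in auto)
   then show ?case using False e by (simp add: dist_norm)
  qed
 qed
qed

text \<open>The sources vary with \<open>n\<close> and need not converge, so closeness of the
  semigroups is required uniformly over vectors. It holds at every \<open>s\<close> below
  \<open>t0\<close>; dominated convergence does the rest.\<close>

lemma duh_close:
 assumes f: "!!n. f n \<in> borel_measurable borel" "!!n s. norm (f n s) <= M"
  and t: "t \<longlonglongrightarrow> t0" "!!n. 0 <= t n"
 shows "(%n. coef.duh K (\<rho>' n) (f n) (t n) - duh (f n) t0) \<longlonglongrightarrow> 0"
proof -
 have t0: "0 <= t0" using t by (intro LIMSEQ_le_const[OF t(1)]) auto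
 have M0: "0 <= M" using order_trans[OF norm_ge_zero f(2)] by blast
 obtain B where B: "!!n. t n <= B"
 proof -
  have "Bseq t" using t(1) by (intro convergent_imp_Bseq convergentI)
  then obtain B where B: "!!n. norm (t n) <= B" unfolding Bseq_def by blast
  have "t n <= B" for n using B[of n] by simp
  then show ?thesis by (rule that)
 qed
 have B0: "0 <= B" by (rule order_trans[OF t(2)[of 0] B[of 0]])
 have B1: "t0 <= B" by (rule LIMSEQ_le_const2[OF t(1)]) (use B in blast)
 define g where "g n s = indicator {0..t n} s *\<^sub>R sgc K (\<rho>' n) (t n - s) (f n s)" for n s
 define h where "h n s = indicator {0..t0} s *\<^sub>R sg (t0 - s) (f n s)" for n s
 have gi: "integrable lborel (g n)" for n
 proof -
  interpret b: coef K "\<rho>' n" by (rule coefs)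
  show ?thesis unfolding g_def by (rule b.duh_integrable[OF f(1), of _ _ M]) (rule f(2))
 qed
 have gb: "norm (g n s) <= M * indicator {0..B} s" for n s
 proof -
  interpret b: coef K "\<rho>' n" by (rule coefs)
  show ?thesis using b.sg_contraction[of "t n - s" "f n s"] f(2)[of n s] B[of n] M0 by (auto simp: g_def indicator_def)
 qed
 have hi: "integrable lborel (h n)" for n
  unfolding h_def by (rule duh_integrable[OF f(1), of _ _ M]) (rule f(2))
 have hb: "norm (h n s) <= M * indicator {0..B} s" for n s
  using sg_contraction[of "t0 - s" "f n s"] f(2)[of n s] B0 B1 M0 by (auto simp: h_def indicator_def)
 have "(%n. LINT s|lborel. norm (g n s - h n s)) \<longlonglongrightarrow> (LINT s|(lborel :: real measure). (0::real))"
 proof (rule integral_dominated_convergence[where w="%s. 2 * (M * indicator {0..B} s)"])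
  show "integrable lborel (%s. 2 * (M * indicator {0..B} s))"
   using B0 by (intro integrable_mult_right integrable_real_indicator) auto
  show "(%s. norm (g n s - h n s)) \<in> borel_measurable lborel" for n using gi[of n] hi[of n] by auto
  show "AE s in lborel. norm (norm (g n s - h n s)) <= 2 * (M * indicator {0..B} s)" for n
  proof (intro always_eventually allI)
   fix s show "norm (norm (g n s - h n s)) <= 2 * (M * indicator {0..B} s)"
    using norm_triangle_ineq4[of "g n s" "h n s"] gb[of n s] hb[of n s] by simp
  qed
  have "AE s in lborel. s ~= t0" by (rule AE_lborel_singleton)
  then show "AE s in lborel. (%n. norm (g n s - h n s)) \<longlonglongrightarrow> 0"
  proof eventually_elim
   case (elim s)
   consider "s < 0" | "t0 < s" | "0 <= s" "s < t0" using elim by linarith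
   then show ?case
   proof cases
    case 1
    then show ?thesis by (simp add: g_def h_def)
   next
    case 2
    have "\<forall>\<^sub>F n in sequentially. t n < s" by (rule order_tendstoD(2)[OF t(1) 2])
    then have "\<forall>\<^sub>F n in sequentially. norm (g n s - h n s) = 0"
     by eventually_elim (use 2 in \<open>simp add: g_def h_def\<close>)
    then show ?thesis by (rule tendsto_eventually)
   next
    case 3
    show ?thesis
    proof (rule tendstoI)
     fix e :: real assume e: "0 < e"
     define e' where "e' = e / (2 * (M + 1))"
     have e': "0 < e'" using e M0 by (simp add: e'_def)
     have "e' * M <= e' * (M + 1)" using e' by simp
     also have "... = e / 2" using M0 by (simp add: e'_def field_simps)
     finally have e'M: "e' * M < e" using e by simp
     have "(%n. t n - s) \<longlonglongrightarrow> t0 - s" by (intro tendsto_intros t(1))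
     then have "\<forall>\<^sub>F n in sequentially. \<forall>x. norm (sgc K (\<rho>' n) (t n - s) x - sg (t0 - s) x) <= e' * norm x"
      using 3 e' by (intro sgc_close_eventually) auto
     moreover have "\<forall>\<^sub>F n in sequentially. s < t n" by (rule order_tendstoD(1)[OF t(1) 3(2)])
     ultimately show "\<forall>\<^sub>F n in sequentially. dist (norm (g n s - h n s)) 0 < e"
     proof eventually_elim
      case (elim n)
      have "norm (g n s - h n s) = norm (sgc K (\<rho>' n) (t n - s) (f n s) - sg (t0 - s) (f n s))"
       using elim 3 by (simp add: g_def h_def)
      also have "... <= e' * norm (f n s)" using elim by blast
      also have "... <= e' * M" using e' f(2) by (intro mult_left_mono) auto
      finally show ?case using e'M by simp
     qed
    qed
   qed
  qed
 qed simp
 then have lim: "(%n. LINT s|lborel. norm (g n s - h n s)) \<longlonglongrightarrow> 0" by simp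
 have bnd: "norm (coef.duh K (\<rho>' n) (f n) (t n) - duh (f n) t0) <= (LINT s|lborel. norm (g n s - h n s))" for n
 proof -
  interpret b: coef K "\<rho>' n" by (rule coefs)
  have "b.duh (f n) (t n) - duh (f n) t0 = (LINT s|lborel. g n s - h n s)"
   using Bochner_Integration.integral_diff[OF gi[of n] hi[of n]] unfolding b.duh_def duh_def g_def h_def by (rule HOL.sym)
  then show ?thesis by (simp only: integral_norm_bound)
 qed
 show ?thesis by (rule Lim_null_comparison[OF _ lim]) (simp add: bnd)
qed

end

subsection \<open>Controls and mild solutions\<close>

lemma nice_version:
 assumes u: "u \<in> control_ball t J M" and J: "J \<in> sets borel" and M: "0 <= M"
 obtains v where "nice v M" "AE q in lebesgue_on ({0<..<t} \<times> J). u q = v q"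
proof -
 let ?Q = "{0<..<t} \<times> J"
 have Q: "?Q \<in> sets borel" using J by (intro borel_Times) auto
 define w where "w q = indicator ?Q q *\<^sub>R u q" for q
 have um: "u \<in> borel_measurable (lebesgue_on ?Q)" and ub: "AE q in lebesgue_on ?Q. norm (u q) <= M"
  using u by (auto simp: control_ball_def)
 have w: "w \<in> borel_measurable lebesgue"
  unfolding w_def using um Q by (subst (asm) borel_measurable_restrict_space_iff) auto
 have m: "(%x. Re (w x)) \<in> borel_measurable (completion lborel)"
  "(%x. Im (w x)) \<in> borel_measurable (completion lborel)"
  using w by measurable
 obtain p q where pq: "p \<in> borel_measurable lborel" "AE x in lborel. Re (w x) = p x"
   "q \<in> borel_measurable lborel" "AE x in lborel. Im (w x) = q x"
  using completion_ex_borel_measurable_real[OF m(1)] completion_ex_borel_measurable_real[OF m(2)] by blast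
 define g where "g x = Complex (p x) (q x)" for x
 have g [measurable]: "g \<in> borel_measurable borel"
  unfolding g_def using pq by (simp add: Complex_eq)
 have wg: "AE x in lborel. w x = g x"
  using pq(2,4) by eventually_elim (simp add: g_def complex_eq_iff)
 define v where "v x = (if norm (g x) <= M then g x else 0)" for x
 have "v \<in> borel_measurable borel" unfolding v_def by measurable
 then have "nice v M" using M by (simp add: nice_def v_def)
 moreover have "AE x in lebesgue_on ?Q. u x = v x"
 proof -
  have "AE x in lborel. x \<in> ?Q --> norm (u x) <= M" using ub Q by (subst (asm) AE_lebesgue_on_iff) auto
  with wg have "AE x in lborel. x \<in> ?Q --> u x = v x"
  proof eventually_elim
   case (elim x)
   show ?case
   proof
    assume "x \<in> ?Q"
    then have "w x = u x" "norm (u x) <= M" using elim by (simp_all add: w_def)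
    then show "u x = v x" using elim(1) by (simp add: v_def)
   qed
  qed
  then show ?thesis using Q by (subst AE_lebesgue_on_iff) auto
 qed
 ultimately show ?thesis by (rule that)
qed

text \<open>By Fubini the time slices agree for almost every time, and the slice of \<open>u\<close>
  inherits measurability from that of the Borel control \<open>v\<close>.\<close>

lemma control_input_AE:
 assumes v: "nice v M" and J: "J \<in> sets borel"
  and ae: "AE q in lebesgue_on ({0<..<t} \<times> J). u q = v q"
 shows "AE s in lborel. 0 < s --> s < t --> control_input J u s = control_input J v s"
proof -
 have Q: "{0<..<t} \<times> J \<in> sets borel" using J by (intro borel_Times) auto
 have "AE q in lborel. q \<in> {0<..<t} \<times> J --> u q = v q" using ae Q by (subst (asm) AE_lebesgue_on_iff) auto
 then have "AE q in lborel \<Otimes>\<^sub>M lborel. q \<in> {0<..<t} \<times> J --> u q = v q" unfolding lborel_prod .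
 then have "AE s in lborel. AE x in lborel. (s, x) \<in> {0<..<t} \<times> J --> u (s, x) = v (s, x)"
  by (rule lborel_pair.AE_pair)
 then show ?thesis
 proof eventually_elim
  case (elim s)
  show ?case
  proof (intro impI)
   assume s: "0 < s" "s < t"
   let ?f = "%x. indicator J x * u (s, x)" and ?g = "%x. indicator J x * v (s, x)"
   have ae: "AE x in lborel. ?g x = ?f x" using elim by eventually_elim (use s in \<open>auto simp: indicator_def\<close>)
   have gm: "?g \<in> borel_measurable borel" "?g \<in> L2_fun" using control_slice[OF v J] by auto
   have "?g \<in> borel_measurable lebesgue" using gm(1) by (intro measurable_completion) simp
   then have "?f \<in> borel_measurable lebesgue" using ae by (rule borel_measurable_AE[OF _ AE_completion])
   then have fm: "?f \<in> borel_measurable leb01" by (rule measurable_restrict_space1)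
   have ae': "AE x in leb01. ?g x = ?f x"
    using ae by (subst AE_lebesgue_on_iff) (auto elim: eventually_mono)
   have "?f \<in> L2_fun" by (rule L2_fun_AE_cong[OF gm(2) fm ae'])
   then show "control_input J u s = control_input J v s"
    using gm(2) ae' unfolding control_input_def by (subst L2_of_eq_iff) (auto elim: eventually_mono)
  qed
 qed
qed

context coef begin

text \<open>Every semigroup with this generator is \<open>sg\<close>, so the existential quantifier
  over semigroups in \<open>mild_solution\<close> collapses, and steering to zero becomes one
  identity for a nice representative.\<close>

lemma mild_solution_iff:
 assumes \<alpha>: "AE x in leb01. \<alpha> x = 1 / \<rho> x" and v: "nice v M" and J: "J \<in> sets borel"
  and ae: "AE q in lebesgue_on ({0<..<\<tau>} \<times> J). u q = v q" and \<tau>: "0 < \<tau>"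
 shows "(\<exists>z. mild_solution \<alpha> (control_input J u) z0 \<tau> z \<and> z \<tau> = 0) \<longleftrightarrow> duh (control_input J v) \<tau> = - sg \<tau> z0"
proof -
 let ?f = "control_input J u" and ?g = "control_input J v"
 have gm: "?g \<in> borel_measurable borel" by (rule control_input_measurable[OF v J])
 have gb: "norm (?g s) <= M" for s by (rule control_slice(3)[OF v J])
 have aefg: "AE s in lborel. 0 < s --> s < \<tau> --> ?f s = ?g s" by (rule control_input_AE[OF v J ae])
 have aet: "AE s in lebesgue_on {0..t}. sg (t - s) (?f s) = sg (t - s) (?g s)" if "t <= \<tau>" for t
 proof -
  have "AE s in lborel. s ~= 0" "AE s in lborel. s ~= \<tau>" by (rule AE_lborel_singleton)+
  with aefg have "AE s in lborel. s \<in> {0..t} --> sg (t - s) (?f s) = sg (t - s) (?g s)"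
   by eventually_elim (use that in auto)
  then show ?thesis by (subst AE_lebesgue_on_iff) auto
 qed
 have sgm: "(%s. sg (t - s) (?g s)) \<in> borel_measurable borel" for t by (rule sg_measurable[OF _ gm]) measurable
 have bi: "has_bochner_integral (lebesgue_on {0..t}) (%s. sg (t - s) (?g s)) (duh ?g t)" for t
  unfolding has_bochner_integral_iff
  using duh_integrable[OF gm, of t M] gb sgm
  by (simp add: integrable_lebesgue_on_borel integral_lebesgue_on_borel duh_def)
 have m: "(%s. sg (t - s) (?f s)) \<in> borel_measurable (lebesgue_on {0..t})" if "t <= \<tau>" for t
  by (rule borel_measurable_lebesgue_on_AE[OF sgm _ aet[OF that]]) simp
 have bf: "has_bochner_integral (lebesgue_on {0..t}) (%s. sg (t - s) (?f s)) (duh ?g t)" if "t <= \<tau>" for t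
 proof (subst has_bochner_integral_cong_AE[OF m[OF that] _ aet[OF that]])
  show "(%s. sg (t - s) (?g s)) \<in> borel_measurable (lebesgue_on {0..t})"
   using bi[of t] by (rule borel_measurable_has_bochner_integral)
 qed (rule bi)
 have gen: "generator sg F G \<longleftrightarrow> dirichlet_op \<alpha> F G" for F G
  unfolding generator_sg dirichlet_op_iff[OF \<alpha>] ..
 show ?thesis
 proof
  assume "\<exists>z. mild_solution \<alpha> ?f z0 \<tau> z \<and> z \<tau> = 0"
  then obtain z where z: "mild_solution \<alpha> ?f z0 \<tau> z" "z \<tau> = 0" by blast
  from z(1) obtain T where T: "C0_semigroup T" "!!F G. generator T F G \<longleftrightarrow> dirichlet_op \<alpha> F G"
    and i': "\<forall>t\<in>{0..\<tau>}. has_bochner_integral (lebesgue_on {0..t}) (%s. T (t - s) (?f s)) (z t - T t z0)"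
   unfolding mild_solution_def by blast
  have i: "has_bochner_integral (lebesgue_on {0..\<tau>}) (%s. T (\<tau> - s) (?f s)) (z \<tau> - T \<tau> z0)"
   by (rule bspec[OF i']) (use \<tau> in simp)
  have Tsg: "T t x = sg t x" if "0 <= t" for t x
   by (rule C0_semigroup_unique[OF T(1) _ that]) (simp add: T(2) dirichlet_op_iff[OF \<alpha>])
  have "has_bochner_integral (lebesgue_on {0..\<tau>}) (%s. sg (\<tau> - s) (?f s)) (z \<tau> - T \<tau> z0)"
   using i by (subst has_bochner_integral_cong[OF refl _ refl]) (auto simp: space_restrict_space Tsg)
  then have "duh ?g \<tau> = z \<tau> - T \<tau> z0"
   using bf[OF order_refl] has_bochner_integral_eq by blast
  then show "duh ?g \<tau> = - sg \<tau> z0" using z(2) \<tau> by (simp add: Tsg)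
 next
  assume e: "duh ?g \<tau> = - sg \<tau> z0"
  define z where "z t = sg t z0 + duh ?g t" for t
  have "mild_solution \<alpha> ?f z0 \<tau> z"
   unfolding mild_solution_def
  proof (intro exI[of _ sg] conjI C0_semigroup_sg allI gen ballI)
   fix t assume "t \<in> {0..\<tau>}"
   then show "has_bochner_integral (lebesgue_on {0..t}) (%s. sg (t - s) (?f s)) (z t - sg t z0)"
    using bf[of t] by (simp add: z_def)
  qed
  then show "\<exists>z. mild_solution \<alpha> ?f z0 \<tau> z \<and> z \<tau> = 0" using e by (auto simp: z_def)
 qed
qed

end

section \<open>A Gevrey cutoff\<close>

lemma has_real_derivative_Re_of_real:
 assumes "(f has_field_derivative f') (at (of_real x :: complex))"
 shows "((%x. Re (f (of_real x))) has_real_derivative Re f') (at x)"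
proof -
 have "((%x. f (of_real x)) has_derivative (%h. f' * of_real h)) (at x)"
  using has_derivative_compose[OF has_derivative_of_real[OF has_derivative_ident], of f "(*) f'" x UNIV] assms
  by (simp add: has_field_derivative_def)
 then have "((%x. Re (f (of_real x))) has_derivative (%h. Re (f' * of_real h))) (at x)"
  by (rule bounded_linear.has_derivative[OF bounded_linear_Re])
 then show ?thesis by (simp add: has_field_derivative_def mult.commute[of "Re f'"] mult_commute_abs)
qed

text \<open>Seen from the origin the disc spans a small angle, so \<open>1 / w\<^sup>2\<close> stays
  in the right half-plane with real part comparable to \<open>1 / a\<^sup>2\<close>; the constant
  1/5 leaves room in the arithmetic.\<close>

lemma Re_inverse_square_ge:
 fixes w :: complex
 assumes a: "0 < a" and w: "norm (w - of_real a) <= a / 4"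
 shows "1 / (5 * a\<^sup>2) <= Re (1 / w\<^sup>2)" "w ~= 0"
proof -
 define p q where "p = Re w" and "q = Im w"
 have "\<bar>p - a\<bar> <= a / 4" "\<bar>q\<bar> <= a / 4"
  using abs_Re_le_cmod[of "w - of_real a"] abs_Im_le_cmod[of "w - of_real a"] w by (simp_all add: p_def q_def)
 then have p: "3 * a / 4 <= p" "p <= 5 * a / 4" and q: "\<bar>q\<bar> <= a / 4" by linarith+
 then show "w ~= 0" using a by (auto simp: p_def)
 have q2: "q\<^sup>2 <= a\<^sup>2 / 16" using power_mono[OF q, of 2] by (simp add: power_divide)
 have p2: "9 * a\<^sup>2 / 16 <= p\<^sup>2" using power_mono[OF p(1), of 2] a by (simp add: power_divide power_mult_distrib)
 have "norm w <= a + a / 4" using norm_triangle_ineq[of "of_real a" "w - of_real a"] a w by simp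
 then have "(norm w)\<^sup>2 <= (5 * a / 4)\<^sup>2" by (intro power_mono) auto
 then have n: "p\<^sup>2 + q\<^sup>2 <= 25 * a\<^sup>2 / 16" by (simp add: cmod_power2 p_def q_def power_divide power_mult_distrib)
 have a2: "0 < a\<^sup>2" using a by simp
 have pos: "0 < p\<^sup>2 + q\<^sup>2" using p2 a2 zero_le_power2[of q] by linarith
 have "Re (1 / w\<^sup>2) = (p\<^sup>2 - q\<^sup>2) / ((p\<^sup>2 - q\<^sup>2)\<^sup>2 + (2 * p * q)\<^sup>2)"
  by (simp add: Re_divide p_def q_def power2_eq_square algebra_simps)
 also have "(p\<^sup>2 - q\<^sup>2)\<^sup>2 + (2 * p * q)\<^sup>2 = (p\<^sup>2 + q\<^sup>2)\<^sup>2" by (simp add: power2_eq_square algebra_simps)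
 finally have e: "Re (1 / w\<^sup>2) = (p\<^sup>2 - q\<^sup>2) / (p\<^sup>2 + q\<^sup>2)\<^sup>2" .
 have "(p\<^sup>2 + q\<^sup>2)\<^sup>2 <= (25 * a\<^sup>2 / 16)\<^sup>2" using n pos by (intro power_mono) auto
 also have "... = 625 / 256 * (a\<^sup>2 * a\<^sup>2)" by (simp add: power2_eq_square)
 also have "... <= 5 / 2 * (a\<^sup>2 * a\<^sup>2)" by (intro mult_right_mono) auto
 also have "... = 5 * a\<^sup>2 * (a\<^sup>2 / 2)" by simp
 also have "... <= 5 * a\<^sup>2 * (p\<^sup>2 - q\<^sup>2)" using p2 q2 a2 by (intro mult_left_mono) auto
 finally have c: "(p\<^sup>2 + q\<^sup>2)\<^sup>2 <= 5 * a\<^sup>2 * (p\<^sup>2 - q\<^sup>2)" .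
 have "1 / (5 * a\<^sup>2) = (p\<^sup>2 + q\<^sup>2)\<^sup>2 / (5 * a\<^sup>2) / (p\<^sup>2 + q\<^sup>2)\<^sup>2" using less_imp_neq[OF pos] a by simp
 also have "... <= (p\<^sup>2 - q\<^sup>2) / (p\<^sup>2 + q\<^sup>2)\<^sup>2"
  using c a2 by (intro divide_right_mono) (auto simp: divide_le_eq mult.commute)
 finally show "1 / (5 * a\<^sup>2) <= Re (1 / w\<^sup>2)" unfolding e .
qed

text \<open>The squares in the exponent give derivatives of size \<open>(i!)^(3/2)\<close>. First
  powers would give \<open>(i!)^2\<close>, which is exactly the borderline growth for series with
  denominators \<open>(2 i)!\<close>.\<close>

definition bump :: "complex => complex" where
 "bump z = exp (- (1 / z\<^sup>2) - 1 / (1 - z)\<^sup>2)"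

lemma bump_holomorphic: "bump holomorphic_on {z. 0 < Re z \<and> Re z < 1}"
proof -
 have "z\<^sup>2 ~= 0 \<and> (1 - z)\<^sup>2 ~= 0" if "0 < Re z" "Re z < 1" for z :: complex
  using that by auto
 then show ?thesis unfolding bump_def by (intro holomorphic_intros) auto
qed

text \<open>The square of the claim is the bound of a power by a factorial times an exponential, at
  \<open>2 / 5 * y\<^sup>2\<close>; the square root of the factorial is the extra 1/2 in the order
  3/2.\<close>

lemma power_exp_sq_le:
 fixes y :: real
 assumes "0 <= y"
 shows "y ^ i * exp (- (y\<^sup>2) / 5) <= 2 ^ i * sqrt (fact i)"
proof (rule power2_le_imp_le)
 have "(2 / 5 * y\<^sup>2) ^ i <= fact i * exp (2 / 5 * y\<^sup>2)" by (rule power_le_fact_exp) simp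
 then have "(2 / 5 * y\<^sup>2) ^ i * exp (- (2 / 5 * y\<^sup>2)) <= fact i" by (simp add: exp_minus field_simps)
 then have "(5 / 2) ^ i * ((2 / 5 * y\<^sup>2) ^ i * exp (- (2 / 5 * y\<^sup>2))) <= (5 / 2) ^ i * fact i"
  by (intro mult_left_mono) auto
 also have "... <= 4 ^ i * fact i" by (intro mult_right_mono power_mono) auto
 finally have "(y\<^sup>2) ^ i * exp (- (2 / 5 * y\<^sup>2)) <= 4 ^ i * fact i"
  by (simp flip: power_mult_distrib mult.assoc)
 moreover have "(y ^ i * exp (- (y\<^sup>2) / 5))\<^sup>2 = (y\<^sup>2) ^ i * exp (- (2 / 5 * y\<^sup>2))"
  by (simp add: power_mult_distrib exp_double[symmetric] flip: power_mult) (simp add: mult.commute)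
 moreover have "(2 ^ i * sqrt (fact i))\<^sup>2 = 4 ^ i * (fact i :: real)"
  by (simp add: power_mult_distrib) (simp flip: power_mult power_mult_distrib add: power2_eq_square mult.commute)
 ultimately show "(y ^ i * exp (- (y\<^sup>2) / 5))\<^sup>2 <= (2 ^ i * sqrt (fact i))\<^sup>2" by simp
qed simp

text \<open>The \<open>i\<close>-th derivative of the bump on the unit interval, extended by zero.
  The extensions are derivatives of each other on the whole line by
  \<open>bd_has_derivative\<close>.\<close>

definition bd :: "nat => real => real" where
 "bd i x = (if 0 < x \<and> x < 1 then Re ((deriv ^^ i) bump (of_real x)) else 0)"

text \<open>Cauchy's inequality on a disc whose radius is a quarter of the distance \<open>m\<close>
  to the end points. The radius costs \<open>(4 / m) ^ i\<close>, and the bump decays like an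
  exponential of \<open>- 1 / m\<^sup>2\<close>.\<close>

lemma bd_bound_aux:
 assumes x: "0 < x" "x < 1" and m: "m = min x (1 - x)"
 shows "\<bar>bd i x\<bar> <= fact i * 4 ^ i * ((1 / m) ^ i * exp (- ((1 / m)\<^sup>2) / 5))"
proof -
 have m0: "0 < m" "m <= x" "m <= 1 - x" using x m by auto
 have in_strip: "0 < Re z \<and> Re z < 1" if "z \<in> cball (of_real x) (m / 4)" for z
  using abs_Re_le_cmod[of "z - of_real x"] that m0 by (auto simp: dist_norm norm_minus_commute)
 have hol: "bump holomorphic_on cball (of_real x) (m / 4)"
  by (rule holomorphic_on_subset[OF bump_holomorphic]) (use in_strip in blast)
 have "norm ((deriv ^^ i) bump (of_real x)) <= fact i * exp (- ((1 / m)\<^sup>2) / 5) / (m / 4) ^ i"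
 proof (rule Cauchy_inequality)
  show "bump holomorphic_on ball (of_real x) (m / 4)"
   by (rule holomorphic_on_subset[OF hol]) auto
  show "continuous_on (cball (of_real x) (m / 4)) bump" by (rule holomorphic_on_imp_continuous_on[OF hol])
  fix z :: complex assume z: "norm (of_real x - z) = m / 4"
  have 1: "1 / (5 * x\<^sup>2) <= Re (1 / z\<^sup>2)"
   using z m0 x by (intro Re_inverse_square_ge) (auto simp: norm_minus_commute)
  have "norm ((1 - z) - of_real (1 - x)) = norm (of_real x - z)" by simp
  then have 2: "1 / (5 * (1 - x)\<^sup>2) <= Re (1 / (1 - z)\<^sup>2)"
   using z m0 x by (intro Re_inverse_square_ge) auto
  have "(1 / m)\<^sup>2 / 5 <= 1 / (5 * x\<^sup>2) + 1 / (5 * (1 - x)\<^sup>2)"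
   using m x by (cases "x <= 1 - x") (auto simp: min_def power_divide mult.commute)
  then have "(1 / m)\<^sup>2 / 5 <= Re (1 / z\<^sup>2) + Re (1 / (1 - z)\<^sup>2)" using 1 2 by linarith
  then show "norm (bump z) <= exp (- ((1 / m)\<^sup>2) / 5)" by (simp add: bump_def norm_exp_eq_Re del: Re_divide)
 qed (use m0 in auto)
 moreover have "\<bar>bd i x\<bar> <= norm ((deriv ^^ i) bump (of_real x))" using x abs_Re_le_cmod by (simp add: bd_def)
 moreover have "fact i * exp (- ((1 / m)\<^sup>2) / 5) / (m / 4) ^ i = fact i * 4 ^ i * ((1 / m) ^ i * exp (- ((1 / m)\<^sup>2) / 5))"
  by (simp add: power_divide field_simps)
 ultimately show ?thesis by linarith
qed

lemma bd_bound: "\<bar>bd i x\<bar> <= 8 ^ i * (fact i * sqrt (fact i))"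
proof (cases "0 < x \<and> x < 1")
 case True
 define m where "m = min x (1 - x)"
 have m0: "0 < m" using True by (simp add: m_def)
 have "\<bar>bd i x\<bar> <= fact i * 4 ^ i * ((1 / m) ^ i * exp (- ((1 / m)\<^sup>2) / 5))"
  using True by (intro bd_bound_aux) (auto simp: m_def)
 also have "... <= fact i * 4 ^ i * (2 ^ i * sqrt (fact i))"
  using m0 by (intro mult_left_mono power_exp_sq_le) auto
 also have "... = (4 * 2) ^ i * (fact i * sqrt (fact i))" unfolding power_mult_distrib by (simp only: mult_ac)
 finally show ?thesis by simp
qed (auto simp: bd_def)

text \<open>The exponential absorbs two more powers of \<open>1 / m\<close> than required, which
  leaves a quadratic factor. It yields derivative zero at the end points.\<close>

lemma bd_flat:
 assumes "x <= 0 \<or> 1 <= x"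
 shows "\<bar>bd i y\<bar> <= fact i * 4 ^ i * (2 ^ (i + 2) * sqrt (fact (i + 2))) * (y - x)\<^sup>2"
proof (cases "0 < y \<and> y < 1")
 case True
 define m where "m = min y (1 - y)"
 have m0: "0 < m" using True by (simp add: m_def)
 have my: "m\<^sup>2 <= (y - x)\<^sup>2"   proof -
  have "m <= \<bar>y - x\<bar>" using assms True unfolding m_def by linarith
  then show ?thesis using m0 power_mono[of m "\<bar>y - x\<bar>" 2] by simp
 qed
 have "\<bar>bd i y\<bar> <= fact i * 4 ^ i * ((1 / m) ^ i * exp (- ((1 / m)\<^sup>2) / 5))"
  using True by (intro bd_bound_aux) (auto simp: m_def)
 also have "(1 / m) ^ i = (1 / m) ^ (i + 2) * m\<^sup>2" using m0 by (simp add: power_add power2_eq_square)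
 also have "fact i * 4 ^ i * ((1 / m) ^ (i + 2) * m\<^sup>2 * exp (- ((1 / m)\<^sup>2) / 5))
   = fact i * 4 ^ i * ((1 / m) ^ (i + 2) * exp (- ((1 / m)\<^sup>2) / 5)) * m\<^sup>2" by (simp only: mult_ac)
 also have "... <= fact i * 4 ^ i * (2 ^ (i + 2) * sqrt (fact (i + 2))) * (y - x)\<^sup>2"
  using m0 my by (intro mult_mono mult_left_mono power_exp_sq_le) auto
 finally show ?thesis .
qed (auto simp: bd_def)

lemma bd_has_derivative: "(bd i has_real_derivative bd (Suc i) x) (at x)"
proof (cases "0 < x \<and> x < 1")
 case True
 let ?S = "{z :: complex. 0 < Re z \<and> Re z < 1}"
 have "open ?S" by (intro open_Collect_conj open_Collect_less continuous_intros)
 then have "((deriv ^^ i) bump has_field_derivative deriv ((deriv ^^ i) bump) (of_real x)) (at (of_real x))"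
  using holomorphic_derivI[OF holomorphic_higher_deriv[OF bump_holomorphic]] True by simp
 from has_real_derivative_Re_of_real[OF this]
 have "((%x. Re ((deriv ^^ i) bump (of_real x))) has_real_derivative bd (Suc i) x) (at x)"
  using True by (simp add: bd_def)
 then show ?thesis
  by (rule has_field_derivative_transform_within_open[of _ _ _ "{0<..<1}"]) (use True in \<open>auto simp: bd_def\<close>)
next
 case False
 define c where "c = fact i * 4 ^ i * (2 ^ (i + 2) * sqrt (fact (i + 2)))"
 have b: "\<bar>bd i y\<bar> <= c * (y - x)\<^sup>2" for y unfolding c_def using False by (intro bd_flat) auto
 have "bd i x = 0" "bd (Suc i) x = 0" using False by (auto simp: bd_def)
 moreover have "((%h. (bd i (x + h) - 0) / h) \<longlongrightarrow> 0) (at 0)"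
 proof (rule Lim_null_comparison)
  show "\<forall>\<^sub>F h in at 0. norm ((bd i (x + h) - 0) / h) <= c * \<bar>h\<bar>"
   unfolding eventually_at_filter
  proof (intro always_eventually allI impI)
   fix h :: real assume "h ~= 0"
   then show "norm ((bd i (x + h) - 0) / h) <= c * \<bar>h\<bar>"
    using b[of "x + h"] by (simp add: abs_divide divide_le_eq power2_eq_square mult.assoc flip: abs_mult)
  qed
  have "((%h. c * \<bar>h\<bar>) \<longlongrightarrow> c * \<bar>0\<bar>) (at 0)" by (intro tendsto_intros)
  then show "((%h. c * \<bar>h\<bar>) \<longlongrightarrow> 0) (at 0)" by simp
 qed
 ultimately show ?thesis by (simp add: DERIV_def)
qed

lemma bd_continuous: "continuous_on A (bd i)"
 by (rule continuous_at_imp_continuous_on) (meson DERIV_isCont bd_has_derivative)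

lemma bd_0_nonneg: "0 <= bd 0 x" and bd_0_half: "bd 0 (1 / 2) ~= 0"
proof -
 have e: "bump (of_real y) = of_real (exp (- (1 / y\<^sup>2) - 1 / (1 - y)\<^sup>2))" for y
  by (simp add: bump_def exp_of_real[symmetric])
 show "0 <= bd 0 x" "bd 0 (1 / 2) ~= 0" by (simp_all add: bd_def e del: of_real_divide)
qed

text \<open>One minus the normalised primitive of the bump: its derivatives of positive order are
  multiples of bumps and so vanish at both ends.\<close>

lemma gevrey_cutoff:
 obtains \<theta> :: "nat => real => real" and A :: real
 where "!!i t. 0 < t ==> t < 1 ==> (\<theta> i has_real_derivative \<theta> (Suc i) t) (at t)"
  and "!!i. continuous_on {0..1} (\<theta> i)"
  and "\<theta> 0 0 = 1" and "!!i. \<theta> (Suc i) 0 = 0" and "!!i. \<theta> i 1 = 0" and "0 < A"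
  and "!!i t. 0 <= t ==> t <= 1 ==> \<bar>\<theta> i t\<bar> <= A * 8 ^ i * (fact i * sqrt (fact i))"
proof -
 define I where "I t = integral {0..t} (bd 0)" for t
 have int: "bd 0 integrable_on {a..b}" for a b by (intro integrable_continuous_real bd_continuous)
 have I1: "0 < I 1"
 proof -
  have "I 1 ~= 0"
   unfolding I_def using bd_0_half bd_0_nonneg
   by (subst integral_eq_0_iff) (auto intro: bd_continuous bexI[of _ "1 / 2"])
  moreover have "0 <= I 1" unfolding I_def by (intro integral_nonneg int bd_0_nonneg)
  ultimately show ?thesis by simp
 qed
 have Ib: "0 <= I t" "I t <= I 1" if "0 <= t" "t <= 1" for t
  unfolding I_def using that bd_0_nonneg by (auto intro!: integral_nonneg int integral_subset_le)
 have Id: "(I has_real_derivative bd 0 t) (at t within {0..1})" if "t \<in> {0..1}" for t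
  unfolding I_def using that by (intro integral_has_real_derivative bd_continuous)
 define \<theta> where "\<theta> i t = (case i of 0 => 1 - I t / I 1 | Suc j => - (bd j t / I 1))" for i t
 have t0: "\<theta> 0 = (%t. 1 - I t / I 1)" and tS: "\<theta> (Suc j) = (%t. - (bd j t / I 1))" for j
  by (auto simp: \<theta>_def)
 show ?thesis
 \<comment> \<open>The constant covers both the function itself, bounded by 1, and its derivatives,
   which carry the factor \<open>1 / I 1\<close>.\<close>
 proof (rule that[of \<theta> "1 + 1 / I 1"])
  fix i and t :: real assume t: "0 < t" "t < 1"
  show "(\<theta> i has_real_derivative \<theta> (Suc i) t) (at t)"
  proof (cases i)
   case 0
   have "(I has_real_derivative bd 0 t) (at t within {0..1})" using Id[of t] t by simp
   moreover have "at t within {0..1} = at t" using t by (intro at_within_interior) simp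
   ultimately have "(I has_real_derivative bd 0 t) (at t)" by simp
   then have "((%t. 1 - I t / I 1) has_real_derivative 0 - bd 0 t / I 1) (at t)"
    by (intro DERIV_diff DERIV_const DERIV_cdivide)
   then show ?thesis by (simp add: 0 t0 tS)
  next
   case (Suc j)
   show ?thesis unfolding Suc tS by (intro DERIV_minus DERIV_cdivide bd_has_derivative)
  qed
 next
  fix i
  show "continuous_on {0..1} (\<theta> i)"
  proof (cases i)
   case 0
   have "continuous_on {0..1} I"
    by (intro continuous_on_eq_continuous_within[THEN iffD2] ballI DERIV_continuous[OF Id])
   then show ?thesis using I1 unfolding 0 t0 by (intro continuous_intros) auto
  next
   case (Suc j)
   show ?thesis unfolding Suc tS using I1 by (intro continuous_intros bd_continuous) auto
  qed
 next
  fix i and t :: real assume t: "0 <= t" "t <= 1"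
  show "\<bar>\<theta> i t\<bar> <= (1 + 1 / I 1) * 8 ^ i * (fact i * sqrt (fact i))"
  proof (cases i)
   case 0
   have "\<bar>1 - I t / I 1\<bar> <= 1" using Ib[OF t] I1 by (simp add: field_simps abs_le_iff)
   then show ?thesis using I1 unfolding 0 t0 by (simp add: add_increasing2)
  next
   case (Suc j)
   have "\<bar>bd j t\<bar> / I 1 <= (8 ^ j * (fact j * sqrt (fact j))) * (1 + 1 / I 1)"
   proof -
    have "\<bar>bd j t\<bar> / I 1 <= (8 ^ j * (fact j * sqrt (fact j))) * (1 / I 1)"
     using I1 bd_bound[of j t] by (simp add: divide_right_mono)
    also have "... <= (8 ^ j * (fact j * sqrt (fact j))) * (1 + 1 / I 1)" by (intro mult_left_mono) auto
    finally show ?thesis .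
   qed
   also have "... <= (8 ^ Suc j * (fact (Suc j) * sqrt (fact (Suc j)))) * (1 + 1 / I 1)"
    using I1 by (intro mult_right_mono mult_mono power_increasing fact_mono real_sqrt_le_mono) auto
   finally show ?thesis using I1 unfolding Suc tS by (simp add: mult_ac)
  qed
 next
  show "\<theta> 0 0 = 1" by (simp add: t0 I_def)
  show "\<theta> (Suc i) 0 = 0" for i by (simp add: tS bd_def)
  show "\<theta> i 1 = 0" for i using I1 by (cases i) (simp_all add: t0 tS bd_def)
  show "0 < 1 + 1 / I 1" using I1 by (simp add: add_pos_pos)
 qed
qed

section \<open>Leibniz' rule and a factorial estimate\<close>

lemma leibniz_sequence:
 fixes \<theta> :: "nat => real => real" and y :: "nat => real => complex"
 assumes "!!i. (\<theta> i has_real_derivative \<theta> (Suc i) t) (at t)" "!!i. (y i has_vector_derivative y (Suc i) t) (at t)"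
 shows "((%t. \<Sum>j\<le>i. (real (i choose j) * \<theta> (i - j) t) *\<^sub>R y j t) has_vector_derivative
   (\<Sum>j\<le>Suc i. (real (Suc i choose j) * \<theta> (Suc i - j) t) *\<^sub>R y j t)) (at t)"
proof -
 have "((%t. (real (i choose j) * \<theta> (i - j) t) *\<^sub>R y j t) has_vector_derivative
   (real (i choose j) * \<theta> (i - j) t) *\<^sub>R y (Suc j) t + (real (i choose j) * \<theta> (Suc (i - j)) t) *\<^sub>R y j t) (at t)" for j
  using assms by (intro has_vector_derivative_scaleR DERIV_cmult)
 then have "((%t. \<Sum>j\<le>i. (real (i choose j) * \<theta> (i - j) t) *\<^sub>R y j t) has_vector_derivative
   (\<Sum>j\<le>i. (real (i choose j) * \<theta> (i - j) t) *\<^sub>R y (Suc j) t + (real (i choose j) * \<theta> (Suc (i - j)) t) *\<^sub>R y j t)) (at t)"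
  by (intro has_vector_derivative_sum)
 moreover have "(\<Sum>j\<le>i. (real (i choose j) * \<theta> (i - j) t) *\<^sub>R y (Suc j) t + (real (i choose j) * \<theta> (Suc (i - j)) t) *\<^sub>R y j t)
   = (\<Sum>j\<le>Suc i. (real (Suc i choose j) * \<theta> (Suc i - j) t) *\<^sub>R y j t)"
 proof -
  let ?a = "%j. \<theta> (Suc i - j) t *\<^sub>R y j t"
  have "(\<Sum>j\<le>Suc i. (real (Suc i choose j) * \<theta> (Suc i - j) t) *\<^sub>R y j t)
    = ?a 0 + (\<Sum>j\<le>i. (real (i choose Suc j) + real (i choose j)) *\<^sub>R ?a (Suc j))"
   by (subst sum.atMost_Suc_shift) (simp add: add.commute)
  also have "... = (?a 0 + (\<Sum>j\<le>i. real (i choose Suc j) *\<^sub>R ?a (Suc j))) + (\<Sum>j\<le>i. real (i choose j) *\<^sub>R ?a (Suc j))"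
   by (simp add: scaleR_add_left distrib_right sum.distrib)
  also have "?a 0 + (\<Sum>j\<le>i. real (i choose Suc j) *\<^sub>R ?a (Suc j)) = (\<Sum>j\<le>Suc i. real (i choose j) *\<^sub>R ?a j)"
   by (subst sum.atMost_Suc_shift) simp
  also have "... = (\<Sum>j\<le>i. real (i choose j) *\<^sub>R ?a j)" by (simp add: binomial_eq_0)
  also have "... = (\<Sum>j\<le>i. (real (i choose j) * \<theta> (Suc (i - j)) t) *\<^sub>R y j t)"
   by (intro sum.cong) (auto simp: Suc_diff_le)
  finally show ?thesis by (simp add: sum.distrib add.commute)
 qed
 ultimately show ?thesis by simp
qed

text \<open>An analytic factor does not raise the Gevrey order: \<open>j! (i - j)!\<close> is at
  most \<open>i!\<close> and the square root grows with its argument, so only the geometric rates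
  \<open>P\<close> and \<open>Q\<close> add up.\<close>

lemma leibniz_bound:
 fixes \<theta> :: "nat => real" and y :: "nat => complex"
 assumes "!!i. \<bar>\<theta> i\<bar> <= A * P ^ i * (fact i * sqrt (fact i))" "!!i. norm (y i) <= B * Q ^ i * fact i"
  and nn: "0 <= A" "0 <= B" "0 <= P" "0 <= Q"
 shows "norm (\<Sum>j\<le>i. (real (i choose j) * \<theta> (i - j)) *\<^sub>R y j) <= A * B * (P + Q) ^ i * (fact i * sqrt (fact i))"
proof -
 have "norm (\<Sum>j\<le>i. (real (i choose j) * \<theta> (i - j)) *\<^sub>R y j)
   <= (\<Sum>j\<le>i. A * B * (fact i * sqrt (fact i)) * (real (i choose j) * Q ^ j * P ^ (i - j)))"
 proof (rule sum_norm_le)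
  fix j assume j: "j \<in> {..i}"
  have "norm ((real (i choose j) * \<theta> (i - j)) *\<^sub>R y j) <= real (i choose j) * (A * P ^ (i - j) * (fact (i - j) * sqrt (fact (i - j)))) * (B * Q ^ j * fact j)"
   using assms(1)[of "i - j"] assms(2)[of j] nn
   by (auto simp: abs_mult intro!: mult_mono mult_left_mono mult_nonneg_nonneg)
  also have "... = A * B * (fact j * fact (i - j) * sqrt (fact (i - j))) * (real (i choose j) * Q ^ j * P ^ (i - j))"
   by (simp only: mult_ac)
  also have "... <= A * B * (fact i * sqrt (fact i)) * (real (i choose j) * Q ^ j * P ^ (i - j))"
  proof (intro mult_right_mono mult_left_mono mult_mono real_sqrt_le_mono)
   have "fact j * fact (i - j) <= (fact j * fact (i - j) * (i choose j) :: nat)" using j by (simp add: Suc_le_eq zero_less_binomial)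
   also have "... = fact i" using j by (intro binomial_fact_lemma) auto
   finally have "real (fact j * fact (i - j)) <= real (fact i)" by (simp only: of_nat_le_iff)
   then show "fact j * fact (i - j) <= (fact i :: real)" by (simp only: of_nat_mult of_nat_fact)
   show "fact (i - j) <= (fact i :: real)" by (rule fact_mono) simp
  qed (use nn in auto)
  finally show "norm ((real (i choose j) * \<theta> (i - j)) *\<^sub>R y j) <= A * B * (fact i * sqrt (fact i)) * (real (i choose j) * Q ^ j * P ^ (i - j))" .
 qed
 also have "... = A * B * (fact i * sqrt (fact i)) * (P + Q) ^ i"
  using binomial_ring[of Q P i] by (simp add: sum_distrib_left add.commute)
 finally show ?thesis by (simp add: mult_ac)
qed

lemma fact_square_le: "(fact i :: real) * fact i <= fact (2 * i)"
proof -
 have "fact i * fact i * (2 * i choose i) = fact (2 * i)"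
  using binomial_fact_lemma[of i "2 * i"] by simp
 moreover have "fact i * fact i * 1 <= fact i * fact i * (2 * i choose i)" by (intro mult_left_mono) (auto simp: Suc_le_eq zero_less_binomial)
 ultimately have "real (fact i * fact i) <= real (fact (2 * i))" by (simp only: of_nat_le_iff mult_1_right)
 then show ?thesis by (simp only: of_nat_mult of_nat_fact)
qed

text \<open>Dividing by \<open>(2 i)! >= (i!)^2\<close> leaves \<open>x ^ i / sqrt (fact i)\<close>,
  which is summable for every \<open>x\<close>. Here it matters that the order is below 2.\<close>

lemma gevrey_summable:
 fixes x :: real
 assumes "0 <= x"
 shows "summable (%i. x ^ i * (fact i * sqrt (fact i)) / fact (2 * i))"
proof (rule summable_comparison_test')
 show "norm (x ^ i * (fact i * sqrt (fact i)) / fact (2 * i)) <= x ^ i / sqrt (fact i)" for i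
 proof -
  have s: "sqrt (fact i) * sqrt (fact i) = (fact i :: real)" by simp
  have "x ^ i * (fact i * sqrt (fact i)) / fact (2 * i) <= x ^ i * (fact i * sqrt (fact i)) / (fact i * fact i)"
   using assms by (intro divide_left_mono fact_square_le) auto
  also have "... = x ^ i * (sqrt (fact i) / (sqrt (fact i) * sqrt (fact i)))" unfolding s by (simp add: field_simps)
  also have "... = x ^ i / sqrt (fact i)" by (simp add: field_simps)
  finally show ?thesis using assms by simp
 qed
 show "summable (%i. x ^ i / sqrt (fact i))"
 proof -
  obtain N where N: "4 * x\<^sup>2 <= real N" using real_arch_simple by blast
  show ?thesis
 proof (rule summable_ratio_test[where c="1 / 2" and N=N])
  show "(1 / 2 :: real) < 1" by simp
  fix n assume n: "N <= n"
  have "2 * x <= sqrt (real (Suc n))"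
   by (rule real_le_rsqrt) (use N n in \<open>simp add: power_mult_distrib\<close>)
  then have "x / sqrt (real (Suc n)) <= 1 / 2" by (simp add: divide_le_eq)
  then have le: "x / sqrt (real (Suc n)) * (x ^ n / sqrt (fact n)) <= 1 / 2 * (x ^ n / sqrt (fact n))"
   using assms by (intro mult_right_mono) auto
  have eq: "x ^ Suc n / sqrt (fact (Suc n)) = x / sqrt (real (Suc n)) * (x ^ n / sqrt (fact n))"
   unfolding fact_Suc real_sqrt_mult by simp
  have nn: "norm (x ^ k / sqrt (fact k)) = x ^ k / sqrt (fact k)" for k using assms by simp
  show "norm (x ^ Suc n / sqrt (fact (Suc n))) <= 1 / 2 * norm (x ^ n / sqrt (fact n))"
   unfolding nn unfolding eq by (rule le)
 qed
 qed
qed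

section \<open>Volterra expansions from a base point\<close>

text \<open>An algebra of functions closed under \<open>iprim\<close>, in which every integral over
  a part of the unit interval exists.\<close>

definition bdd :: "(real => complex) => bool" where
 "bdd f \<longleftrightarrow> f \<in> borel_measurable borel \<and> (\<exists>B. \<forall>x. 0 < x --> x < 1 --> norm (f x) <= B)"

lemma bddI: "f \<in> borel_measurable borel ==> (!!x. 0 < x ==> x < 1 ==> norm (f x) <= B) ==> bdd f"
 unfolding bdd_def by blast

lemma bdd_meas [measurable_dest]: "bdd f ==> f \<in> borel_measurable borel"
 by (simp add: bdd_def)

lemma bddE:
 assumes "bdd f"
 obtains B where "0 <= B" "!!x. 0 < x ==> x < 1 ==> norm (f x) <= B"
proof -
 obtain B where B: "!!x. 0 < x ==> x < 1 ==> norm (f x) <= B" using assms by (auto simp: bdd_def)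
 moreover have "0 <= B" using order_trans[OF norm_ge_zero B[of "1/2"]] by simp
 ultimately show ?thesis using that by blast
qed

lemma bdd_add: "bdd f ==> bdd g ==> bdd (%x. f x + g x)"
proof -
 assume f: "bdd f" and g: "bdd g"
 obtain B where B: "!!x. 0 < x ==> x < 1 ==> norm (f x) <= B" using f by (rule bddE) blast
 obtain C where C: "!!x. 0 < x ==> x < 1 ==> norm (g x) <= C" using g by (rule bddE) blast
 show ?thesis
  by (rule bddI[where B="B + C"]) (use f g B C in \<open>auto intro!: norm_triangle_mono dest: bdd_meas\<close>)
qed

lemma bdd_mult: "bdd f ==> bdd g ==> bdd (%x. f x * g x)"
proof -
 assume f: "bdd f" and g: "bdd g"
 obtain B where B: "0 <= B" "!!x. 0 < x ==> x < 1 ==> norm (f x) <= B" using f by (rule bddE) blast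
 obtain C where C: "0 <= C" "!!x. 0 < x ==> x < 1 ==> norm (g x) <= C" using g by (rule bddE) blast
 show ?thesis
  by (rule bddI[where B="B * C"]) (use f g B C in \<open>auto simp: norm_mult intro!: mult_mono dest: bdd_meas\<close>)
qed

lemma bdd_const: "bdd (%x. c)"
 by (rule bddI[where B="norm c"]) auto

lemma bdd_minus: "bdd f ==> bdd (%x. - f x)"
 using bdd_mult[OF bdd_const[of "-1"], of f] by simp

lemma bdd_diff: "bdd f ==> bdd g ==> bdd (%x. f x - g x)"
 using bdd_add[OF _ bdd_minus] by fastforce

lemma bdd_sum: "(!!i. i \<in> A ==> bdd (f i)) ==> bdd (%x. \<Sum>i\<in>A. f i x)"
 by (induction A rule: infinite_finite_induct) (auto intro: bdd_const bdd_add)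

lemma bdd_L2:
 assumes f: "bdd f"
 shows "f \<in> L2_fun"
proof -
 obtain B where "0 <= B" "!!x. 0 < x ==> x < 1 ==> norm (f x) <= B" using f by (rule bddE) blast
 then show ?thesis by (intro norm_L2_of_le(1)[OF borel_imp_leb01[OF bdd_meas[OF f]], of B]) auto
qed

lemma bdd_prim_integrable:
 assumes f: "bdd f" and ab: "b <= 1" "0 <= a"
 shows "integrable lborel (%y. indicator {a<..<b} y *\<^sub>R f y)"
proof -
 obtain B where B: "0 <= B" "!!x. 0 < x ==> x < 1 ==> norm (f x) <= B" using f by (rule bddE) blast
 show ?thesis by (rule indicator_integrable_bounded[OF bdd_meas[OF f], where B=B]) (use B(2) ab in auto)
qed

lemma prim_add: "bdd f ==> bdd g ==> x <= 1 ==> prim (%y. f y + g y) x = prim f x + prim g x"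
 unfolding prim_def scaleR_add_right by (intro Bochner_Integration.integral_add bdd_prim_integrable) auto

lemma prim_diff_fun: "bdd f ==> bdd g ==> x <= 1 ==> prim (%y. f y - g y) x = prim f x - prim g x"
 unfolding prim_def scaleR_diff_right by (intro Bochner_Integration.integral_diff bdd_prim_integrable) auto

lemma prim_cmult: "prim (%y. c * f y) x = c * (prim f x :: complex)"
 unfolding prim_def by (subst integral_mult_right_zero[symmetric]) (simp add: mult_scaleR_right)

lemma prim_sum: "(!!i. i \<in> A ==> bdd (f i)) ==> x <= 1 ==> prim (%y. \<Sum>i\<in>A. f i y) x = (\<Sum>i\<in>A. prim (f i) x)"
proof (induction A rule: infinite_finite_induct)
 case (insert i A)
 then show ?case by (simp add: prim_add bdd_sum)
qed (auto simp: prim_def)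

definition clamp1 :: "real => real" where "clamp1 x = max 0 (min 1 x)"

lemma clamp1: "0 <= clamp1 x" "clamp1 x <= 1" "0 <= x ==> x <= 1 ==> clamp1 x = x"
 by (auto simp: clamp1_def)

text \<open>The primitive vanishing at \<open>x0\<close>. Clamping the argument makes the result
  continuous on the whole line, hence Borel, regardless of \<open>f\<close> outside the unit
  interval.\<close>

definition iprim :: "real => (real => complex) => real => complex" where
 "iprim x0 f x = prim f (clamp1 x) - prim f x0"

lemma iprim_eq: "0 <= x ==> x <= 1 ==> iprim x0 f x = prim f x - prim f x0"
 by (simp add: iprim_def clamp1)

lemma prim_lipschitz_sym:
 assumes f: "f \<in> borel_measurable borel" "!!y. 0 < y ==> y < 1 ==> norm (f y) <= B"
  and "0 <= x" "x <= 1" "0 <= y" "y <= 1"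
 shows "norm (prim f y - prim f x) <= B * \<bar>y - x\<bar>"
proof (cases "x <= y")
 case True
 then show ?thesis using prim_lipschitz[where b=1, OF f(1) f(2), of x y] assms(3-) by simp
next
 case False
 then show ?thesis using prim_lipschitz[where b=1, OF f(1) f(2), of y x] assms(3-) by (simp add: norm_minus_commute)
qed

lemma iprim_bdd:
 assumes f: "bdd f" and x0: "0 <= x0" "x0 <= 1"
 shows "bdd (iprim x0 f)"
proof -
 obtain B where B: "0 <= B" "!!x. 0 < x ==> x < 1 ==> norm (f x) <= B" using f by (rule bddE) blast
 have lip: "norm (prim f (clamp1 y) - prim f (clamp1 x)) <= B * \<bar>y - x\<bar>" for x y
 proof -
  have "norm (prim f (clamp1 y) - prim f (clamp1 x)) <= B * \<bar>clamp1 y - clamp1 x\<bar>"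
   by (rule prim_lipschitz_sym[OF bdd_meas[OF f] B(2)]) (auto simp: clamp1)
  also have "... <= B * \<bar>y - x\<bar>" using B by (intro mult_left_mono) (auto simp: clamp1_def)
  finally show ?thesis .
 qed
 have "continuous_on UNIV (%x. prim f (clamp1 x))"
 proof (rule continuous_onI)
  fix x e :: real assume e: "0 < e"
  have "dist (prim f (clamp1 y)) (prim f (clamp1 x)) <= e" if "dist y x < e / (B + 1)" for y
  proof -
   have "dist (prim f (clamp1 y)) (prim f (clamp1 x)) <= B * \<bar>y - x\<bar>" unfolding dist_norm by (rule lip)
   also have "... <= (B + 1) * \<bar>y - x\<bar>" by (intro mult_right_mono) auto
   also have "... <= (B + 1) * (e / (B + 1))" using that B by (intro mult_left_mono) (auto simp: dist_real_def)
   also have "... = e" using B by simp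
   finally show ?thesis .
  qed
  then show "\<exists>d>0. \<forall>y\<in>UNIV. dist y x < d --> dist (prim f (clamp1 y)) (prim f (clamp1 x)) <= e"
   using e B by (intro exI[of _ "e / (B + 1)"]) auto
 qed
 then have [measurable]: "(%x. prim f (clamp1 x)) \<in> borel_measurable borel" by (rule borel_measurable_continuous_onI)
 show ?thesis
 proof (rule bddI[where B=B])
  show "iprim x0 f \<in> borel_measurable borel" unfolding iprim_def by measurable
  fix x :: real assume x: "0 < x" "x < 1"
  have "norm (iprim x0 f x) <= B * \<bar>x - x0\<bar>"
   using lip[of x x0] x x0 by (simp add: iprim_def clamp1)
  also have "... <= B * 1" using x x0 B by (intro mult_left_mono) auto
  finally show "norm (iprim x0 f x) <= B" by simp
 qed
qed

lemma shift_power_deriv: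
 "((%y. (m * y + c) ^ Suc n / real (Suc n)) has_real_derivative m * (m * y + c) ^ n) (at y within A)"
proof -
 have "((%y. (m * y + c) ^ Suc n) has_real_derivative real (Suc n) * (m * (m * y + c) ^ n)) (at y within A)"
  by (auto intro!: derivative_eq_intros simp del: power_Suc)
 from DERIV_cdivide[OF this, of "real (Suc n)"] show ?thesis by simp
qed

lemma lint_power_right: "a <= b ==> (LINT y|lborel. (y - a) ^ n * indicator {a..b} y) = (b - a) ^ Suc n / real (Suc n)"
 using integral_FTC_Icc_real[of a b "%y. (y - a) ^ Suc n / real (Suc n)" "%y. (y - a) ^ n"] shift_power_deriv[of 1 "- a" n]
 by (simp add: continuous_on_diff continuous_on_power)

lemma iprim_power_bound:
 assumes f: "bdd f" and B: "0 <= B" "!!y. 0 < y ==> y < 1 ==> norm (f y) <= B * \<bar>y - x0\<bar> ^ n"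
  and x: "0 <= x" "x <= 1" and x0: "0 <= x0" "x0 <= 1"
 shows "norm (iprim x0 f x) <= B * \<bar>x - x0\<bar> ^ Suc n / real (Suc n)"
proof -
 have main: "norm (prim f b - prim f a) <= B * (b - a) ^ Suc n / real (Suc n)"
  if ab: "0 <= a" "a <= b" "b <= 1"
   and B: "!!y. a < y ==> y < b ==> norm (f y) <= B * p y" and p: "p \<in> borel_measurable borel"
   and i: "integrable lborel (%y. p y * indicator {a..b} y)" and v: "(LINT y|lborel. p y * indicator {a..b} y) = (b - a) ^ Suc n / real (Suc n)"
   and p0: "!!y. a <= y ==> y <= b ==> 0 <= p y"
  for a b p
 proof -
  have "prim f b - prim f a = (LINT u|lborel. indicator {a<..<b} u *\<^sub>R f u)"
   using ab by (intro prim_diff[where b=1] bdd_prim_integrable[OF f]) auto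
  also have "norm ... <= (LINT u|lborel. norm (indicator {a<..<b} u *\<^sub>R f u))" by (rule integral_norm_bound)
  also have "... <= (LINT u|lborel. B * (p u * indicator {a..b} u))"
  proof (rule integral_mono)
   show "integrable lborel (%u. norm (indicator {a<..<b} u *\<^sub>R f u))"
    using ab by (intro integrable_norm bdd_prim_integrable[OF f]) auto
   show "integrable lborel (%u. B * (p u * indicator {a..b} u))" using i by simp
   show "norm (indicator {a<..<b} u *\<^sub>R f u) <= B * (p u * indicator {a..b} u)" for u
    using B[of u] p0[of u] assms(2) by (auto simp: indicator_def)
  qed
  also have "... = B * ((b - a) ^ Suc n / real (Suc n))" by (simp only: integral_mult_right_zero v)
  finally show ?thesis by simp
 qed
 show ?thesis
 proof (cases "x0 <= x")
  case True
  have "norm (prim f x - prim f x0) <= B * (x - x0) ^ Suc n / real (Suc n)"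
  proof (rule main[where p="%y. (y - x0) ^ n"])
   show "integrable lborel (%y. (y - x0) ^ n * indicator {x0..x} y)"
    using borel_integrable_atLeastAtMost[of x0 x "%y. (y - x0) ^ n"] by (auto intro!: continuous_intros simp: mult.commute)
   show "norm (f y) <= B * (y - x0) ^ n" if "x0 < y" "y < x" for y using B(2)[of y] that x x0 by simp
  qed (use True x x0 lint_power_right in auto)
  then show ?thesis using True x by (simp add: iprim_eq)
 next
  case False
  have "(LINT y|lborel. (x0 - y) ^ n * indicator {x..x0} y) = (x0 - x) ^ Suc n / real (Suc n)"
  proof -
   have "((%y. - ((x0 - y) ^ Suc n / real (Suc n))) has_real_derivative (x0 - y) ^ n) (at y)" for y
    using DERIV_minus[OF shift_power_deriv[of "-1" x0 n y]] by simp
   then show ?thesis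
    using integral_FTC_Icc_real[of x x0 "%y. - ((x0 - y) ^ Suc n / real (Suc n))" "%y. (x0 - y) ^ n"] False
    by (simp add: continuous_on_diff continuous_on_power)
  qed
  then have "norm (prim f x0 - prim f x) <= B * (x0 - x) ^ Suc n / real (Suc n)"
  proof (rule main[where p="%y. (x0 - y) ^ n", rotated 6])
   show "integrable lborel (%y. (x0 - y) ^ n * indicator {x..x0} y)"
    using borel_integrable_atLeastAtMost[of x x0 "%y. (x0 - y) ^ n"] by (auto intro!: continuous_intros simp: mult.commute)
   show "norm (f y) <= B * (x0 - y) ^ n" if "x < y" "y < x0" for y using B(2)[of y] that x x0 by simp
  qed (use False x x0 in auto)
  then show ?thesis using False x by (simp add: iprim_eq norm_minus_commute abs_minus_commute)
 qed
qed

context coef begin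

lemma bdd_rho: "bdd (%x. of_real (\<rho> x))"
 by (rule bddI[where B=K]) (use rho_pos rho_le in \<open>auto simp: abs_of_pos\<close>)

text \<open>The functions of the Volterra series: a flux coefficient of order \<open>i\<close> at
  \<open>x0\<close> contributes \<open>gg x0 i\<close> to the solution and \<open>gv x0 i\<close> to
  the flux. For \<open>\<rho> = 1\<close> they are the powers of \<open>x - x0\<close> of degree
  \<open>2 i + 1\<close> and \<open>2 i\<close>, divided by the factorials of the degrees.\<close>

primrec gv :: "real => nat => real => complex" where
 "gv x0 0 = (%x. 1)"
| "gv x0 (Suc i) = iprim x0 (iprim x0 (%s. of_real (\<rho> s) * gv x0 i s))"

definition gg :: "real => nat => real => complex" where
 "gg x0 i = iprim x0 (%s. of_real (\<rho> s) * gv x0 i s)"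

lemma gv_Suc: "gv x0 (Suc i) = iprim x0 (gg x0 i)"
 by (simp add: gg_def)

lemma gv_bdd: "0 <= x0 ==> x0 <= 1 ==> bdd (gv x0 i)"
 by (induction i) (auto intro!: bdd_const iprim_bdd bdd_mult bdd_rho)

lemma gg_bdd: "0 <= x0 ==> x0 <= 1 ==> bdd (gg x0 i)"
 unfolding gg_def by (intro iprim_bdd bdd_mult bdd_rho gv_bdd)

text \<open>Two primitives raise the order of vanishing at the base point by two.\<close>

lemma two_primitives_bound:
 assumes f: "bdd f" and B: "0 <= B" "!!y. 0 <= y ==> y <= 1 ==> norm (f y) <= B * \<bar>y - x0\<bar> ^ n / fact n"
  and x0: "0 <= x0" "x0 <= 1" and x: "0 <= x" "x <= 1"
 shows "norm (iprim x0 f x) <= B * \<bar>x - x0\<bar> ^ Suc n / fact (Suc n)"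
  and "norm (iprim x0 (%s. of_real (\<rho> s) * iprim x0 f s) x) <= K * B * \<bar>x - x0\<bar> ^ (n + 2) / fact (n + 2)"
proof -
 have 1: "norm (iprim x0 f x) <= B * \<bar>x - x0\<bar> ^ Suc n / fact (Suc n)" if x: "0 <= x" "x <= 1" for x
 proof -
  have "norm (iprim x0 f x) <= (B / fact n) * \<bar>x - x0\<bar> ^ Suc n / real (Suc n)"
   by (rule iprim_power_bound[OF f _ _ x x0]) (use B in auto)
  then show ?thesis by (simp add: field_simps)
 qed
 then show "norm (iprim x0 f x) <= B * \<bar>x - x0\<bar> ^ Suc n / fact (Suc n)" using x .
 have K0: "0 < K" using K1 by simp
 have "norm (iprim x0 (%s. of_real (\<rho> s) * iprim x0 f s) x) <= (K * B / fact (Suc n)) * \<bar>x - x0\<bar> ^ Suc (Suc n) / real (Suc (Suc n))"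
 proof (rule iprim_power_bound[OF bdd_mult[OF bdd_rho iprim_bdd[OF f x0]] _ _ x x0])
  fix y :: real assume y: "0 < y" "y < 1"
  have "norm (of_real (\<rho> y) * iprim x0 f y) <= K * (B * \<bar>y - x0\<bar> ^ Suc n / fact (Suc n))"
   unfolding norm_mult using 1[of y] y rho_pos[of y] rho_le[of y] K0 by (intro mult_mono) auto
  then show "norm (of_real (\<rho> y) * iprim x0 f y) <= K * B / fact (Suc n) * \<bar>y - x0\<bar> ^ Suc n"
   by (simp add: mult_ac)
 qed (use K0 B in auto)
 also have "... = K * B * \<bar>x - x0\<bar> ^ (n + 2) / fact (n + 2)" by (simp add: divide_simps)
 finally show "norm (iprim x0 (%s. of_real (\<rho> s) * iprim x0 f s) x) <= K * B * \<bar>x - x0\<bar> ^ (n + 2) / fact (n + 2)" .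
qed

lemma gv_gg_power_bound:
 assumes x0: "0 <= x0" "x0 <= 1" and x: "0 <= x" "x <= 1"
 shows "norm (gg x0 i x) <= K ^ Suc i * \<bar>x - x0\<bar> ^ (2 * i + 1) / fact (2 * i + 1)"
 using x
proof (induction i arbitrary: x)
 case 0
 have "norm (iprim x0 (%s. of_real (\<rho> s) * gv x0 0 s) x) <= K * \<bar>x - x0\<bar> ^ Suc 0 / real (Suc 0)"
  by (rule iprim_power_bound[OF bdd_mult[OF bdd_rho gv_bdd] _ _ 0 x0])
    (use x0 rho_pos rho_le K1 in \<open>auto simp: abs_of_pos\<close>)
 then show ?case by (simp add: gg_def)
next
 case (Suc i)
 have e: "gg x0 (Suc i) = iprim x0 (%s. of_real (\<rho> s) * iprim x0 (gg x0 i) s)" by (simp add: gg_def)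
 have "norm (gg x0 (Suc i) x) <= K * K ^ Suc i * \<bar>x - x0\<bar> ^ (2 * i + 1 + 2) / fact (2 * i + 1 + 2)"
  unfolding e using K1 by (intro two_primitives_bound(2)[OF gg_bdd _ _ _ _ Suc.prems] Suc.IH x0) auto
 moreover have "2 * i + 1 + 2 = 2 * Suc i + 1" by simp
 ultimately show ?case by (simp only: power_Suc mult.assoc)
qed

lemma fact_mono_divide: "m <= n ==> a \<ge> 0 ==> a / (fact n :: real) <= a / fact m"
 by (intro divide_left_mono fact_mono mult_pos_pos) auto

text \<open>The power of the distance is dropped and the denominator lowered, so that
  \<open>gg\<close> and \<open>gv\<close> obey the same bound.\<close>

lemma gg_bound:
 assumes x0: "0 <= x0" "x0 <= 1" and x: "0 <= x" "x <= 1"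
 shows "norm (gg x0 i x) <= K ^ Suc i / fact (2 * i)"
proof -
 have "norm (gg x0 i x) <= K ^ Suc i * \<bar>x - x0\<bar> ^ (2 * i + 1) / fact (2 * i + 1)"
  by (rule gv_gg_power_bound[OF x0 x])
 also have "... <= K ^ Suc i * 1 / fact (2 * i + 1)"
  using K1 x x0 by (intro divide_right_mono mult_left_mono power_le_one) auto
 also have "... <= K ^ Suc i * 1 / fact (2 * i)" using K1 by (intro fact_mono_divide) auto
 finally show ?thesis by simp
qed

lemma gv_bound:
 assumes x0: "0 <= x0" "x0 <= 1" and x: "0 <= x" "x <= 1"
 shows "norm (gv x0 i x) <= K ^ Suc i / fact (2 * i)"
proof (cases i)
 case 0
 then show ?thesis using K1 by simp
next
 case (Suc j)
 have "norm (iprim x0 (gg x0 j) x) <= K ^ Suc j * \<bar>x - x0\<bar> ^ Suc (2 * j + 1) / fact (Suc (2 * j + 1))"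
  using K1 by (intro two_primitives_bound(1)[OF gg_bdd _ _ _ _ x] gv_gg_power_bound x0) auto
 also have "... <= K ^ Suc j * 1 / fact (Suc (2 * j + 1))"
  using K1 x x0 by (intro divide_right_mono mult_left_mono power_le_one) auto
 also have "... <= K ^ Suc i / fact (2 * i)"
  unfolding Suc using K1 by (intro frac_le power_increasing fact_mono) (auto intro: power_increasing)
 finally show ?thesis unfolding Suc gv_Suc .
qed

lemma iprim_diff_sum:
 assumes f: "bdd f" and g: "!!i. i < n ==> bdd (g i)" and x: "0 <= x" "x <= 1" and x0: "0 <= x0" "x0 <= 1"
 shows "iprim x0 (%y. f y - (\<Sum>i<n. c i * g i y)) x = iprim x0 f x - (\<Sum>i<n. c i * iprim x0 (g i) x)"
proof -
 have b: "bdd (%y. c i * g i y)" if "i < n" for i using g[OF that] by (intro bdd_mult bdd_const)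
 have "prim (%y. f y - (\<Sum>i<n. c i * g i y)) x = prim f x - (\<Sum>i<n. c i * prim (g i) x)" if "x <= 1" for x
  using prim_diff_fun[OF f bdd_sum[of "{..<n}", OF b] that] prim_sum[of "{..<n}", OF b that] by (simp add: prim_cmult)
 then show ?thesis using x x0 by (simp add: iprim_eq sum_subtractf right_diff_distrib)
qed

text \<open>Here \<open>\<omega> j\<close> and \<open>v j\<close> model the \<open>j\<close>-th time
  derivatives of state and flux, linked by two first order equations in space. Going once through
  both costs one time derivative and gains two orders of vanishing. The state is zero at
  \<open>x0\<close>, so only flux values enter the series.\<close>

lemma volterra_expansion:
 assumes x0: "0 <= x0" "x0 <= 1"
  and \<omega>: "!!j. bdd (\<omega> j)" and v: "!!j. bdd (v j)"
  and v_eq: "!!j x. 0 <= x ==> x <= 1 ==> v j x = v j x0 + iprim x0 (\<omega> (Suc j)) x"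
  and \<omega>_eq: "!!j x. 0 <= x ==> x <= 1 ==> \<omega> j x = iprim x0 (%s. of_real (\<rho> s) * v j s) x"
  and B: "!!j x. 0 <= x ==> x <= 1 ==> norm (\<omega> j x) <= B j"
  and x: "0 <= x" "x <= 1"
 shows "norm (\<omega> j x - (\<Sum>i<n. v (j + i) x0 * gg x0 i x)) <= K ^ n * B (j + n) * \<bar>x - x0\<bar> ^ (2 * n) / fact (2 * n)"
 using x
proof (induction n arbitrary: j x)
 case 0
 then show ?case using B by simp
next
 case (Suc n)
 have B0: "0 <= B j" for j using order_trans[OF norm_ge_zero B[of 0 j]] by simp
 \<comment> \<open>The remainder for the next time derivative with one term less. One integration
   gives the remainder of the flux, a second one that of the state.\<close>
 define E where "E y = \<omega> (Suc j) y - (\<Sum>i<n. v (Suc j + i) x0 * gg x0 i y)" for y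
 have E: "bdd E" unfolding E_def by (intro bdd_diff bdd_sum bdd_mult bdd_const \<omega> gg_bdd x0)
 have Eb: "norm (E y) <= K ^ n * B (Suc j + n) * \<bar>y - x0\<bar> ^ (2 * n) / fact (2 * n)" if "0 <= y" "y <= 1" for y
  unfolding E_def by (rule Suc.IH[OF that])
 have vE: "v j y - (\<Sum>i<Suc n. v (j + i) x0 * gv x0 i y) = iprim x0 E y" if y: "0 <= y" "y <= 1" for y
 proof -
  have "iprim x0 E y = iprim x0 (\<omega> (Suc j)) y - (\<Sum>i<n. v (Suc j + i) x0 * gv x0 (Suc i) y)"
   unfolding E_def gv_Suc by (rule iprim_diff_sum[OF \<omega> gg_bdd[OF x0] y x0])
  then show ?thesis using v_eq[OF y, of j] by (simp add: sum.lessThan_Suc_shift del: gv.simps(2) sum.lessThan_Suc)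
 qed
 have "\<omega> j x - (\<Sum>i<Suc n. v (j + i) x0 * gg x0 i x)
   = iprim x0 (%s. of_real (\<rho> s) * v j s) x - (\<Sum>i<Suc n. v (j + i) x0 * iprim x0 (%s. of_real (\<rho> s) * gv x0 i s) x)"
  using \<omega>_eq[OF Suc.prems] by (simp add: gg_def)
 also have "... = iprim x0 (%s. of_real (\<rho> s) * v j s - (\<Sum>i<Suc n. v (j + i) x0 * (of_real (\<rho> s) * gv x0 i s))) x"
  by (rule iprim_diff_sum[symmetric, OF bdd_mult[OF bdd_rho v] bdd_mult[OF bdd_rho gv_bdd[OF x0]] Suc.prems x0])
 also have "... = iprim x0 (%s. of_real (\<rho> s) * iprim x0 E s) x"
 proof -
  have "of_real (\<rho> s) * v j s - (\<Sum>i<Suc n. v (j + i) x0 * (of_real (\<rho> s) * gv x0 i s)) = of_real (\<rho> s) * iprim x0 E s"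
   if "0 < s" "s < 1" for s
   using that by (subst vE[symmetric]) (auto simp: right_diff_distrib sum_distrib_left mult.left_commute simp del: sum.lessThan_Suc)
  then have "prim (%s. of_real (\<rho> s) * v j s - (\<Sum>i<Suc n. v (j + i) x0 * (of_real (\<rho> s) * gv x0 i s))) x
    = prim (%s. of_real (\<rho> s) * iprim x0 E s) x" if "x <= 1" for x
   using that by (intro prim_cong) auto
  then show ?thesis using Suc.prems x0 by (simp only: iprim_eq)
 qed
 also have "norm ... <= K * (K ^ n * B (Suc j + n)) * \<bar>x - x0\<bar> ^ (2 * n + 2) / fact (2 * n + 2)"
  using K1 B0 Eb by (intro two_primitives_bound(2)[OF E _ _ x0 Suc.prems]) auto
 finally show ?case by (simp add: mult.assoc)
qed

end

section \<open>Absolutely continuous functions, products, and localisation of solutions\<close>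

definition ac :: "(real => complex) => (real => complex) => bool" where
 "ac f f' \<longleftrightarrow> bdd f \<and> bdd f' \<and> (\<forall>x. 0 <= x --> x <= 1 --> f x = f 0 + prim f' x)"

lemma acI: "bdd f ==> bdd f' ==> (!!x. 0 <= x ==> x <= 1 ==> f x = f 0 + prim f' x) ==> ac f f'"
 unfolding ac_def by blast

lemma acD:
 assumes "ac f f'"
 shows "bdd f" "bdd f'" "0 <= x ==> x <= 1 ==> f x = f 0 + prim f' x"
 using assms unfolding ac_def by blast+

lemma ac_const: "ac (%x. c) (%x. 0)"
 by (rule acI) (simp_all add: bdd_const prim_def)

lemma ac_add:
 assumes f: "ac f f'" and g: "ac g g'"
 shows "ac (%x. f x + g x) (%x. f' x + g' x)"
proof (rule acI)
 fix x :: real assume x: "0 <= x" "x <= 1"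
 have "f x + g x = (f 0 + prim f' x) + (g 0 + prim g' x)" by (rule arg_cong2[OF acD(3)[OF f x] acD(3)[OF g x]])
 then show "f x + g x = f 0 + g 0 + prim (%x. f' x + g' x) x"
  unfolding prim_add[OF acD(2)[OF f] acD(2)[OF g] x(2)] by (simp only: add_ac)
qed (use acD[OF f] acD[OF g] in \<open>blast intro: bdd_add\<close>)+

lemma ac_cmult:
 assumes "ac f f'"
 shows "ac (%x. c * f x) (%x. c * f' x)"
proof -
 have "c * f x = c * f 0 + prim (%x. c * f' x) x" if "0 <= x" "x <= 1" for x
  unfolding prim_cmult distrib_left[symmetric] by (rule arg_cong[OF acD(3)[OF assms that]])
 moreover have "bdd (%x. c * f x)" "bdd (%x. c * f' x)" using acD(1,2)[OF assms] by (auto intro!: bdd_mult bdd_const)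
 ultimately show ?thesis unfolding ac_def by blast
qed

lemma ac_sum: "(!!i. i \<in> A ==> ac (f i) (f' i)) ==> ac (%x. \<Sum>i\<in>A. f i x) (%x. \<Sum>i\<in>A. f' i x)"
 by (induction A rule: infinite_finite_induct) (auto intro: ac_const ac_add)

lemma ac_iprim: "bdd f ==> 0 <= x0 ==> x0 <= 1 ==> ac (iprim x0 f) f"
 by (rule acI) (simp_all add: iprim_bdd iprim_eq)

text \<open>Integration by parts for merely bounded integrands: the square is cut into two triangles
  and Fubini is applied to one of them.\<close>

lemma prim_mult:
 assumes f: "bdd f" and g: "bdd g" and x: "x <= 1"
 shows "prim f x * prim g x = prim (%y. f y * prim g y + prim f y * g y) x"
proof (cases "0 <= x")
 case True
 define F where "F y = indicator {0<..<x} y *\<^sub>R f y" for y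
 define G where "G y = indicator {0<..<x} y *\<^sub>R g y" for y
 have i: "integrable lborel F" "integrable lborel G"
  unfolding F_def G_def using f g x by (auto intro!: bdd_prim_integrable)
 have 1: "(LINT y|lborel. indicator {s<..} y *\<^sub>R F y) = prim f x - prim f s" if "0 < s" "s < x" for s
 proof -
  have "prim f x - prim f s = (LINT u|lborel. indicator {s<..<x} u *\<^sub>R f u)"
   by (rule prim_diff[where b=1]) (use f x that in \<open>auto intro!: bdd_prim_integrable\<close>)
  also have "... = (LINT y|lborel. indicator {s<..} y *\<^sub>R F y)"
   using that by (intro integral_eqI) (auto simp: F_def indicator_def)
  finally show ?thesis by simp
 qed
 have 2: "(LINT s|lborel. indicator {..<y} s *\<^sub>R G s) = prim g y" if "0 < y" "y < x" for y
  unfolding prim_def G_def using that by (intro integral_eqI) (auto simp: indicator_def)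
 have b: "bdd (%y. iprim 0 h y)" if "bdd h" for h using that by (intro iprim_bdd) auto
 have "(LINT s|lborel. G s * (LINT y|lborel. indicator {s<..} y *\<^sub>R F y)) = prim (%s. (prim f x - iprim 0 f s) * g s) x"
  unfolding prim_def[of "%s. (prim f x - iprim 0 f s) * g s"] using x 1
  by (intro integral_eqI) (auto simp: G_def indicator_def iprim_eq)
 moreover have "(LINT y|lborel. F y * (LINT s|lborel. indicator {..<y} s *\<^sub>R G s)) = prim (%y. f y * iprim 0 g y) x"
  unfolding prim_def[of "%y. f y * iprim 0 g y"] using x 2
  by (intro integral_eqI) (auto simp: F_def indicator_def iprim_eq)
 ultimately have "prim (%s. prim f x * g s - iprim 0 f s * g s) x = prim (%y. f y * iprim 0 g y) x"
  using fubini_triangle[OF i] by (simp add: left_diff_distrib)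
 then have "prim f x * prim g x = prim (%y. f y * iprim 0 g y + iprim 0 f y * g y) x"
  using x f g b by (simp add: prim_diff_fun prim_add bdd_mult bdd_const prim_cmult diff_eq_eq)
 also have "... = prim (%y. f y * prim g y + prim f y * g y) x"
  using x by (intro prim_cong) (auto simp: iprim_eq)
 finally show ?thesis .
qed simp

lemma ac_mult:
 assumes f: "ac f f'" and g: "ac g g'"
 shows "ac (%x. f x * g x) (%x. f' x * g x + f x * g' x)"
proof -
 note b = acD(1,2)[OF f] acD(1,2)[OF g]
 have "f x * g x = f 0 * g 0 + prim (%x. f' x * g x + f x * g' x) x" if x: "0 <= x" "x <= 1" for x
 proof -
  have i: "bdd (iprim 0 f')" "bdd (iprim 0 g')" using b by (auto intro!: iprim_bdd)
  have "prim (%y. f' y * g y + f y * g' y) x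
    = prim (%y. (g 0 * f' y + f 0 * g' y) + (f' y * iprim 0 g' y + iprim 0 f' y * g' y)) x"
  proof (intro prim_cong)
   fix y assume y: "0 < y" "y < x"
   have e: "f y = f 0 + iprim 0 f' y" "g y = g 0 + iprim 0 g' y"
    using acD(3)[OF f, of y] acD(3)[OF g, of y] x y by (auto simp: iprim_eq)
   show "f' y * g y + f y * g' y = (g 0 * f' y + f 0 * g' y) + (f' y * iprim 0 g' y + iprim 0 f' y * g' y)"
    unfolding e by (simp add: algebra_simps)
  qed
  also have "... = g 0 * prim f' x + f 0 * prim g' x + prim (%y. f' y * iprim 0 g' y + iprim 0 f' y * g' y) x"
   using x by (subst prim_add, intro bdd_add bdd_mult bdd_const b, intro bdd_add bdd_mult bdd_const b i, simp)
    (subst prim_add, intro bdd_mult bdd_const b, intro bdd_mult bdd_const b, simp, simp add: prim_cmult)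
  also have "prim (%y. f' y * iprim 0 g' y + iprim 0 f' y * g' y) x = prim (%y. f' y * prim g' y + prim f' y * g' y) x"
   using x by (intro prim_cong) (auto simp: iprim_eq)
  also have "... = prim f' x * prim g' x" using prim_mult[OF b(2,4)] x by simp
  finally have "prim (%y. f' y * g y + f y * g' y) x = g 0 * prim f' x + f 0 * prim g' x + prim f' x * prim g' x" .
  moreover have "f x * g x = (f 0 + prim f' x) * (g 0 + prim g' x)" by (rule arg_cong2[OF acD(3)[OF f x] acD(3)[OF g x]])
  moreover have "(a + p) * (b' + q) = a * b' + (b' * p + a * q + p * q)" for a p b' q :: complex by (simp add: algebra_simps)
  ultimately show ?thesis by (simp only:)
 qed
 moreover have "bdd (%x. f x * g x)" "bdd (%x. f' x * g x + f x * g' x)" using b by (auto intro!: bdd_mult bdd_add)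
 ultimately show ?thesis unfolding ac_def by blast
qed

lemma bdd_unit_rep:
 assumes f: "bdd f"
 shows "unit_rep (%x. indicator {0<..<1} x * f x)" "L2_of (%x. indicator {0<..<1} x * f x) = L2_of f"
proof -
 have m: "(%x. indicator {0<..<1} x * f x) \<in> borel_measurable borel" using bdd_meas[OF f] by measurable
 have ae: "AE x in leb01. indicator {0<..<1} x * f x = f x"
  by (rule AE_I2) (auto simp: space_restrict_space)
 have L: "(%x. indicator {0<..<1} x * f x) \<in> L2_fun"
  by (rule L2_fun_AE_cong[OF bdd_L2[OF f] borel_imp_leb01[OF m]]) (use ae in \<open>auto elim: eventually_mono\<close>)
 have "(%y. indicator {0<..<1} y *\<^sub>R f y) = (%x. indicator {0<..<1} x * f x)" by (auto simp: indicator_def)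
 then show "unit_rep (%x. indicator {0<..<1} x * f x)"
  using m L bdd_prim_integrable[OF f, of 1 0] by (auto simp: unit_rep_def)
 show "L2_of (%x. indicator {0<..<1} x * f x) = L2_of f"
  by (subst L2_of_eq_iff[OF L bdd_L2[OF f]]) (rule ae)
qed

context coef begin

text \<open>A form of \<open>primitive_solution\<close> whose hypotheses can be verified by the
  calculus of sums and products for \<open>ac\<close> alone; \<open>w\<close> is the flux of
  \<open>Z\<close>.\<close>

lemma ac_solution:
 assumes Z: "ac Z (%s. of_real (\<rho> s) * w s)" "Z 0 = 0" "Z 1 = 0" and w: "ac w f"
 shows "L2_of Z = - green (L2_of f)"
proof -
 have eq: "Z x = - zf (L2_of f) x" if x: "0 <= x" "x <= 1" for x
  unfolding bdd_unit_rep(2)[OF acD(2)[OF w], symmetric]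
 proof (rule primitive_solution(2)[where v=w and ?v0.0="w 0" and z=Z])
  show "unit_rep (%x. indicator {0<..<1} x * f x)" by (rule bdd_unit_rep(1)[OF acD(2)[OF w]])
  show "Z 1 = 0" "0 <= x" "x <= 1" by fact+
  fix x :: real assume x: "0 <= x" "x <= 1"
  have "prim (%x. indicator {0<..<1} x * f x) x = prim f x" using x by (intro prim_cong) auto
  then show "w x = w 0 + prim (%x. indicator {0<..<1} x * f x) x" using acD(3)[OF w x] by simp
  show "Z x = prim (%s. of_real (\<rho> s) * w s) x" using acD(3)[OF Z(1) x] Z(2) by simp
 qed
 have L: "(%x. (-1) * zf (L2_of f) x) \<in> L2_fun" by (intro L2_fun_cmult zf_L2)
 have "L2_of Z = L2_of (%x. (-1) * zf (L2_of f) x)"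
  by (subst L2_of_eq_iff[OF bdd_L2[OF acD(1)[OF Z(1)]] L]) (use eq in \<open>auto intro!: AE_I2 simp: space_restrict_space\<close>)
 also have "... = - green (L2_of f)"
  unfolding green_def using L2_of_scaleR[OF zf_L2, of "-1" "L2_of f"] by (simp add: scaleR_conv_of_real)
 finally show ?thesis .
qed

lemma gg_ac: "0 <= x0 ==> x0 <= 1 ==> ac (gg x0 i) (%s. of_real (\<rho> s) * gv x0 i s)"
 unfolding gg_def by (intro ac_iprim bdd_mult bdd_rho gv_bdd)

lemma gv_ac: "0 <= x0 ==> x0 <= 1 ==> ac (gv x0 i) (case i of 0 => %s. 0 | Suc j => gg x0 j)"
 by (cases i) (auto simp: gg_def intro!: ac_const ac_iprim iprim_bdd bdd_mult bdd_rho gv_bdd)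

text \<open>Localising a finite Volterra sum with the cutoff \<open>\<psi>\<close>, whose flux is \<open>\<kappa> \<eta>\<close>, produces a source supported where
 \<open>\<eta>\<close> lives, up to the shifted sum.\<close>

lemma localized_sum:
 fixes n :: nat and b :: "nat => complex"
 assumes x0: "0 <= x0" "x0 <= 1" and chi: "ac \<psi> (%s. of_real (\<rho> s) * (\<kappa> * \<eta> s))" and eta: "ac \<eta> e"
  and z: "!!i. \<psi> 0 * gg x0 i 0 = 0" "!!i. \<psi> 1 * gg x0 i 1 = 0"
 defines "P \<equiv> (%x. \<Sum>i<Suc n. b i * gg x0 i x)" and "Q \<equiv> (%x. \<Sum>i<Suc n. b i * gv x0 i x)"
 shows "L2_of (%x. \<psi> x * P x) = - green (L2_of (%x. \<psi> x * (\<Sum>i<n. b (Suc i) * gg x0 i x)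
  + \<kappa> * (e x * P x + 2 * (\<eta> x * (of_real (\<rho> x) * Q x)))))"
proof -
 have P: "ac P (%s. \<Sum>i<Suc n. b i * (of_real (\<rho> s) * gv x0 i s))"
  unfolding P_def by (intro ac_sum ac_cmult gg_ac x0)
 then have P: "ac P (%s. of_real (\<rho> s) * Q s)"
  by (simp add: Q_def sum_distrib_left mult.left_commute del: sum.lessThan_Suc)
 have "ac Q (%s. \<Sum>i<Suc n. b i * (case i of 0 => %s. 0 | Suc j => gg x0 j) s)"
  unfolding Q_def by (intro ac_sum ac_cmult gv_ac x0)
 then have Q: "ac Q (%s. \<Sum>i<n. b (Suc i) * gg x0 i s)"
  by (simp add: sum.lessThan_Suc_shift del: sum.lessThan_Suc)
 have w: "ac (%x. \<kappa> * (\<eta> x * P x) + \<psi> x * Q x) (%x. \<kappa> * (e x * P x + \<eta> x * (of_real (\<rho> x) * Q x))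
   + (of_real (\<rho> x) * (\<kappa> * \<eta> x) * Q x + \<psi> x * (\<Sum>i<n. b (Suc i) * gg x0 i x)))"
  by (intro ac_add ac_cmult ac_mult P Q eta chi)
 have "ac (%x. \<psi> x * P x) (%x. of_real (\<rho> x) * (\<kappa> * \<eta> x) * P x + \<psi> x * (of_real (\<rho> x) * Q x))"
  by (intro ac_mult P chi)
 then have Z: "ac (%x. \<psi> x * P x) (%x. of_real (\<rho> x) * (\<kappa> * (\<eta> x * P x) + \<psi> x * Q x))"
  by (simp add: algebra_simps)
 have "L2_of (%x. \<psi> x * P x) = - green (L2_of (%x. \<kappa> * (e x * P x + \<eta> x * (of_real (\<rho> x) * Q x))
   + (of_real (\<rho> x) * (\<kappa> * \<eta> x) * Q x + \<psi> x * (\<Sum>i<n. b (Suc i) * gg x0 i x))))"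
 proof (rule ac_solution[OF Z _ _ w])
  show "\<psi> 0 * P 0 = 0" "\<psi> 1 * P 1 = 0" unfolding P_def sum_distrib_left
   by (intro sum.neutral ballI; use z in \<open>simp only: mult.left_commute[of "\<psi> _"] mult_zero_right\<close>)+
 qed
 then show ?thesis by (simp add: algebra_simps)
qed

text \<open>The \<open>j\<close>-th time derivatives at \<open>t\<close> of the solution started at \<open>z\<close> and of its flux; the index \<open>Suc j\<close> makes up for
 the Green operator contained in \<open>zf\<close> and \<open>flux\<close>.\<close>

definition psol :: "real => L2 => nat => real => complex" where
 "psol t z j x = (-1) ^ j * zf (sgd (Suc j) t z) x"

definition pflx :: "real => L2 => nat => real => complex" where
 "pflx t z j x = (-1) ^ j * flux (sgd (Suc j) t z) x"

lemma zf_0: "zf F 0 = 0"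
 using zf_eq_prim[of 0] by simp

lemma zf_bdd: "bdd (zf F)"
 using K1 zf_bound[of _ F] by (intro bddI[where B="2 * K * norm F"]) auto

lemma psol_bound:
 assumes t: "0 < t" and x: "x <= 1"
 shows "norm (psol t z j x) <= 2 * K * (fact (Suc j) / t ^ Suc j * norm z)"
proof -
 have "norm (psol t z j x) <= 2 * K * norm (sgd (Suc j) t z)"
  using zf_bound[OF x] by (simp add: psol_def norm_mult norm_power)
 also have "... <= 2 * K * (fact (Suc j) / t ^ Suc j * norm z)"
  using K1 by (intro mult_left_mono sgd_norm t) auto
 finally show ?thesis .
qed

text \<open>The base point may be an end point, where the boundary condition holds at all times, as
  in the construction of controls; or it may be any point where all time derivatives vanish, as in
  unique continuation.\<close>

lemma heat_expansion_power:
 assumes t: "0 < t" and x0: "0 <= x0" "x0 <= 1" and z0: "!!j. psol t z j x0 = 0" and x: "0 <= x" "x <= 1"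
 shows "norm (psol t z 0 x - (\<Sum>i<n. pflx t z i x0 * gg x0 i x))
  <= K ^ n * (2 * K * (fact (Suc n) / t ^ Suc n * norm z)) * \<bar>x - x0\<bar> ^ (2 * n) / fact (2 * n)"
proof -
 note zb = zf_bdd
 have fb: "bdd (flux F)" for F using flux_bound[of F] by (intro bddI[where B="2 * norm F"]) auto
 have p: "bdd (psol t z j)" for j unfolding psol_def by (intro bdd_mult bdd_const zb)
 have q: "bdd (pflx t z j)" for j unfolding pflx_def by (intro bdd_mult bdd_const fb)
 have "norm (psol t z 0 x - (\<Sum>i<n. pflx t z (0 + i) x0 * gg x0 i x))
   <= K ^ n * (2 * K * (fact (Suc (0 + n)) / t ^ Suc (0 + n) * norm z)) * \<bar>x - x0\<bar> ^ (2 * n) / fact (2 * n)"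
 proof (rule volterra_expansion[where v="pflx t z" and \<omega>="psol t z", OF x0 p q _ _ _ x])
  fix j and x :: real assume x: "0 <= x" "x <= 1"
  have "prim (%s. of_real (\<rho> s) * pflx t z j s) y = psol t z j y" if "y <= 1" for y
   using zf_eq_prim[OF that] prim_cmult[of "(-1) ^ j" "%s. of_real (\<rho> s) * flux (sgd (Suc j) t z) s" y]
   unfolding pflx_def psol_def mult.left_commute[of "of_real _" "(-1) ^ j"] by simp
  then show "psol t z j x = iprim x0 (%s. of_real (\<rho> s) * pflx t z j s) x"
   using x x0 z0[of j] by (simp add: iprim_eq)
  have W: "sgd (Suc j) t z = L2_of (%x. indicator {0<..<1} x * zf (sgd (Suc (Suc j)) t z) x)"
   unfolding bdd_unit_rep(2)[OF zb] using S_sgd[OF t, of "Suc j" z] by (simp add: green_def)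
  have fl: "flux (sgd (Suc j) t z) y = flux (sgd (Suc j) t z) 0 - prim (zf (sgd (Suc (Suc j)) t z)) y" if "0 <= y" "y <= 1" for y
  proof -
   have "prim (%x. indicator {0<..<1} x * zf (sgd (Suc (Suc j)) t z) x) y = prim (zf (sgd (Suc (Suc j)) t z)) y"
    using that by (intro prim_cong) auto
   then show ?thesis using flux_diff[OF bdd_unit_rep(1)[OF zb[of "sgd (Suc (Suc j)) t z"]] that] by (simp add: W[symmetric])
  qed
  have ps: "prim (psol t z (Suc j)) y = (-1) ^ Suc j * prim (zf (sgd (Suc (Suc j)) t z)) y" for y
   unfolding psol_def by (rule prim_cmult)
  have e: "flux (sgd (Suc j) t z) x = flux (sgd (Suc j) t z) x0
    - (prim (zf (sgd (Suc (Suc j)) t z)) x - prim (zf (sgd (Suc (Suc j)) t z)) x0)"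
   unfolding fl[OF x] fl[OF x0] by simp
  show "pflx t z j x = pflx t z j x0 + iprim x0 (psol t z (Suc j)) x"
   unfolding iprim_eq[OF x] ps pflx_def e by (simp add: algebra_simps)
  show "norm (psol t z j x) <= 2 * K * (fact (Suc j) / t ^ Suc j * norm z)" by (rule psol_bound[OF t x(2)])
 qed
 then show ?thesis by simp
qed

lemma heat_expansion:
 assumes t: "0 < t" and x0: "0 <= x0" "x0 <= 1" and z0: "!!j. psol t z j x0 = 0" and x: "0 <= x" "x <= 1"
 shows "norm (psol t z 0 x - (\<Sum>i<n. pflx t z i x0 * gg x0 i x)) <= 2 * K / t * norm z * ((2 * K / t) ^ n * fact n / fact (2 * n))"
proof -
 have "norm (psol t z 0 x - (\<Sum>i<n. pflx t z i x0 * gg x0 i x))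
  <= K ^ n * (2 * K * (fact (Suc n) / t ^ Suc n * norm z)) * (\<bar>x - x0\<bar> ^ (2 * n) / fact (2 * n))"
  using heat_expansion_power[OF t x0 z0 x] by simp
 also have "... <= K ^ n * (2 * K * ((2 ^ n * fact n) / t ^ Suc n * norm z)) * (1 / fact (2 * n))"
 proof (intro mult_mono mult_left_mono divide_right_mono mult_right_mono power_le_one)
  \<comment> \<open>The factor \<open>Suc n\<close> of the factorial is absorbed into the geometric
    rate.\<close>
  have "real (Suc n) <= 2 ^ n" using of_nat_less_two_power[of n] by (metis Suc_leI of_nat_le_iff of_nat_numeral of_nat_power less_exp)
  then show "fact (Suc n) <= (2 ^ n * fact n :: real)" by (simp add: mult_right_mono)
 qed (use K1 t x x0 in auto)
 also have "... = 2 * K / t * norm z * ((2 * K / t) ^ n * fact n / fact (2 * n))"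
  by (simp add: power_mult_distrib power_divide mult_ac)
 finally show ?thesis by simp
qed

lemma heat_expansion_limit:
 assumes t: "0 < t"
 shows "(%n. 2 * K / t * norm z * ((2 * K / t) ^ n * fact n / fact (2 * n))) \<longlonglongrightarrow> 0"
proof -
 have K0: "0 <= 2 * K / t" using K1 t by simp
 have "(%n. (2 * K / t) ^ n * fact n / fact (2 * n)) \<longlonglongrightarrow> 0"
 proof (rule tendsto_sandwich[OF _ _ tendsto_const summable_LIMSEQ_zero[OF gevrey_summable[OF K0]]])
  show "\<forall>\<^sub>F n in sequentially. (2 * K / t) ^ n * fact n / fact (2 * n) <= (2 * K / t) ^ n * (fact n * sqrt (fact n)) / fact (2 * n)"
   using K0 by (intro always_eventually allI divide_right_mono mult_left_mono) auto
 qed (use K0 in \<open>auto intro!: always_eventually\<close>)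
 then show ?thesis using tendsto_mult_right_zero by blast
qed

end

section \<open>A tent function supported in the control interval\<close>

lemma prim_indicator:
 assumes "0 <= a" "a <= b"
 shows "prim (indicator {a<..<b}) x = (of_real (max 0 (min x b - a)) :: complex)"
proof -
 have "prim (indicator {a<..<b}) x = (LINT y|lborel. indicator {a<..<min x b} y *\<^sub>R (1::complex))"
  unfolding prim_def using assms by (intro integral_eqI) (auto simp: indicator_def)
 also have "... = of_real (max 0 (min x b - a))"
  by (cases "a <= min x b") (auto simp: scaleR_conv_of_real max_def)
 finally show ?thesis .
qed

text \<open>A tent over \<open>(c,d)\<close> with slopes 1 and -1. It serves as the flux of the
  cutoff in space: the cutoff has derivative proportional to \<open>\<rho>\<close> times the tent,
  so that \<open>\<rho>\<close> itself is never differentiated.\<close>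

definition hat :: "real => real => real => real" where
 "hat c d x = max 0 (min x ((c + d) / 2) - c) - max 0 (min x d - (c + d) / 2)"

definition hat' :: "real => real => real => complex" where
 "hat' c d x = indicator {c<..<(c + d) / 2} x - indicator {(c + d) / 2<..<d} x"

lemma hat:
 assumes "0 <= c" "c < d" "d <= 1"
 shows "ac (%x. of_real (hat c d x)) (hat' c d)" "x \<notin> {c<..<d} ==> hat c d x = 0" "0 <= hat c d x" "hat c d x <= 1"
  "x \<in> {c + (d - c) / 4<..<d - (d - c) / 4} ==> (d - c) / 4 <= hat c d x"
  "x \<notin> {c<..<d} ==> hat' c d x = 0" "norm (hat' c d x) <= 1" "hat c d \<in> borel_measurable borel"
proof -
 have b: "bdd (indicator {a<..<b})" for a b by (rule bddI[where B=1]) (auto simp: indicator_def)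
 have h: "bdd (hat' c d)" unfolding hat'_def by (intro bdd_diff b)
 have hx: "hat c d x = 0 \<or> (c < x \<and> x < d \<and> hat c d x = min (x - c) (d - x))" for x
  using assms by (auto simp: hat_def max_def min_def field_simps)
 show 0: "x \<notin> {c<..<d} ==> hat c d x = 0" "0 <= hat c d x" "hat c d x <= 1"
  "x \<in> {c + (d - c) / 4<..<d - (d - c) / 4} ==> (d - c) / 4 <= hat c d x" for x
  using assms by (auto simp: hat_def max_def min_def field_simps)
 show m: "hat c d \<in> borel_measurable borel" unfolding hat_def by measurable
 have "prim (hat' c d) x = of_real (hat c d x)" if "x <= 1" for x
 proof -
  have "hat' c d = (%x. indicator {c<..<(c + d) / 2} x - indicator {(c + d) / 2<..<d} x)" by (intro ext) (simp add: hat'_def)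
  then show ?thesis
   using assms prim_diff_fun[OF b b that] prim_indicator[of c "(c + d) / 2" x] prim_indicator[of "(c + d) / 2" d x] by (simp add: hat_def)
 qed
 moreover have "bdd (%x. of_real (hat c d x))" using 0(2,3) m by (intro bddI[where B=1]) auto
 ultimately show "ac (%x. of_real (hat c d x)) (hat' c d)"
  using h assms 0(1)[of 0] by (intro acI) auto
 show "x \<notin> {c<..<d} ==> hat' c d x = 0" "norm (hat' c d x) <= 1" using assms by (auto simp: hat'_def indicator_def field_simps)
qed

lemma emeasure_lborel_Ioo_less_top: "emeasure lborel {a<..<b::real} < top"
 by (cases "a <= b") (auto simp: emeasure_lborel_Ioo)

text \<open>On the middle half of the interval the tent is at least \<open>(d - c) / 4\<close> and
  \<open>\<rho>\<close> at least \<open>1 / K\<close>. The mass normalises the cutoff in space, so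
  its lower bound enters the control cost.\<close>

lemma (in coef) hat_mass:
 assumes "0 <= c" "c < d" "d <= 1"
 obtains m where "(d - c)\<^sup>2 / (8 * K) <= m" "prim (%s. of_real (\<rho> s) * of_real (hat c d s)) 1 = (of_real m :: complex)"
proof -
 define m where "m = (LINT s|lborel. indicator {0<..<1} s * (\<rho> s * hat c d s))"
 have [measurable]: "hat c d \<in> borel_measurable borel" by (rule hat(8)[OF assms])
 have i: "integrable lborel (%s. indicator {0<..<1} s * (\<rho> s * hat c d s))"
 proof -
  have "\<bar>\<rho> y * hat c d y\<bar> <= K * 1" for y
   unfolding abs_mult using rho_pos[of y] rho_le[of y] hat(3,4)[OF assms, of y] by (intro mult_mono) auto
  then show ?thesis using indicator_integrable_bounded[of "%s. \<rho> s * hat c d s" 0 1 K] by simp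
 qed
 have "prim (%s. of_real (\<rho> s) * of_real (hat c d s)) 1 = (LINT s|lborel. (of_real (indicator {0<..<1} s * (\<rho> s * hat c d s)) :: complex))"
  unfolding prim_def by (intro integral_eqI) (auto simp: indicator_def)
 then have e: "prim (%s. of_real (\<rho> s) * of_real (hat c d s)) 1 = (of_real m :: complex)"
  unfolding m_def by (simp only: integral_complex_of_real)
 have "(d - c)\<^sup>2 / (8 * K) = (LINT s|lborel. indicator {c + (d - c) / 4<..<d - (d - c) / 4} s * ((1 / K) * ((d - c) / 4)))"
 proof -
  have "d - (d - c) / 4 - (c + (d - c) / 4) = (d - c) / 2" by (simp add: field_simps)
  moreover have "c + (d - c) / 4 <= d - (d - c) / 4" using assms by (simp add: field_simps)
  ultimately have m: "measure lborel {c + (d - c) / 4<..<d - (d - c) / 4} = (d - c) / 2" by (simp only: measure_lborel_Ioo)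
  have "(LINT s|lborel. indicator {c + (d - c) / 4<..<d - (d - c) / 4} s * ((1 / K) * ((d - c) / 4)))
    = measure lborel {c + (d - c) / 4<..<d - (d - c) / 4} * ((1 / K) * ((d - c) / 4))" by simp
  then show ?thesis unfolding m by (simp add: power2_eq_square)
 qed
 also have "... <= m"
  unfolding m_def
 proof (rule integral_mono[OF _ i])
  show "integrable lborel (%s. indicator {c + (d - c) / 4<..<d - (d - c) / 4} s * (1 / K * ((d - c) / 4)))"
   by (intro integrable_mult_left integrable_real_indicator) (auto simp: emeasure_lborel_Ioo_less_top)
  fix s
  show "indicator {c + (d - c) / 4<..<d - (d - c) / 4} s * (1 / K * ((d - c) / 4)) <= indicator {0<..<1} s * (\<rho> s * hat c d s)"
  proof (cases "s \<in> {c + (d - c) / 4<..<d - (d - c) / 4}")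
   case True
   then have "s \<in> {0<..<1}" using assms by (auto simp: field_simps)
   moreover have "1 / K * ((d - c) / 4) <= \<rho> s * hat c d s"
    using hat(5)[OF assms True] rho_ge[of s] rho_pos[of s] K1 assms by (intro mult_mono) auto
   ultimately show ?thesis using True by simp
  next
   case False
   then show ?thesis using rho_pos[of s] hat(3)[OF assms, of s] by simp
  qed
 qed
 finally show ?thesis using e by (rule that)
qed

section \<open>Null controllability\<close>

lemma ci_add:
 assumes "nice u M" "nice v N" "J \<in> sets borel"
 shows "control_input J (%p. u p + v p) = (%s. control_input J u s + control_input J v s)"
 using L2_of_add[OF control_slice(2)[OF assms(1,3)] control_slice(2)[OF assms(2,3)]]
 by (intro ext) (simp add: control_input_def distrib_left)

lemma ci_scaleR:
 assumes "nice u M" "J \<in> sets borel"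
 shows "control_input J (%p. r *\<^sub>R u p) = (%s. r *\<^sub>R control_input J u s)"
 using L2_of_scaleR[OF control_slice(2)[OF assms]] by (intro ext) (simp add: control_input_def)

lemma niceD:
 assumes "nice u M"
 shows "u \<in> borel_measurable borel" "norm (u p) <= M"
 using assms unfolding nice_def by blast+

lemma nice_add: "nice u M ==> nice v N ==> nice (%p. u p + v p) (M + N)"
 by (auto simp: nice_def intro: norm_triangle_mono)

lemma nice_scaleR: "nice u M ==> nice (%p. r *\<^sub>R u p) (\<bar>r\<bar> * M)"
 by (auto simp: nice_def intro: mult_left_mono)

lemma nice_mono: "nice u M ==> M <= M' ==> nice u M'"
 by (auto simp: nice_def intro: order_trans)

lemma nice_zero: "0 <= M ==> nice (%p. 0) M"
 by (simp add: nice_def)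

lemma nice_shift:
 assumes "nice u M"
 shows "nice (%p. u (fst p + h, snd p)) M"
proof -
 have "(%p. u (fst p + h, snd p)) \<in> borel_measurable (borel \<Otimes>\<^sub>M borel)" by (rule nice_meas[OF assms]) measurable
 then show ?thesis using assms by (simp add: nice_def borel_prod)
qed

lemma nice_limit:
 assumes v: "!!k. nice (v k) M" "!!p. (%k. v k p) \<longlonglongrightarrow> u p"
 shows "nice u M"
 unfolding nice_def
proof (intro conjI allI)
 show "u \<in> borel_measurable borel" by (rule borel_measurable_LIMSEQ_metric[OF niceD(1)[OF v(1)] v(2)])
 show "norm (u p) <= M" for p by (rule LIMSEQ_le_const2[OF tendsto_norm[OF v(2)]]) (use niceD(2)[OF v(1)] in auto)
qed

lemma ci_tendsto:
 assumes v: "!!k. nice (v k) M" "!!p. (%k. v k p) \<longlonglongrightarrow> u p" and J: "J \<in> sets borel"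
 shows "(%k. control_input J (v k) s) \<longlonglongrightarrow> control_input J u s"
 unfolding control_input_def
proof (rule L2_of_tendsto[where w="%x. of_real M"])
 show "(%x. indicator J x * v k (s, x)) \<in> borel_measurable leb01" for k by (rule borel_imp_leb01[OF control_slice(1)[OF v(1) J]])
 show "(%x. indicator J x * u (s, x)) \<in> borel_measurable leb01" by (rule borel_imp_leb01[OF control_slice(1)[OF nice_limit[OF v] J]])
 show "(%k. indicator J x * v k (s, x)) \<longlonglongrightarrow> indicator J x * u (s, x)" for x by (intro tendsto_intros v)
 show "norm (indicator J x * v k (s, x)) <= norm (complex_of_real M)" for k x
  using niceD(2)[OF v(1), of k "(s, x)"] by (auto simp: indicator_def)
 show "(%x. complex_of_real M) \<in> L2_fun" by (intro bdd_L2 bdd_const)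
qed

text \<open>Concatenation: \<open>u\<close> up to time \<open>t\<close>, then \<open>v\<close> with
  its clock reset to zero.\<close>

definition cc :: "real => (real \<times> real => complex) => (real \<times> real => complex) => real \<times> real => complex" where
 "cc t u v p = (if fst p <= t then u p else v (fst p - t, snd p))"

lemma nice_cc:
 assumes u: "nice u M" and v: "nice v M"
 shows "nice (cc t u v) M"
proof -
 have [measurable]: "u \<in> borel_measurable (borel \<Otimes>\<^sub>M borel)" "(%p. v (fst p - t, snd p)) \<in> borel_measurable (borel \<Otimes>\<^sub>M borel)"
  using u nice_shift[OF v, of "- t"] by (auto simp: nice_def borel_prod)
 have "cc t u v \<in> borel_measurable (borel \<Otimes>\<^sub>M borel)" unfolding cc_def[abs_def] by measurable
 then show ?thesis using u v by (auto simp: nice_def cc_def borel_prod)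
qed

lemma Q_sets: "J \<in> sets borel ==> {0<..<t::real} \<times> J \<in> sets borel"
 by (intro borel_Times) auto

lemma bounded_integrable_Q:
 fixes f :: "real \<times> real => 'a::{banach, second_countable_topology}"
 assumes f: "f \<in> borel_measurable borel" "!!p. norm (f p) <= B" and J: "J \<in> sets borel" "J \<subseteq> {0<..<1}"
 shows "integrable (lebesgue_on ({0<..<t} \<times> J)) f" and "finite_measure (lebesgue_on ({0<..<t} \<times> J))"
  and "f \<in> borel_measurable (lebesgue_on ({0<..<t} \<times> J))"
proof -
 have "emeasure lborel ({0<..<t} \<times> J) <= emeasure lborel (cbox (0, 0) (t, 1 :: real))"
  by (intro emeasure_mono) (use J in \<open>force simp: cbox_Pair_eq\<close>, simp)
 also have "... < \<infinity>" by (rule emeasure_lborel_cbox_finite)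
 finally have "emeasure lebesgue ({0<..<t} \<times> J) < \<infinity>" using Q_sets[OF J(1), of t] by simp
 then show fin: "finite_measure (lebesgue_on ({0<..<t} \<times> J))"
  using Q_sets[OF J(1), of t] by (intro finite_measureI) (auto simp: emeasure_restrict_space space_restrict_space)
 show m: "f \<in> borel_measurable (lebesgue_on ({0<..<t} \<times> J))"
  using f(1) by (intro measurable_restrict_space1 measurable_completion) (simp add: measurable_lborel1)
 show "integrable (lebesgue_on ({0<..<t} \<times> J)) f"
  by (rule finite_measure.integrable_const_bound[OF fin AE_I2[OF f(2)] m])
qed

context coef begin

lemma duh_ci_AE:
 assumes u: "nice u M" and v: "nice v N" and J: "J \<in> sets borel" and ae: "AE q in lebesgue_on ({0<..<t} \<times> J). u q = v q"
 shows "duh (control_input J u) t = duh (control_input J v) t"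
 by (rule duh_cong_AE[OF control_input_measurable[OF u J] control_input_measurable[OF v J] control_input_AE[OF v J ae]])

lemma duh_ci_tendsto:
 assumes v: "!!k. nice (v k) M" "!!p. (%k. v k p) \<longlonglongrightarrow> u p" and J: "J \<in> sets borel" and t: "0 <= t"
 shows "(%k. duh (control_input J (v k)) t) \<longlonglongrightarrow> duh (control_input J u) t"
 by (rule duh_tendsto[OF control_input_measurable[OF v(1) J] control_slice(3)[OF v(1) J] control_input_measurable[OF nice_limit[OF v] J] t])
   (simp add: ci_tendsto[OF v J])

lemma duh_cc:
 assumes u: "nice u M" and v: "nice v M" and J: "J \<in> sets borel" and t: "0 <= t" "0 <= r"
 shows "duh (control_input J (cc t u v)) (t + r) = sg r (duh (control_input J u) t) + duh (control_input J v) r"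
proof -
 note c = control_input_measurable[OF nice_cc[OF u v] J] control_slice(3)[OF nice_cc[OF u v] J]
 have "duh (control_input J (cc t u v)) t = duh (control_input J u) t"
  by (rule duh_cong_AE[OF c(1) control_input_measurable[OF u J]]) (auto simp: control_input_def cc_def)
 moreover have "duh (%s. control_input J (cc t u v) (t + s)) r = duh (control_input J v) r"
 proof (rule duh_cong_AE[OF _ control_input_measurable[OF v J]])
  show "(%s. control_input J (cc t u v) (t + s)) \<in> borel_measurable borel" by (rule measurable_compose[OF _ c(1)]) simp
 qed (auto simp: control_input_def cc_def)
 ultimately show ?thesis using duh_concat[OF c t] by simp
qed

lemma sg_lin: "sg t (a + b) = sg t a + sg t b" "sg t (a - b) = sg t a - sg t b" "sg t (- a) = - sg t a" "sg t (r *\<^sub>R a) = r *\<^sub>R sg t a" "sg t 0 = 0"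
 using bounded_linear.linear[OF sg_bounded_linear] by (simp_all add: linear_add linear_diff linear_neg linear_scale linear_0)

lemma duh_zero: "duh (control_input J (%p. 0)) t = 0"
proof -
 have "control_input J (%p. 0) = (%s. 0)" by (intro ext) (simp add: control_input_def L2_of_zero)
 then show ?thesis using duh_scaleR[of 0 "%s. 0"] by simp
qed

end

text \<open>Multiplication by the cutoff, rescaled to \<open>[0,L]\<close>, keeps all initial
  derivatives of the analytic curve and annihilates all final ones; Leibniz' rule produces the new
  derivatives. The constant \<open>A\<close> depends on the cutoff alone and is fixed before
  \<open>L\<close>, \<open>B\<close>, \<open>Q\<close> and the curve.\<close>

lemma gevrey_transition:
 "\<exists>A>0. \<forall>L B Q (y :: nat => real => complex). 0 < L \<and> 0 <= B \<and> 0 <= Q \<and>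
   (\<forall>j s. 0 <= s --> s <= L --> (y j has_vector_derivative y (Suc j) s) (at s)) \<and>
   (\<forall>j s. 0 <= s --> s <= L --> norm (y j s) <= B * Q ^ j * fact j) -->
   (\<exists>Y :: nat => real => complex. (\<forall>i. continuous_on UNIV (Y i)) \<and>
    (\<forall>i s. 0 < s --> s < L --> (Y i has_vector_derivative Y (Suc i) s) (at s)) \<and>
    (\<forall>i. Y i 0 = y i 0 \<and> Y i L = 0) \<and> (\<forall>i s. norm (Y i s) <= A * B * (8 / L + Q) ^ i * (fact i * sqrt (fact i))))"
proof -
 obtain \<theta> :: "nat => real => real" and A where th: "!!i t. 0 < t ==> t < 1 ==> (\<theta> i has_real_derivative \<theta> (Suc i) t) (at t)"
   "!!i. continuous_on {0..1} (\<theta> i)" "\<theta> 0 0 = 1" "!!i. \<theta> (Suc i) 0 = 0" "!!i. \<theta> i 1 = 0" and A: "0 < A"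
   "!!i t. 0 <= t ==> t <= 1 ==> \<bar>\<theta> i t\<bar> <= A * 8 ^ i * (fact i * sqrt (fact i))"
  using gevrey_cutoff by metis
 show ?thesis
 proof (intro exI[of _ A] conjI allI impI A(1))
  fix L B Q :: real and y :: "nat => real => complex"
  assume asm: "0 < L \<and> 0 <= B \<and> 0 <= Q \<and>
   (\<forall>j s. 0 <= s --> s <= L --> (y j has_vector_derivative y (Suc j) s) (at s)) \<and>
   (\<forall>j s. 0 <= s --> s <= L --> norm (y j s) <= B * Q ^ j * fact j)"
  have L: "0 < L" and B: "0 <= B" "0 <= Q" and y: "!!j s. 0 <= s ==> s <= L ==> (y j has_vector_derivative y (Suc j) s) (at s)"
   and yb: "!!j s. 0 <= s ==> s <= L ==> norm (y j s) <= B * Q ^ j * fact j"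
   using asm by blast+
  define \<phi> where "\<phi> i s = \<theta> i (s / L) / L ^ i" for i s
  define Z where "Z i s = (\<Sum>j\<le>i. (real (i choose j) * \<phi> (i - j) s) *\<^sub>R y j s)" for i s
  \<comment> \<open>Clamping the time makes the curves continuous on the whole line and their bounds
    valid at all times.\<close>
  define cl where "cl s = max 0 (min L s)" for s
  have cl: "0 <= cl s" "cl s <= L" "0 <= s ==> s <= L ==> cl s = s" for s using L by (auto simp: cl_def)
  have ph': "(\<phi> i has_real_derivative \<phi> (Suc i) s) (at s)" if "0 < s" "s < L" for i s
  proof -
   have "((%s. \<theta> i (s / L)) has_real_derivative \<theta> (Suc i) (s / L) * (1 / L)) (at s)"
    using that L by (intro DERIV_chain'[where g="\<theta> i"] th(1)) (auto intro!: derivative_eq_intros)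
   from DERIV_cdivide[OF this, of "L ^ i"] show ?thesis by (simp add: \<phi>_def[abs_def])
  qed
  have Z': "(Z i has_vector_derivative Z (Suc i) s) (at s)" if "0 < s" "s < L" for i s
   unfolding Z_def[abs_def] by (rule leibniz_sequence) (use that ph' y in auto)
  have phc: "continuous_on {0..L} (\<phi> i)" for i
   unfolding \<phi>_def using L by (intro continuous_intros continuous_on_compose2[OF th(2)]) (auto simp: field_simps)
  have yc: "continuous_on {0..L} (y j)" for j
   by (rule continuous_at_imp_continuous_on, intro ballI, rule has_vector_derivative_continuous, rule y) auto
  have Zc: "continuous_on {0..L} (Z i)" for i
   unfolding Z_def by (intro continuous_intros phc yc)
  have "continuous_on UNIV (%s. Z i (cl s))" for i
   by (rule continuous_on_compose2[OF Zc]) (use L in \<open>auto simp: cl_def intro!: continuous_intros\<close>)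
  moreover have "((%s. Z i (cl s)) has_vector_derivative Z (Suc i) (cl s)) (at s)" if s: "0 < s" "s < L" for i s
  proof (rule has_vector_derivative_transform_within_open[where S="{0<..<L}"])
   show "(Z i has_vector_derivative Z (Suc i) (cl s)) (at s)" using Z'[OF s] cl(3)[of s] s by simp
  qed (use s cl in auto)
  moreover have "Z i (cl 0) = y i 0" for i
  proof -
   have "\<phi> (i - j) 0 = 0" if "j < i" for j
    using th(4)[of "i - Suc j"] that by (simp add: \<phi>_def Suc_diff_Suc)
   then have "Z i 0 = (\<Sum>j\<le>i. if j = i then y i 0 else 0)"
    unfolding Z_def by (intro sum.cong refl) (auto simp: \<phi>_def th(3))
   then show ?thesis using cl(3)[of 0] L by simp
  qed
  moreover have "Z i (cl L) = 0" for i
   using cl(3)[of L] L by (simp add: Z_def \<phi>_def th(5))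
  moreover have "norm (Z i (cl s)) <= A * B * (8 / L + Q) ^ i * (fact i * sqrt (fact i))" for i s
   unfolding Z_def
  proof (rule leibniz_bound)
   show "\<bar>\<phi> i (cl s)\<bar> <= A * (8 / L) ^ i * (fact i * sqrt (fact i))" for i
   proof -
    have "\<bar>\<phi> i (cl s)\<bar> = \<bar>\<theta> i (cl s / L)\<bar> / L ^ i" using L by (simp add: \<phi>_def)
    also have "... <= (A * 8 ^ i * (fact i * sqrt (fact i))) / L ^ i"
     using L cl[of s] by (intro divide_right_mono A(2)) auto
    finally show ?thesis by (simp add: power_divide)
   qed
  qed (use A B L yb cl in auto)
  ultimately show "\<exists>Y. (\<forall>i. continuous_on UNIV (Y i)) \<and>
    (\<forall>i s. 0 < s --> s < L --> (Y i has_vector_derivative Y (Suc i) s) (at s)) \<and>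
    (\<forall>i. Y i 0 = y i 0 \<and> Y i L = 0) \<and> (\<forall>i s. norm (Y i s) <= A * B * (8 / L + Q) ^ i * (fact i * sqrt (fact i)))"
   by (intro exI[of _ "%i s. Z i (cl s)"]) blast
 qed
qed

lemma L2_of_cmult_bounded_linear:
 assumes h: "bdd h"
 shows "bounded_linear (%c. L2_of (%x. c * h x))"
proof -
 obtain B where B: "0 <= B" "!!x. 0 < x ==> x < 1 ==> norm (h x) <= B" using h by (rule bddE) blast
 have L: "(%x. c * h x) \<in> L2_fun" for c using h by (intro bdd_L2 bdd_mult bdd_const)
 show ?thesis
 proof (rule bounded_linear_intro)
  show "L2_of (%x. (a + b) * h x) = L2_of (%x. a * h x) + L2_of (%x. b * h x)" for a b
   by (simp only: distrib_right L2_of_add[OF L L])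
  show "L2_of (%x. r *\<^sub>R a * h x) = r *\<^sub>R L2_of (%x. a * h x)" for r a
   by (simp only: mult_scaleR_left L2_of_scaleR[OF L])
  show "norm (L2_of (%x. a * h x)) <= norm a * B" for a
   by (rule norm_L2_of_le(2)) (use B bdd_meas[OF h] in \<open>auto simp: norm_mult intro!: mult_left_mono borel_imp_leb01\<close>)
 qed
qed

lemma L2_of_sum:
 assumes "!!i. i \<in> A ==> f i \<in> L2_fun"
 shows "L2_of (%x. \<Sum>i\<in>A. f i x) = (\<Sum>i\<in>A. L2_of (f i))"
proof -
 have "L2_of (%x. \<Sum>i\<in>A. f i x) = (\<Sum>i\<in>A. L2_of (f i)) \<and> (%x. \<Sum>i\<in>A. f i x) \<in> L2_fun"
 using assms by (induction A rule: infinite_finite_induct) (auto simp: L2_of_zero L2_fun_zero L2_of_add L2_fun_add)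
 then show ?thesis ..
qed

text \<open>The total of the majorising series when Gevrey coefficients of rate \<open>q\<close>
  meet denominators \<open>(2 i)!\<close>; it enters the control cost.\<close>

definition gsum :: "real => real" where
 "gsum q = (\<Sum>i. q ^ i * (fact i * sqrt (fact i)) / fact (2 * i))"

lemma gevrey_series:
 fixes a :: "nat => complex"
 assumes a: "!!i. norm (a i) <= H * (q ^ i * (fact i * sqrt (fact i)) / fact (2 * i))" and q: "0 <= q" "0 <= H"
 shows "summable a" "norm (\<Sum>i<n. a i) <= H * gsum q"
proof -
 have s: "summable (%i. H * (q ^ i * (fact i * sqrt (fact i)) / fact (2 * i)))"
  using gevrey_summable[OF q(1)] by (rule summable_mult)
 show "summable a" by (rule summable_comparison_test'[OF s a])
 have "norm (\<Sum>i<n. a i) <= (\<Sum>i<n. H * (q ^ i * (fact i * sqrt (fact i)) / fact (2 * i)))"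
  by (rule sum_norm_le[OF a])
 also have "... <= (\<Sum>i. H * (q ^ i * (fact i * sqrt (fact i)) / fact (2 * i)))"
  using q by (intro sum_le_suminf[OF s]) auto
 also have "... = H * gsum q" unfolding gsum_def by (rule suminf_mult[OF gevrey_summable[OF q(1)]])
 finally show "norm (\<Sum>i<n. a i) <= H * gsum q" .
qed

context coef begin

lemma pflx_derivative:
 assumes "0 < t"
 shows "((%t. pflx t z j x) has_vector_derivative pflx t z (Suc j) x) (at t)"
proof -
 have bl: "bounded_linear (%F. (-1) ^ j * flux F x)"
 proof (rule bounded_linear_intro)
  show "norm ((-1) ^ j * flux F x) <= norm F * 2" for F using flux_bound[of F x] by (simp add: norm_mult norm_power)
 qed (simp_all add: flux_add flux_scaleR distrib_left)
 have "flux (- F) x = - flux F x" for F using flux_scaleR[of "-1" F x] by simp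
 then show ?thesis
  using bounded_linear.has_vector_derivative[OF bl sgd_has_vector_derivative[OF assms, of "Suc j" z]] by (simp add: pflx_def)
qed

lemma pflx_bound:
 assumes t: "0 < L" "L <= t"
 shows "norm (pflx t z j x) <= (2 * norm z / L) * (2 / L) ^ j * fact j"
proof -
 have "norm (pflx t z j x) <= 2 * norm (sgd (Suc j) t z)"
  using flux_bound[of "sgd (Suc j) t z" x] by (simp add: pflx_def norm_mult norm_power)
 also have "... <= 2 * (fact (Suc j) / t ^ Suc j * norm z)"
  using t by (intro mult_left_mono sgd_norm) auto
 also have "... <= 2 * ((2 ^ j * fact j) / L ^ Suc j * norm z)"
 proof (intro mult_left_mono mult_right_mono frac_le power_mono)
  have "real (Suc j) <= 2 ^ j" by (metis Suc_leI less_exp of_nat_le_iff of_nat_numeral of_nat_power)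
  then show "fact (Suc j) <= (2 ^ j * fact j :: real)" by (simp add: mult_right_mono)
 qed (use t in auto)
 finally show ?thesis by (simp add: power_divide mult_ac)
qed

text \<open>The trajectory is \<open>\<psi>\<close> times the Volterra series with coefficients
  \<open>Y\<close>. It starts at \<open>\<psi>\<close> times the state at time \<open>L\<close>,
  ends at zero, and violates the free equation only where the flux of \<open>\<psi>\<close> lives,
  inside \<open>(c,d)\<close>; the defect is the control. Partial sums avoid differentiating the
  series: they obey the equation up to one surplus term that tends to zero.\<close>

lemma one_sided_control:
 fixes Y :: "nat => real => complex"
 assumes L: "0 < L" and cd: "0 <= c" "c < d" "d <= 1" and x0: "0 <= x0" "x0 <= 1"
  and psi: "ac \<psi> (%s. of_real (\<rho> s) * (\<kappa> * of_real (hat c d s)))"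
  and z: "!!i. \<psi> 0 * gg x0 i 0 = 0" "!!i. \<psi> 1 * gg x0 i 1 = 0" "!!j. psol L z0 j x0 = 0"
  and Y: "!!i. continuous_on UNIV (Y i)" "!!i s. 0 < s ==> s < L ==> (Y i has_vector_derivative Y (Suc i) s) (at s)"
   "!!i. Y i 0 = pflx L z0 i x0" "!!i. Y i L = 0"
  and H: "0 <= H" "0 <= q" "!!i s. norm (Y i s) <= H * q ^ i * (fact i * sqrt (fact i))"
 shows "\<exists>u. nice u (norm \<kappa> * (1 + 2 * K) * (H * K * gsum (q * K))) \<and>
  duh (control_input {c<..<d} u) L = - sg L (L2_of (%x. \<psi> x * zf (sgd 1 L z0) x))"
proof -
 define J where "J = {c<..<d}"
 have K0: "0 < K" using K1 by simp
 have J[measurable]: "J \<in> sets borel" by (simp add: J_def)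
 note ggb = gg_bdd[OF x0] and gvb = gv_bdd[OF x0]
 have psib: "bdd \<psi>" by (rule acD(1)[OF psi])
 obtain B where B: "0 <= B" "!!x. 0 < x ==> x < 1 ==> norm (\<psi> x) <= B" using psib by (rule bddE) blast
 define P where "P n s x = (\<Sum>i<n. Y i s * gg x0 i x)" for n s x
 define Q where "Q n s x = (\<Sum>i<n. Y i s * gv x0 i x)" for n s x
 \<comment> \<open>The commutator of the cutoff with the spatial operator, as in
   \<open>localized_sum\<close>, with the sign that makes it a source.\<close>
 define w where "w n p = - (\<kappa> * (hat' c d (snd p) * P (Suc n) (fst p) (snd p)
   + 2 * (of_real (hat c d (snd p)) * (of_real (\<rho> (snd p)) * Q (Suc n) (fst p) (snd p)))))" for n p
 define M where "M = norm \<kappa> * (1 + 2 * K) * (H * K * gsum (q * K))"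
 have trm: "norm (Y i s * gg x0 i x) <= (H * K) * ((q * K) ^ i * (fact i * sqrt (fact i)) / fact (2 * i))"
   "norm (Y i s * gv x0 i x) <= (H * K) * ((q * K) ^ i * (fact i * sqrt (fact i)) / fact (2 * i))"
  if x: "0 <= x" "x <= 1" for i s x
 proof -
  have "norm (Y i s) * norm (gg x0 i x) <= (H * q ^ i * (fact i * sqrt (fact i))) * (K ^ Suc i / fact (2 * i))"
   using H K0 by (intro mult_mono gg_bound x x0) auto
  then show "norm (Y i s * gg x0 i x) <= (H * K) * ((q * K) ^ i * (fact i * sqrt (fact i)) / fact (2 * i))"
   by (simp add: norm_mult power_mult_distrib mult_ac)
  have "norm (Y i s) * norm (gv x0 i x) <= (H * q ^ i * (fact i * sqrt (fact i))) * (K ^ Suc i / fact (2 * i))"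
   using H K0 by (intro mult_mono gv_bound x x0) auto
  then show "norm (Y i s * gv x0 i x) <= (H * K) * ((q * K) ^ i * (fact i * sqrt (fact i)) / fact (2 * i))"
   by (simp add: norm_mult power_mult_distrib mult_ac)
 qed
 have qK: "0 <= q * K" "0 <= H * K" using H K0 by auto
 have PQ: "norm (P n s x) <= H * K * gsum (q * K)" "norm (Q n s x) <= H * K * gsum (q * K)"
   "summable (%i. Y i s * gg x0 i x)" "summable (%i. Y i s * gv x0 i x)" if x: "0 <= x" "x <= 1" for n s x
  unfolding P_def Q_def using gevrey_series[OF trm(1)[OF x] qK] gevrey_series[OF trm(2)[OF x] qK] by auto
 have off: "w n p = 0" if "snd p \<notin> J" for n p
  using hat(2,6)[OF cd, of "snd p"] that by (simp add: w_def J_def)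
 have wm[measurable]: "w n \<in> borel_measurable borel" for n
 proof -
  have [measurable]: "Y i \<in> borel_measurable borel" for i by (rule borel_measurable_continuous_onI[OF Y(1)])
  have [measurable]: "gg x0 i \<in> borel_measurable borel" "gv x0 i \<in> borel_measurable borel" for i
   using ggb gvb by (auto intro: bdd_meas)
  have [measurable]: "hat' c d \<in> borel_measurable borel" "(%x. complex_of_real (hat c d x)) \<in> borel_measurable borel"
   using acD(1,2)[OF hat(1)[OF cd]] by (auto intro: bdd_meas)
  show ?thesis unfolding w_def P_def Q_def borel_prod[symmetric] by measurable
 qed
 have g0: "0 <= gsum (q * K)" using gevrey_series(2)[of "%_. 0" 1 "q * K" 0] qK by simp
 have wb: "norm (w n p) <= M" for n p
 proof (cases "snd p \<in> J")
  case True
  then have x: "0 <= snd p" "snd p <= 1" using cd by (auto simp: J_def)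
  have "norm (hat' c d (snd p) * P (Suc n) (fst p) (snd p)) <= 1 * (H * K * gsum (q * K))"
   unfolding norm_mult using hat(7)[OF cd] PQ(1)[OF x] by (intro mult_mono) auto
  moreover have "norm (complex_of_real (hat c d (snd p)) * (of_real (\<rho> (snd p)) * Q (Suc n) (fst p) (snd p))) <= 1 * (K * (H * K * gsum (q * K)))"
   unfolding norm_mult using hat(3,4)[OF cd] PQ(2)[OF x] rho_pos[of "snd p"] rho_le[of "snd p"] K0
   by (intro mult_mono) auto
  ultimately have "norm (hat' c d (snd p) * P (Suc n) (fst p) (snd p)
   + 2 * (complex_of_real (hat c d (snd p)) * (of_real (\<rho> (snd p)) * Q (Suc n) (fst p) (snd p)))) <= (1 + 2 * K) * (H * K * gsum (q * K))"
   by (intro order_trans[OF norm_triangle_ineq]) (simp add: norm_mult distrib_right)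
  then show ?thesis unfolding w_def M_def norm_minus_cancel norm_mult mult.assoc by (intro mult_left_mono) auto
 next
  case False
  then show ?thesis using off K0 qK g0 by (auto simp: M_def)
 qed
 have wn: "nice (w n) M" for n using wb by (simp add: nice_def)
 define u where "u p = lim (%n. w n p)" for p
 have wu: "(%n. w n p) \<longlonglongrightarrow> u p" for p
 proof -
  have "convergent (%n. w n p)"
  proof (cases "snd p \<in> J")
   case True
   then have x: "0 <= snd p" "snd p <= 1" using cd by (auto simp: J_def)
   have "convergent (%n. P (Suc n) (fst p) (snd p))" "convergent (%n. Q (Suc n) (fst p) (snd p))"
    unfolding P_def Q_def convergent_Suc_iff[of "%n. \<Sum>i<n. _ i"] summable_iff_convergent[symmetric] by (rule PQ(3,4)[OF x])+
   then obtain a b where ab: "(%n. P (Suc n) (fst p) (snd p)) \<longlonglongrightarrow> a" "(%n. Q (Suc n) (fst p) (snd p)) \<longlonglongrightarrow> b"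
    unfolding convergent_def by blast
   show ?thesis unfolding w_def
    by (rule convergentI[OF tendsto_minus[OF tendsto_mult_left[OF tendsto_add[OF tendsto_mult_left[OF ab(1)]
     tendsto_mult_left[OF tendsto_mult_left[OF tendsto_mult_left[OF ab(2)]]]]]]])
  qed (simp add: off convergent_const)
  then show ?thesis unfolding u_def by (simp add: convergent_LIMSEQ_iff)
 qed
 have un: "nice u M" by (rule nice_limit[OF wn wu])
 define h where "h i x = \<psi> x * gg x0 i x" for i x
 have hb: "bdd (h i)" for i unfolding h_def by (intro bdd_mult psib ggb)
 define cm where "cm i c = L2_of (%x. c * h i x)" for i c
 have cm: "bounded_linear (cm i)" for i unfolding cm_def by (rule L2_of_cmult_bounded_linear[OF hb])
 have cmL: "(%x. c * h i x) \<in> L2_fun" for c i by (intro bdd_L2 bdd_mult bdd_const hb)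
 \<comment> \<open>A bound for the surplus term, which combines \<open>Y (Suc n)\<close> with only
   \<open>gg x0 n\<close>. Passing from \<open>(2 n)!\<close> to \<open>(2 n + 2)!\<close> costs
   \<open>4 * 4 ^ Suc n\<close>, hence the enlarged rate.\<close>
 define e where "e n = H * B * 4 * ((4 * (q * K)) ^ n * (fact n * sqrt (fact n)) / fact (2 * n))" for n
 have e0: "(%n. e (Suc n)) \<longlonglongrightarrow> 0"
 proof -
  have "e \<longlonglongrightarrow> 0"
   unfolding e_def using qK by (intro tendsto_mult_right_zero summable_LIMSEQ_zero gevrey_summable) auto
  then show ?thesis by (rule LIMSEQ_Suc)
 qed
 have E: "norm (cm n (Y (Suc n) s)) <= e (Suc n)" for n s
  unfolding cm_def
 proof (rule norm_L2_of_le(2))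
  show "(%x. Y (Suc n) s * h n x) \<in> borel_measurable leb01"
   using cmL unfolding L2_fun_def by blast
  have f: "1 / fact (2 * n) <= 4 * 4 ^ Suc n / (fact (2 * Suc n) :: real)"
  proof -
   have "real (Suc n) <= 2 ^ Suc n" by (metis less_exp less_imp_le_nat of_nat_le_iff of_nat_numeral of_nat_power)
   then have "real (Suc n) ^ 2 <= (2 ^ Suc n) ^ 2" by (intro power_mono) auto
   also have "... = 4 ^ Suc n" by (simp add: power_mult[symmetric] mult.commute power2_eq_square flip: power_mult_distrib)
   finally have 1: "real (Suc n) * real (Suc n) <= 4 ^ Suc n" by (simp only: power2_eq_square)
   have "(fact (2 * Suc n) :: real) = real (2 * n + 2) * (real (2 * n + 1) * fact (2 * n))" by (simp add: algebra_simps)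
   also have "... <= real (2 * n + 2) * (real (2 * n + 2) * fact (2 * n))" by (intro mult_left_mono mult_right_mono) auto
   also have "... = 4 * (real (Suc n) * real (Suc n)) * fact (2 * n)" by (simp add: algebra_simps)
   also have "... <= 4 * 4 ^ Suc n * fact (2 * n)" using 1 by (intro mult_right_mono mult_left_mono) auto
   finally show ?thesis by (simp only: divide_simps) simp
  qed
  have "0 <= e m" for m using H B qK by (simp add: e_def)
  then show "0 <= e (Suc n)" .
  fix x :: real assume x: "x \<in> {0<..<1}"
  have "norm (Y (Suc n) s * h n x) <= (H * q ^ Suc n * (fact (Suc n) * sqrt (fact (Suc n)))) * (B * (K ^ Suc n * (1 / fact (2 * n))))"
   unfolding h_def norm_mult using x H B K0 gg_bound[OF x0, of x n]
   by (intro mult_mono) (auto simp del: power_Suc fact_Suc)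
  also have "... <= (H * q ^ Suc n * (fact (Suc n) * sqrt (fact (Suc n)))) * (B * (K ^ Suc n * (4 * 4 ^ Suc n / fact (2 * Suc n))))"
   using H B K0 by (intro mult_left_mono f) auto
  also have "... = e (Suc n)" unfolding e_def power_mult_distrib by (simp only: divide_inverse mult_ac)
  finally show "norm (Y (Suc n) s * h n x) <= e (Suc n)" .
 qed
 obtain Eb where Eb: "!!n. norm (e (Suc n)) <= Eb"
  using Bseq_eq_bounded convergent_imp_Bseq[OF convergentI[OF e0]] by (metis BseqE)
 \<comment> \<open>The source of the \<open>n\<close>-th partial sum: the control, and the time
   derivative of the last term, which has no partner in the shifted sum.\<close>
 define F where "F n s = cm n (Y (Suc n) s) + control_input J (w n) s" for n s
 have cmm: "(%s. cm i (Y j s)) \<in> borel_measurable borel" for i j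
  by (intro borel_measurable_continuous_onI bounded_linear.continuous_on[OF cm] Y(1))
 have Fm: "F n \<in> borel_measurable borel" for n
 proof -
  have "F n = (%s. cm n (Y (Suc n) s) + control_input J (w n) s)" by (intro ext) (simp add: F_def)
  then show ?thesis using borel_measurable_add[OF cmm[of n "Suc n"] control_input_measurable[OF wn[of n] J]] by simp
 qed
 have Fb: "norm (F n s) <= Eb + M" for n s
  unfolding F_def using order_trans[OF E order_trans[OF abs_ge_self Eb[unfolded real_norm_def]]] control_slice(3)[OF wn J]
  by (rule norm_triangle_mono)
 define zn where "zn n s = (\<Sum>i<Suc n. cm i (Y i s))" for n s
 have duh: "zn n L = sg L (zn n 0) + duh (F n) L" for n
 proof (rule duhamel[OF L Fm Fb])
  show "continuous_on {0..L} (zn n)" unfolding zn_def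
   by (intro continuous_on_sum bounded_linear.continuous_on[OF cm] continuous_on_subset[OF Y(1)]) auto
  fix s assume s: "0 < s" "s < L"
  show "(zn n has_vector_derivative (\<Sum>i<Suc n. cm i (Y (Suc i) s))) (at s)"
   unfolding zn_def[abs_def] by (intro has_vector_derivative_sum bounded_linear.has_vector_derivative[OF cm] Y(2) s)
  have P: "bdd (%x. \<Sum>i<m. Y (k i) s * gg x0 i x)" "bdd (%x. \<Sum>i<m. Y (k i) s * gv x0 i x)" for k m
   by (intro bdd_sum bdd_mult bdd_const ggb gvb)+
  have csum: "L2_of (%x. \<psi> x * (\<Sum>i<m. b i * gg x0 i x)) = (\<Sum>i<m. cm i (b i))" for b m
   using L2_of_sum[of "{..<m}" "%i x. b i * h i x", OF cmL]
   by (simp add: h_def cm_def sum_distrib_left mult.left_commute)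
  have ci: "control_input J (w n) s = L2_of (%x. - (\<kappa> * (hat' c d x * P (Suc n) s x + 2 * (of_real (hat c d x) * (of_real (\<rho> x) * Q (Suc n) s x)))))"
  proof -
   have "(%x. indicator J x * w n (s, x)) = (%x. w n (s, x))"
   proof
    show "indicator J x * w n (s, x) = w n (s, x)" for x using off[of "(s, x)" n] by (cases "x \<in> J") auto
   qed
   then show ?thesis unfolding control_input_def by (simp add: w_def)
  qed
  have L1: "(%x. \<psi> x * (\<Sum>i<n. Y (Suc i) s * gg x0 i x)) \<in> L2_fun"
   by (intro bdd_L2 bdd_mult psib P)
  have L2: "(%x. - (\<kappa> * (hat' c d x * P (Suc n) s x + 2 * (of_real (hat c d x) * (of_real (\<rho> x) * Q (Suc n) s x))))) \<in> L2_fun"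
   unfolding P_def Q_def
   by (intro bdd_L2 bdd_minus bdd_mult bdd_add bdd_const bdd_rho P acD(1,2)[OF hat(1)[OF cd]])
  have "zn n s = L2_of (%x. \<psi> x * (\<Sum>i<Suc n. Y i s * gg x0 i x))" by (simp only: zn_def csum)
  also have "... = - green (L2_of (%x. \<psi> x * (\<Sum>i<n. Y (Suc i) s * gg x0 i x)
    + \<kappa> * (hat' c d x * P (Suc n) s x + 2 * (of_real (hat c d x) * (of_real (\<rho> x) * Q (Suc n) s x)))))"
   unfolding P_def Q_def by (rule localized_sum[OF x0 psi hat(1)[OF cd] z(1,2)])
  also have "L2_of (%x. \<psi> x * (\<Sum>i<n. Y (Suc i) s * gg x0 i x)
    + \<kappa> * (hat' c d x * P (Suc n) s x + 2 * (of_real (hat c d x) * (of_real (\<rho> x) * Q (Suc n) s x))))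
   = (\<Sum>i<n. cm i (Y (Suc i) s)) - control_input J (w n) s"
   using L2_of_diff[OF L1 L2] unfolding ci csum by simp
  also have "... = (\<Sum>i<Suc n. cm i (Y (Suc i) s)) - F n s" by (simp add: F_def)
  finally show "zn n s = - green ((\<Sum>i<Suc n. cm i (Y (Suc i) s)) - F n s)" .
 qed
 have "zn n L = 0" for n using Y(4) linear_0[OF bounded_linear.linear[OF cm]] by (simp add: zn_def)
 then have eq: "duh (F n) L = - sg L (zn n 0)" for n using duh[of n] by (simp add: eq_neg_iff_add_eq_0 add.commute)
 \<comment> \<open>\<open>zf (sgd 1 L z0)\<close> is the continuous representative of
   \<open>sg L z0\<close>, and the initial coefficients \<open>Y i 0\<close> are those of its
   expansion at \<open>x0\<close>.\<close>
 have zlim: "(%n. zn n 0) \<longlonglongrightarrow> L2_of (%x. \<psi> x * zf (sgd 1 L z0) x)"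
 proof (rule LIM_zero_cancel, rule Lim_null_comparison)
  let ?b = "%n. B * (2 * K / L * norm z0 * ((2 * K / L) ^ Suc n * fact (Suc n) / fact (2 * Suc n)))"
  show "(%n. ?b n) \<longlonglongrightarrow> 0"
   by (intro tendsto_mult_right_zero LIMSEQ_Suc[OF heat_expansion_limit[OF L]])
  show "\<forall>\<^sub>F n in sequentially. norm (zn n 0 - L2_of (%x. \<psi> x * zf (sgd 1 L z0) x))
    <= ?b n"
  proof (rule always_eventually, rule allI)
   fix n
   define p where "p x = \<psi> x * psol L z0 0 x" for x
   have pz: "p = (%x. \<psi> x * zf (sgd 1 L z0) x)" by (intro ext) (simp add: p_def psol_def)
   have pb: "bdd p" unfolding pz by (intro bdd_mult psib zf_bdd)
   define S where "S x = \<psi> x * (\<Sum>i<Suc n. pflx L z0 i x0 * gg x0 i x)" for x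
   have Sb: "bdd S" unfolding S_def by (intro bdd_mult psib bdd_sum bdd_const ggb)
   have zS: "zn n 0 = L2_of S"
    using L2_of_sum[of "{..<Suc n}" "%i x. Y i 0 * h i x", OF cmL]
    by (simp add: zn_def S_def[abs_def] h_def cm_def sum_distrib_left mult.left_commute Y(3) del: sum.lessThan_Suc)
   have "norm (L2_of (%x. S x - p x)) <= ?b n"
   proof (rule norm_L2_of_le(2))
    show "(%x. S x - p x) \<in> borel_measurable leb01" by (intro borel_imp_leb01 bdd_meas bdd_diff Sb pb)
    have "0 <= 2 * K / L * norm z0 * ((2 * K / L) ^ m * fact m / fact (2 * m))" for m using L K0 by simp
    then show "0 <= ?b n"
     by (rule mult_nonneg_nonneg[OF B(1)])
    fix x :: real assume x: "x \<in> {0<..<1}"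
    have "norm (S x - p x) = norm (\<psi> x) * norm (psol L z0 0 x - (\<Sum>i<Suc n. pflx L z0 i x0 * gg x0 i x))"
     unfolding S_def p_def right_diff_distrib[symmetric] norm_mult by (intro arg_cong2[where f="(*)"] refl norm_minus_commute)
    also have "... <= ?b n"
     using x B by (intro mult_mono heat_expansion[OF L x0 z(3)]) auto
    finally show "norm (S x - p x) <= ?b n" .
   qed
   then show "norm (zn n 0 - L2_of (%x. \<psi> x * zf (sgd 1 L z0) x))
     <= ?b n"
    unfolding pz[symmetric] zS L2_of_diff[OF bdd_L2[OF Sb] bdd_L2[OF pb]] .
  qed
 qed
 have "(%n. duh (F n) L) \<longlonglongrightarrow> duh (control_input J u) L"
 proof (rule duh_tendsto[OF Fm Fb control_input_measurable[OF un J]])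
  have "(%n. F n s) \<longlonglongrightarrow> 0 + control_input J u s" for s
   unfolding F_def
  proof (intro tendsto_add)
   show "(%n. cm n (Y (Suc n) s)) \<longlonglongrightarrow> 0"
    by (rule Lim_null_comparison[OF always_eventually e0]) (use E in auto)
   show "(%n. control_input J (w n) s) \<longlonglongrightarrow> control_input J u s" by (rule ci_tendsto[OF wn wu J])
  qed
  then show "AE s in lborel. 0 < s --> s < L --> (%n. F n s) \<longlonglongrightarrow> control_input J u s" by simp
 qed (use L in simp)
 moreover have "(%n. duh (F n) L) \<longlonglongrightarrow> - sg L (L2_of (%x. \<psi> x * zf (sgd 1 L z0) x))"
  unfolding eq by (intro tendsto_minus bounded_linear.tendsto[OF sg_bounded_linear] zlim)
 ultimately show ?thesis using LIMSEQ_unique un unfolding J_def M_def by blast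
qed

end

text \<open>After half of the time the free solution is analytic in time. Its state is then split by
  \<open>1 - p\<close> and \<open>p\<close>, which pass from 1 to 0 and from 0 to 1 inside
  \<open>(c,d)\<close>. The first part is expanded from the end point 0, the second from 1; each has
  its own control and the controls add up.\<close>

theorem null_control:
 fixes K l t :: real
 assumes K: "1 <= K" and l: "0 < l" and t: "0 < t"
 shows "\<exists>C\<ge>0. \<forall>\<rho> c d z0. coef K \<rho> --> 0 <= c --> d <= 1 --> d - c = l -->
  (\<exists>u. nice u (C * norm z0) \<and> coef.duh K \<rho> (control_input {c<..<d} u) t = - sgc K \<rho> t z0)"
proof -
 obtain A where A: "0 < A" and tr: "!!L B Q (y :: nat => real => complex). 0 < L \<and> 0 <= B \<and> 0 <= Q \<and>
   (\<forall>j s. 0 <= s --> s <= L --> (y j has_vector_derivative y (Suc j) s) (at s)) \<and>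
   (\<forall>j s. 0 <= s --> s <= L --> norm (y j s) <= B * Q ^ j * fact j) ==>
   (\<exists>Y :: nat => real => complex. (\<forall>i. continuous_on UNIV (Y i)) \<and>
    (\<forall>i s. 0 < s --> s < L --> (Y i has_vector_derivative Y (Suc i) s) (at s)) \<and>
    (\<forall>i. Y i 0 = y i 0 \<and> Y i L = 0) \<and> (\<forall>i s. norm (Y i s) <= A * B * (8 / L + Q) ^ i * (fact i * sqrt (fact i))))"
  using gevrey_transition by blast
 define L where "L = t / 2"
 have L: "0 < L" using t by (simp add: L_def)
 \<comment> \<open>The rate of the cutoff on an interval of length \<open>L\<close>, plus the rate
   of the flux derivatives after time \<open>L\<close>. In \<open>C1\<close> the factor
   \<open>8 * K / l\<^sup>2\<close> bounds the normalisation \<open>1 / m\<close> obtained from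
   \<open>hat_mass\<close>.\<close>
 define q where "q = 8 / L + 2 / L"
 define C1 where "C1 = 8 * K / l\<^sup>2 * (1 + 2 * K) * (A * (2 / L) * K * gsum (q * K))"
 have q0: "0 <= q" using L by (simp add: q_def)
 have g0: "0 <= gsum (q * K)" using gevrey_series(2)[of "%_. 0" 1 "q * K" 0] q0 K by simp
 have C1: "0 <= C1" using g0 A L K l by (simp add: C1_def)
 have "\<exists>u. nice u (2 * C1 * norm z) \<and> coef.duh K \<rho> (control_input {c<..<d} u) t = - sgc K \<rho> t z"
  if co: "coef K \<rho>" and cd: "0 <= c" "d <= 1" "d - c = l" for \<rho> c d and z :: L2
 proof -
  interpret coef K \<rho> by (rule co)
  have cd': "c < d" using cd l by simp
  define J where "J = {c<..<d}"
  have J[measurable]: "J \<in> sets borel" by (simp add: J_def)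
  obtain m where m: "(d - c)\<^sup>2 / (8 * K) <= m" "prim (%s. of_real (\<rho> s) * of_real (hat c d s)) 1 = (of_real m :: complex)"
   using hat_mass[OF cd(1) cd' cd(2)] by blast
  have m0: "0 < m" using m(1) l cd K1 by (intro less_le_trans[OF _ m(1)]) simp
  have hb: "bdd (%s. of_real (\<rho> s) * of_real (hat c d s))"
   by (intro bdd_mult bdd_rho acD(1)[OF hat(1)[OF cd(1) cd' cd(2)]])
  define p where "p = (%x. of_real (1 / m) * iprim 0 (%s. of_real (\<rho> s) * of_real (hat c d s)) x)"
  have "ac p (%s. of_real (1 / m) * (of_real (\<rho> s) * of_real (hat c d s)))"
   unfolding p_def by (intro ac_cmult ac_iprim hb) auto
  then have p: "ac p (%s. of_real (\<rho> s) * (of_real (1 / m) * of_real (hat c d s)))" by (simp add: mult.left_commute)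
  have p01: "p 0 = 0" "p 1 = 1" using m m0 by (simp_all add: p_def iprim_eq)
  have "ac (%x. 1 + (-1) * p x) (%s. 0 + (-1) * (of_real (\<rho> s) * (of_real (1 / m) * of_real (hat c d s))))"
   by (intro ac_add ac_const ac_cmult p)
  then have p': "ac (%x. 1 + (-1) * p x) (%s. of_real (\<rho> s) * (of_real (- (1 / m)) * of_real (hat c d s)))" by simp
  have gg0: "gg x0 i x0 = 0" if "0 <= x0" "x0 <= 1" for x0 i using that by (simp add: gg_def iprim_eq)
  have ex: "\<exists>u. nice u (C1 * norm z) \<and> duh (control_input J u) L = - sg L (L2_of (%x. \<psi> x * zf (sgd 1 L z) x))"
   if x0: "0 <= x0" "x0 <= 1" and z: "!!j. psol L z j x0 = 0" and psi: "ac \<psi> (%s. of_real (\<rho> s) * (\<kappa> * of_real (hat c d s)))"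
    "!!i. \<psi> 0 * gg x0 i 0 = 0" "!!i. \<psi> 1 * gg x0 i 1 = 0" and kap: "norm \<kappa> <= 8 * K / l\<^sup>2"
   for x0 \<psi> \<kappa>
  proof -
   \<comment> \<open>The end point flux of the free solution is followed beyond time
     \<open>L\<close>; the transition takes it to zero over another interval of length
     \<open>L\<close>.\<close>
   have y': "((%s. pflx (L + s) z j x0) has_vector_derivative pflx (L + s) z (Suc j) x0) (at s)" if "0 <= s" for j s
   proof -
    have "((%s. L + s) has_vector_derivative 1) (at s)" by (auto intro!: derivative_eq_intros)
    then show ?thesis
     using vector_diff_chain_at[of "%s. L + s" 1 s "%t. pflx t z j x0"] pflx_derivative[of "L + s" z j x0] that L
     by (simp add: o_def)
   qed
   have yb: "norm (pflx (L + s) z j x0) <= (2 * norm z / L) * (2 / L) ^ j * fact j" if "0 <= s" for j s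
    using pflx_bound[OF L, of "L + s"] that by simp
   obtain Y :: "nat => real => complex" where Y': "(\<forall>i. continuous_on UNIV (Y i)) \<and>
     (\<forall>i s. 0 < s --> s < L --> (Y i has_vector_derivative Y (Suc i) s) (at s)) \<and>
     (\<forall>i. Y i 0 = pflx (L + 0) z i x0 \<and> Y i L = 0) \<and>
     (\<forall>i s. norm (Y i s) <= A * (2 * norm z / L) * (8 / L + 2 / L) ^ i * (fact i * sqrt (fact i)))"
    using tr[of L "2 * norm z / L" "2 / L" "%j s. pflx (L + s) z j x0"] L y' yb by auto
   then have Y: "!!i. continuous_on UNIV (Y i)" "!!i s. 0 < s ==> s < L ==> (Y i has_vector_derivative Y (Suc i) s) (at s)"
     "!!i. Y i 0 = pflx (L + 0) z i x0" "!!i. Y i L = 0"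
     "!!i s. norm (Y i s) <= A * (2 * norm z / L) * (8 / L + 2 / L) ^ i * (fact i * sqrt (fact i))"
    by blast+
   have Y3: "Y i 0 = pflx L z i x0" for i using Y(3)[of i] by simp
   obtain u where u: "nice u (norm \<kappa> * (1 + 2 * K) * (A * (2 * norm z / L) * K * gsum (q * K)))"
     "duh (control_input J u) L = - sg L (L2_of (%x. \<psi> x * zf (sgd 1 L z) x))"
    using one_sided_control[OF L cd(1) cd' cd(2) x0 psi z Y(1,2) Y3 Y(4) _ q0, of "A * (2 * norm z / L)"] Y(5) A L
    unfolding J_def q_def by auto
   have "norm \<kappa> * (1 + 2 * K) * (A * (2 * norm z / L) * K * gsum (q * K))
     <= 8 * K / l\<^sup>2 * (1 + 2 * K) * (A * (2 * norm z / L) * K * gsum (q * K))"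
    using kap K A L g0 by (intro mult_right_mono) auto
   also have "... = C1 * norm z" by (simp add: C1_def)
   finally show ?thesis using nice_mono[OF u(1)] u(2) by blast
  qed
  have ps: "psol L z j 0 = 0" "psol L z j 1 = 0" for j by (simp_all add: psol_def zf_0 zf_1)
  have "m \<ge> l\<^sup>2 / (8 * K)" using m cd by simp
  then have kap: "1 / m <= 8 * K / l\<^sup>2"
   using m0 l K by (simp add: field_simps)
  obtain u0 where u0: "nice u0 (C1 * norm z)" "duh (control_input J u0) L = - sg L (L2_of (%x. (1 + (-1) * p x) * zf (sgd 1 L z) x))"
   using ex[of 0 "%x. 1 + (-1) * p x", OF _ _ ps(1) p'] gg0[of 0] p01 m0 kap by (auto simp: norm_divide)
  obtain u1 where u1: "nice u1 (C1 * norm z)" "duh (control_input J u1) L = - sg L (L2_of (%x. p x * zf (sgd 1 L z) x))"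
   using ex[of 1 p, OF _ _ ps(2) p] gg0[of 1] p01 m0 kap by (auto simp: norm_divide)
  define u where "u = (%p. u0 p + u1 p)"
  \<comment> \<open>No control acts during the first half, while the solution becomes
    analytic.\<close>
  define v where "v = cc L (%p. 0) u"
  have zn: "nice (%p. 0) (2 * C1 * norm z)" using C1 by (intro nice_zero) simp
  have un: "nice u (2 * C1 * norm z)" unfolding u_def using nice_add[OF u0(1) u1(1)] by (simp add: mult.assoc)
  have "duh (control_input J v) t = duh (control_input J u) L"
   unfolding v_def using duh_cc[OF zn un J, of L L] L by (simp add: L_def duh_zero sg_lin)
  also have "... = duh (control_input J u0) L + duh (control_input J u1) L"
   unfolding u_def ci_add[OF u0(1) u1(1) J]
   by (rule duh_add[OF control_input_measurable[OF u0(1) J] control_slice(3)[OF u0(1) J]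
     control_input_measurable[OF u1(1) J] control_slice(3)[OF u1(1) J]])
  also have "... = - sg L (L2_of (%x. (1 + (-1) * p x) * zf (sgd 1 L z) x) + L2_of (%x. p x * zf (sgd 1 L z) x))"
   unfolding u0(2) u1(2) sg_lin by simp
  also have "L2_of (%x. (1 + (-1) * p x) * zf (sgd 1 L z) x) + L2_of (%x. p x * zf (sgd 1 L z) x) = L2_of (%x. zf (sgd 1 L z) x)"
   by (subst L2_of_add[symmetric]) (auto intro!: bdd_L2 bdd_diff bdd_mult zf_bdd acD(1)[OF p] acD(1)[OF p'] simp: algebra_simps)
  also have "... = sg L z" using S_sgd[OF L, of 0 z] sgd_0[OF L, of z] by (simp add: green_def)
  also have "sg L (sg L z) = sg t z" using sg_add[of L L z] L by (simp add: L_def)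
  finally show ?thesis using nice_cc[OF zn un, of L] unfolding J_def v_def by blast
 qed
 then show ?thesis using C1 by (intro exI[of _ "2 * C1"]) auto
qed

section \<open>Unique continuation and approximate controllability\<close>

context coef begin

lemma psol_taylor:
 assumes h: "\<bar>h\<bar> < t" and x: "x <= 1"
 shows "norm (psol (t + h) z k x - (\<Sum>m<n. of_real (h ^ m / fact m) * psol t z (k + m) x))
  <= 2 * K * (fact (Suc k + n) / fact n * \<bar>h\<bar> ^ n / (t - \<bar>h\<bar>) ^ (Suc k + n) * norm z)"
proof -
 have lin: "linear (%F. zf F x)"
  by (rule linearI) (simp_all add: zf_add[OF x] zf_scaleR)
 have "(-1) ^ k * zf (sgd (Suc k) (t + h) z - (\<Sum>m<n. ((- h) ^ m / fact m) *\<^sub>R sgd (Suc k + m) t z)) x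
   = (-1) ^ k * (zf (sgd (Suc k) (t + h) z) x - (\<Sum>m<n. ((- h) ^ m / fact m) *\<^sub>R zf (sgd (Suc k + m) t z) x))"
  by (simp only: linear_diff[OF lin] linear_sum[OF lin] linear_scale[OF lin])
 also have "... = psol (t + h) z k x - (\<Sum>m<n. of_real (h ^ m / fact m) * psol t z (k + m) x)"
 proof -
  have "(-1) ^ k * (((- h) ^ m / fact m) *\<^sub>R zf (sgd (Suc k + m) t z) x) = of_real (h ^ m / fact m) * psol t z (k + m) x" for m
   unfolding power_minus[of h m] psol_def add_Suc power_add scaleR_conv_of_real by simp
  then show ?thesis by (simp only: right_diff_distrib sum_distrib_left psol_def[of "t + h"])
 qed
 finally have e: "psol (t + h) z k x - (\<Sum>m<n. of_real (h ^ m / fact m) * psol t z (k + m) x)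
   = (-1) ^ k * zf (sgd (Suc k) (t + h) z - (\<Sum>m<n. ((- h) ^ m / fact m) *\<^sub>R sgd (Suc k + m) t z)) x" by (rule HOL.sym)
 have "norm (psol (t + h) z k x - (\<Sum>m<n. of_real (h ^ m / fact m) * psol t z (k + m) x))
   = norm (zf (sgd (Suc k) (t + h) z - (\<Sum>m<n. ((- h) ^ m / fact m) *\<^sub>R sgd (Suc k + m) t z)) x)"
  unfolding e norm_mult norm_power by simp
 also have "... <= 2 * K * norm (sgd (Suc k) (t + h) z - (\<Sum>m<n. ((- h) ^ m / fact m) *\<^sub>R sgd (Suc k + m) t z))"
  by (rule zf_bound[OF x])
 also have "... <= 2 * K * (fact (Suc k + n) / fact n * \<bar>h\<bar> ^ n / (t - \<bar>h\<bar>) ^ (Suc k + n) * norm z)"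
  using K1 by (intro mult_left_mono sgd_taylor h) auto
 finally show ?thesis .
qed

text \<open>All Taylor coefficients at \<open>t\<close> vanish, and for
  \<open>\<bar>h\<bar> < t / 2\<close> the ratio \<open>\<bar>h\<bar> / (t - \<bar>h\<bar>)\<close>
  governing the remainder is below 1.\<close>

lemma psol_zero_extend:
 assumes t: "0 < t" and x: "x <= 1" and z: "!!j. psol t z j x = 0" and h: "\<bar>h\<bar> < t / 2"
 shows "psol (t + h) z k x = 0"
proof -
 define r where "r = \<bar>h\<bar> / (t - \<bar>h\<bar>)"
 have r: "0 <= r" "r < 1" using h t by (auto simp: r_def field_simps)
 have b: "norm (psol (t + h) z k x) <= 2 * K * norm z / (t - \<bar>h\<bar>) ^ Suc k * (fact (Suc k + n) / fact n * r ^ n)" for n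
  using psol_taylor[of h t x z k n] h t x z by (simp add: r_def power_add power_divide mult_ac)
 have "summable (%n. fact (Suc k + n) / fact n * r ^ n)"
 proof -
  have "conv_radius (%n. fact (Suc k + n) / fact n :: real) = 1"
  proof (rule conv_radius_ratio_limit_nonzero[where c=1])
   have "(%n. real (Suc n) / real (Suc (Suc k + n))) \<longlonglongrightarrow> 1" by real_asymp
   moreover have "norm (fact (Suc k + n) / fact n :: real) / norm (fact (Suc k + Suc n) / fact (Suc n) :: real) = real (Suc n) / real (Suc (Suc k + n))" for n
   proof -
    have "(fact (Suc k + Suc n) :: real) = real (Suc (Suc k + n)) * fact (Suc k + n)" "(fact (Suc n) :: real) = real (Suc n) * fact n"
     by (simp_all only: add_Suc_right fact_Suc of_nat_mult of_nat_fact)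
    then show ?thesis by (simp del: fact_Suc of_nat_Suc add_Suc add_Suc_right)
   qed
   ultimately show "(%n. norm (fact (Suc k + n) / fact n :: real) / norm (fact (Suc k + Suc n) / fact (Suc n) :: real)) \<longlonglongrightarrow> 1" by (simp only:)
  qed auto
  then show ?thesis using r by (intro summable_in_conv_radius) simp
 qed
 then have "(%n. fact (Suc k + n) / fact n * r ^ n) \<longlonglongrightarrow> 0" by (rule summable_LIMSEQ_zero)
 then have "(%n. 2 * K * norm z / (t - \<bar>h\<bar>) ^ Suc k * (fact (Suc k + n) / fact n * r ^ n)) \<longlonglongrightarrow> 0" by (rule tendsto_mult_right_zero)
 then have "norm (psol (t + h) z k x) <= 0" by (rule LIMSEQ_le_const) (use b in auto)
 then show ?thesis by simp
qed

text \<open>The admissible step is proportional to the time already reached, so the interval of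
  zeros grows by the factors 2/3 and 4/3 at its ends and exhausts the positive times.\<close>

lemma psol_zero_everywhere:
 assumes t0: "0 < t0" and x: "x <= 1" and z: "!!j. psol t0 z j x = 0" and t: "0 < t"
 shows "psol t z j x = 0"
proof -
 have step: "\<forall>t j. t0 * (2 / 3) ^ n <= t \<and> t <= t0 * (4 / 3) ^ n --> psol t z j x = 0" for n
 proof (induction n)
  case 0
  then show ?case using z by (auto dest: antisym)
 next
  case (Suc n)
  show ?case
  proof (intro allI impI)
   fix t j assume a: "t0 * (2 / 3) ^ Suc n <= t \<and> t <= t0 * (4 / 3) ^ Suc n"
   define lo where "lo = t0 * (2 / 3) ^ n"
   define hi where "hi = t0 * (4 / 3) ^ n"
   have lh: "0 < lo" "lo <= hi" using t0 unfolding lo_def hi_def by (auto intro!: mult_left_mono power_mono)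
   define t' where "t' = max lo (min hi t)"
   have a': "2 / 3 * lo <= t" "t <= 4 / 3 * hi" using a by (simp_all add: lo_def hi_def mult_ac)
   have "lo <= t'" "t' <= hi" using lh by (auto simp: t'_def)
   then have z': "psol t' z j x = 0" for j using Suc.IH by (simp add: lo_def hi_def)
   have "\<bar>t - t'\<bar> < t' / 2" using a' lh by (auto simp: t'_def max_def min_def abs_if)
   then show "psol t z j x = 0"
    using psol_zero_extend[OF _ x z', of "t - t'" j] \<open>lo <= t'\<close> lh by simp
  qed
 qed
 have p: "(%n. t0 * (2 / 3) ^ n) \<longlonglongrightarrow> 0" "filterlim (%n. t0 * (4 / 3 :: real) ^ n) at_top sequentially"
  using t0 by real_asymp+
 have "eventually (%n. t0 * (2 / 3) ^ n < t) sequentially" using order_tendstoD(2)[OF p(1)] t by simp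
 moreover have "eventually (%n. t <= t0 * (4 / 3) ^ n) sequentially" using p(2) by (simp add: filterlim_at_top)
 ultimately have "eventually (%n. t0 * (2 / 3) ^ n <= t \<and> t <= t0 * (4 / 3) ^ n) sequentially" by eventually_elim simp
 then obtain n where "t0 * (2 / 3) ^ n <= t \<and> t <= t0 * (4 / 3) ^ n" using eventually_happens'[OF sequentially_bot] by blast
 then show ?thesis using step by blast
qed

text \<open>The identity theorem in time: at an accumulation point of zeros the first nonvanishing
  derivative would dominate the nearby values.\<close>

lemma psol_accumulating_zeros:
 assumes S: "infinite S" "S \<subseteq> {a..b}" "0 < a" and z: "!!s. s \<in> S ==> psol s z 0 x = 0" and x: "x <= 1" and t: "0 < t"
 shows "psol t z j x = 0"
proof -
 obtain t0 where t0: "t0 \<in> {a..b}" "t0 islimpt S"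
  using S compact_Icc[of a b] unfolding compact_eq_Bolzano_Weierstrass by blast
 have t0p: "0 < t0" using t0 S by auto
 have "psol t0 z m x = 0" for m
 proof (induction m rule: less_induct)
  case (less m)
  define C where "C = 2 * K * (fact (Suc (Suc m)) / fact (Suc m) / (t0 / 2) ^ (Suc (Suc m)) * norm z) * fact m"
  have C: "0 <= C" using K1 t0p by (simp add: C_def)
  have b: "norm (psol t0 z m x) <= C * \<bar>h\<bar>" if h: "h ~= 0" "\<bar>h\<bar> < t0 / 2" "t0 + h \<in> S" for h
  proof -
   have "(\<Sum>i<Suc m. of_real (h ^ i / fact i) * psol t0 z (0 + i) x) = of_real (h ^ m / fact m) * psol t0 z m x"
    using less by simp
   then have "norm (of_real (h ^ m / fact m) * psol t0 z m x)
     <= 2 * K * (fact (Suc 0 + Suc m) / fact (Suc m) * \<bar>h\<bar> ^ Suc m / (t0 - \<bar>h\<bar>) ^ (Suc 0 + Suc m) * norm z)"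
    using psol_taylor[of h t0 x z 0 "Suc m"] z[OF h(3)] x h t0p by (simp only: diff_0 norm_minus_cancel)
   also have "... <= 2 * K * (fact (Suc 0 + Suc m) / fact (Suc m) * \<bar>h\<bar> ^ Suc m / (t0 / 2) ^ (Suc 0 + Suc m) * norm z)"
    using h t0p K1 by (intro mult_left_mono mult_right_mono divide_left_mono power_mono mult_pos_pos zero_less_power) auto
   also have "... = (\<bar>h\<bar> ^ m / fact m) * (C * \<bar>h\<bar>)" by (simp add: C_def)
   finally have "(\<bar>h\<bar> ^ m / fact m) * norm (psol t0 z m x) <= (\<bar>h\<bar> ^ m / fact m) * (C * \<bar>h\<bar>)"
    by (simp add: norm_mult norm_divide norm_power)
   then show ?thesis using h(1) by (subst (asm) mult_le_cancel_left_pos) auto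
  qed
  have "norm (psol t0 z m x) <= 0 + e" if e: "0 < e" for e
  proof -
   obtain s where s: "s \<in> S" "s ~= t0" "dist s t0 < min (t0 / 2) (e / (C + 1))"
    using t0(2) e C t0p unfolding islimpt_approachable by (metis add_nonneg_pos divide_pos_pos half_gt_zero min_less_iff_conj zero_less_one)
   have "norm (psol t0 z m x) <= C * \<bar>s - t0\<bar>" using b[of "s - t0"] s by (auto simp: dist_real_def)
   also have "... <= (C + 1) * (e / (C + 1))" using s C by (intro mult_mono) (auto simp: dist_real_def)
   finally show ?thesis using C by simp
  qed
  then have "norm (psol t0 z m x) <= 0" by (rule field_le_epsilon)
  then show ?case by simp
 qed
 then show ?thesis by (rule psol_zero_everywhere[OF t0p x _ t])
qed

lemma psol_continuous: "continuous_on A (psol t z j)"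
 unfolding psol_def[abs_def] by (intro continuous_intros continuous_on_subset[OF zf_continuous]) auto

text \<open>Near an accumulation point \<open>x0\<close> the solution is, to first order, its flux
  times \<open>R x - R x0\<close>, so the flux at \<open>x0\<close> vanishes as well, at all times
  and with all time derivatives. The Volterra series at \<open>x0\<close> is then zero for every
  positive time, and time tends to 0.\<close>

lemma spatial_unique_continuation:
 assumes X: "infinite X" "X \<subseteq> {0..1}" and z: "!!x t j. x \<in> X ==> 0 < t ==> psol t z j x = 0"
 shows "z = 0"
proof -
 obtain x0 where x0: "x0 \<in> {0..1}" "x0 islimpt X"
  using X compact_Icc[of "0::real" 1] unfolding compact_eq_Bolzano_Weierstrass by blast
 have x01: "0 <= x0" "x0 <= 1" using x0 by auto
 have K0: "0 < K" using K1 by simp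
 have ps: "psol t z j x0 = 0" if t: "0 < t" for t j
 proof -
  have "closed {x. psol t z j x = 0}"
   by (rule closed_Collect_eq[OF psol_continuous continuous_on_const])
  moreover have "x0 islimpt {x. psol t z j x = 0}" by (rule islimpt_subset[OF x0(2)]) (use z t in auto)
  ultimately show ?thesis unfolding closed_limpt by blast
 qed
 have pf0: "pflx t z 0 x0 = 0" if t: "0 < t" for t
 proof -
  define C where "C = K * (K * (2 * K * (fact (Suc 1) / t ^ Suc 1 * norm z)) / 2)"
  have C: "0 <= C" using K0 t by (simp add: C_def)
  have b: "norm (pflx t z 0 x0) <= C * \<bar>x - x0\<bar>" if x: "x \<in> X" "x ~= x0" for x
  proof -
   have x1: "0 <= x" "x <= 1" using x X by auto
   have Rp: "prim (%s. complex_of_real (\<rho> s) * 1) y = of_real (R y)" for y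
    by (simp add: R_def prim_def scaleR_conv_of_real flip: integral_complex_of_real of_real_mult)
   have "gg x0 0 x = of_real (R x - R x0)" using x1 x01 Rp by (simp add: gg_def iprim_eq)
   then have "norm (pflx t z 0 x0) * \<bar>R x - R x0\<bar> <= K * (2 * K * (fact (Suc 1) / t ^ Suc 1 * norm z)) * \<bar>x - x0\<bar>\<^sup>2 / 2"
    using heat_expansion_power[OF t x01 ps[OF t] x1, of 1] z[OF x(1) t, of 0] by (simp add: norm_mult del: of_real_diff)
   moreover have "\<bar>x - x0\<bar> / K <= \<bar>R x - R x0\<bar>"
    using R_diff(3)[of x x0] R_diff(3)[of x0 x] x1 x01 by (cases "x <= x0") auto
   ultimately have "norm (pflx t z 0 x0) * (\<bar>x - x0\<bar> / K) <= K * (2 * K * (fact (Suc 1) / t ^ Suc 1 * norm z)) * \<bar>x - x0\<bar>\<^sup>2 / 2"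
    by (meson mult_left_mono norm_ge_zero order_trans)
   also have "... = (C * \<bar>x - x0\<bar>) * (\<bar>x - x0\<bar> / K)" using K0 by (simp add: C_def power2_eq_square)
   finally show ?thesis using x(2) K0 by (subst (asm) mult_le_cancel_right_pos) auto
  qed
  have "norm (pflx t z 0 x0) <= 0 + e" if e: "0 < e" for e
  proof -
   have "0 < e / (C + 1)" using e C by simp
   then obtain s where s: "s \<in> X" "s ~= x0" "dist s x0 < e / (C + 1)"
    using x0(2) unfolding islimpt_approachable by blast
   have "norm (pflx t z 0 x0) <= C * \<bar>s - x0\<bar>" using b s by auto
   also have "... <= (C + 1) * (e / (C + 1))" using s C by (intro mult_mono) (auto simp: dist_real_def)
   finally show ?thesis using C by simp
  qed
  then have "norm (pflx t z 0 x0) <= 0" by (rule field_le_epsilon)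
  then show ?thesis by simp
 qed
 have pf: "\<forall>t>0. pflx t z j x0 = 0" for j
 proof (induction j)
  case (Suc j)
  show ?case
  proof (intro allI impI)
   fix t :: real assume t: "0 < t"
   have "((%t. pflx t z j x0) has_vector_derivative 0) (at t)"
    by (rule has_vector_derivative_transform_within_open[OF _ _ _ , of "%_. 0" _ _ "{0<..}"]) (use Suc t in auto)
   then show "pflx t z (Suc j) x0 = 0" using vector_derivative_unique_at[OF pflx_derivative[OF t]] by blast
  qed
 qed (use pf0 in blast)
 have "sg t z = 0" if t: "0 < t" for t
 proof -
  have "zf (sgd 1 t z) x = 0" if x: "0 <= x" "x <= 1" for x
  proof -
   have "norm (psol t z 0 x) <= 2 * K / t * norm z * ((2 * K / t) ^ n * fact n / fact (2 * n))" for n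
    using heat_expansion[OF t x01 ps[OF t] x, of n] pf t by simp
   then have "norm (psol t z 0 x) <= 0" by (intro LIMSEQ_le_const[OF heat_expansion_limit[OF t, of z]]) auto
   then show ?thesis by (simp add: psol_def)
  qed
  then have "L2_of (zf (sgd 1 t z)) = L2_of (%x. 0)"
   by (subst L2_of_eq_iff[OF zf_L2 L2_fun_zero]) (auto intro!: AE_I2 simp: space_restrict_space)
  then show ?thesis using S_sgd[OF t, of 0 z] sgd_0[OF t, of z] by (simp add: green_def L2_of_zero)
 qed
 then have ev: "\<forall>\<^sub>F t in at_right 0. sg t z = 0" by (auto simp: eventually_at_filter)
 have "((%t. 0) \<longlongrightarrow> z) (at_right (0::real))"
  by (rule Lim_transform_eventually[OF tendsto_mono[OF at_le[OF subset_UNIV] sg_tendsto_0] ev])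
 then show ?thesis by (simp add: tendsto_const_iff)
qed

text \<open>By Fubini infinitely many positions have a time slice of positive measure, which is
  therefore infinite. Zeros accumulate first in time at each such position, then in space.\<close>

lemma measurable_unique_continuation:
 assumes E: "E \<in> sets (borel :: (real \<times> real) measure)" "E \<subseteq> {a..b} \<times> {0..1}" "b < \<tau>" "emeasure lborel E ~= 0"
  and z: "!!s x. (s, x) \<in> E ==> psol (\<tau> - s) z 0 x = 0"
 shows "z = 0"
proof -
 have Em: "E \<in> sets (lborel \<Otimes>\<^sub>M lborel)" unfolding lborel_prod using E(1) by simp
 define m where "m x = emeasure lborel ((%s. (s, x)) -` E)" for x :: real
 define X where "X = {x. m x ~= 0}"
 have mm: "m \<in> borel_measurable lborel"
  unfolding m_def using lborel_pair.measurable_emeasure_Pair2[OF Em] by simp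
 have "(\<integral>\<^sup>+ x. m x \<partial>lborel) = emeasure lborel E"
  unfolding m_def using lborel_pair.emeasure_pair_measure_alt2[OF Em] by (simp add: lborel_prod)
 then have "\<not> (AE x in lborel. m x = 0)" using E(4) nn_integral_0_iff_AE[OF mm] by simp
 then have "X \<notin> null_sets lborel" using AE_not_in[of X lborel] by (auto simp: X_def)
 then have inf: "infinite X" using finite_imp_null_set_lborel by blast
 have XE: "\<exists>s. (s, x) \<in> E" if "x \<in> X" for x
 proof (rule ccontr)
  assume "\<nexists>s. (s, x) \<in> E"
  then have "(%s. (s, x)) -` E = {}" by blast
  then show False using that by (simp add: X_def m_def)
 qed
 show ?thesis
 proof (rule spatial_unique_continuation[OF inf])
  show "X \<subseteq> {0..1}" using XE E(2) by blast
  fix x t j assume x: "x \<in> X" and t: "0 < (t::real)"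
  show "psol t z j x = 0"
  proof (rule psol_accumulating_zeros[OF _ _ _ _ _ t])
   have "infinite ((%s. (s, x)) -` E)"
    using x finite_imp_null_set_lborel[of "(%s. (s, x)) -` E"] by (auto simp: X_def m_def null_sets_def)
   then show "infinite ((%s. \<tau> - s) ` (%s. (s, x)) -` E)" by (subst finite_image_iff) (auto simp: inj_on_def)
   show "(%s. \<tau> - s) ` (%s. (s, x)) -` E \<subseteq> {\<tau> - b..\<tau> - a}" "0 < \<tau> - b" using E(2,3) by auto
   show "psol s z 0 x = 0" if "s \<in> (%s. \<tau> - s) ` (%s. (s, x)) -` E" for s using z that by auto
   show "x <= 1" using XE[OF x] E(2) by auto
  qed
 qed
qed

lemma sg_eq_L2_of:
 assumes "0 < t"
 shows "sg t z = L2_of (zf (sgd 1 t z))"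
 using S_sgd[OF assms, of 0 z] sgd_0[OF assms, of z] by (simp add: green_def)

text \<open>The Gramian of the observation on \<open>E\<close> is positive and, by unique continuation, injective; so it has dense range.\<close>

lemma approximate_controllability:
 assumes E: "E \<in> sets (borel :: (real \<times> real) measure)" "E \<subseteq> {0<..<\<tau> - \<delta>} \<times> J" "emeasure lborel E ~= 0"
  and J: "J \<in> sets borel" "J \<subseteq> {0<..<1}" and \<delta>: "0 < \<delta>" "\<delta> < \<tau>" and e: "0 < e"
 obtains w W where "nice w W" "!!p. p \<notin> E ==> w p = 0" "norm (duh (control_input J w) \<tau> - y) < e"
proof -
 \<comment> \<open>Time to go and position are clamped so that \<open>g z\<close> is bounded and
   continuous on the whole plane; on \<open>E\<close> the clamps are inactive.\<close>
 define g where "g z p = psol (max \<delta> (\<tau> - fst p)) z 0 (min 1 (snd p))" for z :: L2 and p :: "real \<times> real"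
 define w where "w z p = indicator E p * g z p" for z p
 define W where "W z = 2 * K * (1 / \<delta> * norm z)" for z :: L2
 have K0: "0 < K" using K1 by simp
 have gb: "norm (g z p) <= W z" for z p
 proof -
  have "norm (g z p) <= 2 * K * (fact (Suc 0) / (max \<delta> (\<tau> - fst p)) ^ Suc 0 * norm z)"
   unfolding g_def using \<delta> by (intro psol_bound) auto
  also have "... <= W z" unfolding W_def using \<delta> K0 by (intro mult_left_mono mult_right_mono) (auto simp: field_simps)
  finally show ?thesis .
 qed
 have gm: "g z \<in> borel_measurable borel" for z
 proof -
  have "continuous_on UNIV (g z)"
   unfolding continuous_on_eq_continuous_at[OF open_UNIV]
  proof (intro ballI)
   fix p :: "real \<times> real"
   define F where "F q = sgd 1 (max \<delta> (\<tau> - fst q)) z" for q :: "real \<times> real"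
   have Fc: "isCont F p"
   proof -
    have "isCont (%t. sgd 1 t z) t" if "0 < t" for t by (rule has_vector_derivative_continuous[OF sgd_has_vector_derivative[OF that]])
    from isCont_o2[OF _ this, of p "%q. max \<delta> (\<tau> - fst q)"] show ?thesis
     unfolding F_def using \<delta> by (simp add: continuous_max continuous_diff continuous_fst)
   qed
   have gz: "g z q = zf (F q) (min 1 (snd q))" for q by (simp add: g_def F_def psol_def)
   have d: "zf (G - G') x = zf G x - zf G' x" if "x <= 1" for G G' x
    using zf_add[OF that, of "G - G'" G'] by simp
   have "(%q. zf (F q) (min 1 (snd q)) - zf (F p) (min 1 (snd q))) \<midarrow>p\<rightarrow> 0"
   proof (rule Lim_null_comparison[OF always_eventually])
    show "\<forall>q. norm (zf (F q) (min 1 (snd q)) - zf (F p) (min 1 (snd q))) <= 2 * K * norm (F q - F p)"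
     using zf_bound d by (metis min.cobounded1)
    have "(%q. 2 * K * norm (F q - F p)) \<midarrow>p\<rightarrow> 2 * K * norm (F p - F p)" using Fc unfolding isCont_def by (intro tendsto_intros)
    then show "(%q. 2 * K * norm (F q - F p)) \<midarrow>p\<rightarrow> 0" by simp
   qed
   moreover have "isCont (%q. zf (F p) (min 1 (snd q))) p"
   proof (rule isCont_o2[where g="zf (F p)"])
    show "isCont (%q. min 1 (snd q)) p" by (simp add: continuous_min continuous_snd)
    show "isCont (zf (F p)) (min 1 (snd p))" using zf_continuous[of "F p"] by (simp add: continuous_on_eq_continuous_at)
   qed
   ultimately have "(%q. (zf (F q) (min 1 (snd q)) - zf (F p) (min 1 (snd q))) + zf (F p) (min 1 (snd q))) \<midarrow>p\<rightarrow> 0 + zf (F p) (min 1 (snd p))"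
    unfolding isCont_def by (intro tendsto_add)
   then show "isCont (g z) p" unfolding isCont_def gz by simp
  qed
  then show ?thesis by (rule borel_measurable_continuous_onI)
 qed
 have wn: "nice (w z) (W z)" for z
  unfolding nice_def
 proof (intro conjI allI)
  show "w z \<in> borel_measurable borel" unfolding w_def[abs_def] using E(1) gm by measurable
  show "norm (w z p) <= W z" for p using gb[of z p] order_trans[OF norm_ge_zero gb[of z p]] by (auto simp: w_def indicator_def)
 qed
 have lin: "zf (sgd 1 t (a + b)) x = zf (sgd 1 t a) x + zf (sgd 1 t b) x" "zf (sgd 1 t (r *\<^sub>R a)) x = r *\<^sub>R zf (sgd 1 t a) x"
  if "0 < t" "x <= 1" for t a b r x
  using bounded_linear.linear[OF sgd_bounded_linear[OF that(1), of 1]] that by (simp_all add: linear_add linear_scale zf_add zf_scaleR)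
 have glin: "g (a + b) p = g a p + g b p" "g (r *\<^sub>R a) p = r *\<^sub>R g a p" for a b r p
  using lin \<delta> by (simp_all add: g_def psol_def)
 define A where "A z = duh (control_input J (w z)) \<tau>" for z
 note ci = control_input_measurable[OF wn J(1)] control_slice(3)[OF wn J(1)]
 have wlin: "w (a + b) p = w a p + w b p" "w (r *\<^sub>R a) p = r *\<^sub>R w a p" for a b r p
  using glin by (simp_all add: w_def distrib_left)
 have "control_input J (w (a + b)) = (%s. control_input J (w a) s + control_input J (w b) s)" for a b
  by (intro ext) (simp add: control_input_def wlin distrib_left L2_of_add[OF control_slice(2)[OF wn J(1)] control_slice(2)[OF wn J(1)]])
 then have Aadd: "A (a + b) = A a + A b" for a b unfolding A_def using duh_add[OF ci ci] by simp
 have "control_input J (w (r *\<^sub>R a)) = (%s. r *\<^sub>R control_input J (w a) s)" for r a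
  by (intro ext) (simp add: control_input_def wlin flip: L2_of_scaleR[OF control_slice(2)[OF wn J(1)]])
 then have Asc: "A (r *\<^sub>R a) = r *\<^sub>R A a" for r a unfolding A_def using duh_scaleR by simp
 define \<mu> where "\<mu> = lebesgue_on ({0<..<\<tau>} \<times> J)"
 define B where "B a b = (LINT q|\<mu>. w a q \<bullet> w b q)" for a b
 have Qb: "{0<..<\<tau>} \<times> J \<in> sets borel" by (rule Q_sets[OF J(1)])
 have off: "w a q = 0" if "q \<notin> {0<..<\<tau> - \<delta>} \<times> J" for a q using E(2) that by (auto simp: w_def indicator_def)
 have hm: "(%q. w a q \<bullet> w b q) \<in> borel_measurable borel" for a b using niceD(1)[OF wn] by (intro borel_measurable_inner) auto
 have hi: "integrable \<mu> (%q. w a q \<bullet> w b q)" for a b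
  unfolding \<mu>_def
 proof (rule bounded_integrable_Q(1)[OF hm _ J])
  show "norm (w a q \<bullet> w b q) <= W a * W b" for q
   using order_trans[OF Cauchy_Schwarz_ineq2 mult_mono[OF niceD(2)[OF wn] niceD(2)[OF wn] nice_nonneg[OF wn] norm_ge_zero]] by simp
 qed
 have AB: "A a \<bullet> b = B a b" for a b
 proof -
  have sub: "indicator ({0<..<\<tau>} \<times> J) q *\<^sub>R (w a q \<bullet> w b q) = w a q \<bullet> w b q" for q
  proof (cases "q \<in> {0<..<\<tau>} \<times> J")
   case False
   then have "q \<notin> {0<..<\<tau> - \<delta>} \<times> J" using \<delta> by (cases q) auto
   then show ?thesis using off[of q a] by simp
  qed simp
  have il: "integrable lborel (%q. w a q \<bullet> w b q)"
   using hi[of a b] unfolding \<mu>_def integrable_lebesgue_on_borel[OF hm Qb] sub .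
  have "B a b = (LINT q|lborel. w a q \<bullet> w b q)"
   unfolding B_def \<mu>_def integral_lebesgue_on_borel[OF hm Qb] sub ..
  also have "... = (LINT s|lborel. LINT x|lborel. w a (s, x) \<bullet> w b (s, x))"
   using il unfolding lborel_prod[symmetric] by (rule lborel_pair.integral_fst'[symmetric])
  also have "... = (LINT s|lborel. indicator {0..\<tau>} s * (control_input J (w a) s \<bullet> sg (\<tau> - s) b))"
  proof (intro integral_eqI)
   fix s
   show "(LINT x|lborel. w a (s, x) \<bullet> w b (s, x)) = indicator {0..\<tau>} s * (control_input J (w a) s \<bullet> sg (\<tau> - s) b)"
   proof (cases "0 < s \<and> s < \<tau> - \<delta>")
    case True
    then have t: "0 < \<tau> - s" using \<delta> by simp
    have "control_input J (w a) s \<bullet> sg (\<tau> - s) b = (LINT x|leb01. (indicator J x * w a (s, x)) \<bullet> zf (sgd 1 (\<tau> - s) b) x)"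
     unfolding control_input_def sg_eq_L2_of[OF t] by (rule inner_L2_of[OF control_slice(2)[OF wn J(1)] zf_L2])
    also have "... = (LINT x|lborel. indicator {0<..<1} x *\<^sub>R ((indicator J x * w a (s, x)) \<bullet> zf (sgd 1 (\<tau> - s) b) x))"
     by (rule integral_lebesgue_on_borel) (auto intro!: borel_measurable_inner control_slice(1)[OF wn J(1)])
    also have "... = (LINT x|lborel. w a (s, x) \<bullet> w b (s, x))"
     using E(2) J(2) True by (intro integral_eqI) (auto simp: w_def g_def psol_def indicator_def)
    finally show ?thesis using True \<delta> by simp
   next
    case False
    then have "w a (s, x) = 0" for a x using off by auto
    then show ?thesis by (simp add: control_input_def L2_of_zero)
   qed
  qed
  finally show ?thesis unfolding A_def duh_inner[OF ci] by simp
 qed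
 have Ainj: "z = 0" if "A z = 0" for z
 proof -
  have "B z z = 0" using AB[of z z] that by simp
  then have "AE q in \<mu>. w z q \<bullet> w z q = 0" unfolding B_def by (subst (asm) integral_nonneg_eq_0_iff_AE[OF hi]) auto
  then have ae: "AE q in lborel. q \<in> {0<..<\<tau>} \<times> J --> w z q \<bullet> w z q = 0"
   unfolding \<mu>_def using Qb by (subst (asm) AE_lebesgue_on_iff) auto
  define E' where "E' = {p \<in> E. g z p = 0}"
  have ae': "AE p in lborel. p \<in> E --> p \<in> E'"
   using ae by eventually_elim (use E(2) \<delta> in \<open>auto simp: E'_def w_def\<close>)
  have E'm: "E' \<in> sets borel"
  proof -
   have "E' = E \<inter> {p. g z p = 0}" by (auto simp: E'_def)
   moreover have "{p. g z p = 0} \<in> sets borel" using measurable_sets_borel[OF gm, of "{0}" z] by (simp add: vimage_def)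
   ultimately show ?thesis using E(1) by auto
  qed
  have "emeasure lborel E' = emeasure lborel E"
   by (rule emeasure_eq_AE) (use ae' E'm E(1) in \<open>auto simp: E'_def elim: eventually_mono\<close>)
  then have Ep: "emeasure lborel E' ~= 0" using E(3) by simp
  show "z = 0"
  proof (rule measurable_unique_continuation[OF E'm _ _ Ep, of 0 "\<tau> - \<delta>" \<tau>])
   show "E' \<subseteq> {0..\<tau> - \<delta>} \<times> {0..1}" using E(2) J(2) by (fastforce simp: E'_def)
   fix s x assume a: "(s, x) \<in> E'"
   then have "(s, x) \<in> E" "g z (s, x) = 0" by (auto simp: E'_def)
   then have "x < 1" "\<delta> <= \<tau> - s" using E(2) J(2) by auto
   then show "psol (\<tau> - s) z 0 x = 0" using \<open>g z (s, x) = 0\<close> by (simp add: g_def)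
  qed (use \<delta> in simp)
 qed
 interpret P: pos_inj A "2 * K * (1 / \<delta>) * \<tau>"
 proof
  show "0 < 2 * K * (1 / \<delta>) * \<tau>" using K0 \<delta> by simp
  show "A (a + b) = A a + A b" "A (r *\<^sub>R a) = r *\<^sub>R A a" "A a = 0 ==> a = 0" for a b r by (fact Aadd Asc Ainj)+
  show "A a \<bullet> b = a \<bullet> A b" for a b
   unfolding AB inner_commute[of a] B_def by (simp add: inner_commute)
  show "0 <= A a \<bullet> a" for a unfolding AB B_def by (intro integral_nonneg_AE AE_I2) simp_all
  show "norm (A a) <= 2 * K * (1 / \<delta>) * \<tau> * norm a" for a
   using duh_norm[OF ci, of \<tau> a] \<delta> by (simp add: A_def W_def mult_ac)
 qed
 obtain z where z: "norm (y - A z) < e" using P.S_dense[OF e] by blast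
 show ?thesis
  by (rule that[OF wn[of z]]) (use z in \<open>auto simp: w_def A_def norm_minus_commute\<close>)
qed

end

section \<open>Limits of controls\<close>

text \<open>A substitute for Cauchy-Schwarz with a free parameter: \<open>b\<close> is made small
  first, then the square integral, which yields smallness in the \<open>L^1\<close> norm.\<close>

lemma nice_L1_le:
 fixes T :: real
 assumes w: "nice w B" and J: "J \<in> sets borel" "J \<subseteq> {0<..<1}" and b: "0 < b"
 defines "\<mu> \<equiv> lebesgue_on ({0<..<T} \<times> J)"
 shows "(LINT q|\<mu>. norm (w q)) <= b * measure \<mu> (space \<mu>) + (1 / b) * (LINT q|\<mu>. (norm (w q))\<^sup>2)"
  and "integrable \<mu> (%q. norm (w q))" and "integrable \<mu> (%q. (norm (w q))\<^sup>2)"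
proof -
 have fin: "finite_measure \<mu>" unfolding \<mu>_def by (rule bounded_integrable_Q(2)[OF niceD[OF w] J])
 have m: "(%q. norm (w q)) \<in> borel_measurable borel" "(%q. (norm (w q))\<^sup>2) \<in> borel_measurable borel"
  using niceD(1)[OF w] by measurable
 show i1: "integrable \<mu> (%q. norm (w q))"
  unfolding \<mu>_def by (rule bounded_integrable_Q(1)[OF m(1) _ J, where B=B]) (simp add: niceD(2)[OF w])
 show i2: "integrable \<mu> (%q. (norm (w q))\<^sup>2)"
  unfolding \<mu>_def by (rule bounded_integrable_Q(1)[OF m(2) _ J, where B="B\<^sup>2"]) (simp add: niceD(2)[OF w] power_mono)
 have i: "integrable \<mu> (%q. b + (1 / b) * (norm (w q))\<^sup>2)"
  by (intro Bochner_Integration.integrable_add integrable_mult_right i2 finite_measure.integrable_const[OF fin])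
 have "(LINT q|\<mu>. norm (w q)) <= (LINT q|\<mu>. b + (1 / b) * (norm (w q))\<^sup>2)"
 proof (rule integral_mono[OF i1 i])
  fix q
  have "0 <= b * norm (w q)" using b by simp
  then have "b * norm (w q) <= b\<^sup>2 + (norm (w q))\<^sup>2"
   using sum_squares_bound[of b "norm (w q)"] unfolding mult.assoc by linarith
  then show "norm (w q) <= b + (1 / b) * (norm (w q))\<^sup>2" using b by (simp add: field_simps power2_eq_square)
 qed
 also have "... = b * measure \<mu> (space \<mu>) + (1 / b) * (LINT q|\<mu>. (norm (w q))\<^sup>2)"
  by (subst Bochner_Integration.integral_add[OF finite_measure.integrable_const[OF fin] integrable_mult_right[OF i2]]) (simp add: mult.commute)
 finally show "(LINT q|\<mu>. norm (w q)) <= b * measure \<mu> (space \<mu>) + (1 / b) * (LINT q|\<mu>. (norm (w q))\<^sup>2)" .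
qed

text \<open>Minimising the \<open>L\<^sup>2\<close> norm over decreasing convex sets of controls replaces weak-star compactness.\<close>

lemma (in coef) convex_selection:
 assumes u: "!!n. nice (u n) M" and J: "J \<in> sets borel" "J \<subseteq> {0<..<1}" and t: "0 < t"
  and lim: "(%n. duh (control_input J (u n)) t) \<longlonglongrightarrow> y"
  and g: "nice g B" and \<beta>: "!!n. (LINT q|lebesgue_on ({0<..<t} \<times> J). u n q \<bullet> g q) <= \<beta>"
 obtains v where "nice v M" "duh (control_input J v) t = y" "(LINT q|lebesgue_on ({0<..<t} \<times> J). v q \<bullet> g q) <= \<beta>"
proof -
 define \<mu> where "\<mu> = lebesgue_on ({0<..<t} \<times> J)"
 define \<Phi> where "\<Phi> v = duh (control_input J v) t" for v
 define G where "G v = (LINT q|\<mu>. v q \<bullet> g q)" for v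
 define q where "q v = (LINT p|\<mu>. (norm (v p))\<^sup>2)" for v :: "real \<times> real => complex"
 have M0: "0 <= M" by (rule nice_nonneg[OF u])
 have fin: "finite_measure \<mu>" unfolding \<mu>_def using bounded_integrable_Q(2)[of "%_. 0 :: real" 0, OF _ _ J] by simp
 have int: "integrable \<mu> f" if "f \<in> borel_measurable borel" "!!p. norm (f p) <= B" for f :: "real \<times> real => real" and B
  unfolding \<mu>_def by (rule bounded_integrable_Q(1)[OF that J])
 have iq: "integrable \<mu> (%p. (norm (v p))\<^sup>2)" if "nice v N" for v N
  unfolding \<mu>_def by (rule nice_L1_le(3)[OF that J zero_less_one])
 have gb: "norm (v p \<bullet> g p) <= N * B" if v: "nice v N" for v N p
  using order_trans[OF Cauchy_Schwarz_ineq2 mult_mono[OF niceD(2)[OF v] niceD(2)[OF g] nice_nonneg[OF v] norm_ge_zero]] by simp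
 have iG: "integrable \<mu> (%p. v p \<bullet> g p)" if v: "nice v N" for v N
 proof (rule int[where B="N * B"])
  show "(%p. v p \<bullet> g p) \<in> borel_measurable borel" using v g by (auto simp: nice_def)
  show "norm (v p \<bullet> g p) <= N * B" for p by (rule gb[OF v])
 qed
 \<comment> \<open>Decreasing convex sets of controls that reach \<open>y\<close> up to
   \<open>1 / Suc k\<close>. The constraint on \<open>G\<close> is linear, hence compatible with
   midpoints.\<close>
 define W where "W k = {v. nice v M \<and> norm (\<Phi> v - y) <= 1 / real (Suc k) \<and> G v <= \<beta>}" for k
 have Wne: "W k ~= {}" for k
 proof -
  obtain n where "norm (\<Phi> (u n) - y) < 1 / real (Suc k)"
   using LIMSEQ_D[OF lim, of "1 / real (Suc k)"] unfolding \<Phi>_def by auto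
  then show ?thesis using u \<beta>[of n] unfolding W_def G_def \<mu>_def by force
 qed
 have Wdec: "W k \<subseteq> W j" if "j <= k" for j k
  using that by (auto simp: W_def elim!: order_trans intro!: divide_left_mono)
 have Wmid: "(%p. (1 / 2) *\<^sub>R (v p + w p)) \<in> W k" if "v \<in> W k" "w \<in> W k" for v w k
 proof -
  have n: "nice v M" "nice w M" using that by (auto simp: W_def)
  have vw: "nice (%p. v p + w p) (M + M)" by (rule nice_add[OF n])
  have "\<Phi> (%p. (1 / 2) *\<^sub>R (v p + w p)) = (1 / 2) *\<^sub>R (\<Phi> v + \<Phi> w)"
   unfolding \<Phi>_def ci_scaleR[OF vw J(1)] duh_scaleR ci_add[OF n J(1)]
   by (simp add: duh_add[OF control_input_measurable[OF n(1) J(1)] control_slice(3)[OF n(1) J(1)]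
      control_input_measurable[OF n(2) J(1)] control_slice(3)[OF n(2) J(1)]])
  also have "... - y = (1 / 2) *\<^sub>R ((\<Phi> v - y) + (\<Phi> w - y))"
   by (simp add: algebra_simps flip: scaleR_add_left)
  also have "norm ... <= (1 / 2) * (1 / real (Suc k) + 1 / real (Suc k))"
   unfolding norm_scaleR using that by (intro mult_mono norm_triangle_mono) (auto simp: W_def)
  finally have 1: "norm (\<Phi> (%p. (1 / 2) *\<^sub>R (v p + w p)) - y) <= 1 / real (Suc k)" by simp
  have "G (%p. (1 / 2) *\<^sub>R (v p + w p)) = (1 / 2) * (G v + G w)"
   unfolding G_def using iG n by (simp add: inner_add_left)
  then have 2: "G (%p. (1 / 2) *\<^sub>R (v p + w p)) <= \<beta>" using that by (simp add: W_def)
  have "nice (%p. (1 / 2) *\<^sub>R (v p + w p)) M" using nice_scaleR[OF vw, of "1 / 2"] by simp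
  then show ?thesis using 1 2 by (simp add: W_def)
 qed
 define m where "m k = Inf (q ` W k)" for k
 have q0: "0 <= q v" for v by (simp add: q_def)
 have bdd: "bdd_below (q ` W k)" for k using q0 by (intro bdd_belowI[of _ 0]) auto
 have mle: "m k <= q v" if "v \<in> W k" for k v unfolding m_def using that bdd by (intro cInf_lower) auto
 have "\<exists>v. v \<in> W k \<and> q v < m k + 1 / real (Suc k)" for k
  using cInf_lessD[of "q ` W k" "m k + 1 / real (Suc k)"] Wne by (auto simp: m_def)
 then obtain v where v: "!!k. v k \<in> W k" "!!k. q (v k) < m k + 1 / real (Suc k)" by metis
 have vn: "nice (v k) M" for k using v(1) by (simp add: W_def)
 have inc: "incseq m"
  unfolding incseq_def m_def by (intro allI impI cInf_superset_mono image_mono Wdec bdd) (use Wne in auto)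
 have "m k <= M\<^sup>2 * measure \<mu> (space \<mu>)" for k
 proof -
  have "q (v k) <= (LINT p|\<mu>. M\<^sup>2)" unfolding q_def
   using vn[of k] iq[OF vn] finite_measure.integrable_const[OF fin] by (intro integral_mono) (auto simp: nice_def intro!: power_mono)
  then show ?thesis using mle[OF v(1)[of k]] by (simp add: mult.commute)
 qed
 then have "convergent m" using incseq_convergent[OF inc] by (metis convergentI)
 then have mC: "Cauchy m" by (rule convergent_Cauchy)
 \<comment> \<open>The parallelogram identity: midpoints of nearly minimal elements stay in
   \<open>W i\<close>, so their square norm cannot fall below \<open>m i\<close>, and the difference
   must be small.\<close>
 have par: "q (%p. v i p - v j p) <= 2 * \<bar>m i - m j\<bar> + 2 * (1 / real (Suc i)) + 2 * (1 / real (Suc j))" if "i <= j" for i j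
 proof -
  have vj: "v j \<in> W i" using v(1) Wdec[OF that] by blast
  have "(norm (v i p - v j p))\<^sup>2 = 2 * (norm (v i p))\<^sup>2 + 2 * (norm (v j p))\<^sup>2 - 4 * (norm ((1 / 2) *\<^sub>R (v i p + v j p)))\<^sup>2" for p
   by (simp add: power_divide power2_norm_eq_inner inner_add_left inner_add_right inner_diff_left inner_diff_right inner_commute add_divide_distrib)
  then have "q (%p. v i p - v j p) = 2 * q (v i) + 2 * q (v j) - 4 * q (%p. (1 / 2) *\<^sub>R (v i p + v j p))"
   unfolding q_def using iq[OF vn[of i]] iq[OF vn[of j]] iq[OF nice_scaleR[OF nice_add[OF vn[of i] vn[of j]], of "1 / 2"]]
   by simp
  moreover have "Q <= 2 * \<bar>m1 - m2\<bar> + 2 * A + 2 * B"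
   if "Q = 2 * a + 2 * b - 4 * s" "a < m1 + A" "b < m2 + B" "m1 <= s" for Q a b s m1 m2 A B :: real
   using that by (smt (verit))
  ultimately show ?thesis using v(2)[of i] v(2)[of j] mle[OF Wmid[OF v(1)[of i] vj]] by blast
 qed
 have C: "\<exists>N. \<forall>i\<ge>N. \<forall>j\<ge>N. (LINT p|\<mu>. norm (v i p - v j p)) < e" if e: "0 < e" for e
 proof -
  define A where "A = measure \<mu> (space \<mu>)"
  have A: "0 <= A" by (simp add: A_def)
  define b where "b = e / (2 * (A + 1))"
  have b: "0 < b" using e A by (simp add: b_def)
  obtain N1 where N1: "!!i j. N1 <= i ==> N1 <= j ==> \<bar>m i - m j\<bar> < b * e / 12"
   using mC b e unfolding Cauchy_def dist_real_def by (metis divide_pos_pos mult_pos_pos zero_less_numeral)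
  obtain N2 where N2: "1 / real (Suc N2) < b * e / 12" using b e nat_approx_posE[of "b * e / 12"] by auto
  have main: "(LINT p|\<mu>. norm (v i p - v j p)) < e" if ij: "max N1 N2 <= i" "i <= j" for i j
  proof -
   have "1 / real (Suc i) <= 1 / real (Suc N2)" "1 / real (Suc j) <= 1 / real (Suc N2)"
    using ij by (auto intro!: divide_left_mono)
   then have "q (%p. v i p - v j p) < b * (e / 2)"
    using par[OF ij(2)] N1[of i j] N2 ij by simp
   have "nice (%p. v i p - v j p) (M + M)" using nice_add[OF vn[of i] nice_scaleR[OF vn[of j], of "-1"]] by simp
   from nice_L1_le(1)[OF this J b, of t]
   have "(LINT p|\<mu>. norm (v i p - v j p)) <= b * A + (1 / b) * q (%p. v i p - v j p)"
    unfolding q_def A_def \<mu>_def .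
   also have "... < e / 2 + e / 2"
   proof (rule add_le_less_mono)
    show "b * A <= e / 2" using e A by (simp add: b_def field_simps)
    show "1 / b * q (%p. v i p - v j p) < e / 2" using \<open>q (%p. v i p - v j p) < b * (e / 2)\<close> b by (simp add: field_simps)
   qed
   finally show ?thesis by simp
  qed
  have "(LINT p|\<mu>. norm (v i p - v j p)) < e" if "max N1 N2 <= i" "max N1 N2 <= j" for i j
   using main[of i j] main[of j i] that by (cases "i <= j") (auto simp: norm_minus_commute)
  then show ?thesis by blast
 qed
 have "integrable \<mu> (v n)" for n
  unfolding \<mu>_def using vn[of n] by (intro bounded_integrable_Q(1)[OF _ _ J]) (auto simp: nice_def)
 then obtain r where r: "strict_mono r" "AE p in \<mu>. Cauchy (%i. v (r i) p)"
  using cauchy_L1_AE_cauchy_subseq[of \<mu> v, OF _ C] by blast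
 \<comment> \<open>Setting the controls to zero where the subsequence fails to converge makes it
   converge everywhere, which keeps the limit Borel and bounded at every point.\<close>
 define S where "S = {p. Cauchy (%i. v (r i) p)}"
 have Sm: "S \<in> sets borel"
  unfolding S_def using sets_Collect_Cauchy[OF niceD(1)[OF vn]] by simp
 define w where "w i p = indicator S p *\<^sub>R v (r i) p" for i p
 have wn: "nice (w i) M" for i
  unfolding nice_def w_def[abs_def] using vn[of "r i"] Sm M0 by (auto simp: nice_def indicator_def)
 have "convergent (%i. w i p)" for p
  by (cases "p \<in> S") (auto simp: w_def S_def Cauchy_convergent_iff convergent_const)
 then have wl: "(%i. w i p) \<longlonglongrightarrow> lim (%i. w i p)" for p by (simp add: convergent_LIMSEQ_iff)
 have wv: "AE p in \<mu>. w i p = v (r i) p" for i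
  using r(2) by eventually_elim (simp add: w_def S_def)
 have Pw: "\<Phi> (w i) = \<Phi> (v (r i))" for i
  unfolding \<Phi>_def by (rule duh_ci_AE[OF wn vn J(1)]) (use wv[of i] in \<open>simp only: \<mu>_def\<close>)
 have "(%i. \<Phi> (w i) - y) \<longlonglongrightarrow> 0"
 proof (rule Lim_null_comparison[OF always_eventually LIMSEQ_Suc[OF lim_1_over_n]], rule allI)
  fix i
  have "norm (\<Phi> (w i) - y) <= 1 / real (Suc (r i))" using v(1)[of "r i"] by (simp add: Pw W_def)
  also have "... <= 1 / real (Suc i)" using seq_suble[OF r(1), of i] by (intro divide_left_mono) auto
  finally show "norm (\<Phi> (w i) - y) <= 1 / real (Suc i)" .
 qed
 then have 1: "\<Phi> (%p. lim (%i. w i p)) = y"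
  using LIMSEQ_unique[OF LIM_zero_cancel duh_ci_tendsto[OF wn wl J(1)]] t unfolding \<Phi>_def by force
 have Gw: "G (w i) = G (v (r i))" for i
  unfolding G_def using wv[of i] iG[OF wn] iG[OF vn] by (intro integral_cong_AE) (auto elim: eventually_mono)
 have "(%i. G (w i)) \<longlonglongrightarrow> G (%p. lim (%i. w i p))"
  unfolding G_def
 proof (rule integral_dominated_convergence[where w="%p. M * B"])
  show "AE p in \<mu>. (%i. w i p \<bullet> g p) \<longlonglongrightarrow> lim (%i. w i p) \<bullet> g p" by (intro AE_I2 tendsto_intros wl)
  show "AE p in \<mu>. norm (w i p \<bullet> g p) <= M * B" for i
   by (rule AE_I2, rule gb[OF wn])
 qed (use iG[OF wn] iG[OF nice_limit[OF wn wl]] finite_measure.integrable_const[OF fin] in auto)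
 then have "G (%p. lim (%i. w i p)) <= \<beta>"
  by (rule LIMSEQ_le_const2) (use v(1) Gw in \<open>auto simp: W_def\<close>)
 with 1 show ?thesis by (intro that[OF nice_limit[OF wn wl]]) (simp_all add: \<Phi>_def G_def \<mu>_def)
qed

section \<open>Time-optimal controls\<close>

locale tocp = coef +
 fixes c d M :: real and z0 :: L2
 assumes cd: "0 <= c" "c < d" "d <= 1" and M0: "0 < M" and z0: "z0 ~= 0"
begin

abbreviation J where "J \<equiv> {c<..<d}"

text \<open>The bound \<open>N\<close> is a separate parameter because the arguments below trade
  slack in the bound for time.\<close>

definition adm :: "real => real => (real \<times> real => complex) => bool" where
 "adm N \<tau> u \<longleftrightarrow> 0 < \<tau> \<and> nice u N \<and> duh (control_input J u) \<tau> = - sg \<tau> z0"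

definition topt :: real where "topt = Inf {\<tau>. \<exists>u. adm M \<tau> u}"

lemma J: "J \<in> sets borel" "J \<subseteq> {0<..<1}"
 using cd by auto

lemma topt_le: "adm M \<tau> u ==> topt <= \<tau>"
 unfolding topt_def by (intro cInf_lower bdd_belowI[of _ 0]) (auto simp: adm_def)

lemma null_control_here:
 assumes "0 < t"
 obtains C where "0 <= C" "!!z. \<exists>u. nice u (C * norm z) \<and> duh (control_input J u) t = - sg t z"
proof -
 have l: "0 < d - c" using cd by simp
 obtain C where "0 <= C" "\<forall>\<rho> c' d' z0. coef K \<rho> --> 0 <= c' --> d' <= 1 --> d' - c' = d - c -->
   (\<exists>u. nice u (C * norm z0) \<and> coef.duh K \<rho> (control_input {c'<..<d'} u) t = - sgc K \<rho> t z0)"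
  using null_control[OF K1 l assms] by blast
 then show ?thesis using that coef_axioms cd by blast
qed

lemma duh_add':
 assumes u: "nice u N" and v: "nice v N'"
 shows "duh (control_input J (%p. u p + v p)) t = duh (control_input J u) t + duh (control_input J v) t"
 unfolding ci_add[OF u v J(1)]
 by (rule duh_add[OF control_input_measurable[OF u J(1)] control_slice(3)[OF u J(1)]
   control_input_measurable[OF v J(1)] control_slice(3)[OF v J(1)]])

lemma duh_scaleR': "nice u N ==> duh (control_input J (%p. r *\<^sub>R u p)) t = r *\<^sub>R duh (control_input J u) t"
 using ci_scaleR[OF _ J(1), of u N r] duh_scaleR by simp

lemma adm_convex:
 assumes u: "adm N \<tau> u" and v: "adm N' \<tau> v" and w: "!!p. norm ((1 - r) *\<^sub>R u p + r *\<^sub>R v p) <= L"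
 shows "adm L \<tau> (%p. (1 - r) *\<^sub>R u p + r *\<^sub>R v p)"
proof -
 have n: "nice u N" "nice v N'" using u v by (auto simp: adm_def)
 have "duh (control_input J (%p. (1 - r) *\<^sub>R u p + r *\<^sub>R v p)) \<tau> = (1 - r) *\<^sub>R (- sg \<tau> z0) + r *\<^sub>R (- sg \<tau> z0)"
  unfolding duh_add'[OF nice_scaleR[OF n(1)] nice_scaleR[OF n(2)]] duh_scaleR'[OF n(1)] duh_scaleR'[OF n(2)]
  using u v by (simp add: adm_def)
 also have "... = - sg \<tau> z0" by (simp add: scaleR_diff_left)
 finally show ?thesis
  using u w niceD(1)[OF nice_add[OF nice_scaleR[OF n(1), of "1 - r"] nice_scaleR[OF n(2), of r]]] by (simp add: adm_def nice_def)
qed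

text \<open>The slack \<open>M - N\<close> pays for a null control of the small difference between \<open>z0\<close> and the state at time \<open>h\<close>,
 so that the control can be started at time \<open>h\<close>.\<close>

lemma adm_shorter:
 assumes u: "adm N \<tau> u" and N: "N < M"
 shows "topt < \<tau>"
proof -
 have t: "0 < \<tau>" and un: "nice u N" and ud: "duh (control_input J u) \<tau> = - sg \<tau> z0" using u by (auto simp: adm_def)
 note uc = control_input_measurable[OF un J(1)] control_slice(3)[OF un J(1)]
 \<comment> \<open>The null control is given the fixed time \<open>\<tau> / 2\<close>, so its cost
   stays bounded while \<open>h\<close> tends to 0.\<close>
 obtain C where C: "0 <= C" "!!z. \<exists>u. nice u (C * norm z) \<and> duh (control_input J u) (\<tau> / 2) = - sg (\<tau> / 2) z"
  using null_control_here[of "\<tau> / 2"] t by auto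
 \<comment> \<open>The error committed when the control shifted by \<open>h\<close> starts from
   \<open>z0\<close> instead of the state reached at time \<open>h\<close>.\<close>
 define y where "y h = z0 - (sg h z0 + duh (control_input J u) h)" for h
 have "(y \<longlongrightarrow> 0) (at_right 0)"
 proof -
  have 1: "((%h. sg h z0) \<longlongrightarrow> z0) (at_right 0)" by (rule tendsto_mono[OF at_le[OF subset_UNIV] sg_tendsto_0])
  have "((%h. N * h) \<longlongrightarrow> N * 0) (at_right 0)" by (intro tendsto_intros)
  then have "((%h. N * h) \<longlongrightarrow> 0) (at_right 0)" by simp
  then have 2: "((%h. duh (control_input J u) h) \<longlongrightarrow> 0) (at_right 0)"
  proof (rule Lim_null_comparison[rotated])
   show "\<forall>\<^sub>F h in at_right 0. norm (duh (control_input J u) h) <= N * h"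
    using eventually_at_right_less[of 0] by eventually_elim (rule duh_norm[OF uc], simp)
  qed
  show ?thesis unfolding y_def using tendsto_diff[OF tendsto_const[of z0] tendsto_add[OF 1 2]] by simp
 qed
 then have "((%h. C * norm (y h)) \<longlongrightarrow> C * norm (0 :: L2)) (at_right 0)" by (intro tendsto_intros)
 then have "\<forall>\<^sub>F h in at_right 0. C * norm (y h) < M - N" using N by (intro order_tendstoD(2)) auto
 moreover have "\<forall>\<^sub>F h in at_right 0. h < \<tau> / 2" "\<forall>\<^sub>F h in at_right 0. (0::real) < h"
  using t by (auto simp: eventually_at_right_less eventually_at_right_field intro!: exI[of _ "\<tau> / 2"])
 ultimately have "\<forall>\<^sub>F h in at_right 0. C * norm (y h) < M - N \<and> h < \<tau> / 2 \<and> 0 < h" by eventually_elim simp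
 then obtain h where h: "C * norm (y h) < M - N" "h < \<tau> / 2" "0 < h"
  using eventually_happens'[OF trivial_limit_at_right_real] by blast
 obtain v where v: "nice v (C * norm (y h))" "duh (control_input J v) (\<tau> / 2) = - sg (\<tau> / 2) (y h)" using C(2) by blast
 define v' where "v' = cc (\<tau> / 2) v (%p. 0)"
 define u' where "u' p = u (fst p + h, snd p)" for p :: "real \<times> real"
 have v'n: "nice v' (C * norm (y h))" unfolding v'_def using C by (intro nice_cc[OF v(1)] nice_zero) auto
 have "duh (control_input J v') (\<tau> / 2 + (\<tau> / 2 - h)) = sg (\<tau> / 2 - h) (- sg (\<tau> / 2) (y h))"
  unfolding v'_def using h t C v(2) by (subst duh_cc[OF v(1) nice_zero J(1)]) (auto simp: duh_zero)
 also have "... = - sg (\<tau> - h) (y h)" using sg_add[of "\<tau> / 2 - h" "\<tau> / 2" "y h"] h t by (simp add: sg_lin)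
 finally have v'd: "duh (control_input J v') (\<tau> - h) = - sg (\<tau> - h) (y h)" by simp
 have u'n: "nice u' N" unfolding u'_def by (rule nice_shift[OF un])
 have "control_input J u' = (%s. control_input J u (h + s))" by (intro ext) (simp add: control_input_def u'_def add.commute)
 then have "duh (control_input J u) (h + (\<tau> - h)) = sg (\<tau> - h) (duh (control_input J u) h) + duh (control_input J u') (\<tau> - h)"
  using duh_concat[OF uc, of h "\<tau> - h"] h t by simp
 then have "duh (control_input J u') (\<tau> - h) = - sg (\<tau> - h) (sg h z0) - sg (\<tau> - h) (duh (control_input J u) h)"
  using ud sg_add[of "\<tau> - h" h z0] h t by simp
 then have "duh (control_input J (%p. u' p + v' p)) (\<tau> - h) = - sg (\<tau> - h) z0"
  unfolding duh_add'[OF u'n v'n] v'd y_def sg_lin by simp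
 moreover have "nice (%p. u' p + v' p) M" by (rule nice_mono[OF nice_add[OF u'n v'n]]) (use h in simp)
 ultimately have "adm M (\<tau> - h) (%p. u' p + v' p)" using h t by (simp add: adm_def)
 then show ?thesis using topt_le h by fastforce
qed

text \<open>A second control \<open>a\<close> is built that may be huge on a set \<open>E k\<close>
  where \<open>u\<close> has slack, but is at most \<open>M / 2\<close> elsewhere. Mixing a small
  proportion \<open>r\<close> of it into \<open>u\<close> lowers the norm off \<open>E k\<close>,
  while on \<open>E k\<close> the slack pays for \<open>a\<close>.\<close>

theorem bang_bang:
 assumes u: "adm M topt u"
 shows "AE q in lebesgue_on ({0<..<topt} \<times> J). norm (u q) = M"
proof (rule ccontr)
 assume neg: "\<not> (AE q in lebesgue_on ({0<..<topt} \<times> J). norm (u q) = M)"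
 have t: "0 < topt" and un: "nice u M" using u by (auto simp: adm_def)
 have [measurable]: "u \<in> borel_measurable borel" by (rule niceD(1)[OF un])
 define E where "E k = {q \<in> {0<..<topt - 1 / real (Suc k)} \<times> J. norm (u q) <= M - 1 / real (Suc k)}" for k
 have Em: "E k \<in> sets borel" for k
 proof -
  have "E k = ({0<..<topt - 1 / real (Suc k)} \<times> J) \<inter> {q. norm (u q) <= M - 1 / real (Suc k)}" by (auto simp: E_def)
  moreover have "{q. norm (u q) <= M - 1 / real (Suc k)} \<in> sets borel" by measurable
  ultimately show ?thesis using Q_sets[OF J(1)] by auto
 qed
 have "\<exists>k. emeasure lborel (E k) ~= 0"
 proof (rule ccontr)
  assume "\<not> ?thesis"
  then have "AE q in lborel. q \<notin> E k" for k using Em by (intro AE_not_in) (auto simp: null_sets_def)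
  then have "AE q in lborel. \<forall>k. q \<notin> E k" by (simp add: AE_all_countable)
  then have "AE q in lborel. q \<in> {0<..<topt} \<times> J --> norm (u q) = M"
  proof eventually_elim
   fix q assume q: "\<forall>k. q \<notin> E k"
   show "q \<in> {0<..<topt} \<times> J --> norm (u q) = M"
   proof
    assume a: "q \<in> {0<..<topt} \<times> J"
    show "norm (u q) = M"
    proof (rule ccontr)
     assume "norm (u q) ~= M"
     then have "0 < min (M - norm (u q)) (topt - fst q)" using niceD(2)[OF un, of q] a by auto
     then obtain k where k: "1 / real (Suc k) < min (M - norm (u q)) (topt - fst q)" by (rule nat_approx_posE)
     then have "q \<in> E k" using a by (auto simp: E_def)
     then show False using q by blast
    qed
   qed
  qed
  then show False using neg Q_sets[OF J(1), of topt] by (subst (asm) AE_lebesgue_on_iff) auto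
 qed
 then obtain k where k: "emeasure lborel (E k) ~= 0" by blast
 \<comment> \<open>The time left after \<open>E k\<close> is halved. The last part of length
   \<open>\<delta>\<close> is for the null control; the part before it keeps \<open>E k\<close> at
   distance \<open>\<delta>\<close> from time \<open>\<tau>\<close>, as approximate controllability
   requires.\<close>
 define \<eta> where "\<eta> = 1 / real (Suc k)"
 define \<delta> where "\<delta> = \<eta> / 2"
 define \<tau> where "\<tau> = topt - \<delta>"
 have eta: "0 < \<eta>" by (simp add: \<eta>_def)
 have "E k ~= {}" using k by auto
 then have te: "\<eta> < topt" by (auto simp: E_def \<eta>_def)
 have "\<tau> - \<delta> = topt - 1 / real (Suc k)" unfolding \<tau>_def \<delta>_def \<eta>_def[symmetric] by linarith
 then have Es: "E k \<subseteq> {0<..<\<tau> - \<delta>} \<times> J" unfolding E_def by simp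
 have dl: "0 < \<delta>" "\<delta> < \<tau>" using eta te by (auto simp: \<delta>_def \<tau>_def)
 obtain C where C: "0 <= C" "!!z. \<exists>u. nice u (C * norm z) \<and> duh (control_input J u) \<delta> = - sg \<delta> z"
  using null_control_here[OF dl(1)] by blast
 \<comment> \<open>Small enough that removing the remaining error after time \<open>\<tau>\<close>
   costs at most \<open>M / 2\<close>.\<close>
 define e where "e = M / (2 * (C + 1))"
 have e: "0 < e" "C * e <= M / 2" using C M0 by (auto simp: e_def field_simps)
 obtain w W where w: "nice w W" "!!p. p \<notin> E k ==> w p = 0" "norm (duh (control_input J w) \<tau> - (- sg \<tau> z0)) < e"
  using approximate_controllability[OF Em Es k J dl e(1)] by blast
 define y where "y = duh (control_input J w) \<tau> + sg \<tau> z0"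
 obtain v where v: "nice v (C * norm y)" "duh (control_input J v) \<delta> = - sg \<delta> y" using C(2) by blast
 have yb: "C * norm y <= M / 2"
  using mult_left_mono[of "norm y" e C] w(3) C e by (simp add: y_def)
 have vb: "norm (v p) <= M / 2" for p using niceD(2)[OF v(1), of p] yb by simp
 define B where "B = max W (M / 2)"
 have B: "0 <= B" "nice w B" "nice v B"
  using nice_mono[OF w(1), of B] nice_mono[OF v(1), of B] yb M0 by (auto simp: B_def)
 define a where "a = cc \<tau> w v"
 have "duh (control_input J a) (\<tau> + \<delta>) = sg \<delta> (duh (control_input J w) \<tau>) - sg \<delta> y"
  unfolding a_def using dl v(2) by (subst duh_cc[OF B(2,3) J(1)]) auto
 also have "... = - sg topt z0"
  using sg_add[of \<delta> \<tau> z0] dl by (simp add: y_def sg_lin \<tau>_def)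
 finally have aa: "adm B topt a" unfolding adm_def using t nice_cc[OF B(2,3), of \<tau>] by (simp add: a_def \<tau>_def)
 \<comment> \<open>With this proportion the mixed-in control uses at most half of the slack
   \<open>\<eta>\<close> on \<open>E k\<close>.\<close>
 define r where "r = min 1 (\<eta> / (2 * (B + 1)))"
 have r: "0 < r" "r <= 1" using eta B by (auto simp: r_def)
 have rB: "r * B <= \<eta> / 2"
 proof -
  have "r * B <= \<eta> / (2 * (B + 1)) * (B + 1)" using B eta r by (intro mult_mono) (auto simp: r_def)
  moreover have "\<eta> / (2 * (B + 1)) * (B + 1) = \<eta> / 2" using B by (simp add: field_simps)
  ultimately show ?thesis by (simp only:)
 qed
 define N where "N = max (M - r * (M / 2)) (M - \<eta> / 2)"
 have "adm N topt (%p. (1 - r) *\<^sub>R u p + r *\<^sub>R a p)"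
 proof (rule adm_convex[OF u aa])
  fix p
  have tri: "norm ((1 - r) *\<^sub>R u p + r *\<^sub>R a p) <= (1 - r) * norm (u p) + r * norm (a p)"
   using norm_triangle_ineq[of "(1 - r) *\<^sub>R u p" "r *\<^sub>R a p"] r by simp
  show "norm ((1 - r) *\<^sub>R u p + r *\<^sub>R a p) <= N"
  proof (cases "p \<in> E k")
   case True
   have "(1 - r) * norm (u p) <= 1 * (M - \<eta>)" using True r by (intro mult_mono) (auto simp: E_def \<eta>_def intro: order_trans[OF norm_ge_zero])
   moreover have "r * norm (a p) <= r * B" using r aa niceD(2)[of a B p] by (intro mult_left_mono) (auto simp: adm_def)
   ultimately show ?thesis using tri rB by (simp add: N_def)
  next
   case False
   have "norm (a p) <= M / 2" using w(2)[OF False] vb M0 by (simp add: a_def cc_def)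
   then have "r * norm (a p) <= r * (M / 2)" using r by (intro mult_left_mono) auto
   moreover have "(1 - r) * norm (u p) <= (1 - r) * M" using r niceD(2)[OF un] by (intro mult_left_mono) auto
   moreover have "(1 - r) * M + r * (M / 2) = M - r * (M / 2)" by (simp add: algebra_simps)
   ultimately show ?thesis using tri unfolding N_def by linarith
  qed
 qed
 moreover have "N < M" using r M0 eta by (simp add: N_def)
 ultimately show False using adm_shorter by blast
qed

theorem optimal_unique:
 assumes u: "adm M topt u" and v: "adm M topt v"
 shows "AE q in lebesgue_on ({0<..<topt} \<times> J). u q = v q"
proof -
 have "adm M topt (%p. (1 - 1 / 2) *\<^sub>R u p + (1 / 2) *\<^sub>R v p)"
 proof (rule adm_convex[OF u v])
  fix p
  have "norm (u p) <= M" "norm (v p) <= M" using u v niceD(2) by (auto simp: adm_def)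
  then show "norm ((1 - 1 / 2) *\<^sub>R u p + (1 / 2) *\<^sub>R v p) <= M"
   by (intro order_trans[OF norm_triangle_ineq]) simp
 qed
 from bang_bang[OF this] bang_bang[OF u] bang_bang[OF v] show ?thesis
 proof eventually_elim
  case (elim q)
  have "(norm (u q - v q))\<^sup>2 = 2 * (norm (u q))\<^sup>2 + 2 * (norm (v q))\<^sup>2 - 4 * (norm ((1 - 1 / 2) *\<^sub>R u q + (1 / 2) *\<^sub>R v q))\<^sup>2"
   by (simp add: power2_norm_eq_inner inner_add_left inner_add_right inner_diff_left inner_diff_right inner_commute)
  then show ?case using elim by simp
 qed
qed

end

section \<open>Optimal times and controls along converging coefficients\<close>

locale tocp_seq = tocp + coef_seq
begin

definition adm' :: "nat => real => (real \<times> real => complex) => bool" where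
 "adm' n \<tau> u \<longleftrightarrow> 0 < \<tau> \<and> nice u M \<and> coef.duh K (\<rho>' n) (control_input J u) \<tau> = - sgc K (\<rho>' n) \<tau> z0"

text \<open>A control of size \<open>M\<close> moves the state by at most
  \<open>M * \<tau> n\<close>, which cannot cancel \<open>z0\<close> in vanishing time; so the limit
  time is positive. The controls then almost solve the limit problem, and
  \<open>convex_selection\<close> applies. The linear constraint is carried along for
  \<open>controls_converge\<close>.\<close>

lemma limit_control:
 assumes u: "!!n. adm' n (\<tau> n) (u n)" and lim: "\<tau> \<longlonglongrightarrow> t" and g: "nice g B"
  and \<beta>: "!!n. (LINT q|lebesgue_on ({0<..<t} \<times> J). u n q \<bullet> g q) <= \<beta>"
 shows "\<exists>v. adm M t v \<and> (LINT q|lebesgue_on ({0<..<t} \<times> J). v q \<bullet> g q) <= \<beta>"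
proof -
 have un: "nice (u n) M" and tn: "0 < \<tau> n" and ud: "coef.duh K (\<rho>' n) (control_input J (u n)) (\<tau> n) = - sgc K (\<rho>' n) (\<tau> n) z0" for n
  using u[of n] by (auto simp: adm'_def)
 note uc = control_input_measurable[OF un J(1)] control_slice(3)[OF un J(1)]
 have s: "(%n. sgc K (\<rho>' n) (\<tau> n) z0) \<longlonglongrightarrow> sg t z0" by (rule sgc_tendsto[OF lim])
 have "0 <= t" by (rule LIMSEQ_le_const[OF lim]) (use tn less_imp_le in blast)
 moreover have "t ~= 0"
 proof
  assume t0: "t = 0"
  have "(%n. M * \<tau> n) \<longlonglongrightarrow> M * t" by (intro tendsto_intros lim)
  then have "(%n. M * \<tau> n) \<longlonglongrightarrow> 0" using t0 by simp
  then have "(%n. sgc K (\<rho>' n) (\<tau> n) z0) \<longlonglongrightarrow> 0"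
  proof (rule Lim_null_comparison[rotated], intro always_eventually allI)
   fix n
   interpret b: coef K "\<rho>' n" by (rule coefs)
   have "norm (b.duh (control_input J (u n)) (\<tau> n)) <= M * \<tau> n" using tn[of n] by (intro b.duh_norm[OF uc]) auto
   then show "norm (sgc K (\<rho>' n) (\<tau> n) z0) <= M * \<tau> n" unfolding ud by simp
  qed
  then have "sg t z0 = 0" using LIMSEQ_unique[OF s] by blast
  then show False using t0 z0 by simp
 qed
 ultimately have t: "0 < t" by simp
 have "(%n. coef.duh K (\<rho>' n) (control_input J (u n)) (\<tau> n) - duh (control_input J (u n)) t) \<longlonglongrightarrow> 0"
  by (rule duh_close[OF uc lim]) (use tn less_imp_le in blast)
 from tendsto_diff[OF tendsto_minus[OF s] this] have "(%n. duh (control_input J (u n)) t) \<longlonglongrightarrow> - sg t z0"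
  unfolding ud by simp
 from convex_selection[OF un J t this g \<beta>] show ?thesis using t unfolding adm_def by blast
qed

text \<open>Following a control of the limit problem leaves a small state, which a null control then removes.\<close>

lemma eventually_adm':
 assumes u: "adm M t u" and h: "0 < h"
 shows "\<forall>\<^sub>F n in sequentially. \<exists>v. adm' n (t + h) v"
proof -
 have l: "0 < d - c" using cd by simp
 have t: "0 < t" and un: "nice u M" and ud: "duh (control_input J u) t = - sg t z0" using u by (auto simp: adm_def)
 note uc = control_input_measurable[OF un J(1)] control_slice(3)[OF un J(1)]
 obtain C where C: "0 <= C" "\<forall>\<rho> c' d' z0. coef K \<rho> --> 0 <= c' --> d' <= 1 --> d' - c' = d - c -->
   (\<exists>u. nice u (C * norm z0) \<and> coef.duh K \<rho> (control_input {c'<..<d'} u) h = - sgc K \<rho> h z0)"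
  using null_control[OF K1 l h] by blast
 define y where "y n = sgc K (\<rho>' n) t z0 + coef.duh K (\<rho>' n) (control_input J u) t" for n
 have "(%n. coef.duh K (\<rho>' n) (control_input J u) t - duh (control_input J u) t) \<longlonglongrightarrow> 0"
  by (rule duh_close[OF uc tendsto_const]) (use t in simp)
 from tendsto_diff[OF tendsto_add[OF this sgc_tendsto[OF tendsto_const, of t z0]] tendsto_const[of "sg t z0"]] have "y \<longlonglongrightarrow> 0"
  unfolding y_def ud by (simp add: algebra_simps)
 then have "(%n. C * norm (y n)) \<longlonglongrightarrow> C * norm (0 :: L2)" by (intro tendsto_intros)
 then have "\<forall>\<^sub>F n in sequentially. C * norm (y n) < M" using M0 by (intro order_tendstoD(2)) auto
 then show ?thesis
 proof eventually_elim
  case (elim n)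
  interpret b: coef K "\<rho>' n" by (rule coefs)
  obtain v where v: "nice v (C * norm (y n))" "b.duh (control_input J v) h = - sgc K (\<rho>' n) h (y n)"
   using C(2) b.coef_axioms cd by blast
  have vn: "nice v M" using nice_mono[OF v(1)] elim by simp
  have "b.duh (control_input J (cc t u v)) (t + h) = - sgc K (\<rho>' n) (t + h) z0"
   using t h b.sg_add[of h t z0] by (subst b.duh_cc[OF un vn J(1)]) (auto simp: v(2) y_def b.sg_lin add.commute)
  then show ?case unfolding adm'_def using t h nice_cc[OF un vn] by (intro exI[of _ "cc t u v"]) simp
 qed
qed

end

lemma subseq_tocp:
 assumes "tocp_seq K \<rho> c d M z0 \<rho>' \<delta>" "strict_mono r"
 shows "tocp_seq K \<rho> c d M z0 (%n. \<rho>' (r n)) (%n. \<delta> (r n))"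
proof -
 interpret tocp_seq K \<rho> c d M z0 \<rho>' \<delta> by (rule assms)
 show ?thesis
  by (intro tocp_seq.intro coef_seq.intro coef_seq_axioms.intro tocp_axioms coef_axioms coefs green_close)
    (use LIMSEQ_subseq_LIMSEQ[OF delta assms(2)] in \<open>simp add: o_def\<close>)
qed

text \<open>Free decay at rate \<open>1 / (2 * K)\<close> makes the state so small that a null
  control in unit time stays below \<open>M\<close>. The position of the interval, the coefficient
  and the initial state enter only through \<open>l\<close>, \<open>K\<close> and the norm.\<close>

theorem reach_bound:
 assumes K: "1 <= K" and l: "0 < l" and M: "0 < M"
 shows "\<exists>T>0. \<forall>\<rho> c d z0. tocp K \<rho> c d M z0 --> d - c = l --> norm z0 = n --> (\<exists>u. tocp.adm K \<rho> c d z0 M T u)"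
proof -
 obtain C where C: "0 <= C" "\<forall>\<rho> c d z0. coef K \<rho> --> 0 <= c --> d <= 1 --> d - c = l -->
   (\<exists>u. nice u (C * norm z0) \<and> coef.duh K \<rho> (control_input {c<..<d} u) 1 = - sgc K \<rho> 1 z0)"
  using null_control[OF K l, of 1] by auto
 have "((%t. C * (exp (- t / (2 * K)) * \<bar>n\<bar>)) \<longlongrightarrow> 0) at_top" using K by real_asymp
 then have "\<forall>\<^sub>F t in at_top. C * (exp (- t / (2 * K)) * \<bar>n\<bar>) < M" using M by (intro order_tendstoD(2)) auto
 moreover have "\<forall>\<^sub>F t in at_top. (0::real) < t" by (rule eventually_gt_at_top)
 ultimately have "\<forall>\<^sub>F t in at_top. C * (exp (- t / (2 * K)) * \<bar>n\<bar>) < M \<and> 0 < t" by eventually_elim simp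
 then obtain t where t: "C * (exp (- t / (2 * K)) * \<bar>n\<bar>) < M" "0 < t"
  using eventually_happens'[OF trivial_limit_at_top_linorder] by blast
 show ?thesis
 proof (intro exI[of _ "t + 1"] conjI allI impI)
  fix \<rho> c d z0 assume a: "tocp K \<rho> c d M z0" "d - c = l" "norm z0 = n"
  interpret tocp K \<rho> c d M z0 by (rule a)
  obtain v where v: "nice v (C * norm (sg t z0))" "duh (control_input J v) 1 = - sg 1 (sg t z0)"
   using C(2) coef_axioms cd a(2) by blast
  have "C * norm (sg t z0) <= C * (exp (- t / (2 * K)) * norm z0)" using C t by (intro mult_left_mono sg_decay) auto
  then have vn: "nice v M" using t a(3) by (intro nice_mono[OF v(1)]) auto
  have "duh (control_input J (cc t (%p. 0) v)) (t + 1) = - sg (t + 1) z0"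
   using t v(2) sg_add[of 1 t z0] M by (subst duh_cc[OF nice_zero vn J(1)]) (auto simp: duh_zero sg_lin add.commute)
  then show "\<exists>u. adm M (t + 1) u" unfolding adm_def using t nice_cc[OF nice_zero vn, of t] M by (intro exI[of _ "cc t (%p. 0) v"]) simp
 qed (use t in simp)
qed

text \<open>For the constant sequence of coefficients \<open>limit_control\<close> becomes an
  existence theorem, applied along a minimising sequence of times.\<close>

lemma (in tocp) optimal_exists: "\<exists>u. adm M topt u"
proof -
 interpret s: tocp_seq K \<rho> c d M z0 "%n. \<rho>" "%n. 0"
  by unfold_locales (auto intro: coef_axioms)
 have l: "0 < d - c" using cd by simp
 have ne: "{\<tau>. \<exists>u. adm M \<tau> u} ~= {}" using reach_bound[OF K1 l M0, of "norm z0"] tocp_axioms by blast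
 have "\<exists>\<tau> u. adm M \<tau> u \<and> \<tau> < topt + 1 / real (Suc n)" for n
  using cInf_lessD[OF ne, of "topt + 1 / real (Suc n)"] unfolding topt_def by force
 then obtain \<tau> u where u: "!!n. adm M (\<tau> n) (u n)" "!!n. \<tau> n < topt + 1 / real (Suc n)" by metis
 have "\<tau> \<longlonglongrightarrow> topt"
 proof (rule real_tendsto_sandwich[OF _ _ tendsto_const])
  show "(%n. topt + 1 / real (Suc n)) \<longlonglongrightarrow> topt"
   using tendsto_add[OF tendsto_const LIMSEQ_Suc[OF lim_1_over_n], of topt] by simp
  show "\<forall>\<^sub>F n in sequentially. topt <= \<tau> n" by (intro always_eventually allI topt_le[OF u(1)])
  show "\<forall>\<^sub>F n in sequentially. \<tau> n <= topt + 1 / real (Suc n)" by (intro always_eventually allI less_imp_le u(2))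
 qed
 then show ?thesis
  using s.limit_control[of \<tau> u topt "%p. 0" 0 0] u(1) by (auto simp: s.adm'_def adm_def nice_zero)
qed

context tocp_seq begin

abbreviation topt' :: "nat => real" where "topt' n \<equiv> tocp.topt K (\<rho>' n) c d M z0"

lemma tocp': "tocp K (\<rho>' n) c d M z0"
 using coefs cd M0 z0 by (intro tocp.intro tocp_axioms.intro) auto

lemma adm'_eq: "adm' n \<tau> u \<longleftrightarrow> tocp.adm K (\<rho>' n) c d z0 M \<tau> u"
 unfolding adm'_def tocp.adm_def[OF tocp'] ..

lemma topt'_ex: "\<exists>u. adm' n (topt' n) u"
 unfolding adm'_eq by (rule tocp.optimal_exists[OF tocp'])

lemma topt'_pos: "0 < topt' n"
 using topt'_ex[of n] by (auto simp: adm'_def)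

lemma topt'_upper: "0 < h ==> \<forall>\<^sub>F n in sequentially. topt' n <= topt + h"
 using optimal_exists eventually_adm' by (fastforce elim!: eventually_mono simp: adm'_eq intro: tocp.topt_le[OF tocp'])

end

text \<open>From above, the limit control followed by a short null control is admissible for late
  \<open>n\<close>. From below, times at most \<open>a < topt\<close> along a subsequence would
  produce a control of the limit problem at a time at most \<open>a\<close>.\<close>

theorem topt_tendsto:
 assumes "tocp_seq K \<rho> c d M z0 \<rho>' \<delta>"
 shows "(%n. tocp.topt K (\<rho>' n) c d M z0) \<longlonglongrightarrow> tocp.topt K \<rho> c d M z0"
proof (rule order_tendstoI)
 interpret tocp_seq K \<rho> c d M z0 \<rho>' \<delta> by (rule assms)
 fix a assume "topt < a"
 then have "\<forall>\<^sub>F n in sequentially. topt' n <= topt + (a - topt) / 2" by (intro topt'_upper) simp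
 then show "\<forall>\<^sub>F n in sequentially. topt' n < a" by eventually_elim (use \<open>topt < a\<close> in \<open>simp add: field_simps\<close>)
next
 interpret tocp_seq K \<rho> c d M z0 \<rho>' \<delta> by (rule assms)
 fix a assume a: "a < topt"
 show "\<forall>\<^sub>F n in sequentially. a < topt' n"
 proof (rule ccontr)
  assume "\<not> ?thesis"
  then have "\<exists>\<^sub>F n in sequentially. topt' n <= a" by (simp add: not_eventually not_less)
  then have inf: "infinite {n. topt' n <= a}" unfolding cofinite_eq_sequentially[symmetric] frequently_cofinite .
  obtain r :: "nat => nat" where r: "strict_mono r" "!!n. topt' (r n) <= a"
   using infinite_enumerate[OF inf] by auto
  have ra: "\<forall>n. topt' (r n) \<in> {0..a}" using r(2) topt'_pos[THEN less_imp_le] by simp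
  obtain t and q :: "nat => nat" where q: "t \<in> {0..a}" "strict_mono q" "((%n. topt' (r n)) \<circ> q) \<longlonglongrightarrow> t"
   by (rule seq_compactE[OF compact_imp_seq_compact[OF compact_Icc] ra])
  interpret s: tocp_seq K \<rho> c d M z0 "%n. \<rho>' (r (q n))" "%n. \<delta> (r (q n))"
   using subseq_tocp[OF assms strict_mono_o[OF r(1) q(2)]] by (simp add: o_def)
  obtain u where u: "!!n. adm' n (topt' n) (u n)" using topt'_ex by metis
  have "\<exists>v. adm M t v \<and> (LINT p|lebesgue_on ({0<..<t} \<times> J). v p \<bullet> 0) <= 0"
   by (rule s.limit_control[of "%n. topt' (r (q n))" "%n. u (r (q n))"])
     (use u q(3) nice_zero[of 0] in \<open>auto simp: adm'_def s.adm'_def o_def\<close>)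
  then show False using topt_le q(1) a by fastforce
 qed
qed

section \<open>Homogenization and convergence of the optimal controls\<close>

lemma AE_affine:
 fixes P :: "real => bool"
 assumes c: "c ~= 0" and P: "AE x in lborel. P x"
 shows "AE x in lborel. P (t + c * x)"
proof -
 obtain N where N: "{x. \<not> P x} \<subseteq> N" "emeasure lborel N = 0" "N \<in> sets lborel" using AE_E[OF P] by (auto simp: space_lborel)
 have "AE x in lborel. x \<notin> N" using N by (intro AE_not_in) (auto simp: null_sets_def)
 then have "AE x in lborel. t + c * x \<notin> N" using N(3) by (intro AE_borel_affine[OF c]) auto
 then show ?thesis by eventually_elim (use N(1) in auto)
qed

lemma prim_affine:
 assumes e: "0 < e"
 shows "prim (%x. b (x / e)) x = e * (prim b (x / e) :: real)"
proof -
 have "prim b (x / e) = (1 / e) *\<^sub>R (LINT y|lborel. indicator {0<..<x / e} (0 + (1 / e) * y) *\<^sub>R b (0 + (1 / e) * y))"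
  unfolding prim_def using lborel_integral_real_affine[of "1 / e" "%y. indicator {0<..<x / e} y *\<^sub>R b y" 0] e by simp
 also have "(LINT y|lborel. indicator {0<..<x / e} (0 + (1 / e) * y) *\<^sub>R b (0 + (1 / e) * y)) = prim (%x. b (x / e)) x"
  unfolding prim_def using e by (intro integral_eqI) (auto simp: indicator_def field_simps)
 finally show ?thesis using e by simp
qed

text \<open>Each full period contributes exactly \<open>R 1\<close>, and the remaining fraction of a
  period deviates by at most \<open>K\<close>, however large \<open>X\<close> is.\<close>

lemma (in coef) periodic_mean:
 assumes per: "AE x in lborel. \<rho> (x + 1) = \<rho> x" and X: "0 <= X"
 shows "\<bar>R X - R 1 * X\<bar> <= K"
proof -
 have step: "R (X + 1) = R 1 + R X" if "0 <= X" for X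
 proof -
  have i: "integrable lborel (%y. indicator {0<..<X + 1} y *\<^sub>R \<rho> y)"
   by (rule indicator_integrable_bounded[where B=K]) (use rho_pos rho_le in \<open>auto simp: abs_of_pos\<close>)
  have "R (X + 1) - R 1 = (LINT u|lborel. indicator {1<..<X + 1} u *\<^sub>R \<rho> u)"
   unfolding R_def by (rule prim_diff[OF i]) (use that in auto)
  also have "... = (LINT u|lborel. indicator {1<..<X + 1} (1 + 1 * u) *\<^sub>R \<rho> (1 + 1 * u))"
   using lborel_integral_real_affine[of 1 "%u. indicator {1<..<X + 1} u *\<^sub>R \<rho> u" 1] by simp
  also have "... = (LINT u|lborel. indicator {0<..<X} u *\<^sub>R \<rho> u)"
  proof (rule integral_cong_AE)
   show "AE u in lborel. indicator {1<..<X + 1} (1 + 1 * u) *\<^sub>R \<rho> (1 + 1 * u) = indicator {0<..<X} u *\<^sub>R \<rho> u"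
    using per by eventually_elim (auto simp: indicator_def add.commute)
  qed measurable
  finally show ?thesis by (simp add: R_def prim_def)
 qed
 have base: "\<bar>R X - R 1 * X\<bar> <= K" if "0 <= X" "X <= 1" for X
 proof -
  have "0 <= R X" "R X <= K * X" using R_diff(1,2)[of 0 X] that by simp_all
  moreover have "K * X <= K * 1" "R 1 * X <= K * 1" "0 <= R 1 * X"
   by (rule mult_mono mult_nonneg_nonneg; use that R_1 K1 in simp)+
  ultimately show ?thesis by simp
 qed
 have "\<bar>R (real n + Y) - R 1 * (real n + Y)\<bar> <= K" if "0 <= Y" "Y <= 1" for n Y
 proof (induction n)
  case (Suc n)
  have "R (real (Suc n) + Y) = R 1 + R (real n + Y)" using step[of "real n + Y"] that by (simp add: add_ac)
  then show ?case using Suc by (simp add: algebra_simps)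
 qed (use base that in simp)
 from this[of "X - real (nat \<lfloor>X\<rfloor>)" "nat \<lfloor>X\<rfloor>"] show ?thesis using X by (simp add: of_nat_nat) linarith
qed

lemma coef_R: "coef K \<rho> ==> coef.R \<rho> = prim \<rho>"
 by (rule coef.R_def)

text \<open>The constant at \<open>\<epsilon> = 0\<close> is the mean of \<open>1 / a\<close>, so
  the primitives at \<open>e\<close> and at 0 differ by \<open>e\<close> times the bounded deviation
  of \<open>periodic_mean\<close> at \<open>x / e\<close>. This is where the harmonic mean comes
  from.\<close>

lemma homogenization:
 assumes a: "periodic_coeff a K"
 obtains \<rho> where "!!e. 0 <= e ==> coef K (\<rho> e)" "!!e. 0 <= e ==> AE x in leb01. scaled_coeff a e x = 1 / \<rho> e x"
  "!!e x. 0 < e ==> 0 <= x ==> \<bar>coef.R (\<rho> e) x - coef.R (\<rho> 0) x\<bar> <= K * e"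
proof -
 have K0: "0 < K" and am: "a \<in> borel_measurable lebesgue" and ap: "AE x in lborel. a (x + 1) = a x"
  and ab: "AE x in lborel. inverse K <= a x \<and> a x <= K"
  using a by (auto simp: periodic_coeff_def AE_completion_iff)
 obtain p where p: "p \<in> borel_measurable lborel" "AE x in lborel. a x = p x"
  using completion_ex_borel_measurable_real[OF am] by blast
 \<comment> \<open>The two bounds hold together at some point, which forces
   \<open>1 <= K\<close>.\<close>
 have "\<exists>x. inverse K <= a x \<and> a x <= K"
 proof -
  have "ae_filter (lborel :: real measure) ~= bot" by (simp add: ae_filter_eq_bot_iff)
  from eventually_happens'[OF this ab] show ?thesis .
 qed
 then have "inverse K * K <= K * K" using K0 by (intro mult_right_mono) auto
 then have "1 <= K" using K0 by (simp add: self_le_ge2_pow) (smt (verit) mult_less_cancel_left2)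
 then have K1: "1 <= K" .
 \<comment> \<open>Truncation enforces the bounds everywhere and changes \<open>1 / a\<close> only
   on a null set.\<close>
 define b where "b x = max (1 / K) (min K (1 / p x))" for x
 have bm[measurable]: "b \<in> borel_measurable borel" unfolding b_def using p(1) by simp
 have bb: "1 / K <= b x" "b x <= K" for x
 proof -
  have "1 / K <= 1" using K1 by simp
  then have "1 / K <= K" using K1 by linarith
  then show "1 / K <= b x" "b x <= K" by (auto simp: b_def)
 qed
 have co: "coef K (%x. b (x / e))" for e using K1 bb by unfold_locales auto
 interpret coef K b using K1 bb by unfold_locales auto
 have eq: "AE x in lborel. a x = 1 / b x"
  using p(2) ab
 proof eventually_elim
  case (elim x)
  then have "0 < p x" using K0 by (smt (verit) inverse_positive_iff_positive)
  then have "1 / p x <= K" "1 / K <= 1 / p x" using elim K0 by (simp_all add: field_simps)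
  then show ?case using elim by (simp add: b_def)
 qed
 have per: "AE x in lborel. b (x + 1) = b x"
  using AE_affine[OF one_neq_zero eq, of 1] eq ap
 proof eventually_elim
  case (elim x)
  then have "1 / b (x + 1) = 1 / b x" by (simp add: add.commute)
  then show ?case by simp
 qed
 define \<rho> where "\<rho> e = (if e = 0 then (%x. R 1) else (%x. b (x / e)))" for e
 have c0: "coef K (%x. R 1)" using K1 R_1 by unfold_locales auto
 have R0: "coef.R (\<rho> 0) x = R 1 * x" if "0 <= x" for x
  using that by (simp add: \<rho>_def coef_R[OF c0] prim_def mult.commute)
 show ?thesis
 proof (rule that[of \<rho>])
  fix e :: real assume e: "0 <= e"
  show "coef K (\<rho> e)" using co c0 by (simp add: \<rho>_def)
  show "AE x in leb01. scaled_coeff a e x = 1 / \<rho> e x"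
  proof (cases "e = 0")
   case True
   have "(LINT y|lebesgue_on {0..1}. 1 / a y) = (LINT y|lebesgue_on {0..1}. b y)"
   proof (rule integral_cong_AE)
    have [measurable]: "a \<in> borel_measurable (lebesgue_on {0..1})" using am by (rule measurable_restrict_space1)
    show "(%y. 1 / a y) \<in> borel_measurable (lebesgue_on {0..1})" by measurable
    show "b \<in> borel_measurable (lebesgue_on {0..1})"
     by (intro measurable_restrict_space1 measurable_completion) (simp add: measurable_lborel1)
    show "AE y in lebesgue_on {0..1}. 1 / a y = b y"
     by (subst AE_lebesgue_on_iff) (use eq in \<open>auto elim: eventually_mono\<close>)
   qed
   also have "... = (LINT y|lborel. indicator {0..1} y *\<^sub>R b y)" by (rule integral_lebesgue_on_borel) auto
   also have "... = R 1"
    unfolding R_def prim_def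
   proof (rule integral_cong_AE)
    show "AE y in lborel. indicator {0..1} y *\<^sub>R b y = indicator {0<..<1} y *\<^sub>R b y"
     using AE_lborel_singleton[of "0::real"] AE_lborel_singleton[of "1::real"]
     by eventually_elim (auto simp: indicator_def)
   qed measurable
   finally show ?thesis using True by (simp add: scaled_coeff_def \<rho>_def inverse_eq_divide)
  next
   case False
   have "AE x in lborel. a (0 + (1 / e) * x) = 1 / b (0 + (1 / e) * x)"
    by (rule AE_affine[OF _ eq]) (use False in simp)
   then show ?thesis
    using False by (subst AE_lebesgue_on_iff) (auto simp: scaled_coeff_def \<rho>_def elim: eventually_mono)
  qed
 next
  fix e x :: real assume e: "0 < e" and x: "0 <= x"
  have "coef.R (\<rho> e) x = e * R (x / e)"
   using e by (simp add: \<rho>_def coef_R[OF co] prim_affine R_def)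
  then have "coef.R (\<rho> e) x - coef.R (\<rho> 0) x = e * (R (x / e) - R 1 * (x / e))"
   using e R0[OF x] by (simp add: field_simps)
  also have "\<bar>...\<bar> <= e * K"
   unfolding abs_mult using e x periodic_mean[OF per, of "x / e"] by (intro mult_mono) auto
  finally show "\<bar>coef.R (\<rho> e) x - coef.R (\<rho> 0) x\<bar> <= K * e" by (simp add: mult.commute)
 qed
qed

text \<open>Under a uniform bound, square convergence gives \<open>L^1\<close> convergence, and
  \<open>B powr (p - 1)\<close> times the norm dominates its \<open>p\<close>-th power. For
  weak-star convergence the test function is split at a height \<open>k\<close>.\<close>

lemma L2_conv_imp:
 fixes w :: "real => real \<times> real => complex"
 assumes w: "!!e. nice (w e) B" and J: "J \<in> sets borel" "J \<subseteq> {0<..<1}"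
  and lim: "((%e. LINT q|lebesgue_on ({0<..<T} \<times> J). (norm (w e q))\<^sup>2) \<longlongrightarrow> 0) F"
 shows "1 <= p ==> ((%e. Lp_norm ({0<..<T} \<times> J) p (w e)) \<longlongrightarrow> 0) F"
  and "integrable (lebesgue_on ({0<..<T} \<times> J)) \<phi> ==> ((%e. LINT q|lebesgue_on ({0<..<T} \<times> J). \<phi> q * w e q) \<longlongrightarrow> 0) F"
proof -
 define \<mu> where "\<mu> = lebesgue_on ({0<..<T} \<times> J)"
 define A where "A = measure \<mu> (space \<mu>)"
 have A0: "0 <= A" by (simp add: A_def)
 have B0: "0 <= B" by (rule nice_nonneg[OF w])
 have fin: "finite_measure \<mu>" unfolding \<mu>_def using bounded_integrable_Q(2)[of "%_. 0 :: real" 0, OF _ _ J] by simp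
 have int: "integrable \<mu> f" if "f \<in> borel_measurable borel" "!!p. norm (f p) <= C" for f :: "real \<times> real => real" and C
  unfolding \<mu>_def by (rule bounded_integrable_Q(1)[OF that J])
 have [measurable]: "w e \<in> borel_measurable borel" for e by (rule niceD(1)[OF w])
 have i1: "integrable \<mu> (%q. norm (w e q))" for e unfolding \<mu>_def by (rule nice_L1_le(2)[OF w J zero_less_one])
 have L1: "((%e. LINT q|\<mu>. norm (w e q)) \<longlongrightarrow> 0) F"
 proof (rule tendstoI)
  fix \<epsilon> :: real assume eps: "0 < \<epsilon>"
  define b where "b = \<epsilon> / (2 * (A + 1))"
  have b: "0 < b" "b * A <= \<epsilon> / 2" using eps A0 by (auto simp: b_def field_simps)
  have "\<forall>\<^sub>F e in F. (LINT q|\<mu>. (norm (w e q))\<^sup>2) < b * (\<epsilon> / 2)"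
   unfolding \<mu>_def using lim by (rule order_tendstoD(2)) (use b eps in simp)
  then show "\<forall>\<^sub>F e in F. dist (LINT q|\<mu>. norm (w e q)) 0 < \<epsilon>"
  proof eventually_elim
   case (elim e)
   from nice_L1_le(1)[OF w J b(1), of T e]
   have "(LINT q|\<mu>. norm (w e q)) <= b * A + (1 / b) * (LINT q|\<mu>. (norm (w e q))\<^sup>2)" unfolding A_def \<mu>_def .
   also have "... < \<epsilon> / 2 + \<epsilon> / 2"
    using b elim by (intro add_le_less_mono) (simp_all add: field_simps)
   finally show ?case by simp
  qed
 qed
 {
  assume p: "1 <= p"
  have "((%e. LINT q|\<mu>. norm (w e q) powr p) \<longlongrightarrow> 0) F"
  proof (rule Lim_null_comparison[OF always_eventually])
   show "((%e. B powr (p - 1) * (LINT q|\<mu>. norm (w e q))) \<longlongrightarrow> 0) F" by (rule tendsto_mult_right_zero[OF L1])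
   show "\<forall>e. norm (LINT q|\<mu>. norm (w e q) powr p) <= B powr (p - 1) * (LINT q|\<mu>. norm (w e q))"
   proof
    fix e
    have pb: "norm (w e q) powr p <= B powr (p - 1) * norm (w e q)" for q
    proof (cases "w e q = 0")
     case False
     then have "norm (w e q) powr p = norm (w e q) powr (p - 1) * norm (w e q)"
      using powr_add[of "norm (w e q)" "p - 1" 1] by simp
     also have "... <= B powr (p - 1) * norm (w e q)"
      using niceD(2)[OF w] p by (intro mult_right_mono powr_mono2) auto
     finally show ?thesis .
    qed simp
    have "integrable \<mu> (%q. norm (w e q) powr p)"
    proof (rule int[where C="B powr (p - 1) * B"])
     show "norm (norm (w e q) powr p) <= B powr (p - 1) * B" for q
      using order_trans[OF pb mult_left_mono[OF niceD(2)[OF w]]] by simp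
    qed measurable
    then have "(LINT q|\<mu>. norm (w e q) powr p) <= (LINT q|\<mu>. B powr (p - 1) * norm (w e q))"
     using i1 pb by (intro integral_mono) auto
    then show "norm (LINT q|\<mu>. norm (w e q) powr p) <= B powr (p - 1) * (LINT q|\<mu>. norm (w e q))" by simp
   qed
  qed
  from tendsto_powr2[OF this tendsto_const[of "1 / p"]] show "((%e. Lp_norm ({0<..<T} \<times> J) p (w e)) \<longlongrightarrow> 0) F"
   using p by (simp add: Lp_norm_def \<mu>_def)
 }
 assume "integrable (lebesgue_on ({0<..<T} \<times> J)) \<phi>"
 then have ph: "integrable \<mu> \<phi>" by (simp add: \<mu>_def)
 \<comment> \<open>The part of the test function above height \<open>k\<close>: its integral is
   small for large \<open>k\<close>, uniformly in \<open>e\<close>, and below that height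
   \<open>L^1\<close> convergence is enough.\<close>
 define S where "S k q = norm (\<phi> q) * indicator {y. real k < y} (norm (\<phi> q))" for k :: nat and q
 have Sm: "S k \<in> borel_measurable \<mu>" for k unfolding S_def[abs_def] using ph by measurable
 have "(%k. LINT q|\<mu>. S k q) \<longlonglongrightarrow> (LINT q|\<mu>. 0)"
 proof (rule integral_dominated_convergence[where w="%q. norm (\<phi> q)"])
  show "AE q in \<mu>. (%k. S k q) \<longlonglongrightarrow> 0"
  proof (rule AE_I2)
   fix q
   have "\<forall>\<^sub>F k in sequentially. norm (\<phi> q) <= real k"
    using filterlim_real_sequentially unfolding filterlim_at_top by blast
   then have "\<forall>\<^sub>F k in sequentially. S k q = 0" by eventually_elim (simp add: S_def)
   then show "(%k. S k q) \<longlonglongrightarrow> 0" by (rule tendsto_eventually)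
  qed
  show "AE q in \<mu>. norm (S k q) <= norm (\<phi> q)" for k by (auto simp: S_def indicator_def)
 qed (use ph Sm in auto)
 then have S0: "(%k. B * (LINT q|\<mu>. S k q)) \<longlonglongrightarrow> 0" by (intro tendsto_mult_right_zero) simp
 have Si: "integrable \<mu> (S k)" for k
  by (rule Bochner_Integration.integrable_bound[OF integrable_norm[OF ph] Sm]) (auto simp: S_def indicator_def)
 have "((%e. LINT q|\<mu>. \<phi> q * w e q) \<longlongrightarrow> 0) F"
 proof (rule tendstoI)
  fix \<epsilon> :: real assume eps: "0 < \<epsilon>"
  obtain k where k: "B * (LINT q|\<mu>. S k q) < \<epsilon> / 2"
   using order_tendstoD(2)[OF S0, of "\<epsilon> / 2"] eps eventually_happens'[OF sequentially_bot] by fastforce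
  have "((%e. real k * (LINT q|\<mu>. norm (w e q))) \<longlongrightarrow> 0) F" by (rule tendsto_mult_right_zero[OF L1])
  then have "\<forall>\<^sub>F e in F. real k * (LINT q|\<mu>. norm (w e q)) < \<epsilon> / 2" by (rule order_tendstoD(2)) (use eps in simp)
  then show "\<forall>\<^sub>F e in F. dist (LINT q|\<mu>. \<phi> q * w e q) 0 < \<epsilon>"
  proof eventually_elim
   case (elim e)
   have wm: "w e \<in> borel_measurable \<mu>" unfolding \<mu>_def by (rule bounded_integrable_Q(3)[OF niceD[OF w] J])
   have pt: "norm (\<phi> q * w e q) <= real k * norm (w e q) + B * S k q" for q
   proof (cases "real k < norm (\<phi> q)")
    case True
    have "norm (\<phi> q) * norm (w e q) <= norm (\<phi> q) * B" by (intro mult_left_mono niceD(2)[OF w]) simp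
    then show ?thesis using True by (simp add: S_def norm_mult mult.commute add_increasing)
   next
    case False
    then show ?thesis by (simp add: S_def norm_mult mult_right_mono)
   qed
   have i3: "integrable \<mu> (%q. real k * norm (w e q) + B * S k q)" using i1 Si by simp
   have "norm (LINT q|\<mu>. \<phi> q * w e q) <= (LINT q|\<mu>. real k * norm (w e q) + B * S k q)"
   proof (rule order_trans[OF integral_norm_bound integral_mono[OF _ i3 pt]])
    have m: "(%q. norm (\<phi> q * w e q)) \<in> borel_measurable \<mu>" using ph wm by measurable
    show "integrable \<mu> (%q. norm (\<phi> q * w e q))"
     by (rule Bochner_Integration.integrable_bound[OF i3 m], rule AE_I2) (use order_trans[OF pt abs_ge_self] in simp)
   qed
   also have "... = real k * (LINT q|\<mu>. norm (w e q)) + B * (LINT q|\<mu>. S k q)" using i1 Si by simp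
   also have "... < \<epsilon>" using elim k by simp
   finally show ?case by simp
  qed
 qed
 then show "((%e. LINT q|lebesgue_on ({0<..<T} \<times> J). \<phi> q * w e q) \<longlongrightarrow> 0) F" by (simp add: \<mu>_def)
qed

lemma nice_extend: "nice u M ==> Q \<in> sets borel ==> nice (extend_by_zero Q u) M"
proof -
 assume u: "nice u M" and Q: "Q \<in> sets borel"
 have "(%q. indicator Q q *\<^sub>R u q) \<in> borel_measurable borel" using niceD(1)[OF u] Q by measurable
 moreover have "(%q. indicator Q q *\<^sub>R u q) = extend_by_zero Q u" by (auto simp: extend_by_zero_def)
 ultimately show ?thesis using u nice_nonneg[OF u] by (auto simp: nice_def extend_by_zero_def)
qed

lemma rectangle_measure:
 fixes t T c d :: real
 assumes "0 <= t" "c <= d" "t <= T"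
 shows "(LINT q|lebesgue_on ({0<..<T} \<times> {c<..<d}). (indicator ({0<..<t} \<times> {c<..<d}) q :: real)) = t * (d - c)"
proof -
 have [measurable]: "{0<..<t} \<times> {c<..<d} \<in> sets borel" "{0<..<T} \<times> {c<..<d} \<in> sets borel" by (rule Q_sets, simp)+
 have "(LINT q|lebesgue_on ({0<..<T} \<times> {c<..<d}). (indicator ({0<..<t} \<times> {c<..<d}) q :: real))
  = (LINT q|lborel. indicator ({0<..<T} \<times> {c<..<d}) q *\<^sub>R (indicator ({0<..<t} \<times> {c<..<d}) q :: real))"
  by (rule integral_lebesgue_on_borel) auto
 also have "... = (LINT q|lborel. indicator ({0<..<t} \<times> {c<..<d}) q)"
  using assms by (intro integral_eqI) (auto simp: indicator_def intro: less_le_trans)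
 also have "... = measure lborel ({0<..<t} \<times> {c<..<d})" by simp
 also have "... = t * (d - c)"
  unfolding measure_def lborel_prod[symmetric] using assms
  by (subst lborel.emeasure_pair_measure_Times) (auto simp: emeasure_lborel_Ioo enn2real_mult)
 finally show ?thesis .
qed

context tocp_seq begin

text \<open>Bang-bang controls have square norm \<open>M\<^sup>2\<close> times the area on which
  they act, so the norms converge with the optimal times. After expanding the square, a lower bound
  on the inner products with the limit control is enough.\<close>

theorem controls_converge:
 assumes u: "!!n. adm' n (topt' n) (u n)" and u0: "adm M topt u0" and T: "!!n. topt' n <= T" "topt <= T"
 defines "v \<equiv> (%n. extend_by_zero ({0<..<topt' n} \<times> J) (u n))" and "v0 \<equiv> extend_by_zero ({0<..<topt} \<times> J) u0"
 shows "(%n. LINT q|lebesgue_on ({0<..<T} \<times> J). (norm (v n q - v0 q))\<^sup>2) \<longlonglongrightarrow> 0"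
proof -
 define \<mu> where "\<mu> = lebesgue_on ({0<..<T} \<times> J)"
 define G where "G n = (LINT q|\<mu>. v n q \<bullet> v0 q)" for n
 define A where "A = M\<^sup>2 * (topt * (d - c))"
 have ts: "tocp_seq K \<rho> c d M z0 \<rho>' \<delta>" by unfold_locales
 have Tp: "0 < topt" using u0 by (simp add: adm_def)
 have un: "nice (u n) M" "nice u0 M" for n using u[of n] u0 by (auto simp: adm'_def adm_def)
 have vn: "nice (v n) M" "nice v0 M" for n unfolding v_def v0_def by (intro nice_extend un Q_sets J)+
 have int: "integrable \<mu> f" if "f \<in> borel_measurable borel" "!!p. norm (f p) <= B" for f :: "real \<times> real => real" and B
  unfolding \<mu>_def by (rule bounded_integrable_Q(1)[OF that J])
 have sq: "(LINT q|\<mu>. (norm (extend_by_zero ({0<..<t} \<times> J) w q))\<^sup>2) = M\<^sup>2 * (t * (d - c))"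
  if ae: "AE q in lebesgue_on ({0<..<t} \<times> J). norm (w q) = M" and w: "nice w M" and t: "0 <= t" "t <= T" for t w
 proof -
  have ae': "AE q in lborel. q \<in> {0<..<t} \<times> J --> norm (w q) = M" using ae Q_sets[OF J(1), of t] by (subst (asm) AE_lebesgue_on_iff) auto
  have wm: "(%q. (norm (extend_by_zero ({0<..<t} \<times> J) w q))\<^sup>2) \<in> borel_measurable borel"
   using niceD(1)[OF nice_extend[OF w Q_sets[OF J(1), of t]]] by measurable
  have im: "(%q. M\<^sup>2 * indicator ({0<..<t} \<times> J) q) \<in> borel_measurable borel" using Q_sets[OF J(1), of t] by measurable
  have "(LINT q|\<mu>. (norm (extend_by_zero ({0<..<t} \<times> J) w q))\<^sup>2) = (LINT q|\<mu>. M\<^sup>2 * indicator ({0<..<t} \<times> J) q)"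
  proof (rule integral_cong_AE)
   show "AE q in \<mu>. (norm (extend_by_zero ({0<..<t} \<times> J) w q))\<^sup>2 = M\<^sup>2 * indicator ({0<..<t} \<times> J) q"
    unfolding \<mu>_def using ae' Q_sets[OF J(1), of T]
    by (subst AE_lebesgue_on_iff) (auto simp: extend_by_zero_def indicator_def elim!: eventually_mono)
  qed (auto simp: \<mu>_def intro!: measurable_restrict_space1 measurable_completion simp: measurable_lborel1 wm im)
  also have "... = M\<^sup>2 * (t * (d - c))"
   unfolding \<mu>_def using rectangle_measure[OF t(1) _ t(2), of c d] cd by simp
  finally show ?thesis .
 qed
 have a_n: "(LINT q|\<mu>. (norm (v n q))\<^sup>2) = M\<^sup>2 * (topt' n * (d - c))" for n
  unfolding v_def using u[of n] topt'_pos[of n, THEN less_imp_le]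
  by (intro sq un T) (auto simp: adm'_eq intro: tocp.bang_bang[OF tocp'])
 have a_0: "(LINT q|\<mu>. (norm (v0 q))\<^sup>2) = A"
  unfolding v0_def A_def using Tp by (intro sq un T bang_bang u0) simp
 have v_adm: "adm' n (topt' n) (v n)" for n
 proof -
  interpret b: coef K "\<rho>' n" by (rule coefs)
  have "b.duh (control_input J (v n)) (topt' n) = b.duh (control_input J (u n)) (topt' n)"
   by (rule b.duh_ci_AE[OF vn(1) un(1) J(1)], subst AE_lebesgue_on_iff)
     (use Q_sets[OF J(1)] in \<open>auto simp: v_def extend_by_zero_def\<close>)
  then show ?thesis using u[of n] vn by (simp add: adm'_def)
 qed
 have restrict: "(LINT q|\<mu>. w q \<bullet> v0 q) = (LINT q|lebesgue_on ({0<..<topt} \<times> J). w q \<bullet> v0 q)" if w: "nice w N" for w N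
 proof -
  have m: "(%q. w q \<bullet> v0 q) \<in> borel_measurable borel" using niceD(1)[OF w] niceD(1)[OF vn(2)] by measurable
  show ?thesis
   unfolding \<mu>_def integral_lebesgue_on_borel[OF m Q_sets[OF J(1)]] using T
   by (intro integral_eqI) (auto simp: v0_def extend_by_zero_def indicator_def)
 qed
 \<comment> \<open>Inner products at most \<open>\<beta>\<close> along a subsequence would pass to
   an optimal control of the limit problem. By uniqueness that control is \<open>u0\<close> almost
   everywhere, whose inner product is \<open>A > \<beta>\<close>.\<close>
 have low: "\<forall>\<^sub>F n in sequentially. \<beta> < G n" if beta: "\<beta> < A" for \<beta>
 proof (rule ccontr)
  assume "\<not> ?thesis"
  then have "\<exists>\<^sub>F n in sequentially. G n <= \<beta>" by (simp add: not_eventually not_less)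
  then have inf: "infinite {n. G n <= \<beta>}" unfolding cofinite_eq_sequentially[symmetric] frequently_cofinite .
  obtain r :: "nat => nat" where r: "strict_mono r" "!!n. G (r n) <= \<beta>"
   using infinite_enumerate[OF inf] by auto
  interpret s: tocp_seq K \<rho> c d M z0 "%n. \<rho>' (r n)" "%n. \<delta> (r n)" by (rule subseq_tocp[OF ts r(1)])
  have "\<exists>w. adm M topt w \<and> (LINT q|lebesgue_on ({0<..<topt} \<times> J). w q \<bullet> v0 q) <= \<beta>"
  proof (rule s.limit_control[OF _ _ vn(2)])
   show "s.adm' n (topt' (r n)) (v (r n))" for n using v_adm[of "r n"] by (simp add: adm'_def s.adm'_def)
   show "(%n. topt' (r n)) \<longlonglongrightarrow> topt" using LIMSEQ_subseq_LIMSEQ[OF topt_tendsto[OF ts] r(1)] by (simp add: o_def)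
   show "(LINT q|lebesgue_on ({0<..<topt} \<times> J). v (r n) q \<bullet> v0 q) <= \<beta>" for n
    using r(2)[of n] restrict[OF vn(1)] by (simp add: G_def)
  qed
  then obtain w where w: "adm M topt w" "(LINT q|lebesgue_on ({0<..<topt} \<times> J). w q \<bullet> v0 q) <= \<beta>" by blast
  have wn: "nice w M" using w(1) by (simp add: adm_def)
  have ae: "AE q in lebesgue_on ({0<..<topt} \<times> J). w q \<bullet> v0 q = v0 q \<bullet> v0 q"
   using optimal_unique[OF w(1) u0] AE_space
   by eventually_elim (auto simp: v0_def extend_by_zero_def space_restrict_space)
  have m: "(%q. w q \<bullet> v0 q) \<in> borel_measurable borel" "(%q. v0 q \<bullet> v0 q) \<in> borel_measurable borel"
   using niceD(1)[OF wn] niceD(1)[OF vn(2)] by measurable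
  have "(LINT q|lebesgue_on ({0<..<topt} \<times> J). w q \<bullet> v0 q) = (LINT q|lebesgue_on ({0<..<topt} \<times> J). v0 q \<bullet> v0 q)"
   by (rule integral_cong_AE[OF _ _ ae]) (auto intro!: measurable_restrict_space1 measurable_completion simp: measurable_lborel1 m)
  also have "... = A" using restrict[OF vn(2)] a_0 by (simp add: power2_norm_eq_inner)
  finally show False using w(2) beta by simp
 qed
 have D: "(LINT q|\<mu>. (norm (v n q - v0 q))\<^sup>2) = M\<^sup>2 * (topt' n * (d - c)) + A - 2 * G n" for n
 proof -
  have i: "integrable \<mu> (%q. (norm (v n q))\<^sup>2)" "integrable \<mu> (%q. (norm (v0 q))\<^sup>2)"
   using niceD[OF vn(1)] niceD[OF vn(2)] by (auto intro!: int[where B="M\<^sup>2"] power_mono)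
  have b: "norm (v n q \<bullet> v0 q) <= M * M" for q
   using order_trans[OF Cauchy_Schwarz_ineq2 mult_mono[OF niceD(2)[OF vn(1)] niceD(2)[OF vn(2)] less_imp_le[OF M0] norm_ge_zero]] by simp
  have i': "integrable \<mu> (%q. v n q \<bullet> v0 q)"
   by (rule int[OF _ b]) (use niceD(1)[OF vn(1)] niceD(1)[OF vn(2)] in measurable)
  have "(norm (v n q - v0 q))\<^sup>2 = (norm (v n q))\<^sup>2 + (norm (v0 q))\<^sup>2 - 2 * (v n q \<bullet> v0 q)" for q
   by (simp add: power2_norm_eq_inner inner_diff_left inner_diff_right inner_commute)
  then show ?thesis using i i' by (simp add: G_def a_n a_0)
 qed
 have an: "(%n. M\<^sup>2 * (topt' n * (d - c))) \<longlonglongrightarrow> A" unfolding A_def by (intro tendsto_intros topt_tendsto[OF ts])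
 show ?thesis
 proof (rule order_tendstoI)
  fix a :: real assume "a < 0"
  then have "a < (LINT q|lebesgue_on ({0<..<T} \<times> J). (norm (v n q - v0 q))\<^sup>2)" for n
   by (intro less_le_trans[OF _ integral_nonneg_AE]) auto
  then show "\<forall>\<^sub>F n in sequentially. a < (LINT q|lebesgue_on ({0<..<T} \<times> J). (norm (v n q - v0 q))\<^sup>2)" by simp
 next
  fix a :: real assume a: "0 < a"
  have "\<forall>\<^sub>F n in sequentially. A - a / 3 < G n" by (rule low) (use a in simp)
  moreover have "\<forall>\<^sub>F n in sequentially. M\<^sup>2 * (topt' n * (d - c)) < A + a / 3" by (rule order_tendstoD(2)[OF an]) (use a in simp)
  ultimately show "\<forall>\<^sub>F n in sequentially. (LINT q|lebesgue_on ({0<..<T} \<times> J). (norm (v n q - v0 q))\<^sup>2) < a"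
   unfolding D[unfolded \<mu>_def] by eventually_elim linarith
 qed
qed

end

section \<open>Translation between the notions of the statement and nice controls\<close>

context tocp begin

text \<open>The directions are not symmetric: an arbitrary control must first be replaced by a nice
  one that equals it almost everywhere.\<close>

lemma steers_iff:
 assumes \<alpha>: "AE x in leb01. \<alpha> x = 1 / \<rho> x"
 shows "adm M \<tau> v ==> steers_to_zero \<alpha> J M z0 \<tau> v"
  and "steers_to_zero \<alpha> J M z0 \<tau> u ==> \<exists>v. adm M \<tau> v \<and> (AE q in lebesgue_on ({0<..<\<tau>} \<times> J). u q = v q)"
proof -
 show "steers_to_zero \<alpha> J M z0 \<tau> v" if v: "adm M \<tau> v"
 proof -
  have n: "nice v M" "0 < \<tau>" using v by (auto simp: adm_def)
  have "v \<in> control_ball \<tau> J M"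
   unfolding control_ball_def using bounded_integrable_Q(3)[OF niceD[OF n(1)] J] niceD(2)[OF n(1)] by simp
  then show ?thesis
   unfolding steers_to_zero_def using v n mild_solution_iff[OF \<alpha> n(1) J(1) AE_I2 n(2), of v z0] by (simp add: adm_def)
 qed
 assume u: "steers_to_zero \<alpha> J M z0 \<tau> u"
 then have t: "0 < \<tau>" and ub: "u \<in> control_ball \<tau> J M" and ex: "\<exists>z. mild_solution \<alpha> (control_input J u) z0 \<tau> z \<and> z \<tau> = 0"
  by (auto simp: steers_to_zero_def)
 obtain v where v: "nice v M" "AE q in lebesgue_on ({0<..<\<tau>} \<times> J). u q = v q"
  using nice_version[OF ub J(1) less_imp_le[OF M0]] by blast
 have "duh (control_input J v) \<tau> = - sg \<tau> z0" using mild_solution_iff[OF \<alpha> v(1) J(1) v(2) t] ex by blast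
 then show "\<exists>v. adm M \<tau> v \<and> (AE q in lebesgue_on ({0<..<\<tau>} \<times> J). u q = v q)" using t v by (auto simp: adm_def)
qed

lemma optimal_iff:
 assumes \<alpha>: "AE x in leb01. \<alpha> x = 1 / \<rho> x"
 shows "optimal_time \<alpha> J M z0 = topt"
  and "adm M topt v ==> optimal_control \<alpha> J M z0 v"
  and "optimal_control \<alpha> J M z0 u ==> \<exists>v. adm M topt v \<and> (AE q in lebesgue_on ({0<..<topt} \<times> J). u q = v q)"
proof -
 have "{\<tau>. \<exists>u. steers_to_zero \<alpha> J M z0 \<tau> u} = {\<tau>. \<exists>u. adm M \<tau> u}" using steers_iff[OF \<alpha>] by blast
 then show *: "optimal_time \<alpha> J M z0 = topt" by (simp add: optimal_time_def topt_def)
 show "adm M topt v ==> optimal_control \<alpha> J M z0 v"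
  "optimal_control \<alpha> J M z0 u ==> \<exists>v. adm M topt v \<and> (AE q in lebesgue_on ({0<..<topt} \<times> J). u q = v q)"
  unfolding optimal_control_def * using steers_iff[OF \<alpha>] by blast+
qed

end

theorem theorem1p2:
  shows "\<exists>T :: real \<Rightarrow> real \<Rightarrow> real \<Rightarrow> real \<Rightarrow> real.
    \<forall>(a :: real \<Rightarrow> real) (K :: real) (c :: real) (d :: real) (z\<^sub>0 :: L2) (M :: real).
      periodic_coeff a K \<longrightarrow> 0 \<le> c \<longrightarrow> c < d \<longrightarrow> d \<le> 1 \<longrightarrow> z\<^sub>0 \<noteq> 0 \<longrightarrow> 0 < M \<longrightarrow>
      (let J = {c<..<d};
           \<tau> = (\<lambda>\<epsilon>. optimal_time (scaled_coeff a \<epsilon>) J M z\<^sub>0);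
           opt = (\<lambda>\<epsilon>. optimal_control (scaled_coeff a \<epsilon>) J M z\<^sub>0);
           \<tau>hat = T M (measure lebesgue J) K (norm z\<^sub>0);
           ext = (\<lambda>(u :: real \<Rightarrow> real \<times> real \<Rightarrow> complex) \<epsilon>. extend_by_zero ({0<..<\<tau> \<epsilon>} \<times> J) (u \<epsilon>))
       in
         (\<forall>\<epsilon>\<ge>0. \<exists>u. opt \<epsilon> u \<and>
            (\<forall>v. opt \<epsilon> v \<longrightarrow> (AE q in lebesgue_on ({0<..<\<tau> \<epsilon>} \<times> J). v q = u q)) \<and>
            (AE q in lebesgue_on ({0<..<\<tau> \<epsilon>} \<times> J). norm (u q) = M)) \<and>
         0 < \<tau>hat \<and> (\<forall>\<epsilon>\<ge>0. \<tau> \<epsilon> \<le> \<tau>hat) \<and>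
         (\<tau> \<longlongrightarrow> \<tau> 0) (at_right 0) \<and>
         (\<forall>u. (\<forall>\<epsilon>\<ge>0. opt \<epsilon> (u \<epsilon>)) \<longrightarrow>
            weak_star_tendsto ({0<..<\<tau>hat} \<times> J) (ext u) (ext u 0) (at_right 0) \<and>
            (\<forall>p\<ge>1. Lp_tendsto ({0<..<\<tau>hat} \<times> J) p (ext u) (ext u 0) (at_right 0))))"
proof -
 \<comment> \<open>The bound on the optimal times has to be a function of four numbers, chosen
   before coefficient, interval and initial state are known; so \<open>reach\<close> asks for one
   time that serves all such data at once.\<close>
 define reach where "reach M l K n T \<longleftrightarrow> 0 < T \<and> (\<forall>\<rho> c d z0. tocp K \<rho> c d M z0 --> d - c = l --> norm z0 = n -->
   (\<exists>u. tocp.adm K \<rho> c d z0 M T u))" for M l K n T :: real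
 define T where "T M l K n = (SOME T. reach M l K n T)" for M l K n :: real
 show ?thesis
  unfolding Let_def
 proof (rule exI[of _ T], intro allI impI, goal_cases)
  case (1 a K c d z0 M)
  then have a: "periodic_coeff a K" and cd: "0 <= c" "c < d" "d <= 1" and z0: "z0 ~= 0" and M: "0 < M" by auto
  define J where "J = {c<..<d}"
  obtain \<rho> where rho: "!!e. 0 <= e ==> coef K (\<rho> e)" "!!e. 0 <= e ==> AE x in leb01. scaled_coeff a e x = 1 / \<rho> e x"
    "!!e x. 0 < e ==> 0 <= x ==> \<bar>coef.R (\<rho> e) x - coef.R (\<rho> 0) x\<bar> <= K * e"
   using homogenization[OF a] by blast
  have K1: "1 <= K" using rho(1)[of 0] by (simp add: coef_def)
  have tc: "tocp K (\<rho> e) c d M z0" if "0 <= e" for e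
   using rho(1)[OF that] cd M z0 by (intro tocp.intro tocp_axioms.intro) auto
  have Jb: "J \<in> sets borel" "J \<subseteq> {0<..<1}" using cd by (auto simp: J_def)
  define \<tau> where "\<tau> e = optimal_time (scaled_coeff a e) J M z0" for e
  define opt where "opt e = optimal_control (scaled_coeff a e) J M z0" for e
  define H where "H = T M (measure lebesgue J) K (norm z0)"
  define ad where "ad e = tocp.adm K (\<rho> e) c d z0 M" for e
  have tau: "\<tau> e = tocp.topt K (\<rho> e) c d M z0" if "0 <= e" for e
   unfolding \<tau>_def J_def by (rule tocp.optimal_iff(1)[OF tc[OF that] rho(2)[OF that]])
  have opt1: "opt e v" if "0 <= e" "ad e (\<tau> e) v" for e v
   using tocp.optimal_iff(2)[OF tc[OF that(1)] rho(2)[OF that(1)]] that unfolding opt_def J_def ad_def tau[OF that(1)] by blast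
  have opt2: "\<exists>v. ad e (\<tau> e) v \<and> (AE q in lebesgue_on ({0<..<\<tau> e} \<times> J). u q = v q)" if "0 <= e" "opt e u" for e u
   using tocp.optimal_iff(3)[OF tc[OF that(1)] rho(2)[OF that(1)]] that unfolding opt_def J_def ad_def tau[OF that(1)] by blast
  have ln: "measure lebesgue J = d - c" using cd by (simp add: J_def)
  have "reach M (d - c) K (norm z0) H"
   unfolding H_def T_def ln using reach_bound[OF K1 _ M, of "d - c" "norm z0"] cd
   by (intro someI_ex[of "reach M (d - c) K (norm z0)"]) (simp add: reach_def)
  then have H: "0 < H" "!!e. 0 <= e ==> \<exists>u. ad e H u" using tc by (auto simp: reach_def ad_def)
  have tH: "\<tau> e <= H" if "0 <= e" for e
   using H(2)[OF that] tocp.topt_le[OF tc[OF that]] unfolding tau[OF that] ad_def by blast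
  have main: "\<exists>u. opt e u \<and> (\<forall>v. opt e v --> (AE q in lebesgue_on ({0<..<\<tau> e} \<times> J). v q = u q)) \<and>
    (AE q in lebesgue_on ({0<..<\<tau> e} \<times> J). norm (u q) = M)" if e: "0 <= e" for e
  proof -
   obtain u where u: "ad e (\<tau> e) u" using tocp.optimal_exists[OF tc[OF e]] unfolding ad_def tau[OF e] by blast
   have "AE q in lebesgue_on ({0<..<\<tau> e} \<times> J). v q = u q" if v: "opt e v" for v
   proof -
    obtain w where w: "ad e (\<tau> e) w" "AE q in lebesgue_on ({0<..<\<tau> e} \<times> J). v q = w q" using opt2[OF e v] by blast
    from w(2) tocp.optimal_unique[OF tc[OF e] w(1)[unfolded ad_def tau[OF e]] u[unfolded ad_def tau[OF e]], folded J_def tau[OF e]]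
    show ?thesis by eventually_elim simp
   qed
   moreover have "AE q in lebesgue_on ({0<..<\<tau> e} \<times> J). norm (u q) = M"
    using tocp.bang_bang[OF tc[OF e] u[unfolded ad_def tau[OF e]]] unfolding J_def tau[OF e] .
   ultimately show ?thesis using opt1[OF e u] by blast
  qed
  have seq: "tocp_seq K (\<rho> 0) c d M z0 (%n. \<rho> (X n)) (%n. 4 * (1 + K * K) * (K * X n))"
   if X: "!!n. 0 < X n" "X \<longlonglongrightarrow> 0" for X
  proof (intro tocp_seq.intro tc coef_seq.intro coef_seq_axioms.intro rho(1))
   show "norm (coef.green (\<rho> (X n)) F - coef.green (\<rho> 0) F) <= 4 * (1 + K * K) * (K * X n) * norm F" for n F
    by (rule green_perturb) (use rho X(1)[of n] in auto)
   have "(%n. 4 * (1 + K * K) * (K * X n)) \<longlonglongrightarrow> 4 * (1 + K * K) * (K * 0)" by (intro tendsto_intros X)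
   then show "(%n. 4 * (1 + K * K) * (K * X n)) \<longlonglongrightarrow> 0" by simp
  qed (use X(1)[THEN less_imp_le] in auto)
  have taulim: "(\<tau> \<longlongrightarrow> \<tau> 0) (at_right 0)"
   unfolding tendsto_at_iff_sequentially
  proof (intro allI impI)
   fix X :: "nat => real" assume X: "\<forall>i. X i \<in> {0<..} - {0}" "X \<longlonglongrightarrow> 0"
   then have Xp: "0 < X n" "0 <= X n" for n by (simp_all add: less_imp_le)
   from topt_tendsto[OF seq[OF Xp(1) X(2)]] show "(\<tau> \<circ> X) \<longlonglongrightarrow> \<tau> 0" by (simp add: o_def tau Xp)
  qed
  have conv: "weak_star_tendsto ({0<..<H} \<times> J) (%e. extend_by_zero ({0<..<\<tau> e} \<times> J) (u e)) (extend_by_zero ({0<..<\<tau> 0} \<times> J) (u 0)) (at_right 0) \<and>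
    (\<forall>p\<ge>1. Lp_tendsto ({0<..<H} \<times> J) p (%e. extend_by_zero ({0<..<\<tau> e} \<times> J) (u e)) (extend_by_zero ({0<..<\<tau> 0} \<times> J) (u 0)) (at_right 0))"
   if u: "\<forall>e\<ge>0. opt e (u e)" for u
  proof -
   have "\<forall>e. \<exists>v. 0 <= e --> ad e (\<tau> e) v \<and> (AE q in lebesgue_on ({0<..<\<tau> e} \<times> J). u e q = v q)" using opt2 u by blast
   then obtain v where v: "!!e. 0 <= e ==> ad e (\<tau> e) (v e)" "!!e. 0 <= e ==> AE q in lebesgue_on ({0<..<\<tau> e} \<times> J). u e q = v e q" by metis
   define x where "x e = extend_by_zero ({0<..<\<tau> e} \<times> J) (u e)" for e
   define y where "y e = extend_by_zero ({0<..<\<tau> e} \<times> J) (v e)" for e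
   define \<mu> where "\<mu> = lebesgue_on ({0<..<H} \<times> J)"
   have xy: "AE q in \<mu>. x e q = y e q" if "0 <= e" for e
   proof -
    have "AE q in lborel. q \<in> {0<..<\<tau> e} \<times> J --> u e q = v e q" using v(2)[OF that] Q_sets[OF Jb(1)] by (subst (asm) AE_lebesgue_on_iff) auto
    then have "AE q in lborel. x e q = y e q" by eventually_elim (simp add: x_def y_def extend_by_zero_def)
    then show ?thesis unfolding \<mu>_def using Q_sets[OF Jb(1)] by (subst AE_lebesgue_on_iff) (auto elim: eventually_mono)
   qed
   have yn: "nice (y e) M" if "0 <= e" for e
    unfolding y_def using v(1)[OF that] by (intro nice_extend Q_sets Jb) (simp add: ad_def tocp.adm_def[OF tc[OF that]])
   have xmeas: "x e \<in> borel_measurable \<mu>" if "0 <= e" for e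
    using xy[OF that] Q_sets[OF Jb(1)] unfolding \<mu>_def
    by (intro borel_measurable_lebesgue_on_AE[OF niceD(1)[OF yn[OF that]]]) auto
   \<comment> \<open>The absolute value makes the difference nice for every real \<open>e\<close>,
     as \<open>L2_conv_imp\<close> requires; to the right of 0 it has no effect.\<close>
   define w where "w e q = y \<bar>e\<bar> q - y 0 q" for e q
   have wn: "nice (w e) (M + M)" for e
    unfolding w_def using nice_add[OF yn[of "\<bar>e\<bar>"] nice_scaleR[OF yn[of 0], of "-1"]] by simp
   have wx: "AE q in \<mu>. w e q = x e q - x 0 q" if "0 <= e" for e
    using xy[OF that] xy[OF order_refl] by eventually_elim (use that in \<open>simp add: w_def\<close>)
   have pos: "\<forall>\<^sub>F e in at_right 0. (0::real) <= e" using eventually_at_right_less[of "0::real"] by eventually_elim simp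
   have L2: "((%e. LINT q|lebesgue_on ({0<..<H} \<times> J). (norm (w e q))\<^sup>2) \<longlongrightarrow> 0) (at_right 0)"
    unfolding tendsto_at_iff_sequentially
   proof (intro allI impI)
    fix X :: "nat => real" assume X: "\<forall>i. X i \<in> {0<..} - {0}" "X \<longlonglongrightarrow> 0"
    then have Xp: "0 < X n" "0 <= X n" for n by (simp_all add: less_imp_le)
    interpret s: tocp_seq K "\<rho> 0" c d M z0 "%n. \<rho> (X n)" "%n. 4 * (1 + K * K) * (K * X n)" by (rule seq[OF Xp(1) X(2)])
    have "(%n. LINT q|lebesgue_on ({0<..<H} \<times> s.J). (norm (extend_by_zero ({0<..<s.topt' n} \<times> s.J) (v (X n)) q
      - extend_by_zero ({0<..<s.topt} \<times> s.J) (v 0) q))\<^sup>2) \<longlonglongrightarrow> 0"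
    proof (rule s.controls_converge)
     show "s.adm' n (s.topt' n) (v (X n))" for n using v(1)[OF Xp(2)[of n]] by (simp add: s.adm'_eq ad_def tau Xp)
     show "s.adm M s.topt (v 0)" using v(1)[of 0] by (simp add: ad_def tau)
     show "s.topt' n <= H" for n using tH[OF Xp(2)[of n]] by (simp add: tau Xp)
     show "s.topt <= H" using tH[of 0] by (simp add: tau)
    qed
    then show "((%e. LINT q|lebesgue_on ({0<..<H} \<times> J). (norm (w e q))\<^sup>2) \<circ> X) \<longlonglongrightarrow> 0"
     by (simp add: o_def w_def y_def tau Xp J_def abs_of_pos)
   qed
   note cv = L2_conv_imp[OF wn Jb L2]
   have "weak_star_tendsto ({0<..<H} \<times> J) x (x 0) (at_right 0)"
    unfolding weak_star_tendsto_def
   proof (intro allI impI)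
    fix \<phi> :: "real \<times> real => complex" assume ph: "integrable (lebesgue_on ({0<..<H} \<times> J)) \<phi>"
    have ym: "y e \<in> borel_measurable \<mu>" if "0 <= e" for e unfolding \<mu>_def by (rule bounded_integrable_Q(3)[OF niceD[OF yn[OF that]] Jb])
    have iy: "integrable \<mu> (%q. \<phi> q * y e q)" if e: "0 <= e" for e
    proof (rule Bochner_Integration.integrable_bound)
     show "integrable \<mu> (%q. M *\<^sub>R \<phi> q)" using ph by (simp add: \<mu>_def)
     show "AE q in \<mu>. norm (\<phi> q * y e q) <= norm (M *\<^sub>R \<phi> q)"
      using mult_left_mono[OF niceD(2)[OF yn[OF e]] norm_ge_zero] M by (intro AE_I2) (simp add: norm_mult mult.commute[of M])
     show "(%q. \<phi> q * y e q) \<in> borel_measurable \<mu>" using ph ym[OF e] by (auto simp: \<mu>_def intro: borel_measurable_times)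
    qed
    have xm: "(LINT q|\<mu>. \<phi> q * y e q) = (LINT q|\<mu>. \<phi> q * x e q)" if e: "0 <= e" for e
    proof -
     have "AE q in \<mu>. \<phi> q * y e q = \<phi> q * x e q" using xy[OF e] by eventually_elim simp
     moreover note xmeas[OF e]
     ultimately show ?thesis using iy[OF e] ph by (intro integral_cong_AE) (auto simp: \<mu>_def intro: borel_measurable_times)
    qed
    have "\<forall>\<^sub>F e in at_right 0. (LINT q|\<mu>. \<phi> q * w e q) + (LINT q|\<mu>. \<phi> q * y 0 q) = (LINT q|\<mu>. \<phi> q * x e q)"
     using pos
    proof eventually_elim
     case (elim e)
     have "(LINT q|\<mu>. \<phi> q * w e q) = (LINT q|\<mu>. \<phi> q * y e q) - (LINT q|\<mu>. \<phi> q * y 0 q)"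
      using iy[OF elim] iy[of 0] elim by (simp add: w_def right_diff_distrib)
     then show ?case using xm[OF elim] by simp
    qed
    from Lim_transform_eventually[OF tendsto_add[OF cv(2)[OF ph] tendsto_const] this[unfolded \<mu>_def]]
    show "((%e. LINT q|lebesgue_on ({0<..<H} \<times> J). \<phi> q * x e q) \<longlongrightarrow> (LINT q|lebesgue_on ({0<..<H} \<times> J). \<phi> q * x 0 q)) (at_right 0)"
     using xm[of 0] by (simp add: \<mu>_def)
   qed
   moreover have "Lp_tendsto ({0<..<H} \<times> J) p x (x 0) (at_right 0)" if p: "1 <= p" for p
    unfolding Lp_tendsto_def
   proof (rule Lim_transform_eventually[OF cv(1)[OF p]])
    show "\<forall>\<^sub>F e in at_right 0. Lp_norm ({0<..<H} \<times> J) p (w e) = Lp_norm ({0<..<H} \<times> J) p (%q. x e q - x 0 q)"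
     using pos
    proof eventually_elim
     case (elim e)
     have "AE q in \<mu>. norm (w e q) powr p = norm (x e q - x 0 q) powr p" using wx[OF elim] by eventually_elim simp
     moreover have "(%q. norm (x e q - x 0 q) powr p) \<in> borel_measurable \<mu>" using xmeas[OF elim] xmeas[of 0] by measurable
     moreover have "(%q. norm (w e q) powr p) \<in> borel_measurable \<mu>"
      using bounded_integrable_Q(3)[OF niceD[OF wn] Jb] unfolding \<mu>_def by measurable
     ultimately show ?case unfolding Lp_norm_def \<mu>_def[symmetric] by (subst integral_cong_AE) auto
    qed
   qed
   ultimately show ?thesis unfolding x_def by blast
  qed
  show ?case
   using main H(1) tH taulim conv unfolding \<tau>_def opt_def H_def J_def by blast
 qed
qed

end
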